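(* There exist constants $\varepsilon>0$ and $\delta>0$ such that the following holds. Let $\boldsymbol F$ be an axisymmetric vector field, homogeneous of degree $-3$ and of class $C^1$ on $\overline{\mathbb R^3_+}\setminus\{0\}$, with $$\|(\operatorname{curl}\boldsymbol F)^{\tan}\|_{C^0(\mathbb S^2\cap\mathbb R^3_+)}\le\varepsilon .$$ Then the system $$-\Delta\boldsymbol u+(\boldsymbol u\cdot\nabla)\boldsymbol u+\nabla p=\boldsymbol F\ \text{ in }\mathbb R^3_+,\qquad \operatorname{div}\boldsymbol u=0\ \text{ in }\mathbb R^3_+,\qquad \boldsymbol u=0\ \text{ on }\partial\mathbb R^3_+\setminus\{0\}$$ admits exactly one axisymmetric self-similar solution $(\boldsymbol u,p)$ that is small in the sense that $\sup_{\mathbb S^2\cap\mathbb R^3_+}|\boldsymbol u|\le\delta$; moreover this solution satisfies $$\boldsymbol u\in C^{2,\alpha}_{\mathrm{loc}}(\overline{\mathbb R^3_+}\setminus\{0\}),\qquad p\in C^{1,\alpha}_{\mathrm{loc}}(\overline{\mathbb R^3_+}\setminus\{0\})\qquad\text{for every }\alpha\in(0,1).$$ Moreover, if $\boldsymbol F$ has no swirl, then any axisymmetric self-similar solution of the system (not assumed small) is necessarily swirl-free, and it is unique (there is at most one axisymmetric self-similar solution).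
   Context: $\mathbb R^3_+=\{x\in\mathbb R^3:x_3>0\}$ and $\mathbb S^2$ is the unit sphere. Spherical coordinates: $\boldsymbol x=(\rho\sin\varphi\cos\theta,\rho\sin\varphi\sin\theta,\rho\cos\varphi)$, with orthonormal basis $\boldsymbol e_\rho=\boldsymbol x/\rho$, $\boldsymbol e_\theta=(-\sin\theta,\cos\theta,0)$, $\boldsymbol e_\varphi=\boldsymbol e_\theta\times\boldsymbol e_\rho$. A vector field $\boldsymbol v=v^\rho\boldsymbol e_\rho+v^\varphi\boldsymbol e_\varphi+v^\theta\boldsymbol e_\theta$ is axisymmetric if $v^\rho,v^\varphi,v^\theta$ depend only on $(\rho,\varphi)$; $v^\theta$ is its swirl, and $\boldsymbol v$ is swirl-free (has no swirl) if $v^\theta\equiv0$. A scalar function is axisymmetric if it depends only on $(\rho,\varphi)$. $(\operatorname{curl}\boldsymbol F)^{\tan}$ denotes the tangential part of $\operatorname{curl}\boldsymbol F$ on the unit sphere, i.e. its $\boldsymbol e_\varphi$ and $\boldsymbol e_\theta$ components, restricted to $\mathbb S^2\cap\mathbb R^3_+$. An axisymmetric self-similar solution is a pair $(\boldsymbol u,p)$ with $\boldsymbol u\in C^2(\overline{\mathbb R^3_+}\setminus\{0\})$, $p\in C^1(\overline{\mathbb R^3_+}\setminus\{0\})$, both axisymmetric, solving the system pointwise and satisfying $\boldsymbol u(\lambda x)=\lambda^{-1}\boldsymbol u(x)$, $p(\lambda x)=\lambda^{-2}p(x)$ for all $\lambda>0$. In particular $\boldsymbol u=\rho^{-1}(f(\varphi)\boldsymbol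 e_\rho+g(\varphi)\boldsymbol e_\varphi+h(\varphi)\boldsymbol e_\theta)$ with angular profiles $f,g,h$ bounded on $[0,\pi/2]$. *)

theory Defs
  imports "HOL-Analysis.Analysis"
begin

definition half_space :: "(real^3) set" where
  "half_space = {x. x $ 3 > 0}"

definition closed_half_space0 :: "(real^3) set" where
  "closed_half_space0 = {x. x $ 3 \<ge> 0 \<and> x \<noteq> 0}"

definition boundary_plane0 :: "(real^3) set" where
  "boundary_plane0 = {x. x $ 3 = 0 \<and> x \<noteq> 0}"

section \<open>Differential operators\<close>

definition partial :: "3 \<Rightarrow> (real^3 \<Rightarrow> 'a::real_normed_vector) \<Rightarrow> real^3 \<Rightarrow> 'a" where
  "partial i f x = vector_derivative (\<lambda>t. f (x + t *\<^sub>R axis i 1)) (at 0)"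

definition grad :: "(real^3 \<Rightarrow> real) \<Rightarrow> real^3 \<Rightarrow> real^3" where
  "grad p x = (\<chi> i. partial i p x)"

definition divergence :: "(real^3 \<Rightarrow> real^3) \<Rightarrow> real^3 \<Rightarrow> real" where
  "divergence u x = (\<Sum>i\<in>UNIV. partial i u x $ i)"

definition laplacian :: "(real^3 \<Rightarrow> real^3) \<Rightarrow> real^3 \<Rightarrow> real^3" where
  "laplacian u x = (\<Sum>i\<in>UNIV. partial i (partial i u) x)"

definition convection :: "(real^3 \<Rightarrow> real^3) \<Rightarrow> real^3 \<Rightarrow> real^3" where
  "convection u x = (\<Sum>i\<in>UNIV. (u x $ i) *\<^sub>R partial i u x)"

definition curl :: "(real^3 \<Rightarrow> real^3) \<Rightarrow> real^3 \<Rightarrow> real^3" where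
  "curl F x = vector
     [partial 2 F x $ 3 - partial 3 F x $ 2,
      partial 3 F x $ 1 - partial 1 F x $ 3,
      partial 1 F x $ 2 - partial 2 F x $ 1]"

section \<open>Regularity up to the boundary, away from the origin\<close>

text \<open>
  Derivatives are taken in the open half-space only, where two-sided partial derivatives make
  sense; the witness \<open>g\<close> is the extension of the partial derivative to the closed half-space
  minus the origin. Values of functions elsewhere are irrelevant.
\<close>

primrec C_k :: "nat \<Rightarrow> (real^3 \<Rightarrow> 'a::real_normed_vector) \<Rightarrow> bool" where
  "C_k 0 f \<longleftrightarrow> continuous_on closed_half_space0 f"
| "C_k (Suc k) f \<longleftrightarrow> continuous_on closed_half_space0 f \<and>
     (\<forall>i. \<exists>g. C_k k g \<and>
        (\<forall>x\<in>half_space.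
           ((\<lambda>t. f (x + t *\<^sub>R axis i 1)) has_vector_derivative g x) (at 0)))"

definition holder_loc :: "real \<Rightarrow> (real^3 \<Rightarrow> 'a::real_normed_vector) \<Rightarrow> bool" where
  "holder_loc \<alpha> f \<longleftrightarrow>
     (\<forall>K. compact K \<and> K \<subseteq> closed_half_space0 \<longrightarrow>
        (\<exists>C. \<forall>x\<in>K. \<forall>y\<in>K. norm (f x - f y) \<le> C * norm (x - y) powr \<alpha>))"

primrec C_k_alpha_loc :: "nat \<Rightarrow> real \<Rightarrow> (real^3 \<Rightarrow> 'a::real_normed_vector) \<Rightarrow> bool" where
  "C_k_alpha_loc 0 \<alpha> f \<longleftrightarrow> holder_loc \<alpha> f"
| "C_k_alpha_loc (Suc k) \<alpha> f \<longleftrightarrow> continuous_on closed_half_space0 f \<and>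
     (\<forall>i. \<exists>g. C_k_alpha_loc k \<alpha> g \<and>
        (\<forall>x\<in>half_space.
           ((\<lambda>t. f (x + t *\<^sub>R axis i 1)) has_vector_derivative g x) (at 0)))"

section \<open>Spherical coordinates and axisymmetry\<close>

definition e_rho :: "real \<Rightarrow> real \<Rightarrow> real^3" where
  "e_rho \<phi> \<theta> = vector [sin \<phi> * cos \<theta>, sin \<phi> * sin \<theta>, cos \<phi>]"

definition e_theta :: "real \<Rightarrow> real^3" where
  "e_theta \<theta> = vector [- sin \<theta>, cos \<theta>, 0]"

definition e_phi :: "real \<Rightarrow> real \<Rightarrow> real^3" where
  "e_phi \<phi> \<theta> = cross3 (e_theta \<theta>) (e_rho \<phi> \<theta>)"

definition spherical :: "real \<Rightarrow> real \<Rightarrow> real \<Rightarrow> real^3" where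
  "spherical \<rho> \<phi> \<theta> = \<rho> *\<^sub>R e_rho \<phi> \<theta>"

text \<open>
  The ranges \<open>\<rho> > 0\<close>, \<open>0 \<le> \<phi> \<le> \<pi>/2\<close>, \<open>\<theta> \<in> \<real>\<close> parametrize exactly the closed half-space minus
  the origin. On the axis \<open>\<phi> = 0\<close> the point does not depend on \<open>\<theta>\<close> while the frame does, so
  the definition forces the \<open>\<phi>\<close>- and \<open>\<theta>\<close>-components to vanish there; for continuous fields
  this already follows from axisymmetry off the axis.
\<close>

definition axisymmetric_field :: "(real^3 \<Rightarrow> real^3) \<Rightarrow> bool" where
  "axisymmetric_field v \<longleftrightarrow>
     (\<exists>v\<^sub>\<rho> v\<^sub>\<phi> v\<^sub>\<theta> :: real \<Rightarrow> real \<Rightarrow> real.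
        \<forall>\<rho>>0. \<forall>\<phi>\<in>{0..pi/2}. \<forall>\<theta>.
          v (spherical \<rho> \<phi> \<theta>) =
            v\<^sub>\<rho> \<rho> \<phi> *\<^sub>R e_rho \<phi> \<theta> + v\<^sub>\<phi> \<rho> \<phi> *\<^sub>R e_phi \<phi> \<theta> + v\<^sub>\<theta> \<rho> \<phi> *\<^sub>R e_theta \<theta>)"

definition axisymmetric_scalar :: "(real^3 \<Rightarrow> real) \<Rightarrow> bool" where
  "axisymmetric_scalar p \<longleftrightarrow>
     (\<exists>P :: real \<Rightarrow> real \<Rightarrow> real.
        \<forall>\<rho>>0. \<forall>\<phi>\<in>{0..pi/2}. \<forall>\<theta>. p (spherical \<rho> \<phi> \<theta>) = P \<rho> \<phi>)"

definition swirl_free :: "(real^3 \<Rightarrow> real^3) \<Rightarrow> bool" where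
  "swirl_free v \<longleftrightarrow>
     (\<forall>\<rho>>0. \<forall>\<phi>\<in>{0..pi/2}. \<forall>\<theta>. v (spherical \<rho> \<phi> \<theta>) \<bullet> e_theta \<theta> = 0)"

definition homogeneous :: "int \<Rightarrow> (real^3 \<Rightarrow> 'a::real_vector) \<Rightarrow> bool" where
  "homogeneous d f \<longleftrightarrow>
     (\<forall>x\<in>closed_half_space0. \<forall>s>0. f (s *\<^sub>R x) = (s powi d) *\<^sub>R f x)"

section \<open>Supremum norms on the open half-sphere\<close>

definition sup_norm :: "'b set \<Rightarrow> ('b \<Rightarrow> 'a::real_normed_vector) \<Rightarrow> ereal" where
  "sup_norm A f = (SUP x\<in>A. ereal (norm (f x)))"

definition open_half_sphere :: "(real^3) set" where
  "open_half_sphere = sphere 0 1 \<inter> half_space"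

text \<open>
  The tangential part on the unit sphere is written in angular coordinates; on the axis its value
  is the same for every \<open>\<theta>\<close>.
\<close>

definition tangential_part :: "(real^3 \<Rightarrow> real^3) \<Rightarrow> real \<times> real \<Rightarrow> real^3" where
  "tangential_part v = (\<lambda>(\<phi>, \<theta>).
     (v (spherical 1 \<phi> \<theta>) \<bullet> e_phi \<phi> \<theta>) *\<^sub>R e_phi \<phi> \<theta> +
     (v (spherical 1 \<phi> \<theta>) \<bullet> e_theta \<theta>) *\<^sub>R e_theta \<theta>)"

definition open_half_sphere_angles :: "(real \<times> real) set" where
  "open_half_sphere_angles = {0..<pi/2} \<times> UNIV"

section \<open>The stationary Navier--Stokes system\<close>

definition solves_system ::
  "(real^3 \<Rightarrow> real^3) \<Rightarrow> (real^3 \<Rightarrow> real^3) \<Rightarrow> (real^3 \<Rightarrow> real) \<Rightarrow> bool" where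
  "solves_system F u p \<longleftrightarrow>
     (\<forall>x\<in>half_space. - laplacian u x + convection u x + grad p x = F x) \<and>
     (\<forall>x\<in>half_space. divergence u x = 0) \<and>
     (\<forall>x\<in>boundary_plane0. u x = 0)"

definition axisym_selfsim_solution ::
  "(real^3 \<Rightarrow> real^3) \<Rightarrow> (real^3 \<Rightarrow> real^3) \<Rightarrow> (real^3 \<Rightarrow> real) \<Rightarrow> bool" where
  "axisym_selfsim_solution F u p \<longleftrightarrow>
     C_k 2 u \<and> C_k 1 p \<and>
     axisymmetric_field u \<and> axisymmetric_scalar p \<and>
     solves_system F u p \<and>
     homogeneous (- 1) u \<and> homogeneous (- 2) p"

text \<open>Equality as functions on the closed half-space minus the origin.\<close>

definition same_solution ::
  "(real^3 \<Rightarrow> real^3) \<Rightarrow> (real^3 \<Rightarrow> real) \<Rightarrow> (real^3 \<Rightarrow> real^3) \<Rightarrow> (real^3 \<Rightarrow> real) \<Rightarrow> bool" where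
  "same_solution u p u' p' \<longleftrightarrow>
     (\<forall>x\<in>closed_half_space0. u' x = u x \<and> p' x = p x)"

end

theory Submission
  imports Defs
begin

text \<open>
  With \<open>y = cos \<phi>\<close>, an axisymmetric self-similar field is \<open>profile_field (- 1) a k b\<close>, and
  incompressibility expresses \<open>a\<close> and \<open>b\<close> by the single function \<open>v = y a - b\<close>. Eliminating the
  pressure and integrating, the Navier--Stokes system becomes the Riccati equation
  \<open>v' + v\<^sup>2/2 = R / (1 - y\<^sup>2)\<^sup>2\<close>, \<open>v 0 = 0\<close>, where \<open>R''' = N - 2 k W\<close> and the swirl
  \<open>H = (1 - y\<^sup>2) k\<close>, \<open>W = H'\<close>, solves \<open>W' = - q - v W\<close>, \<open>H 0 = H 1 = 0\<close>. The forcing enters only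
  through \<open>q\<close> and \<open>N\<close>; the tangential components of \<open>curl F\<close> are \<open>2 q sin \<phi>\<close> and \<open>- N sin \<phi>\<close>. For given small \<open>v\<close> the two linear problems determine \<open>H\<close> and \<open>R\<close>, and the resulting map
  on \<open>v\<close> is a contraction: this gives existence and uniqueness of the small solution.

  If \<open>q = 0\<close>, then \<open>W\<close> vanishes somewhere by Rolle's theorem, hence everywhere because
  \<open>W' = - v W\<close>; so \<open>R\<close> is determined by \<open>N\<close> alone and \<open>v\<close> by the initial value problem,
  without any smallness.
\<close>

section \<open>Differential inequalities on the unit interval\<close>

text \<open>The delicate end is the axis \<open>y = 1\<close>: there \<open>cos \<phi>\<close> is
  not a smooth coordinate, the bound on the curl gives only \<open>N = O(1 / sin \<phi>)\<close>,
  and the Riccati equation carries the factor \<open>1 / (1 - y\<^sup>2)\<^sup>2\<close>. The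
  third-order equation for \<open>R\<close> leaves a quadratic polynomial free. Two of its
  coefficients are fixed by \<open>R = o(1 - y)\<close>, which holds for every solution because the
  field is continuous on the axis, and the third by \<open>R 0 = 0\<close>, which is no-slip
  expressed through \<open>v'\<close>. Together they force \<open>R = O((1 - y)\<^sup>2)\<close>, so
  the Riccati problem is a regular initial value problem on \<open>[0, 1]\<close>. The end
  conditions on \<open>R\<close> are limits, so that they can be derived for an arbitrary C2
  solution as well as arranged for the constructed one; existence and uniqueness then share the same
  estimates. The price of working in \<open>y\<close> is regularity: profiles are tracked by powers
  of \<open>sin \<phi>\<close>, and a separate argument turns these weights into Lipschitz bounds
  for second derivatives in space. The constants are convenient rather than sharp.\<close>

lemma deriv_dominated:
  fixes f g :: "real \<Rightarrow> real"
  assumes f: "\<And>t. t \<in> {a<..<b} \<Longrightarrow> (f has_real_derivative f' t) (at t)"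
    and g: "\<And>t. t \<in> {a<..<b} \<Longrightarrow> (g has_real_derivative g' t) (at t)"
    and le: "\<And>t. t \<in> {a<..<b} \<Longrightarrow> \<bar>f' t\<bar> \<le> g' t"
    and x: "x \<in> {a<..<b}" and y: "y \<in> {a<..<b}"
  shows "\<bar>f y - f x\<bar> \<le> \<bar>g y - g x\<bar>"
proof -
  \<comment> \<open>Both \<open>g - f\<close> and \<open>g + f\<close> are nondecreasing. Nothing is
    integrated, so \<open>g\<close> may be a multiple of \<open>arcsin\<close>, whose derivative is
    unbounded at 1.\<close>
  have *: "\<bar>f y - f x\<bar> \<le> g y - g x" if "x \<le> y" "x \<in> {a<..<b}" "y \<in> {a<..<b}" for x y
  proof -
    have "(\<lambda>t. g t - f t) x \<le> (\<lambda>t. g t - f t) y"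
    proof (rule DERIV_nonneg_imp_nondecreasing[OF that(1)])
      fix t assume "x \<le> t" "t \<le> y"
      with that have t: "t \<in> {a<..<b}" by auto
      show "\<exists>d. ((\<lambda>t. g t - f t) has_real_derivative d) (at t) \<and> 0 \<le> d"
        using DERIV_diff[OF g[OF t] f[OF t]] le[OF t] by (intro exI[of _ "g' t - f' t"]) auto
    qed
    moreover have "(\<lambda>t. g t + f t) x \<le> (\<lambda>t. g t + f t) y"
    proof (rule DERIV_nonneg_imp_nondecreasing[OF that(1)])
      fix t assume "x \<le> t" "t \<le> y"
      with that have t: "t \<in> {a<..<b}" by auto
      show "\<exists>d. ((\<lambda>t. g t + f t) has_real_derivative d) (at t) \<and> 0 \<le> d"
        using DERIV_add[OF g[OF t] f[OF t]] le[OF t] by (intro exI[of _ "g' t + f' t"]) auto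
    qed
    ultimately show ?thesis by auto
  qed
  show ?thesis
  proof (cases "x \<le> y")
    case True then show ?thesis using *[OF True x y] by auto
  next
    case False then show ?thesis using *[OF _ y x] by (auto simp: abs_minus_commute)
  qed
qed

text \<open>On an interval of length at most 1 the term \<open>\<bar>E\<bar> / 2\<close> can be
  absorbed: if \<open>M\<close> is the maximum of \<open>\<bar>E\<bar>\<close> between
  \<open>\<xi>\<close> and \<open>t\<close>, going from the point of maximum to the zero
  \<open>\<xi>\<close> gives \<open>M \<le> T + M / 2\<close>. The majorant \<open>G'\<close> may be
  unbounded; its effect is measured by the oscillation \<open>T\<close> of \<open>G\<close>.\<close>

lemma small_gronwall:
  fixes E G :: "real \<Rightarrow> real"
  assumes E: "\<And>t. t \<in> {0<..<1} \<Longrightarrow> (E has_real_derivative E' t) (at t)"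
    and G: "\<And>t. t \<in> {0<..<1} \<Longrightarrow> (G has_real_derivative G' t) (at t)"
    and le: "\<And>t. t \<in> {0<..<1} \<Longrightarrow> \<bar>E' t\<bar> \<le> \<bar>E t\<bar> / 2 + G' t"
    and T: "\<And>s t. s \<in> {0<..<1} \<Longrightarrow> t \<in> {0<..<1} \<Longrightarrow> \<bar>G t - G s\<bar> \<le> T"
    and \<xi>: "\<xi> \<in> {0<..<1}" "E \<xi> = 0"
    and t: "t \<in> {0<..<1}"
  shows "\<bar>E t\<bar> \<le> 2 * T"
proof -
  define a b where "a = min t \<xi>" and "b = max t \<xi>"
  have ab: "a \<le> b" "0 < a" "b < 1" "t \<in> {a..b}" "\<xi> \<in> {a..b}"
    using \<xi> t by (auto simp: a_def b_def)
  have "continuous_on {a..b} (\<lambda>t. \<bar>E t\<bar>)"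
    by (intro continuous_intros continuous_at_imp_continuous_on ballI DERIV_isCont[OF E]) (use ab in auto)
  from continuous_attains_sup[OF _ _ this] ab obtain m where
    m: "m \<in> {a..b}" "\<And>s. s \<in> {a..b} \<Longrightarrow> \<bar>E s\<bar> \<le> \<bar>E m\<bar>" by auto
  define M where "M = \<bar>E m\<bar>"
  define a' b' where "a' = min m \<xi>" and "b' = max m \<xi>"
  have ab': "a' \<le> b'" "a \<le> a'" "b' \<le> b" using m(1) ab by (auto simp: a'_def b'_def)
  \<comment> \<open>Monotonicity of \<open>G + M / 2 t - E\<close> and of
    \<open>G + M / 2 t + E\<close> takes the place of an integral of \<open>E'\<close>.\<close>
  have bd: "\<bar>E b' - E a'\<bar> \<le> G b' - G a' + M / 2 * (b' - a')"
  proof -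
    have 1: "(\<lambda>t. G t + M / 2 * t - E t) a' \<le> (\<lambda>t. G t + M / 2 * t - E t) b'"
    proof (rule DERIV_nonneg_imp_nondecreasing[OF ab'(1)])
      fix t assume "a' \<le> t" "t \<le> b'"
      with ab ab' have t: "t \<in> {0<..<1}" "t \<in> {a..b}" by auto
      show "\<exists>d. ((\<lambda>t. G t + M / 2 * t - E t) has_real_derivative d) (at t) \<and> 0 \<le> d"
        using le[OF t(1)] m(2)[OF t(2)]
        by (intro exI[of _ "G' t + M/2 - E' t"]) (auto intro!: derivative_eq_intros E G t simp: M_def)
    qed
    have 2: "(\<lambda>t. G t + M / 2 * t + E t) a' \<le> (\<lambda>t. G t + M / 2 * t + E t) b'"
    proof (rule DERIV_nonneg_imp_nondecreasing[OF ab'(1)])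
      fix t assume "a' \<le> t" "t \<le> b'"
      with ab ab' have t: "t \<in> {0<..<1}" "t \<in> {a..b}" by auto
      show "\<exists>d. ((\<lambda>t. G t + M / 2 * t + E t) has_real_derivative d) (at t) \<and> 0 \<le> d"
        using le[OF t(1)] m(2)[OF t(2)]
        by (intro exI[of _ "G' t + M/2 + E' t"]) (auto intro!: derivative_eq_intros E G t simp: M_def)
    qed
    from 1 2 have "E b' - E a' \<le> G b' - G a' + M / 2 * (b' - a')" "E a' - E b' \<le> G b' - G a' + M / 2 * (b' - a')"
      by (simp_all add: right_diff_distrib)
    then show ?thesis by linarith
  qed
  have "M \<le> \<bar>E b' - E a'\<bar>" using \<xi>(2) by (auto simp: M_def a'_def b'_def min_def max_def)
  also have "G b' - G a' \<le> T" using T[of a' b'] ab ab' by auto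
  then have "G b' - G a' + M / 2 * (b' - a') \<le> T + M / 2 * 1"
    using ab ab' by (intro add_mono mult_left_mono) (auto simp: M_def)
  note order_trans[OF bd this]
  finally have "M \<le> 2 * T" by simp
  then show ?thesis using m(2)[OF ab(4)] by (simp add: M_def)
qed

text \<open>\<open>E\<^sup>2\<close> times \<open>exp (- 2 C s)\<close> decreases and
  \<open>E\<^sup>2\<close> times \<open>exp (2 C s)\<close> increases, so a zero spreads in both
  directions. The zero may sit at the end point 0, where only continuity is available.\<close>

lemma linear_ode_zero:
  fixes E :: "real \<Rightarrow> real"
  assumes E: "\<And>t. t \<in> {0<..<1} \<Longrightarrow> (E has_real_derivative E' t) (at t)"
    and cont: "continuous_on {min \<xi> t..max \<xi> t} E"
    and le: "\<And>t. t \<in> {0<..<1} \<Longrightarrow> \<bar>E' t\<bar> \<le> C * \<bar>E t\<bar>"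
    and \<xi>: "\<xi> \<in> {0..<1}" "E \<xi> = 0"
    and t: "t \<in> {0..<1}"
  shows "E t = 0"
proof -
  have bd: "\<bar>E s * E' s\<bar> \<le> C * (E s)\<^sup>2" if "s \<in> {0<..<1}" for s
  proof -
    have "\<bar>E s * E' s\<bar> \<le> \<bar>E s\<bar> * (C * \<bar>E s\<bar>)"
      unfolding abs_mult by (intro mult_left_mono le that) auto
    also have "\<dots> = C * \<bar>E s\<bar>\<^sup>2" by (simp only: power2_eq_square mult_ac)
    finally show ?thesis by simp
  qed
  have cts: "continuous_on {x..y} (\<lambda>s. (E s)\<^sup>2 * exp (- 2 * C * s))"
      "continuous_on {x..y} (\<lambda>s. (E s)\<^sup>2 * exp (2 * C * s))" if "min \<xi> t \<le> x" "y \<le> max \<xi> t" for x y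
  proof -
    have "continuous_on {x..y} E" by (rule continuous_on_subset[OF cont]) (use that in auto)
    then show "continuous_on {x..y} (\<lambda>s. (E s)\<^sup>2 * exp (- 2 * C * s))"
      "continuous_on {x..y} (\<lambda>s. (E s)\<^sup>2 * exp (2 * C * s))"
      by (auto intro!: continuous_intros)
  qed
  have der: "((\<lambda>s. (E s)\<^sup>2 * exp (c * s)) has_real_derivative
        (2 * (E s * E' s) + c * (E s)\<^sup>2) * exp (c * s)) (at s)" if "s \<in> {0<..<1}" for s c
  proof -
    have "((\<lambda>s. exp (c * s)) has_real_derivative c * exp (c * s)) (at s)"
      by (rule derivative_eq_intros refl | simp)+
    from DERIV_mult[OF DERIV_power[OF E[OF that], of 2] this] show ?thesis
      by (rule DERIV_cong) (simp add: distrib_right)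
  qed
  have "(E t)\<^sup>2 \<le> 0"
  proof (cases "t \<le> \<xi>")
    case False
    have "(\<lambda>s. (E s)\<^sup>2 * exp (- 2 * C * s)) t \<le> (\<lambda>s. (E s)\<^sup>2 * exp (- 2 * C * s)) \<xi>"
    proof (rule DERIV_nonpos_imp_decreasing_open[of \<xi> t "\<lambda>s. (E s)\<^sup>2 * exp (- 2 * C * s)"])
      fix s assume "\<xi> < s" "s < t"
      then have s: "s \<in> {0<..<1}" using \<xi> t by auto
      have "2 * (E s * E' s) + - 2 * C * (E s)\<^sup>2 \<le> 0" using bd[OF s] by linarith
      then show "\<exists>d. ((\<lambda>s. (E s)\<^sup>2 * exp (- 2 * C * s)) has_real_derivative d) (at s) \<and> d \<le> 0"
        using der[OF s, of "- 2 * C"] mult_nonpos_nonneg[OF _ exp_ge_zero] by blast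
    qed (use False \<xi> t cts[of \<xi> t] in auto)
    with \<xi> show ?thesis by (simp add: mult_le_0_iff)
  next
    case True
    have "(\<lambda>s. (E s)\<^sup>2 * exp (2 * C * s)) t \<le> (\<lambda>s. (E s)\<^sup>2 * exp (2 * C * s)) \<xi>"
    proof (rule DERIV_nonneg_imp_increasing_open[of t \<xi> "\<lambda>s. (E s)\<^sup>2 * exp (2 * C * s)"])
      fix s assume "t < s" "s < \<xi>"
      then have s: "s \<in> {0<..<1}" using \<xi> t by auto
      have "0 \<le> 2 * (E s * E' s) + 2 * C * (E s)\<^sup>2" using bd[OF s] by linarith
      then show "\<exists>d. ((\<lambda>s. (E s)\<^sup>2 * exp (2 * C * s)) has_real_derivative d) (at s) \<and> 0 \<le> d"
        using der[OF s, of "2 * C"] mult_nonneg_nonneg[OF _ exp_ge_zero] by blast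
    qed (use True \<xi> t cts[of t \<xi>] in auto)
    with \<xi> show ?thesis by (simp add: mult_le_0_iff)
  qed
  then show ?thesis by simp
qed

lemma DERIV_arcsin_unit:
  "t \<in> {0<..<1} \<Longrightarrow> (arcsin has_real_derivative 1 / sqrt (1 - t\<^sup>2)) (at t)"
  using DERIV_arcsin[of t] by (simp add: divide_inverse)

lemma arcsin_unit_diff:
  assumes "s \<in> {0<..<1}" "t \<in> {0<..<1}" shows "\<bar>arcsin t - arcsin s\<bar> \<le> 2"
proof -
  have "0 \<le> arcsin t" "arcsin t \<le> pi/2" "0 \<le> arcsin s" "arcsin s \<le> pi/2"
    using assms arcsin_bounded[of t] arcsin_bounded[of s] arcsin_le_mono[of 0 t] arcsin_le_mono[of 0 s] by auto
  then show ?thesis using pi_less_4 by linarith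
qed

text \<open>The numerator in the derivative of \<open>q = D / (1 - t)\<close> is
  \<open>D + D1 (1 - t)\<close>, which up to sign is the Taylor remainder between \<open>t\<close>
  and the end point 1, where \<open>D\<close> vanishes. Hence \<open>q\<close> is Lipschitz with
  constant \<open>B\<close> and tends to 0, which is the quadratic bound for
  \<open>D\<close>.\<close>

lemma second_order_zero_at_one:
  fixes D D1 D2 D3 :: "real \<Rightarrow> real"
  assumes 1: "\<And>t. t \<in> {0<..<1} \<Longrightarrow> (D has_real_derivative D1 t) (at t)"
    and 2: "\<And>t. t \<in> {0<..<1} \<Longrightarrow> (D1 has_real_derivative D2 t) (at t)"
    and le: "\<And>t. t \<in> {0<..<1} \<Longrightarrow> \<bar>D2 t\<bar> \<le> B"
    and l1: "((\<lambda>t. D t / (1 - t)) \<longlongrightarrow> 0) (at_left 1)"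
    and t: "t \<in> {0<..<1}"
  shows "\<bar>D t\<bar> \<le> B * (1 - t)\<^sup>2"
proof -
  have ev1: "\<forall>\<^sub>F s in at_left (1::real). s \<in> {t<..<1}" if "t < 1" for t
    using that by (intro eventually_at_leftI[of t]) auto
  have "((\<lambda>t. D t / (1 - t) * (1 - t)) \<longlongrightarrow> 0 * (1 - 1)) (at_left 1)"
    by (intro tendsto_intros l1)
  then have l0': "((\<lambda>t. D t / (1 - t) * (1 - t)) \<longlongrightarrow> 0) (at_left 1)" by simp
  have l0: "(D \<longlongrightarrow> 0) (at_left 1)"
    by (rule Lim_transform_eventually[OF l0' eventually_mono[OF ev1[of 0]]]) auto
  \<comment> \<open>Two mean value steps and then the limit \<open>z \<longrightarrow> 1\<close>;
    the factor 1/2 of the sharp Taylor remainder is given away.\<close>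
  have tay: "\<bar>D t + D1 t * (1 - t)\<bar> \<le> B * (1 - t)\<^sup>2" if t: "t \<in> {0<..<1}" for t
  proof -
    have "\<bar>D z - D t - D1 t * (z - t)\<bar> \<le> B * (z - t)\<^sup>2" if z: "z \<in> {t<..<1}" for z
    proof -
      obtain c where c: "t < c" "c < z" "D z - D t = (z - t) * D1 c"
        using MVT2[of t z D D1] z t 1 by force
      obtain e where e: "t < e" "e < c" "D1 c - D1 t = (c - t) * D2 e"
        using MVT2[of t c D1 D2] c z t 2 by force
      have "D z - D t - D1 t * (z - t) = (z - t) * ((c - t) * D2 e)"
        using c(3) e(3) by algebra
      then have "\<bar>D z - D t - D1 t * (z - t)\<bar> = (z - t) * ((c - t) * \<bar>D2 e\<bar>)"
        using c e by (simp add: abs_mult)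
      also have "\<dots> \<le> (z - t) * ((z - t) * B)"
        using c e z t le[of e] by (intro mult_left_mono mult_mono) auto
      finally show ?thesis by (simp add: power2_eq_square mult_ac)
    qed
    then have ev: "\<forall>\<^sub>F z in at_left 1. \<bar>D z - D t - D1 t * (z - t)\<bar> \<le> B * (z - t)\<^sup>2"
      using ev1[of t] t by (auto elim!: eventually_mono)
    have "\<bar>0 - D t - D1 t * (1 - t)\<bar> \<le> B * (1 - t)\<^sup>2"
    proof (rule tendsto_le[OF _ _ _ ev])
      show "((\<lambda>z. \<bar>D z - D t - D1 t * (z - t)\<bar>) \<longlongrightarrow> \<bar>0 - D t - D1 t * (1 - t)\<bar>) (at_left 1)"
        "((\<lambda>z. B * (z - t)\<^sup>2) \<longlongrightarrow> B * (1 - t)\<^sup>2) (at_left 1)"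
        by (intro tendsto_intros l0)+
    qed simp
    then show ?thesis by (simp add: abs_minus_commute abs_if split: if_splits)
  qed
  define q where "q t = D t / (1 - t)" for t
  have dq: "(q has_real_derivative (D1 t * (1 - t) + D t) / (1 - t)\<^sup>2) (at t)" if "t \<in> {0<..<1}" for t
    unfolding q_def using that by (auto intro!: derivative_eq_intros 1 simp: power2_eq_square)
  have lip: "\<bar>q z - q t\<bar> \<le> \<bar>B * z - B * t\<bar>" if "z \<in> {t<..<1}" for z
  proof (rule deriv_dominated[OF dq, where g' = "\<lambda>_. B"])
    fix s :: real assume s: "s \<in> {0<..<1}"
    then show "\<bar>(D1 s * (1 - s) + D s) / (1 - s)\<^sup>2\<bar> \<le> B"
      using tay[OF s] by (simp add: abs_divide divide_le_eq add.commute)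
  qed (use that t in \<open>auto intro!: derivative_eq_intros\<close>)
  have "\<bar>0 - q t\<bar> \<le> \<bar>B * 1 - B * t\<bar>"
  proof (rule tendsto_le)
    show "((\<lambda>z. \<bar>B * z - B * t\<bar>) \<longlongrightarrow> \<bar>B * 1 - B * t\<bar>) (at_left 1)" by (intro tendsto_intros)
    have "(q \<longlongrightarrow> 0) (at_left 1)" using l1 by (simp add: q_def[abs_def])
    then show "((\<lambda>z. \<bar>q z - q t\<bar>) \<longlongrightarrow> \<bar>0 - q t\<bar>) (at_left 1)" by (intro tendsto_intros)
    show "\<forall>\<^sub>F z in at_left 1. \<bar>q z - q t\<bar> \<le> \<bar>B * z - B * t\<bar>"
      using ev1[of t] t lip by (auto elim!: eventually_mono)
  qed simp
  moreover have "0 \<le> B" using le[OF t] by linarith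
  moreover have "\<bar>B * 1 - B * t\<bar> = B * (1 - t)" if "0 \<le> B"
    using t that by (simp only: right_diff_distrib[symmetric] abs_mult) simp
  ultimately have "\<bar>q t\<bar> \<le> B * (1 - t)" by simp
  then show ?thesis using t by (simp add: q_def abs_divide divide_le_eq power2_eq_square mult_ac)
qed

text \<open>The majorant of \<open>D3\<close> integrates to \<open>arcsin\<close>, so
  \<open>D2\<close> differs from its value \<open>c\<close> at 1/2 by at most \<open>2 B\<close>.
  After removing \<open>c / 2 (1 - t)\<^sup>2\<close> the second-order lemma applies, and the
  condition at 0 bounds \<open>c / 2\<close> by \<open>2 B\<close>: the boundary value at 0 takes
  the place of an initial value for \<open>D2\<close>.\<close>

lemma third_order_bound:
  fixes D D1 D2 D3 :: "real \<Rightarrow> real"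
  assumes 1: "\<And>t. t \<in> {0<..<1} \<Longrightarrow> (D has_real_derivative D1 t) (at t)"
    and 2: "\<And>t. t \<in> {0<..<1} \<Longrightarrow> (D1 has_real_derivative D2 t) (at t)"
    and 3: "\<And>t. t \<in> {0<..<1} \<Longrightarrow> (D2 has_real_derivative D3 t) (at t)"
    and le: "\<And>t. t \<in> {0<..<1} \<Longrightarrow> \<bar>D3 t\<bar> \<le> B / sqrt (1 - t\<^sup>2)"
    and l0: "(D \<longlongrightarrow> 0) (at_right 0)"
    and l1: "((\<lambda>t. D t / (1 - t)) \<longlongrightarrow> 0) (at_left 1)"
    and t: "t \<in> {0<..<1}"
  shows "\<bar>D t\<bar> \<le> 4 * B * (1 - t)\<^sup>2"
proof -
  define c where "c = D2 (1/2)"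
  have B: "0 \<le> B"
  proof -
    have "0 \<le> B / sqrt (1 - t\<^sup>2)" using le[OF t] by linarith
    moreover have "0 < sqrt (1 - t\<^sup>2)" using t by (auto simp: power_less_one_iff)
    ultimately show ?thesis by (simp add: zero_le_divide_iff)
  qed
  have osc: "\<bar>D2 s - c\<bar> \<le> 2 * B" if s: "s \<in> {0<..<1}" for s
  proof -
    have "\<bar>D2 s - D2 (1/2)\<bar> \<le> \<bar>B * arcsin s - B * arcsin (1/2)\<bar>"
      by (rule deriv_dominated[OF 3 DERIV_cmult[OF DERIV_arcsin_unit]]) (use le s in auto)
    also have "\<dots> = B * \<bar>arcsin s - arcsin (1/2)\<bar>"
      using B by (simp only: right_diff_distrib[symmetric] abs_mult abs_of_nonneg)
    also have "\<dots> \<le> B * 2" using arcsin_unit_diff[of "1/2" s] s B by (intro mult_left_mono) auto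
    finally show ?thesis by (simp add: c_def mult.commute)
  qed
  have E: "\<bar>D t - c / 2 * (1 - t)\<^sup>2\<bar> \<le> 2 * B * (1 - t)\<^sup>2" if t: "t \<in> {0<..<1}" for t
  proof (rule second_order_zero_at_one[where ?D1.0 = "\<lambda>t. D1 t + c * (1 - t)" and ?D2.0 = "\<lambda>t. D2 t - c"])
    have "((\<lambda>t. D t / (1 - t) - c / 2 * (1 - t)) \<longlongrightarrow> 0 - c / 2 * (1 - 1)) (at_left 1)"
      by (intro tendsto_intros l1)
    then have *: "((\<lambda>t. D t / (1 - t) - c / 2 * (1 - t)) \<longlongrightarrow> 0) (at_left 1)" by simp
    show "((\<lambda>t. (D t - c / 2 * (1 - t)\<^sup>2) / (1 - t)) \<longlongrightarrow> 0) (at_left 1)"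
    proof (rule Lim_transform_eventually[OF *], rule eventually_at_leftI[of 0])
      fix t :: real assume t: "t \<in> {0<..<1}"
      have "c / 2 * (1 - t)\<^sup>2 / (1 - t) = c / 2 * (1 - t) * (1 - t) / (1 - t)"
        by (simp only: power2_eq_square mult.assoc)
      also have "\<dots> = c / 2 * (1 - t)" using t by (intro nonzero_mult_div_cancel_right) auto
      finally show "D t / (1 - t) - c / 2 * (1 - t) = (D t - c / 2 * (1 - t)\<^sup>2) / (1 - t)"
        by (simp only: diff_divide_distrib)
    qed simp
  qed (use t osc in \<open>auto intro!: derivative_eq_intros 1 2 simp: field_simps\<close>)
  have "\<bar>0 - c / 2 * (1 - 0)\<^sup>2\<bar> \<le> 2 * B * (1 - 0)\<^sup>2"
  proof (rule tendsto_le)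
    show "((\<lambda>t. 2 * B * (1 - t)\<^sup>2) \<longlongrightarrow> 2 * B * (1 - 0)\<^sup>2) (at_right 0)"
      "((\<lambda>t. \<bar>D t - c / 2 * (1 - t)\<^sup>2\<bar>) \<longlongrightarrow> \<bar>0 - c / 2 * (1 - 0)\<^sup>2\<bar>) (at_right 0)"
      by (intro tendsto_intros l0)+
    show "\<forall>\<^sub>F t in at_right 0. \<bar>D t - c / 2 * (1 - t)\<^sup>2\<bar> \<le> 2 * B * (1 - t)\<^sup>2"
      by (rule eventually_at_rightI[of 0 1]) (use E in auto)
  qed simp
  then have c: "\<bar>c / 2\<bar> \<le> 2 * B" by simp
  have "\<bar>D t\<bar> \<le> \<bar>D t - c / 2 * (1 - t)\<^sup>2\<bar> + \<bar>c / 2\<bar> * (1 - t)\<^sup>2"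
    using abs_triangle_ineq[of "D t - c / 2 * (1 - t)\<^sup>2" "c / 2 * (1 - t)\<^sup>2"] by (simp add: abs_mult)
  also have "\<dots> \<le> 2 * B * (1 - t)\<^sup>2 + 2 * B * (1 - t)\<^sup>2"
    by (intro add_mono E[OF t] mult_right_mono c) auto
  finally show ?thesis by (simp add: algebra_simps)
qed

section \<open>Zonal functions and the equations for the profiles\<close>

definition has_partial :: "3 \<Rightarrow> (real^3 \<Rightarrow> 'a::real_normed_vector) \<Rightarrow> 'a \<Rightarrow> real^3 \<Rightarrow> bool" where
  "has_partial i f d x \<longleftrightarrow> ((\<lambda>t. f (x + t *\<^sub>R axis i 1)) has_vector_derivative d) (at 0)"

text \<open>The bridge to the total function \<open>partial\<close>, which has some value even where
  no derivative exists. All calculus is done with the relation, where existence is part of the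
  claim.\<close>

lemma partial_eqI: "has_partial i f d x \<Longrightarrow> partial i f x = d"
  by (simp add: has_partial_def partial_def vector_derivative_at)

lemma has_partial_cong: "has_partial i f d x \<Longrightarrow> d = e \<Longrightarrow> has_partial i f e x"
  by simp

lemma has_partial_unique: "has_partial i f d x \<Longrightarrow> has_partial i f d' x \<Longrightarrow> d = d'"
  using partial_eqI by blast

lemma has_partial_const: "has_partial i (\<lambda>x. c) 0 x"
  by (simp add: has_partial_def)

lemma has_partial_nth: "has_partial i (\<lambda>x. x $ j) (if i = j then 1 else 0) x"
  by (auto simp: has_partial_def axis_def has_real_derivative_iff_has_vector_derivative[symmetric]
      intro!: derivative_eq_intros)

lemma has_partial_add:
  "has_partial i f d x \<Longrightarrow> has_partial i g e x \<Longrightarrow> has_partial i (\<lambda>x. f x + g x) (d + e) x"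
  unfolding has_partial_def by (rule has_vector_derivative_add)

lemma has_partial_diff:
  "has_partial i f d x \<Longrightarrow> has_partial i g e x \<Longrightarrow> has_partial i (\<lambda>x. f x - g x) (d - e) x"
  unfolding has_partial_def by (rule has_vector_derivative_diff)

lemma has_partial_mult:
  fixes f g :: "real^3 \<Rightarrow> real"
  shows "has_partial i f d x \<Longrightarrow> has_partial i g e x \<Longrightarrow>
    has_partial i (\<lambda>x. f x * g x) (f x * e + d * g x) x"
  unfolding has_partial_def using has_vector_derivative_mult by fastforce

lemma has_partial_chain:
  assumes "has_partial i f d x" "(g has_real_derivative g') (at (f x))"
  shows "has_partial i (\<lambda>x. g (f x)) (g' * d) x"
  using DERIV_chain2[of g g' "\<lambda>t. f (x + t *\<^sub>R axis i 1)" 0 d UNIV] assms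
  by (simp add: has_partial_def has_real_derivative_iff_has_vector_derivative[symmetric])

lemma has_partial_vec_nth:
  assumes "has_partial i f d x" shows "has_partial i (\<lambda>x. f x $ j) (d $ j) x"
  using bounded_linear.has_vector_derivative[OF bounded_linear_vec_nth, of _ d] assms
  by (auto simp: has_partial_def)

lemma has_partial_vec:
  fixes f :: "real^3 \<Rightarrow> real^'n"
  assumes "\<And>j. has_partial i (\<lambda>x. f x $ j) (d $ j) x" shows "has_partial i f d x"
proof -
  have "((\<lambda>t. \<Sum>j\<in>UNIV. (f (x + t *\<^sub>R axis i 1) $ j) *\<^sub>R axis j (1::real)) has_vector_derivative
      (\<Sum>j\<in>UNIV. (d $ j) *\<^sub>R axis j 1)) (at 0)"
    by (intro has_vector_derivative_sum
        bounded_linear.has_vector_derivative[OF bounded_linear_scaleR_left])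
       (use assms in \<open>auto simp: has_partial_def\<close>)
  then show ?thesis
    unfolding has_partial_def basis_expansion[where 'a = real, unfolded scalar_mult_eq_scaleR] .
qed

text \<open>Fields are known by formulas only on open sets such as \<open>offaxis\<close>;
  derivatives at a point of the set carry over.\<close>

lemma has_partial_transform:
  assumes "open \<Omega>" "x \<in> \<Omega>" "\<And>z. z \<in> \<Omega> \<Longrightarrow> f z = g z" "has_partial i f d x"
  shows "has_partial i g d x"
  unfolding has_partial_def
proof (rule has_vector_derivative_transform_within_open[of "\<lambda>t. f (x + t *\<^sub>R axis i 1)"])
  show "open ((\<lambda>t. x + t *\<^sub>R axis i (1::real)) -` \<Omega>)"
    by (intro continuous_open_vimage continuous_intros assms)
qed (use assms in \<open>auto simp: has_partial_def\<close>)

section \<open>The half-space off the axis and zonal functions\<close>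

lemma norm_sq_3: "(norm x)\<^sup>2 = (x $ 1)\<^sup>2 + (x $ 2)\<^sup>2 + (x $ 3)\<^sup>2" for x :: "real^3"
  by (simp add: norm_vec_def L2_set_def sum_3 sum_nonneg)

lemma has_partial_norm:
  assumes "x \<noteq> 0" shows "has_partial i norm (x $ i / norm x) x"
proof -
  have eq: "norm (x + t *\<^sub>R axis i 1) = sqrt ((norm x)\<^sup>2 + 2 * t * x $ i + t\<^sup>2)" for t
    by (simp add: norm_eq_sqrt_inner inner_add_left inner_add_right inner_axis inner_axis'
        inner_axis_axis power2_eq_square algebra_simps)
  have "((\<lambda>t. sqrt ((norm x)\<^sup>2 + 2 * t * x $ i + t\<^sup>2)) has_real_derivative x $ i / norm x) (at 0)"
    by (rule derivative_eq_intros refl | use assms in \<open>simp add: field_simps\<close>)+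
  then show ?thesis
    by (simp add: has_partial_def eq has_real_derivative_iff_has_vector_derivative)
qed

text \<open>On this set \<open>x $ 3 / norm x\<close> lies strictly between 0 and 1, so derivatives
  of profiles are used on the open interval only. The equations are verified here and carried to the
  axis by continuity.\<close>

definition offaxis :: "(real^3) set" where
  "offaxis = {x. 0 < x $ 3 \<and> (x $ 1 \<noteq> 0 \<or> x $ 2 \<noteq> 0)}"

lemma open_half_space: "open half_space"
  unfolding half_space_def by (intro open_Collect_less continuous_intros)

lemma open_offaxis: "open offaxis"
  unfolding offaxis_def
  by (intro open_Collect_conj open_Collect_disj open_Collect_less open_Collect_neq continuous_intros)

lemma offaxis_half_space: "x \<in> offaxis \<Longrightarrow> x \<in> half_space"
  by (simp add: offaxis_def half_space_def)

lemma half_space_closed: "x \<in> half_space \<Longrightarrow> x \<in> closed_half_space0"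
  by (auto simp: half_space_def closed_half_space0_def)

lemma offaxis_nz: "x \<in> offaxis \<Longrightarrow> x \<noteq> 0" by (auto simp: offaxis_def)

lemma offaxis_height:
  assumes "x \<in> offaxis" shows "x $ 3 / norm x \<in> {0<..<1}"
proof -
  have "(x $ 3)\<^sup>2 < (norm x)\<^sup>2"
    using assms by (auto simp: norm_sq_3 offaxis_def add_pos_nonneg add_nonneg_pos)
  then have "x $ 3 < norm x" by (rule power_less_imp_less_base) simp
  then show ?thesis using assms offaxis_nz[OF assms] by (auto simp: offaxis_def)
qed

definition zonal :: "int \<Rightarrow> (real \<Rightarrow> real) \<Rightarrow> real^3 \<Rightarrow> real" where
  "zonal n a x = norm x powi n * a (x $ 3 / norm x)"

text \<open>Expressed again by zonal functions, of degrees \<open>n - 2\<close> and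
  \<open>n - 1\<close>, so that the same differentiation rule yields second derivatives.\<close>

definition zonal_partial :: "3 \<Rightarrow> int \<Rightarrow> (real \<Rightarrow> real) \<Rightarrow> (real \<Rightarrow> real) \<Rightarrow> real^3 \<Rightarrow> real" where
  "zonal_partial i n a a1 x = x $ i * zonal (n - 2) (\<lambda>y. of_int n * a y - y * a1 y) x
     + (if i = 3 then zonal (n - 1) a1 x else 0)"

lemma has_partial_zonal:
  assumes x: "x \<in> offaxis" and a: "\<And>y. y \<in> {0<..<1} \<Longrightarrow> (a has_real_derivative a' y) (at y)"
  shows "has_partial i (zonal n a) (zonal_partial i n a a' x) x"
proof -
  have nz: "norm x \<noteq> 0" "x \<noteq> 0" using offaxis_nz[OF x] by auto
  have pw: "norm x powi (n - 1) = norm x powi n / norm x" "norm x powi (n - 2) = norm x powi n / (norm x)\<^sup>2"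
    using nz by (auto simp: power_int_diff)
  have 1: "has_partial i (\<lambda>x. norm x powi n) (of_int n * norm x powi (n - 1) * (x $ i / norm x)) x"
    by (rule has_partial_chain[OF has_partial_norm[OF nz(2)]])
       (use nz in \<open>auto intro!: derivative_eq_intros\<close>)
  have 2: "has_partial i (\<lambda>x. inverse (norm x)) (- (inverse (norm x) ^ 2) * (x $ i / norm x)) x"
    by (rule has_partial_chain[OF has_partial_norm[OF nz(2)]])
       (use nz in \<open>auto intro!: derivative_eq_intros simp: power2_eq_square\<close>)
  have 3: "has_partial i (\<lambda>x. x $ 3 / norm x)
     (x $ 3 * (- (inverse (norm x) ^ 2) * (x $ i / norm x)) + (if i = 3 then 1 else 0) * inverse (norm x)) x"
    unfolding divide_inverse[of "_ $ 3"] by (rule has_partial_mult[OF has_partial_nth 2])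
  note 4 = has_partial_mult[OF 1 has_partial_chain[OF 3 a[OF offaxis_height[OF x]]]]
  show ?thesis
    unfolding zonal_def zonal_partial_def by (rule has_partial_cong[OF 4])
      (use nz in \<open>simp add: pw field_simps power2_eq_square\<close>)
qed

text \<open>The first partials are required on a neighbourhood, as they are differentiated again.\<close>

definition has_laplacian :: "(real^3 \<Rightarrow> real) \<Rightarrow> (3 \<Rightarrow> real) \<Rightarrow> real \<Rightarrow> real^3 \<Rightarrow> bool" where
  "has_laplacian f g l x \<longleftrightarrow> (\<exists>G h. (\<forall>i. \<forall>z\<in>offaxis. has_partial i f (G i z) z) \<and>
     (\<forall>i. g i = G i x) \<and> (\<forall>i. has_partial i (G i) (h i) x) \<and> l = (\<Sum>i\<in>UNIV. h i))"

lemma has_laplacian_diff: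
  assumes "has_laplacian f g l x" "has_laplacian f' g' l' x"
  shows "has_laplacian (\<lambda>z. f z - f' z) (\<lambda>i. g i - g' i) (l - l') x"
proof -
  from assms obtain G h G' h' where
    "\<And>i z. z \<in> offaxis \<Longrightarrow> has_partial i f (G i z) z" "\<And>i. g i = G i x"
    "\<And>i. has_partial i (G i) (h i) x" "l = (\<Sum>i\<in>UNIV. h i)"
    "\<And>i z. z \<in> offaxis \<Longrightarrow> has_partial i f' (G' i z) z" "\<And>i. g' i = G' i x"
    "\<And>i. has_partial i (G' i) (h' i) x" "l' = (\<Sum>i\<in>UNIV. h' i)"
    unfolding has_laplacian_def by blast
  then show ?thesis unfolding has_laplacian_def
    by (intro exI[of _ "\<lambda>i z. G i z - G' i z"] exI[of _ "\<lambda>i. h i - h' i"])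
       (auto simp: sum_subtractf intro!: has_partial_diff)
qed

lemma has_laplacian_add:
  assumes "has_laplacian f g l x" "has_laplacian f' g' l' x"
  shows "has_laplacian (\<lambda>z. f z + f' z) (\<lambda>i. g i + g' i) (l + l') x"
proof -
  from assms obtain G h G' h' where
    "\<And>i z. z \<in> offaxis \<Longrightarrow> has_partial i f (G i z) z" "\<And>i. g i = G i x"
    "\<And>i. has_partial i (G i) (h i) x" "l = (\<Sum>i\<in>UNIV. h i)"
    "\<And>i z. z \<in> offaxis \<Longrightarrow> has_partial i f' (G' i z) z" "\<And>i. g' i = G' i x"
    "\<And>i. has_partial i (G' i) (h' i) x" "l' = (\<Sum>i\<in>UNIV. h' i)"
    unfolding has_laplacian_def by blast
  then show ?thesis unfolding has_laplacian_def
    by (intro exI[of _ "\<lambda>i z. G i z + G' i z"] exI[of _ "\<lambda>i. h i + h' i"])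
       (auto simp: sum.distrib intro!: has_partial_add)
qed

text \<open>The Leibniz rule: the Laplacian of \<open>z $ j\<close> vanishes and its gradient is a
  basis vector, so only the cross term \<open>2 g j\<close> is new.\<close>

lemma has_laplacian_nth_mult:
  assumes "has_laplacian f g l x" "x \<in> offaxis"
  shows "has_laplacian (\<lambda>z. z $ j * f z) (\<lambda>i. x $ j * g i + (if i = j then f x else 0))
    (x $ j * l + 2 * g j) x"
proof -
  from assms obtain G h where G: "\<And>i z. z \<in> offaxis \<Longrightarrow> has_partial i f (G i z) z" "\<And>i. g i = G i x"
    and h: "\<And>i. has_partial i (G i) (h i) x" "l = (\<Sum>i\<in>UNIV. h i)"
    unfolding has_laplacian_def by blast
  have 1: "has_partial i (\<lambda>z. z $ j * f z) (z $ j * G i z + (if i = j then 1 else 0) * f z) z"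
    if "z \<in> offaxis" for i z
    by (intro has_partial_mult has_partial_nth G that)
  have 2: "has_partial i (\<lambda>z. z $ j * G i z + (if i = j then 1 else 0) * f z)
      ((x $ j * h i + (if i = j then 1 else 0) * G i x) + ((if i = j then 1 else 0) * G i x + 0 * f x)) x" for i
    by (intro has_partial_mult has_partial_add has_partial_nth has_partial_const G h assms(2))
  show ?thesis unfolding has_laplacian_def
    by (intro exI conjI allI ballI, erule 1, (subst G(2); simp), rule 2)
       (use exhaust_3[of j] in \<open>auto simp: sum_3 h(2) G(2) algebra_simps\<close>)
qed

text \<open>The Laplacian in spherical coordinates: \<open>n (n + 1)\<close> is the radial part
  acting on degree \<open>n\<close>, and the remaining terms are the Legendre operator
  \<open>((1 - y\<^sup>2) a')'\<close>.\<close>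

lemma has_laplacian_zonal:
  assumes x: "x \<in> offaxis"
    and a: "\<And>y. y \<in> {0<..<1} \<Longrightarrow> (a has_real_derivative a1 y) (at y)"
    and a1: "\<And>y. y \<in> {0<..<1} \<Longrightarrow> (a1 has_real_derivative a2 y) (at y)"
  shows "has_laplacian (zonal n a) (\<lambda>i. zonal_partial i n a a1 x)
    (zonal (n - 2) (\<lambda>y. of_int (n * (n + 1)) * a y - 2 * y * a1 y + (1 - y\<^sup>2) * a2 y) x) x"
proof -
  define A where "A y = of_int n * a y - y * a1 y" for y
  define A1 where "A1 y = of_int n * a1 y - (a1 y + y * a2 y)" for y
  have dA: "(A has_real_derivative A1 y) (at y)" if "y \<in> {0<..<1}" for y
    unfolding A_def[abs_def] A1_def
    by (rule derivative_eq_intros a[OF that] a1[OF that] refl | simp add: algebra_simps)+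
  define \<delta> where "\<delta> i = (if i = (3::3) then 1 else (0::real))" for i
  have zp: "zonal_partial i n a a1 = (\<lambda>z. z $ i * zonal (n - 2) A z + \<delta> i * zonal (n - 1) a1 z)" for i
    by (auto simp: zonal_partial_def[abs_def] A_def[abs_def] \<delta>_def)
  define C where "C i = zonal_partial i (n - 2) A A1 x" for i
  define E where "E i = zonal_partial i (n - 1) a1 a2 x" for i
  have h: "has_partial i (zonal_partial i n a a1)
      (x $ i * C i + (if i = i then 1 else 0) * zonal (n - 2) A x
       + (\<delta> i * E i + 0 * zonal (n - 1) a1 x)) x" for i
    unfolding zp C_def E_def
    by (intro has_partial_add has_partial_mult has_partial_nth has_partial_zonal has_partial_const x dA a1)
  have nz: "norm x \<noteq> 0" using offaxis_nz[OF x] by auto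
  define \<rho> where "\<rho> = norm x"
  define y where "y = x $ 3 / \<rho>"
  have r: "x $ 3 = y * \<rho>" "\<rho> \<noteq> 0" using nz by (auto simp: y_def \<rho>_def)
  \<comment> \<open>The lowest power that occurs; the others are \<open>Q\<close> times a
    nonnegative power of \<open>\<rho>\<close>, which makes the identity polynomial.\<close>
  define Q where "Q = \<rho> powi (n - 4)"
  have pw: "\<rho> powi (n - 2 - 2) = Q" "\<rho> powi (n - 2 - 1) = Q * \<rho>" "\<rho> powi (n - 1 - 2) = Q * \<rho>"
    "\<rho> powi (n - 1 - 1) = Q * \<rho>\<^sup>2" "\<rho> powi (n - 2) = Q * \<rho>\<^sup>2"
    using r(2) power_int_add[of \<rho> "n - 4" 1] power_int_add[of \<rho> "n - 4" 2] by (auto simp: Q_def)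
  define N where "N = (real_of_int n - 2) * A y - y * A1 y"
  have C: "C i = x $ i * (Q * N) + \<delta> i * (Q * \<rho> * A1 y)" for i
    unfolding C_def zonal_partial_def zonal_def \<rho>_def[symmetric] y_def[symmetric] pw by (simp add: N_def \<delta>_def)
  have E: "E 3 = x $ 3 * (Q * \<rho> * ((real_of_int n - 1) * a1 y - y * a2 y)) + Q * \<rho>\<^sup>2 * a2 y"
    unfolding E_def zonal_partial_def zonal_def \<rho>_def[symmetric] y_def[symmetric] pw by simp
  have sum: "(\<Sum>i\<in>UNIV. x $ i * C i + (if i = i then 1 else 0) * zonal (n - 2) A x
       + (\<delta> i * E i + 0 * zonal (n - 1) a1 x))
     = \<rho>\<^sup>2 * (Q * N) + x $ 3 * (Q * \<rho> * A1 y) + E 3 + 3 * (Q * \<rho>\<^sup>2 * A y)"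
    unfolding sum_3 C zonal_def \<rho>_def[symmetric] y_def[symmetric] pw
    unfolding \<rho>_def norm_sq_3 by (simp add: \<delta>_def algebra_simps power2_eq_square)
  have l: "zonal (n - 2) (\<lambda>y. of_int (n * (n + 1)) * a y - 2 * y * a1 y + (1 - y\<^sup>2) * a2 y) x
     = \<rho>\<^sup>2 * (Q * N) + x $ 3 * (Q * \<rho> * A1 y) + E 3 + 3 * (Q * \<rho>\<^sup>2 * A y)"
    unfolding E zonal_def \<rho>_def[symmetric] y_def[symmetric] pw r(1) N_def A_def A1_def
    by (simp add: algebra_simps power2_eq_square)
  show ?thesis unfolding has_laplacian_def
    using h l has_partial_zonal[OF _ a, of _ _ n] sum
    by (intro exI[of _ "\<lambda>i. zonal_partial i n a a1"] exI conjI allI ballI) auto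
qed

section \<open>Fields built from three profiles, and the terms of the system\<close>

lemma laplacian_eqI:
  assumes x: "x \<in> offaxis" and "\<And>j. has_laplacian (\<lambda>z. u z $ j) (g j) (l $ j) x"
  shows "laplacian u x = l"
proof -
  from assms(2) obtain G h where G: "\<And>j i z. z \<in> offaxis \<Longrightarrow> has_partial i (\<lambda>z. u z $ j) (G j i z) z"
    and h: "\<And>j i. has_partial i (G j i) (h j i) x" "\<And>j. l $ j = (\<Sum>i\<in>UNIV. h j i)"
    unfolding has_laplacian_def by metis
  have 1: "(\<chi> j. G j i z) = partial i u z" if "z \<in> offaxis" for i z
    using partial_eqI[OF has_partial_vec[of i u "\<chi> j. G j i z" z]] G[OF that] by simp
  have "partial i (partial i u) x = (\<chi> j. h j i)" for i
    by (rule partial_eqI, rule has_partial_transform[OF open_offaxis x 1], assumption,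
        rule has_partial_vec) (use h in simp)
  then show ?thesis by (simp add: laplacian_def vec_eq_iff h)
qed

text \<open>Horizontal radial part \<open>a\<close>, swirl \<open>k\<close> and vertical part
  \<open>b\<close> in Cartesian form. The factors \<open>x $ 1\<close> and \<open>x $ 2\<close>
  carry the vanishing of the horizontal part on the axis, and the spherical frame, which is
  discontinuous there, does not enter the differentiation.\<close>

definition profile_field :: "int \<Rightarrow> (real \<Rightarrow> real) \<Rightarrow> (real \<Rightarrow> real) \<Rightarrow> (real \<Rightarrow> real) \<Rightarrow> real^3 \<Rightarrow> real^3" where
  "profile_field n a k b x = vector
     [x $ 1 * zonal (n - 1) a x - x $ 2 * zonal (n - 1) k x,
      x $ 2 * zonal (n - 1) a x + x $ 1 * zonal (n - 1) k x,
      zonal n b x]"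

lemma profile_field_nth [simp]:
  "profile_field n a k b x $ 1 = x $ 1 * zonal (n - 1) a x - x $ 2 * zonal (n - 1) k x"
  "profile_field n a k b x $ 2 = x $ 2 * zonal (n - 1) a x + x $ 1 * zonal (n - 1) k x"
  "profile_field n a k b x $ 3 = zonal n b x"
  by (simp_all add: profile_field_def)

text \<open>The horizontal components form a linear system for the two zonal values with determinant
  \<open>(x $ 1)\<^sup>2 + (x $ 2)\<^sup>2\<close>, nonzero off the axis.\<close>

lemma profile_field_eq_iff:
  assumes x: "x \<in> offaxis"
  shows "profile_field n a k b x = profile_field n a' k' b' x \<longleftrightarrow>
    (let y = x $ 3 / norm x in a y = a' y \<and> k y = k' y \<and> b y = b' y)"
proof -
  have *: "p * c - q * d = p * c' - q * d' \<and> q * c + p * d = q * c' + p * d' \<longleftrightarrow> c = c' \<and> d = d'"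
    if "p \<noteq> 0 \<or> q \<noteq> 0" for p q c d c' d' :: real
  proof
    assume h: "p * c - q * d = p * c' - q * d' \<and> q * c + p * d = q * c' + p * d'"
    then have "(p\<^sup>2 + q\<^sup>2) * (c - c') = 0" "(p\<^sup>2 + q\<^sup>2) * (d - d') = 0" by algebra+
    with that show "c = c' \<and> d = d'" by (auto simp: sum_power2_eq_zero_iff)
  qed auto
  have nz: "norm x powi m \<noteq> 0" for m using offaxis_nz[OF x] by simp
  have "x $ 1 \<noteq> 0 \<or> x $ 2 \<noteq> 0" using x by (auto simp: offaxis_def)
  then show ?thesis
    using nz *[of "x $ 1" "x $ 2" "zonal (n - 1) a x" "zonal (n - 1) k x" "zonal (n - 1) a' x" "zonal (n - 1) k' x"]
    unfolding vec_eq_iff forall_3 profile_field_nth by (auto simp: zonal_def Let_def)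
qed

text \<open>Stated for any \<open>u\<close> that agrees with a profile field off the axis, so that
  it serves given fields as well as constructed ones.\<close>

lemma has_partial_profile_field:
  assumes u: "\<And>z. z \<in> offaxis \<Longrightarrow> u z = profile_field n a k b z"
    and x: "x \<in> offaxis"
    and a: "\<And>y. y \<in> {0<..<1} \<Longrightarrow> (a has_real_derivative a1 y) (at y)"
    and k: "\<And>y. y \<in> {0<..<1} \<Longrightarrow> (k has_real_derivative k1 y) (at y)"
    and b: "\<And>y. y \<in> {0<..<1} \<Longrightarrow> (b has_real_derivative b1 y) (at y)"
  shows "has_partial i u
    (vector [x $ 1 * zonal_partial i (n - 1) a a1 x + (if i = 1 then 1 else 0) * zonal (n - 1) a x
        - (x $ 2 * zonal_partial i (n - 1) k k1 x + (if i = 2 then 1 else 0) * zonal (n - 1) k x),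
      x $ 2 * zonal_partial i (n - 1) a a1 x + (if i = 2 then 1 else 0) * zonal (n - 1) a x
        + (x $ 1 * zonal_partial i (n - 1) k k1 x + (if i = 1 then 1 else 0) * zonal (n - 1) k x),
      zonal_partial i n b b1 x]) x"
    (is "has_partial i u (vector [?d1, ?d2, ?d3]) x")
proof -
  note pa = has_partial_mult[OF has_partial_nth has_partial_zonal[OF x a, of _ "n - 1"]]
  note pk = has_partial_mult[OF has_partial_nth has_partial_zonal[OF x k, of _ "n - 1"]]
  have "has_partial i (\<lambda>x. profile_field n a k b x $ 1) ?d1 x"
    using has_partial_diff[OF pa[of i 1] pk[of i 2]] by (simp only: profile_field_nth)
  moreover have "has_partial i (\<lambda>x. profile_field n a k b x $ 2) ?d2 x"
    using has_partial_add[OF pa[of i 2] pk[of i 1]] by (simp only: profile_field_nth)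
  moreover have "has_partial i (\<lambda>x. profile_field n a k b x $ 3) ?d3 x"
    using has_partial_zonal[OF x b, of i n] by (simp only: profile_field_nth)
  ultimately have "\<forall>j. has_partial i (\<lambda>x. profile_field n a k b x $ j) (vector [?d1, ?d2, ?d3] $ j) x"
    unfolding forall_3 vector_3 by blast
  then have "has_partial i (profile_field n a k b) (vector [?d1, ?d2, ?d3]) x"
    by (intro has_partial_vec) blast
  then show ?thesis
    by (rule has_partial_transform[OF open_offaxis x, rotated]) (simp add: u)
qed

text \<open>Here \<open>y = cos \<phi>\<close>, so \<open>1 - y\<^sup>2 = sin\<^sup>2 \<phi>\<close>.\<close>

context
  fixes u a k b a1 k1 b1 x
  assumes u: "\<And>z. z \<in> offaxis \<Longrightarrow> u z = profile_field (- 1) a k b z"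
    and x: "x \<in> offaxis"
    and a: "\<And>y. y \<in> {0<..<1} \<Longrightarrow> (a has_real_derivative a1 y) (at y)"
    and k: "\<And>y. y \<in> {0<..<1} \<Longrightarrow> (k has_real_derivative k1 y) (at y)"
    and b: "\<And>y. y \<in> {0<..<1} \<Longrightarrow> (b has_real_derivative b1 y) (at y)"
begin

text \<open>The horizontal components are coordinates times zonal functions of degree -2. The
  Leibniz term adds \<open>- 4 a - 2 y a1\<close> to the Legendre expression, which accounts for the
  coefficients \<open>- 4 y\<close> and \<open>- 2\<close>; the vertical component has degree -1,
  for which \<open>n (n + 1) = 0\<close>.\<close>

lemma laplacian_profile_field:
  assumes a2: "\<And>y. y \<in> {0<..<1} \<Longrightarrow> (a1 has_real_derivative a2 y) (at y)"
    and k2: "\<And>y. y \<in> {0<..<1} \<Longrightarrow> (k1 has_real_derivative k2 y) (at y)"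
    and b2: "\<And>y. y \<in> {0<..<1} \<Longrightarrow> (b1 has_real_derivative b2 y) (at y)"
  shows "laplacian u x = profile_field (- 3)
    (\<lambda>y. (1 - y\<^sup>2) * a2 y - 4 * y * a1 y - 2 * a y)
    (\<lambda>y. (1 - y\<^sup>2) * k2 y - 4 * y * k1 y - 2 * k y)
    (\<lambda>y. (1 - y\<^sup>2) * b2 y - 2 * y * b1 y) x"
proof -
  note la = has_laplacian_nth_mult[OF has_laplacian_zonal[OF x a a2, of "-2"] x]
  note lk = has_laplacian_nth_mult[OF has_laplacian_zonal[OF x k k2, of "-2"] x]
  note 1 = has_laplacian_diff[OF la[of 1] lk[of 2]]
  note 2 = has_laplacian_add[OF la[of 2] lk[of 1]]
  note 3 = has_laplacian_zonal[OF x b b2, of "-1"]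
  have cong: "has_laplacian (\<lambda>z. u z $ j) g l x"
    if "has_laplacian f g l' x" "\<And>z. profile_field (- 1) a k b z $ j = f z" "l' = l" for f g l l' j
  proof -
    from that(1) obtain G h where G: "\<And>i z. z \<in> offaxis \<Longrightarrow> has_partial i f (G i z) z" "\<And>i. g i = G i x"
      and h: "\<And>i. has_partial i (G i) (h i) x" "l' = (\<Sum>i\<in>UNIV. h i)"
      unfolding has_laplacian_def by blast
    have "has_partial i (\<lambda>z. u z $ j) (G i z) z" if "z \<in> offaxis" for i z
      by (rule has_partial_transform[OF open_offaxis that _ G(1)[OF that]]) (simp add: u \<open>\<And>z. _ = f z\<close>)
    then show ?thesis unfolding has_laplacian_def using G(2) h \<open>l' = l\<close> by blast
  qed
  let ?W = "profile_field (- 3)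
    (\<lambda>y. (1 - y\<^sup>2) * a2 y - 4 * y * a1 y - 2 * a y)
    (\<lambda>y. (1 - y\<^sup>2) * k2 y - 4 * y * k1 y - 2 * k y)
    (\<lambda>y. (1 - y\<^sup>2) * b2 y - 2 * y * b1 y) x"
  define \<rho> where "\<rho> = norm x"
  define y where "y = x $ 3 / \<rho>"
  note un = profile_field_nth zonal_partial_def zonal_def \<rho>_def[symmetric] y_def[symmetric]
  have "\<exists>g. has_laplacian (\<lambda>z. u z $ 1) g (?W $ 1) x"
    by (rule exI, rule cong[OF 1]) (unfold un, simp_all add: algebra_simps)
  moreover have "\<exists>g. has_laplacian (\<lambda>z. u z $ 2) g (?W $ 2) x"
    by (rule exI, rule cong[OF 2]) (unfold un, simp_all add: algebra_simps)
  moreover have "\<exists>g. has_laplacian (\<lambda>z. u z $ 3) g (?W $ 3) x"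
    by (rule exI, rule cong[OF 3]) (unfold un, simp_all add: algebra_simps)
  ultimately have "\<forall>j. \<exists>g. has_laplacian (\<lambda>z. u z $ j) g (?W $ j) x"
    unfolding forall_3 by blast
  from choice[OF this] obtain g where "\<forall>j. has_laplacian (\<lambda>z. u z $ j) (g j) (?W $ j) x" ..
  then show ?thesis by (intro laplacian_eqI[OF x, of u g]) (rule spec)
qed

lemma has_partial_velocity_profile_field:
  "has_partial i u
    (vector [x $ 1 * zonal_partial i (- 2) a a1 x + (if i = 1 then 1 else 0) * zonal (- 2) a x
        - (x $ 2 * zonal_partial i (- 2) k k1 x + (if i = 2 then 1 else 0) * zonal (- 2) k x),
      x $ 2 * zonal_partial i (- 2) a a1 x + (if i = 2 then 1 else 0) * zonal (- 2) a x
        + (x $ 1 * zonal_partial i (- 2) k k1 x + (if i = 1 then 1 else 0) * zonal (- 2) k x),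
      zonal_partial i (- 1) b b1 x]) x"
  using has_partial_profile_field[OF u x a k b, of i] by simp

lemma divergence_profile_field:
  "divergence u x = zonal (- 2) (\<lambda>y. 2 * y\<^sup>2 * a y - (1 - y\<^sup>2) * y * a1 y - y * b y + (1 - y\<^sup>2) * b1 y) x"
proof -
  define \<rho> where "\<rho> = norm x"
  define y where "y = x $ 3 / \<rho>"
  have r: "x $ 3 = y * \<rho>" "\<rho> \<noteq> 0" using offaxis_nz[OF x] by (auto simp: y_def \<rho>_def)
  have s: "x $ 1 * x $ 1 + x $ 2 * x $ 2 = \<rho>\<^sup>2 * (1 - y\<^sup>2)"
    using norm_sq_3[of x] unfolding r(1) \<rho>_def by (simp add: algebra_simps power2_eq_square)
  define Q where "Q = \<rho> powi (- 4)"
  have pw: "\<rho> powi (- 2 - 2) = Q" "\<rho> powi (- 1 - 2) = Q * \<rho>" "\<rho> powi (- 1 - 1) = Q * \<rho>\<^sup>2" "\<rho> powi (- 2) = Q * \<rho>\<^sup>2"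
    using r(2) power_int_add[of \<rho> "- 4" 1] power_int_add[of \<rho> "- 4" 2] by (auto simp: Q_def)
  have "divergence u x = (x $ 1 * x $ 1 + x $ 2 * x $ 2) * (Q * (- 2 * a y - y * a1 y)) + 2 * (Q * \<rho>\<^sup>2 * a y)
      + x $ 3 * (Q * \<rho> * (- b y - y * b1 y)) + Q * \<rho>\<^sup>2 * b1 y"
    unfolding divergence_def partial_eqI[OF has_partial_velocity_profile_field] sum_3 vector_3
      zonal_partial_def zonal_def \<rho>_def[symmetric] y_def[symmetric] pw
    by (simp add: algebra_simps)
  then show ?thesis
    unfolding s r(1) zonal_def \<rho>_def[symmetric] y_def[symmetric] pw
    using r(2) by (simp add: algebra_simps power2_eq_square)
qed

lemma convection_profile_field:
  "convection u x = profile_field (- 3)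
    (\<lambda>y. - 2 * ((1 - y\<^sup>2) * a y + y * b y) * a y - (1 - y\<^sup>2) * (y * a y - b y) * a1 y + (a y)\<^sup>2 - (k y)\<^sup>2)
    (\<lambda>y. - 2 * ((1 - y\<^sup>2) * a y + y * b y) * k y - (1 - y\<^sup>2) * (y * a y - b y) * k1 y + 2 * a y * k y)
    (\<lambda>y. - ((1 - y\<^sup>2) * a y + y * b y) * b y - (1 - y\<^sup>2) * (y * a y - b y) * b1 y) x"
proof -
  define \<rho> where "\<rho> = norm x"
  define y where "y = x $ 3 / \<rho>"
  have r: "x $ 3 = y * \<rho>" "\<rho> \<noteq> 0" using offaxis_nz[OF x] by (auto simp: y_def \<rho>_def)
  have s: "x $ 1 * x $ 1 + x $ 2 * x $ 2 = \<rho>\<^sup>2 * (1 - y\<^sup>2)"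
    using norm_sq_3[of x] unfolding r(1) \<rho>_def by (simp add: algebra_simps power2_eq_square)
  define q where "q = 1 / \<rho>"
  have pw: "\<rho> powi (- 4) = q ^ 4" "\<rho> powi (- 3) = q ^ 3" "\<rho> powi (- 2) = q\<^sup>2" "\<rho> powi (- 1) = q"
    "\<rho> powi (- 2 - 2) = q ^ 4" "\<rho> powi (- 2 - 1) = q ^ 3" "\<rho> powi (- 1 - 2) = q ^ 3" "\<rho> powi (- 1 - 1) = q\<^sup>2"
    "\<rho> powi (- 3 - 1) = q ^ 4"
    by (auto simp: q_def power_int_def power_one_over inverse_eq_divide)
  have q: "q * \<rho> = 1" "q\<^sup>2 * \<rho>\<^sup>2 = 1" using r(2) by (simp_all add: q_def power_one_over)
  \<comment> \<open>The radial velocity profile, equal to \<open>u x \<bullet> x\<close>. Along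
    \<open>u\<close> a zonal function changes only through \<open>f\<close> and the vertical
    component \<open>u3\<close>.\<close>
  define f where "f = (1 - y\<^sup>2) * a y + y * b y"
  define u1 u2 u3 where "u1 = u x $ 1" and "u2 = u x $ 2" and "u3 = u x $ 3"
  have ux: "u1 = x $ 1 * (q\<^sup>2 * a y) - x $ 2 * (q\<^sup>2 * k y)"
    "u2 = x $ 2 * (q\<^sup>2 * a y) + x $ 1 * (q\<^sup>2 * k y)" "u3 = q * b y"
    unfolding u[OF x] u1_def u2_def u3_def profile_field_nth zonal_def \<rho>_def[symmetric] y_def[symmetric] pw by simp_all
  have "u1 * x $ 1 + u2 * x $ 2 + u3 * x $ 3 = (x $ 1 * x $ 1 + x $ 2 * x $ 2) * (q\<^sup>2 * a y) + q * b y * x $ 3"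
    unfolding ux by (simp add: algebra_simps)
  also have "\<dots> = (q\<^sup>2 * \<rho>\<^sup>2) * ((1 - y\<^sup>2) * a y) + (q * \<rho>) * (y * b y)"
    unfolding s r(1) by (simp add: algebra_simps)
  finally have S: "u1 * x $ 1 + u2 * x $ 2 + u3 * x $ 3 = f" by (simp add: q f_def)
  have dir: "u1 * (x $ 1 * A) + u2 * (x $ 2 * A) + u3 * (x $ 3 * A + B) = f * A + u3 * B" for A B
    unfolding S[symmetric] by (simp add: algebra_simps)
  define A K B where "A = q ^ 4 * (- 2 * a y - y * a1 y)" and "K = q ^ 4 * (- 2 * k y - y * k1 y)"
    and "B = q ^ 3 * (- b y - y * b1 y)"
  have zp: "zonal_partial i (- 2) a a1 x = x $ i * A + (if i = 3 then q ^ 3 * a1 y else 0)"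
     "zonal_partial i (- 2) k k1 x = x $ i * K + (if i = 3 then q ^ 3 * k1 y else 0)"
     "zonal_partial i (- 1) b b1 x = x $ i * B + (if i = 3 then q\<^sup>2 * b1 y else 0)"
     "zonal (- 2) a x = q\<^sup>2 * a y" "zonal (- 2) k x = q\<^sup>2 * k y" for i
    unfolding zonal_partial_def zonal_def \<rho>_def[symmetric] y_def[symmetric] pw A_def K_def B_def by simp_all
  have comps: "convection u x $ 1 = x $ 1 * (u1 * (x $ 1 * A) + u2 * (x $ 2 * A) + u3 * (x $ 3 * A + q ^ 3 * a1 y))
      - x $ 2 * (u1 * (x $ 1 * K) + u2 * (x $ 2 * K) + u3 * (x $ 3 * K + q ^ 3 * k1 y))
      + u1 * (q\<^sup>2 * a y) - u2 * (q\<^sup>2 * k y)"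
    "convection u x $ 2 = x $ 2 * (u1 * (x $ 1 * A) + u2 * (x $ 2 * A) + u3 * (x $ 3 * A + q ^ 3 * a1 y))
      + x $ 1 * (u1 * (x $ 1 * K) + u2 * (x $ 2 * K) + u3 * (x $ 3 * K + q ^ 3 * k1 y))
      + u2 * (q\<^sup>2 * a y) + u1 * (q\<^sup>2 * k y)"
    "convection u x $ 3 = u1 * (x $ 1 * B) + u2 * (x $ 2 * B) + u3 * (x $ 3 * B + q\<^sup>2 * b1 y)"
    unfolding convection_def partial_eqI[OF has_partial_velocity_profile_field] sum_3 zp
      u1_def[symmetric] u2_def[symmetric] u3_def[symmetric]
    by (simp_all add: algebra_simps)
  \<comment> \<open>The coefficient of the derivatives in \<open>y\<close> is transport in the polar
    angle; the combination \<open>y a - b\<close> that appears here is the function \<open>v\<close>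
    of the Riccati equation.\<close>
  have f_id: "b y - y * f = - (1 - y\<^sup>2) * (y * a y - b y)"
    by (simp add: f_def algebra_simps power2_eq_square)
  have sl: "f * A + u3 * (q ^ 3 * a1 y) = q ^ 4 * (- 2 * f * a y + (b y - y * f) * a1 y)"
    "f * K + u3 * (q ^ 3 * k1 y) = q ^ 4 * (- 2 * f * k y + (b y - y * f) * k1 y)"
    "f * B + u3 * (q\<^sup>2 * b1 y) = q ^ 3 * (- f * b y + (b y - y * f) * b1 y)"
    unfolding ux A_def K_def B_def by (simp_all add: algebra_simps eval_nat_numeral)
  show ?thesis
    unfolding vec_eq_iff forall_3 comps dir sl profile_field_nth zonal_def \<rho>_def[symmetric] y_def[symmetric] pw
      f_def[symmetric] f_id
    unfolding ux by (simp add: algebra_simps eval_nat_numeral)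
qed

end

lemma grad_zonal:
  assumes p: "\<And>z. z \<in> offaxis \<Longrightarrow> p z = zonal (- 2) P z"
    and x: "x \<in> offaxis"
    and P: "\<And>y. y \<in> {0<..<1} \<Longrightarrow> (P has_real_derivative P1 y) (at y)"
  shows "grad p x = profile_field (- 3) (\<lambda>y. - 2 * P y - y * P1 y) (\<lambda>y. 0)
    (\<lambda>y. - 2 * y * P y + (1 - y\<^sup>2) * P1 y) x"
proof -
  have h: "has_partial i p (zonal_partial i (- 2) P P1 x) x" for i
    by (rule has_partial_transform[OF open_offaxis x _ has_partial_zonal[OF x P]]) (simp_all add: p)
  define \<rho> where "\<rho> = norm x"
  define y where "y = x $ 3 / \<rho>"
  have r: "x $ 3 = y * \<rho>" "\<rho> \<noteq> 0" using offaxis_nz[OF x] by (auto simp: y_def \<rho>_def)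
  have pw: "\<rho> powi (- 3) = \<rho> powi (- 4) * \<rho>"
    using r(2) power_int_add[of \<rho> "- 4" 1] by auto
  have [simp]: "- 2 - 2 = (- 4 :: int)" "- 2 - 1 = (- 3 :: int)" by auto
  show ?thesis
    unfolding grad_def partial_eqI[OF h] vec_eq_iff forall_3
      vec_lambda_beta profile_field_nth zonal_partial_def zonal_def \<rho>_def[symmetric] y_def[symmetric]
    by (simp add: pw r(1) algebra_simps power2_eq_square)
qed

section \<open>The meridian arc on which profiles are read off\<close>

definition meridian :: "real \<Rightarrow> real^3" where
  "meridian y = vector [sqrt (1 - y\<^sup>2), 0, y]"

lemma meridian_nth [simp]:
  "meridian y $ 1 = sqrt (1 - y\<^sup>2)" "meridian y $ 2 = 0" "meridian y $ 3 = y"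
  by (simp_all add: meridian_def)

lemma unit_sq: "y \<in> {0..1} \<Longrightarrow> 0 \<le> 1 - y\<^sup>2" for y :: real
  by (auto simp: power_le_one_iff)

lemma unit_sq_pos: "y \<in> {0..<1} \<Longrightarrow> 0 < 1 - y\<^sup>2" for y :: real
  by (auto simp: power_less_one_iff)

lemma norm_meridian [simp]: "y \<in> {0..1} \<Longrightarrow> norm (meridian y) = 1"
  using norm_sq_3[of "meridian y"] unit_sq[of y] norm_ge_zero[of "meridian y"]
  by (auto simp: power2_eq_1_iff simp del: norm_ge_zero)

lemma meridian_offaxis: "y \<in> {0<..<1} \<Longrightarrow> meridian y \<in> offaxis"
  using unit_sq_pos[of y] by (auto simp: offaxis_def)

lemma zonal_meridian [simp]: "y \<in> {0..1} \<Longrightarrow> zonal n a (meridian y) = a y"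
  by (simp add: zonal_def)

section \<open>Profiles with weighted derivatives\<close>

text \<open>\<open>colat y\<close> is the sine of the polar angle whose cosine is \<open>y\<close>.\<close>

definition colat :: "real \<Rightarrow> real" where
  "colat y = sqrt (1 - y\<^sup>2)"

lemma colat_pos: "y \<in> {0..<1} \<Longrightarrow> 0 < colat y"
  using unit_sq_pos[of y] by (simp add: colat_def)

lemma colat_le_1: "colat y \<le> 1"
  by (simp add: colat_def)

lemma colat_sq: "y \<in> {0..1} \<Longrightarrow> (colat y)\<^sup>2 = 1 - y\<^sup>2"
  using unit_sq[of y] by (simp add: colat_def)

text \<open>\<open>wt n e A\<close>: the \<open>i\<close>-th derivative of \<open>A\<close>, for \<open>i \<le> n\<close>, is \<open>O(colat\<^sup>e\<^sup>-\<^sup>2\<^sup>i)\<close>. Since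
  \<open>y\<close> is the cosine of the polar angle, each derivative in \<open>y\<close> costs two powers of \<open>colat\<close>.\<close>

primrec wt :: "nat \<Rightarrow> int \<Rightarrow> (real \<Rightarrow> real) \<Rightarrow> bool" where
  "wt 0 e A \<longleftrightarrow> (\<exists>C. \<forall>y\<in>{0<..<1}. \<bar>A y\<bar> \<le> C * colat y powi e)"
| "wt (Suc n) e A \<longleftrightarrow> (\<exists>C. \<forall>y\<in>{0<..<1}. \<bar>A y\<bar> \<le> C * colat y powi e) \<and> continuous_on {0..<1} A \<and>
     (\<exists>A'. (\<forall>y\<in>{0<..<1}. (A has_real_derivative A' y) (at y)) \<and> wt n (e - 2) A')"

declare wt.simps [simp del]

lemma wt_0_iff: "wt 0 e A \<longleftrightarrow> (\<exists>C. \<forall>y\<in>{0<..<1}. \<bar>A y\<bar> \<le> C * colat y powi e)"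
  by (simp only: wt.simps)

lemma wt_Suc_iff: "wt (Suc n) e A \<longleftrightarrow> wt 0 e A \<and> continuous_on {0..<1} A \<and>
     (\<exists>A'. (\<forall>y\<in>{0<..<1}. (A has_real_derivative A' y) (at y)) \<and> wt n (e - 2) A')"
  by (simp only: wt.simps)

lemma wt_0I: "(\<And>y. y \<in> {0<..<1} \<Longrightarrow> \<bar>A y\<bar> \<le> C * colat y powi e) \<Longrightarrow> wt 0 e A"
  unfolding wt_0_iff by blast

lemma wt_SucI:
  assumes "wt 0 e A" "continuous_on {0..<1} A"
    "\<And>y. y \<in> {0<..<1} \<Longrightarrow> (A has_real_derivative A' y) (at y)" "wt n (e - 2) A'"
  shows "wt (Suc n) e A"
  unfolding wt_Suc_iff using assms by blast

lemma wt_SucE: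
  assumes "wt (Suc n) e A"
  obtains A' where "\<And>y. y \<in> {0<..<1} \<Longrightarrow> (A has_real_derivative A' y) (at y)" "wt n (e - 2) A'"
  using assms unfolding wt_Suc_iff by blast

lemma wt_imp_0: "wt n e A \<Longrightarrow> wt 0 e A"
  by (cases n) (simp_all only: wt_Suc_iff)

lemma wt_SucD: "wt (Suc n) e A \<Longrightarrow> wt n e A"
proof (induction n arbitrary: e A)
  case 0 then show ?case by (rule wt_imp_0)
next
  case (Suc n)
  then show ?case unfolding wt_Suc_iff[of "Suc n"] wt_Suc_iff[of n] by blast
qed

lemma wt_le:
  assumes "wt n e A" "m \<le> n" shows "wt m e A"
  using assms(2,1) by (induction rule: dec_induct) (blast dest: wt_SucD)+

lemma wt_continuous: "wt (Suc n) e A \<Longrightarrow> continuous_on {0..<1} A"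
  unfolding wt_Suc_iff by blast

lemma wt_bound:
  assumes "wt n e A"
  obtains C where "0 \<le> C" "\<And>y. y \<in> {0<..<1} \<Longrightarrow> \<bar>A y\<bar> \<le> C * colat y powi e"
proof -
  obtain C where C: "\<forall>y\<in>{0<..<1}. \<bar>A y\<bar> \<le> C * colat y powi e"
    using wt_imp_0[OF assms] unfolding wt_0_iff by blast
  have "\<bar>A y\<bar> \<le> \<bar>C\<bar> * colat y powi e" if "y \<in> {0<..<1}" for y
  proof -
    have "\<bar>A y\<bar> \<le> C * colat y powi e" using C that by blast
    also have "\<dots> \<le> \<bar>C\<bar> * colat y powi e"
      using colat_pos[of y] that by (intro mult_right_mono) auto
    finally show ?thesis .
  qed
  then show thesis by (intro that[of "\<bar>C\<bar>"]) auto
qed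

lemma colat_powi_mono:
  assumes "y \<in> {0<..<1}" "e' \<le> e" shows "colat y powi e \<le> colat y powi e'"
proof -
  have p: "0 < colat y" using colat_pos[of y] assms by auto
  have "colat y powi e = colat y powi e' * colat y powi (e - e')"
    using p power_int_add[of "colat y" e' "e - e'"] by simp
  also have "\<dots> \<le> colat y powi e' * 1"
    using p colat_le_1[of y] assms
    by (intro mult_left_mono) (auto simp: power_int_def power_le_one)
  finally show ?thesis by simp
qed

lemma wt_weaken: "wt n e A \<Longrightarrow> e' \<le> e \<Longrightarrow> wt n e' A"
proof (induction n arbitrary: e e' A)
  case (0 e e' A)
  from wt_bound[OF 0(1)] obtain C where C: "0 \<le> C" "\<And>y. y \<in> {0<..<1} \<Longrightarrow> \<bar>A y\<bar> \<le> C * colat y powi e" by blast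
  show ?case
    by (rule wt_0I[of _ C], rule order_trans[OF C(2)], assumption)
       (intro mult_left_mono colat_powi_mono C 0)
next
  case (Suc n)
  from wt_bound[OF Suc.prems(1)] obtain C where C: "0 \<le> C" "\<And>y. y \<in> {0<..<1} \<Longrightarrow> \<bar>A y\<bar> \<le> C * colat y powi e" by blast
  have 1: "wt 0 e' A"
    by (rule wt_0I[of _ C], rule order_trans[OF C(2)], assumption)
       (intro mult_left_mono colat_powi_mono C Suc.prems)
  obtain A' where A': "\<And>y. y \<in> {0<..<1} \<Longrightarrow> (A has_real_derivative A' y) (at y)" "wt n (e - 2) A'"
    using wt_SucE[OF Suc.prems(1)] by blast
  show ?case
    by (rule wt_SucI[OF 1 wt_continuous[OF Suc.prems(1)] A'(1) Suc.IH[OF A'(2)]]) (use Suc.prems in auto)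
qed

text \<open>Lets a profile be replaced by a formula valid inside the interval; continuity on
  \<open>{0..<1}\<close> then adds the behaviour at 0.\<close>

lemma wt_cong_open:
  assumes A: "wt n e A" and eq: "\<And>y. y \<in> {0<..<1} \<Longrightarrow> A y = B y" and "continuous_on {0..<1} B"
  shows "wt n e B"
proof -
  have 0: "wt 0 e B" using wt_imp_0[OF A] eq unfolding wt_0_iff by metis
  show ?thesis
  proof (cases n)
    case (Suc m)
    obtain A' where A': "\<And>y. y \<in> {0<..<1} \<Longrightarrow> (A has_real_derivative A' y) (at y)" "wt m (e - 2) A'"
      using wt_SucE A Suc by blast
    have "(B has_real_derivative A' y) (at y)" if "y \<in> {0<..<1}" for y
      by (rule has_field_derivative_transform_within_open[OF A'(1)[OF that] _ that eq]) auto
    then show ?thesis unfolding Suc by (rule wt_SucI[OF 0 assms(3) _ A'(2)])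
  qed (use 0 in simp)
qed

lemma wt_add: "wt n e A \<Longrightarrow> wt n e B \<Longrightarrow> wt n e (\<lambda>y. A y + B y)"
proof (induction n arbitrary: e A B)
  have z: "wt 0 e (\<lambda>y. A y + B y)" if AB: "wt m e A" "wt m e B" for A B e m
  proof -
    obtain C where C: "\<And>y. y \<in> {0<..<1} \<Longrightarrow> \<bar>A y\<bar> \<le> C * colat y powi e" using wt_bound[OF AB(1)] by blast
    obtain D where D: "\<And>y. y \<in> {0<..<1} \<Longrightarrow> \<bar>B y\<bar> \<le> D * colat y powi e" using wt_bound[OF AB(2)] by blast
    show ?thesis
      by (rule wt_0I[of _ "C + D"]) (use C D in \<open>simp add: distrib_right abs_triangle_ineq[THEN order_trans] add_mono\<close>)
  qed
  {
    case 0 then show ?case by (rule z)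
  next
    case (Suc n)
    obtain A' B' where A': "\<And>y. y \<in> {0<..<1} \<Longrightarrow> (A has_real_derivative A' y) (at y)" "wt n (e - 2) A'" and
       B': "\<And>y. y \<in> {0<..<1} \<Longrightarrow> (B has_real_derivative B' y) (at y)" "wt n (e - 2) B'"
      using wt_SucE Suc.prems by metis
    show ?case
      by (rule wt_SucI[OF z[OF Suc.prems] _ DERIV_add[OF A'(1) B'(1)] Suc.IH[OF A'(2) B'(2)]])
         (intro continuous_intros wt_continuous[OF Suc.prems(1)] wt_continuous[OF Suc.prems(2)])
  }
qed

lemma wt_mult: "wt n e A \<Longrightarrow> wt n f B \<Longrightarrow> wt n (e + f) (\<lambda>y. A y * B y)"
proof (induction n arbitrary: e f A B)
  have z: "wt 0 (e + f) (\<lambda>y. A y * B y)" if AB: "wt m e A" "wt m f B" for A B e f m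
  proof -
    obtain C where C: "0 \<le> C" "\<And>y. y \<in> {0<..<1} \<Longrightarrow> \<bar>A y\<bar> \<le> C * colat y powi e" using wt_bound[OF AB(1)] by blast
    obtain D where D: "0 \<le> D" "\<And>y. y \<in> {0<..<1} \<Longrightarrow> \<bar>B y\<bar> \<le> D * colat y powi f" using wt_bound[OF AB(2)] by blast
    show ?thesis
    proof (rule wt_0I[of _ "C * D"])
      fix y :: real assume y: "y \<in> {0<..<1}"
      have "\<bar>A y * B y\<bar> \<le> (C * colat y powi e) * (D * colat y powi f)"
        unfolding abs_mult using C(2)[OF y] D(2)[OF y] by (intro mult_mono) auto
      also have "\<dots> = C * D * colat y powi (e + f)"
        using colat_pos[of y] y by (simp add: power_int_add)
      finally show "\<bar>A y * B y\<bar> \<le> C * D * colat y powi (e + f)" .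
    qed
  qed
  {
    case 0 then show ?case by (rule z)
  next
    case (Suc n)
    obtain A' B' where A': "\<And>y. y \<in> {0<..<1} \<Longrightarrow> (A has_real_derivative A' y) (at y)" "wt n (e - 2) A'" and
       B': "\<And>y. y \<in> {0<..<1} \<Longrightarrow> (B has_real_derivative B' y) (at y)" "wt n (f - 2) B'"
      using wt_SucE Suc.prems by metis
    have eq: "e - 2 + f = e + f - 2" "f - 2 + e = e + f - 2" by auto
    have d: "wt n (e + f - 2) (\<lambda>y. A' y * B y + B' y * A y)"
      using Suc.IH[OF A'(2) wt_SucD[OF Suc.prems(2)]] Suc.IH[OF B'(2) wt_SucD[OF Suc.prems(1)]]
      unfolding eq by (rule wt_add)
    show ?case
      by (rule wt_SucI[OF z[OF Suc.prems] _ DERIV_mult[OF A'(1) B'(1)] d])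
         (intro continuous_intros wt_continuous[OF Suc.prems(1)] wt_continuous[OF Suc.prems(2)])
  }
qed

lemma wt_const: "wt n 0 (\<lambda>y. c)"
proof -
  have z0: "wt 0 e (\<lambda>y. 0)" for e by (rule wt_0I[of _ 0]) simp
  have z: "wt n e (\<lambda>y. 0)" for n e
  proof (induction n arbitrary: e)
    case (Suc n)
    show ?case by (rule wt_SucI[OF z0 _ _ Suc]) auto
  qed (rule z0)
  have "wt 0 0 (\<lambda>y. c)" by (rule wt_0I[of _ "\<bar>c\<bar>"]) simp
  then show ?thesis
    using z by (cases n) (auto intro!: wt_SucI[where A' = "\<lambda>_. 0"])
qed

lemma wt_cmult: "wt n e A \<Longrightarrow> wt n e (\<lambda>y. c * A y)"
  using wt_mult[OF wt_const[of n c], of e A] by simp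

lemma wt_minus: "wt n e A \<Longrightarrow> wt n e (\<lambda>y. - A y)"
  using wt_cmult[of n e A "-1"] by simp

lemma wt_diff: "wt n e A \<Longrightarrow> wt n e B \<Longrightarrow> wt n e (\<lambda>y. A y - B y)"
  using wt_add[of n e A "\<lambda>y. - B y"] wt_minus[of n e B] by simp

lemma wt_id: "wt n 0 (\<lambda>y. y)"
proof -
  have 0: "wt 0 0 (\<lambda>y. y)" by (rule wt_0I[of _ 1]) simp
  show ?thesis
  proof (cases n)
    case (Suc m)
    have "wt m (0 - 2) (\<lambda>y. 1)" by (rule wt_weaken[OF wt_const]) simp
    then show ?thesis unfolding Suc
      by (rule wt_SucI[OF 0, rotated 2]) (auto intro!: derivative_eq_intros continuous_intros)
  qed (use 0 in simp)
qed

lemma wt_bounded_continuous: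
  assumes "continuous_on {0..1} A" shows "wt 0 0 A"
proof -
  have "compact (A ` {0..1})" by (rule compact_continuous_image[OF assms]) simp
  then obtain C where "\<And>y. y \<in> {0..1} \<Longrightarrow> \<bar>A y\<bar> \<le> C"
    by (metis bounded_iff compact_imp_bounded imageI real_norm_def)
  then show ?thesis by (intro wt_0I[of _ C]) auto
qed

lemma wt_sin_sq: "wt n 2 (\<lambda>y. 1 - y\<^sup>2)"
proof -
  have 0: "wt 0 2 (\<lambda>y. 1 - y\<^sup>2)"
  proof (rule wt_0I[of _ 1])
    fix y :: real assume "y \<in> {0<..<1}"
    then have "1 - y\<^sup>2 = (colat y)\<^sup>2" using colat_sq[of y] by auto
    then show "\<bar>1 - y\<^sup>2\<bar> \<le> 1 * colat y powi 2" by (simp add: power_int_def)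
  qed
  show ?thesis
  proof (cases n)
    case (Suc m)
    have "wt m (2 - 2) (\<lambda>y. - 2 * y)" using wt_cmult[OF wt_id[of m], of "- 2"] by simp
    then show ?thesis unfolding Suc
      by (rule wt_SucI[OF 0, rotated 2]) (auto intro!: derivative_eq_intros continuous_intros)
  qed (use 0 in simp)
qed

lemma wt_inverse_sin_sq: "wt n (- 2) (\<lambda>y. inverse (1 - y\<^sup>2))"
proof -
  have z: "wt 0 (- 2) (\<lambda>y. inverse (1 - y\<^sup>2))"
  proof (rule wt_0I[of _ 1])
    fix y :: real assume "y \<in> {0<..<1}"
    then have "1 - y\<^sup>2 = (colat y)\<^sup>2" "0 < colat y" using colat_sq[of y] colat_pos[of y] by auto
    then show "\<bar>inverse (1 - y\<^sup>2)\<bar> \<le> 1 * colat y powi - 2" by (simp add: power_int_def power_inverse)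
  qed
  have nz: "1 - y\<^sup>2 \<noteq> 0" if "y \<in> {0..<1}" for y :: real using unit_sq_pos[OF that] by simp
  show ?thesis
  proof (induction n)
    case (Suc n)
    have "wt n (- 2 - 2) (\<lambda>y. 2 * y * (inverse (1 - y\<^sup>2) * inverse (1 - y\<^sup>2)))"
      using wt_mult[OF wt_cmult[OF wt_id[of n], of 2] wt_mult[OF Suc Suc]] by simp
    then show ?case
    proof (rule wt_SucI[OF z, rotated 2])
      show "continuous_on {0..<1} (\<lambda>y::real. inverse (1 - y\<^sup>2))"
        by (intro continuous_intros) (use nz in blast)
      fix y :: real assume "y \<in> {0<..<1}"
      then have "1 - y\<^sup>2 \<noteq> 0" using nz[of y] by auto
      then show "((\<lambda>y. inverse (1 - y\<^sup>2)) has_real_derivative 2 * y * (inverse (1 - y\<^sup>2) * inverse (1 - y\<^sup>2))) (at y)"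
        by (auto intro!: derivative_eq_intros simp: power2_eq_square)
    qed
  qed (rule z)
qed

lemma wt_inverse_1_plus: "wt n 0 (\<lambda>y. inverse (1 + y))"
proof -
  have z: "wt 0 0 (\<lambda>y. inverse (1 + y))"
    by (rule wt_bounded_continuous) (auto intro!: continuous_intros)
  show ?thesis
  proof (induction n)
    case (Suc n)
    have "wt n (0 - 2) (\<lambda>y. - (inverse (1 + y) * inverse (1 + y)))"
      using wt_weaken[OF wt_minus[OF wt_mult[OF Suc Suc]], of "0 - 2"] by simp
    then show ?case
      by (rule wt_SucI[OF z, rotated 2]) (auto intro!: continuous_intros derivative_eq_intros)
  qed (rule z)
qed

lemma wt_tendsto_0:
  assumes "wt n 1 A" shows "(A \<longlongrightarrow> 0) (at_left 1)"
proof -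
  obtain C where C: "\<And>y. y \<in> {0<..<1} \<Longrightarrow> \<bar>A y\<bar> \<le> C * colat y powi 1" using wt_bound[OF assms] by blast
  have "((\<lambda>y. C * sqrt (1 - y\<^sup>2)) \<longlongrightarrow> C * sqrt (1 - 1\<^sup>2)) (at_left 1)" by (intro tendsto_intros)
  then have l: "((\<lambda>y. C * sqrt (1 - y\<^sup>2)) \<longlongrightarrow> 0) (at_left 1)" by simp
  show ?thesis
    by (rule Lim_null_comparison[OF _ l], rule eventually_at_leftI[of 0]) (use C in \<open>auto simp: colat_def\<close>)
qed

section \<open>Lipschitz regularity up to the boundary\<close>

text \<open>Every compact subset of the closed half-space without the origin lies in a shell. Shells
  are not convex, so Lipschitz bounds on them are proved directly rather than deduced from bounded
  gradients.\<close>

definition shell :: "real \<Rightarrow> real \<Rightarrow> (real^3) set" where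
  "shell \<alpha> \<beta> = {x \<in> closed_half_space0. \<alpha> \<le> norm x \<and> norm x \<le> \<beta>}"

definition loclip :: "(real^3 \<Rightarrow> 'a::real_normed_vector) \<Rightarrow> bool" where
  "loclip f \<longleftrightarrow> (\<forall>\<alpha>>0. \<forall>\<beta>. \<exists>C. \<forall>x\<in>shell \<alpha> \<beta>. \<forall>y\<in>shell \<alpha> \<beta>. norm (f x - f y) \<le> C * norm (x - y))"

lemma loclipE:
  assumes "loclip f" "0 < \<alpha>"
  obtains C where "0 \<le> C" "\<And>x y. x \<in> shell \<alpha> \<beta> \<Longrightarrow> y \<in> shell \<alpha> \<beta> \<Longrightarrow> norm (f x - f y) \<le> C * norm (x - y)"
proof -
  obtain C where C: "\<forall>x\<in>shell \<alpha> \<beta>. \<forall>y\<in>shell \<alpha> \<beta>. norm (f x - f y) \<le> C * norm (x - y)"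
    using assms unfolding loclip_def by blast
  have "norm (f x - f y) \<le> \<bar>C\<bar> * norm (x - y)" if "x \<in> shell \<alpha> \<beta>" "y \<in> shell \<alpha> \<beta>" for x y
  proof -
    have "norm (f x - f y) \<le> C * norm (x - y)" using C that by blast
    also have "\<dots> \<le> \<bar>C\<bar> * norm (x - y)" by (intro mult_right_mono) auto
    finally show ?thesis .
  qed
  then show thesis by (intro that[of "\<bar>C\<bar>"]) auto
qed

lemma loclip_bounded:
  assumes "loclip f" "0 < \<alpha>"
  obtains B where "0 \<le> B" "\<And>x. x \<in> shell \<alpha> \<beta> \<Longrightarrow> norm (f x) \<le> B"
proof (cases "shell \<alpha> \<beta> = {}")
  case True then show thesis by (intro that[of 0]) auto
next
  case False
  then obtain z where z: "z \<in> shell \<alpha> \<beta>" by auto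
  obtain C where C: "0 \<le> C" "\<And>x y. x \<in> shell \<alpha> \<beta> \<Longrightarrow> y \<in> shell \<alpha> \<beta> \<Longrightarrow> norm (f x - f y) \<le> C * norm (x - y)"
    using loclipE[OF assms] by blast
  have "norm (f x) \<le> norm (f z) + C * (\<beta> + \<beta>)" if x: "x \<in> shell \<alpha> \<beta>" for x
  proof -
    have "norm (f x) \<le> norm (f z) + norm (f x - f z)" by (metis norm_triangle_sub)
    also have "norm (f x - f z) \<le> C * norm (x - z)" by (rule C(2)[OF x z])
    also have "norm (x - z) \<le> \<beta> + \<beta>"
      using x z norm_triangle_ineq4[of x z] by (simp add: shell_def)
    finally show ?thesis using C by (simp add: mult_left_mono)
  qed
  moreover have "0 \<le> \<beta>" using z by (auto simp: shell_def intro: order_trans[OF norm_ge_zero])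
  ultimately show thesis using C(1) by (intro that[of "norm (f z) + C * (\<beta> + \<beta>)"]) auto
qed

lemma loclip_continuous:
  assumes "loclip f" shows "continuous_on closed_half_space0 f"
  unfolding continuous_on_iff
proof (intro ballI allI impI)
  fix x :: "real^3" and e :: real
  assume x: "x \<in> closed_half_space0" and e: "0 < e"
  then have nx: "0 < norm x" by (simp add: closed_half_space0_def)
  obtain C where C: "0 \<le> C" "\<And>y z. y \<in> shell (norm x / 2) (2 * norm x) \<Longrightarrow> z \<in> shell (norm x / 2) (2 * norm x) \<Longrightarrow>
      norm (f y - f z) \<le> C * norm (y - z)"
    using loclipE[OF assms, of "norm x / 2"] nx by (metis half_gt_zero)
  show "\<exists>d>0. \<forall>y\<in>closed_half_space0. dist y x < d \<longrightarrow> dist (f y) (f x) < e"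
  proof (intro exI[of _ "min (norm x / 2) (e / (C + 1))"] conjI ballI impI)
    fix y assume y: "y \<in> closed_half_space0" "dist y x < min (norm x / 2) (e / (C + 1))"
    have "norm x - norm (y - x) \<le> norm y" "norm y \<le> norm x + norm (y - x)"
      using norm_triangle_ineq2[of x y] norm_triangle_sub[of y x] by (simp_all add: norm_minus_commute)
    with y x have "y \<in> shell (norm x / 2) (2 * norm x)" "x \<in> shell (norm x / 2) (2 * norm x)"
      by (auto simp: shell_def dist_norm)
    from C(2)[OF this] have "dist (f y) (f x) \<le> C * dist y x" by (simp add: dist_norm)
    also have "\<dots> \<le> (C + 1) * dist y x" by (simp add: distrib_right)
    also have "\<dots> < (C + 1) * (e / (C + 1))" using y C by (intro mult_strict_left_mono) auto
    finally show "dist (f y) (f x) < e" using C by simp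
  qed (use nx e C in auto)
qed

text \<open>Distances within a compact set are at most \<open>2 b\<close>, so the factor
  \<open>norm (x - y) powr (1 - \<alpha>)\<close> is absorbed in the constant.\<close>

lemma loclip_holder:
  assumes f: "loclip f" and a: "0 < \<alpha>" "\<alpha> < 1"
  shows "holder_loc \<alpha> f"
  unfolding holder_loc_def
proof (intro allI impI, elim conjE)
  fix K :: "(real^3) set"
  assume K: "compact K" "K \<subseteq> closed_half_space0"
  obtain b where b: "\<And>x. x \<in> K \<Longrightarrow> norm x \<le> b" using compact_imp_bounded[OF K(1)] bounded_iff by blast
  have "\<exists>a>0. \<forall>x\<in>K. a \<le> norm x"
  proof (cases "K = {}")
    case False
    obtain x where x: "x \<in> K" "\<And>y. y \<in> K \<Longrightarrow> norm x \<le> norm y"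
      using continuous_attains_inf[OF K(1) False continuous_on_norm_id] by blast
    then have "0 < norm x" using K by (auto simp: closed_half_space0_def)
    with x show ?thesis by blast
  qed (auto intro: exI[of _ 1])
  then obtain a where a': "0 < a" "\<And>x. x \<in> K \<Longrightarrow> a \<le> norm x" by blast
  obtain C where C: "0 \<le> C" "\<And>x y. x \<in> shell a b \<Longrightarrow> y \<in> shell a b \<Longrightarrow> norm (f x - f y) \<le> C * norm (x - y)"
    using loclipE[OF f a'(1)] by blast
  show "\<exists>C. \<forall>x\<in>K. \<forall>y\<in>K. norm (f x - f y) \<le> C * norm (x - y) powr \<alpha>"
  proof (intro exI[of _ "C * (2 * b) powr (1 - \<alpha>)"] ballI)
    fix x y assume xy: "x \<in> K" "y \<in> K"
    then have "x \<in> shell a b" "y \<in> shell a b" using K b a' by (auto simp: shell_def)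
    from C(2)[OF this] have "norm (f x - f y) \<le> C * norm (x - y)" .
    also have "norm (x - y) = norm (x - y) powr (1 - \<alpha>) * norm (x - y) powr \<alpha>"
      by (simp flip: powr_add)
    also have "norm (x - y) powr (1 - \<alpha>) \<le> (2 * b) powr (1 - \<alpha>)"
      using norm_triangle_ineq4[of x y] b[OF xy(1)] b[OF xy(2)] a by (intro powr_mono2) auto
    finally show "norm (f x - f y) \<le> C * (2 * b) powr (1 - \<alpha>) * norm (x - y) powr \<alpha>"
      using C(1) by (simp add: mult.assoc mult_left_mono mult_right_mono)
  qed
qed

section \<open>Algebra of locally Lipschitz functions\<close>

lemma loclip_const: "loclip (\<lambda>x. c)"
  by (auto simp: loclip_def intro: exI[of _ 0])

lemma loclip_nth: "loclip (\<lambda>x. x $ i)"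
  unfolding loclip_def
  by (intro allI impI exI[of _ 1] ballI)
     (simp flip: vector_minus_component, metis component_le_norm_cart real_norm_def)

lemma loclip_add:
  assumes "loclip f" "loclip g" shows "loclip (\<lambda>x. f x + g x)"
  unfolding loclip_def
proof (intro allI impI)
  fix \<alpha> \<beta> :: real assume \<alpha>: "0 < \<alpha>"
  obtain C where C: "\<And>x y. x \<in> shell \<alpha> \<beta> \<Longrightarrow> y \<in> shell \<alpha> \<beta> \<Longrightarrow> norm (f x - f y) \<le> C * norm (x - y)"
    using loclipE[OF assms(1) \<alpha>] by blast
  obtain D where D: "\<And>x y. x \<in> shell \<alpha> \<beta> \<Longrightarrow> y \<in> shell \<alpha> \<beta> \<Longrightarrow> norm (g x - g y) \<le> D * norm (x - y)"
    using loclipE[OF assms(2) \<alpha>] by blast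
  show "\<exists>C. \<forall>x\<in>shell \<alpha> \<beta>. \<forall>y\<in>shell \<alpha> \<beta>. norm (f x + g x - (f y + g y)) \<le> C * norm (x - y)"
  proof (intro exI[of _ "C + D"] ballI)
    fix x y assume xy: "x \<in> shell \<alpha> \<beta>" "y \<in> shell \<alpha> \<beta>"
    have "norm (f x + g x - (f y + g y)) \<le> norm (f x - f y) + norm (g x - g y)"
      by (metis add_diff_add norm_triangle_ineq)
    also have "\<dots> \<le> C * norm (x - y) + D * norm (x - y)" by (intro add_mono C D xy)
    finally show "norm (f x + g x - (f y + g y)) \<le> (C + D) * norm (x - y)" by (simp add: distrib_right)
  qed
qed

lemma loclip_mult:
  fixes f g :: "real^3 \<Rightarrow> real"
  assumes "loclip f" "loclip g" shows "loclip (\<lambda>x. f x * g x)"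
  unfolding loclip_def
proof (intro allI impI)
  fix \<alpha> \<beta> :: real assume \<alpha>: "0 < \<alpha>"
  obtain C where C: "0 \<le> C" "\<And>x y. x \<in> shell \<alpha> \<beta> \<Longrightarrow> y \<in> shell \<alpha> \<beta> \<Longrightarrow> norm (f x - f y) \<le> C * norm (x - y)"
    using loclipE[OF assms(1) \<alpha>] by blast
  obtain D where D: "0 \<le> D" "\<And>x y. x \<in> shell \<alpha> \<beta> \<Longrightarrow> y \<in> shell \<alpha> \<beta> \<Longrightarrow> norm (g x - g y) \<le> D * norm (x - y)"
    using loclipE[OF assms(2) \<alpha>] by blast
  obtain B where B: "0 \<le> B" "\<And>x. x \<in> shell \<alpha> \<beta> \<Longrightarrow> norm (f x) \<le> B"
    using loclip_bounded[OF assms(1) \<alpha>] by blast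
  obtain E where E: "0 \<le> E" "\<And>x. x \<in> shell \<alpha> \<beta> \<Longrightarrow> norm (g x) \<le> E"
    using loclip_bounded[OF assms(2) \<alpha>] by blast
  show "\<exists>C. \<forall>x\<in>shell \<alpha> \<beta>. \<forall>y\<in>shell \<alpha> \<beta>. norm (f x * g x - f y * g y) \<le> C * norm (x - y)"
  proof (intro exI[of _ "B * D + C * E"] ballI)
    fix x y assume xy: "x \<in> shell \<alpha> \<beta>" "y \<in> shell \<alpha> \<beta>"
    have "f x * g x - f y * g y = f x * (g x - g y) + (f x - f y) * g y" by (simp add: algebra_simps)
    then have "norm (f x * g x - f y * g y) \<le> norm (f x) * norm (g x - g y) + norm (f x - f y) * norm (g y)"
      by (metis norm_mult norm_triangle_ineq)
    also have "\<dots> \<le> B * (D * norm (x - y)) + (C * norm (x - y)) * E"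
      by (intro add_mono mult_mono B C D E xy mult_nonneg_nonneg norm_ge_zero)
    finally show "norm (f x * g x - f y * g y) \<le> (B * D + C * E) * norm (x - y)" by (simp add: algebra_simps)
  qed
qed

lemma loclip_inverse_norm: "loclip (\<lambda>x. inverse (norm x))"
  unfolding loclip_def
proof (intro allI impI)
  fix \<alpha> \<beta> :: real assume \<alpha>: "0 < \<alpha>"
  show "\<exists>C. \<forall>x\<in>shell \<alpha> \<beta>. \<forall>y\<in>shell \<alpha> \<beta>. norm (inverse (norm x) - inverse (norm y)) \<le> C * norm (x - y)"
  proof (intro exI[of _ "inverse (\<alpha> * \<alpha>)"] ballI)
    fix x y assume xy: "x \<in> shell \<alpha> \<beta>" "y \<in> shell \<alpha> \<beta>"
    then have p: "\<alpha> \<le> norm x" "\<alpha> \<le> norm y" "0 < norm x" "0 < norm y" using \<alpha> by (auto simp: shell_def)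
    have "inverse (norm x) - inverse (norm y) = (norm y - norm x) * inverse (norm x * norm y)"
      using p by (simp add: field_simps)
    then have "norm (inverse (norm x) - inverse (norm y)) = \<bar>norm y - norm x\<bar> * inverse (norm x * norm y)"
      using p by (simp add: abs_mult)
    also have "\<dots> \<le> norm (x - y) * inverse (\<alpha> * \<alpha>)"
      using p \<alpha> by (intro mult_mono le_imp_inverse_le mult_mono)
        (auto simp: norm_triangle_ineq3 abs_minus_commute)
    finally show "norm (inverse (norm x) - inverse (norm y)) \<le> inverse (\<alpha> * \<alpha>) * norm (x - y)"
      by (simp add: mult.commute)
  qed
qed

lemma loclip_vec:
  fixes f :: "real^3 \<Rightarrow> real^'n"
  assumes "\<And>j. loclip (\<lambda>x. f x $ j)" shows "loclip f"
  unfolding loclip_def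
proof (intro allI impI)
  fix \<alpha> \<beta> :: real assume \<alpha>: "0 < \<alpha>"
  have "\<forall>j. \<exists>C. \<forall>x\<in>shell \<alpha> \<beta>. \<forall>y\<in>shell \<alpha> \<beta>. norm (f x $ j - f y $ j) \<le> C * norm (x - y)"
    using assms \<alpha> unfolding loclip_def by blast
  from choice[OF this] obtain C where
    C: "\<And>j x y. x \<in> shell \<alpha> \<beta> \<Longrightarrow> y \<in> shell \<alpha> \<beta> \<Longrightarrow> norm (f x $ j - f y $ j) \<le> C j * norm (x - y)"
    by blast
  show "\<exists>C. \<forall>x\<in>shell \<alpha> \<beta>. \<forall>y\<in>shell \<alpha> \<beta>. norm (f x - f y) \<le> C * norm (x - y)"
  proof (intro exI[of _ "\<Sum>j\<in>UNIV. C j"] ballI)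
    fix x y assume xy: "x \<in> shell \<alpha> \<beta>" "y \<in> shell \<alpha> \<beta>"
    have "norm (f x - f y) \<le> (\<Sum>j\<in>UNIV. \<bar>(f x - f y) $ j\<bar>)" by (rule norm_le_l1_cart)
    also have "\<dots> \<le> (\<Sum>j\<in>UNIV. C j * norm (x - y))" using C[OF xy] by (intro sum_mono) auto
    finally show "norm (f x - f y) \<le> (\<Sum>j\<in>UNIV. C j) * norm (x - y)" by (simp add: sum_distrib_right)
  qed
qed

text \<open>Like \<open>C_k_alpha_loc n \<alpha>\<close> with Lipschitz bounds at every level, which makes the class
  closed under products.\<close>

primrec Lk :: "nat \<Rightarrow> (real^3 \<Rightarrow> 'a::real_normed_vector) \<Rightarrow> bool" where
  "Lk 0 f \<longleftrightarrow> loclip f"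
| "Lk (Suc n) f \<longleftrightarrow> loclip f \<and> (\<forall>i. \<exists>g. Lk n g \<and> (\<forall>x\<in>half_space. has_partial i f (g x) x))"

declare Lk.simps(2) [simp del]

section \<open>Algebra of the classes \<open>Lk\<close>\<close>

lemma Lk_loclip: "Lk n f \<Longrightarrow> loclip f"
  by (cases n) (auto simp: Lk.simps(2))

lemma Lk_SucD: "Lk (Suc n) f \<Longrightarrow> Lk n f"
  by (induction n arbitrary: f) (simp_all add: Lk.simps(2), metis)

lemma Lk_SucI:
  "loclip f \<Longrightarrow> (\<And>i. Lk n (g i)) \<Longrightarrow> (\<And>i x. x \<in> half_space \<Longrightarrow> has_partial i f (g i x) x) \<Longrightarrow> Lk (Suc n) f"
  unfolding Lk.simps(2) by blast

lemma Lk_SucE: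
  assumes "Lk (Suc n) f"
  obtains g where "\<And>i. Lk n (g i)" "\<And>i x. x \<in> half_space \<Longrightarrow> has_partial i f (g i x) x"
  using assms unfolding Lk.simps(2) by metis

lemma Lk_C_k: "Lk n f \<Longrightarrow> C_k n f"
proof (induction n arbitrary: f)
  case (Suc n)
  then show ?case
    unfolding Lk.simps(2) C_k.simps(2) has_partial_def using loclip_continuous by blast
qed (simp add: loclip_continuous)

lemma Lk_C_k_alpha: "Lk n f \<Longrightarrow> 0 < \<alpha> \<Longrightarrow> \<alpha> < 1 \<Longrightarrow> C_k_alpha_loc n \<alpha> f"
proof (induction n arbitrary: f)
  case (Suc n)
  then show ?case
    unfolding Lk.simps(2) C_k_alpha_loc.simps(2) has_partial_def using loclip_continuous by blast
qed (simp add: loclip_holder)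

lemma Lk_const: "Lk n (\<lambda>x. c)"
  by (induction n arbitrary: c) (auto intro!: Lk_SucI[where g = "\<lambda>_ _. 0"] loclip_const has_partial_const)

lemma Lk_nth: "Lk n (\<lambda>x. x $ j)"
  by (cases n) (auto intro!: Lk_SucI[where g = "\<lambda>i _. if i = j then 1 else 0"] loclip_nth has_partial_nth Lk_const)

lemma Lk_add: "Lk n f \<Longrightarrow> Lk n g \<Longrightarrow> Lk n (\<lambda>x. f x + g x)"
proof (induction n arbitrary: f g)
  case (Suc n)
  obtain f' where f': "\<And>i. Lk n (f' i)" "\<And>i x. x \<in> half_space \<Longrightarrow> has_partial i f (f' i x) x"
    using Lk_SucE[OF Suc.prems(1)] by blast
  obtain g' where g': "\<And>i. Lk n (g' i)" "\<And>i x. x \<in> half_space \<Longrightarrow> has_partial i g (g' i x) x"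
    using Lk_SucE[OF Suc.prems(2)] by blast
  show ?case
    by (rule Lk_SucI[OF loclip_add[OF Lk_loclip[OF Suc.prems(1)] Lk_loclip[OF Suc.prems(2)]]
        Suc.IH[OF f'(1) g'(1)] has_partial_add[OF f'(2) g'(2)]])
qed (simp add: loclip_add)

lemma Lk_mult:
  fixes f g :: "real^3 \<Rightarrow> real"
  shows "Lk n f \<Longrightarrow> Lk n g \<Longrightarrow> Lk n (\<lambda>x. f x * g x)"
proof (induction n arbitrary: f g)
  case (Suc n)
  obtain f' where f': "\<And>i. Lk n (f' i)" "\<And>i x. x \<in> half_space \<Longrightarrow> has_partial i f (f' i x) x"
    using Lk_SucE[OF Suc.prems(1)] by blast
  obtain g' where g': "\<And>i. Lk n (g' i)" "\<And>i x. x \<in> half_space \<Longrightarrow> has_partial i g (g' i x) x"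
    using Lk_SucE[OF Suc.prems(2)] by blast
  show ?case
    by (rule Lk_SucI[OF loclip_mult[OF Lk_loclip[OF Suc.prems(1)] Lk_loclip[OF Suc.prems(2)]]
        Lk_add[OF Suc.IH[OF Lk_SucD[OF Suc.prems(1)] g'(1)] Suc.IH[OF f'(1) Lk_SucD[OF Suc.prems(2)]]]
        has_partial_mult[OF f'(2) g'(2)]])
qed (simp add: loclip_mult)

lemma Lk_minus: "Lk n f \<Longrightarrow> Lk n (\<lambda>x. - f x)" for f :: "real^3 \<Rightarrow> real"
  using Lk_mult[OF Lk_const[of n "- 1"]] by simp

lemma Lk_inverse_norm: "Lk n (\<lambda>x. inverse (norm x))"
proof (induction n)
  case (Suc n)
  have "has_partial i (\<lambda>x. inverse (norm x)) (- (x $ i * (inverse (norm x) * (inverse (norm x) * inverse (norm x))))) x"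
    if "x \<in> half_space" for i and x :: "real^3"
  proof -
    have "x \<noteq> 0" using that by (auto simp: half_space_def)
    then have "(inverse has_real_derivative - (inverse (norm x) * inverse (norm x))) (at (norm x))"
      by (auto intro!: derivative_eq_intros)
    from has_partial_chain[OF has_partial_norm[OF \<open>x \<noteq> 0\<close>] this] show ?thesis
      by (rule has_partial_cong) (simp add: divide_inverse)
  qed
  then show ?case
    by (rule Lk_SucI[OF loclip_inverse_norm Lk_minus[OF Lk_mult[OF Lk_nth Lk_mult[OF Suc Lk_mult[OF Suc Suc]]]]])
qed (simp add: loclip_inverse_norm)

lemma Lk_vec:
  fixes f :: "real^3 \<Rightarrow> real^'n"
  shows "(\<And>j. Lk n (\<lambda>x. f x $ j)) \<Longrightarrow> Lk n f"
proof (induction n arbitrary: f)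
  case (Suc n)
  have "\<forall>j. \<exists>g. (\<forall>i. Lk n (g i)) \<and> (\<forall>i. \<forall>x\<in>half_space. has_partial i (\<lambda>x. f x $ j) (g i x) x)"
    using Lk_SucE[OF Suc.prems] by metis
  from choice[OF this] obtain g where g: "\<And>i j. Lk n (g j i)"
     "\<And>i j x. x \<in> half_space \<Longrightarrow> has_partial i (\<lambda>x. f x $ j) (g j i x) x" by blast
  show ?case
  proof (rule Lk_SucI)
    show "loclip f" using Suc.prems by (intro loclip_vec Lk_loclip)
    show "Lk n (\<lambda>x. \<chi> j. g j i x)" for i by (rule Suc.IH) (simp add: g)
    show "has_partial i f (\<chi> j. g j i x) x" if "x \<in> half_space" for i x
      by (rule has_partial_vec) (simp add: g that)
  qed
qed (simp add: loclip_vec)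

text \<open>A segment through an axis point is approximated by parallel segments shifted
  horizontally by \<open>s\<close>, which avoid the axis. Along these the derivative is
  \<open>g\<close>, close to \<open>g x\<close> by continuity, so the increments differ from
  \<open>t g x\<close> by at most \<open>e \<bar>t\<bar>\<close> uniformly in \<open>s\<close>; the
  limit \<open>s \<longrightarrow> 0\<close> keeps this estimate.\<close>

lemma has_partial_across_axis:
  fixes f :: "real^3 \<Rightarrow> real"
  assumes f: "continuous_on closed_half_space0 f" and g: "continuous_on closed_half_space0 g"
    and off: "\<And>x. x \<in> offaxis \<Longrightarrow> has_partial i f (g x) x"
    and x: "x \<in> half_space"
  shows "has_partial i f (g x) x"
proof (cases "x \<in> offaxis")
  case False
  with x have x0: "x $ 1 = 0" "x $ 2 = 0" "0 < x $ 3" by (auto simp: offaxis_def half_space_def)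
  \<comment> \<open>A horizontal direction other than \<open>i\<close>: a shift along it keeps the
    whole segment off the axis even when \<open>i\<close> itself is horizontal.\<close>
  define j :: 3 where "j = (if i = 1 then 2 else 1)"
  have j: "j \<noteq> i" "j = 1 \<or> j = 2" by (auto simp: j_def)
  define X where "X s t = x + s *\<^sub>R axis j 1 + t *\<^sub>R axis i 1" for s t :: real
  have Xoff: "X s t \<in> offaxis" if "s \<noteq> 0" "\<bar>t\<bar> < x $ 3" for s t
    using that j x0 by (auto simp: offaxis_def X_def axis_def)
  have Xcl: "X s t \<in> closed_half_space0" if "\<bar>t\<bar> < x $ 3" for s t
  proof -
    have "0 < X s t $ 3" using that j x0 by (auto simp: X_def axis_def)
    then show ?thesis by (auto simp: closed_half_space0_def)
  qed
  have D: "((\<lambda>t. f (X s t)) has_real_derivative g (X s t)) (at t)" if "s \<noteq> 0" "\<bar>t\<bar> < x $ 3" for s t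
  proof -
    have "((\<lambda>h. f (X s t + h *\<^sub>R axis i 1)) has_real_derivative g (X s t)) (at 0)"
      using off[OF Xoff[OF that]] by (simp add: has_partial_def has_real_derivative_iff_has_vector_derivative)
    moreover have "X s t + h *\<^sub>R axis i 1 = X s (h + t)" for h by (simp add: X_def algebra_simps)
    ultimately show ?thesis using DERIV_shift[of "\<lambda>t. f (X s t)" "g (X s t)" 0 t] by simp
  qed
  have x_in: "x \<in> closed_half_space0" by (rule half_space_closed[OF x])
  have lin: "\<exists>d>0. \<forall>t. \<bar>t\<bar> < d \<longrightarrow> \<bar>f (X 0 t) - f (X 0 0) - t * g x\<bar> \<le> e * \<bar>t\<bar>" if e: "0 < e" for e
  proof -
    obtain d0 where d0: "0 < d0" "\<And>z. z \<in> closed_half_space0 \<Longrightarrow> dist z x < d0 \<Longrightarrow> dist (g z) (g x) < e"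
      using g[unfolded continuous_on_iff] x_in e by blast
    define d where "d = min (d0 / 2) (x $ 3)"
    have d: "0 < d" using d0 x0 by (simp add: d_def)
    have "\<bar>f (X 0 t) - f (X 0 0) - t * g x\<bar> \<le> e * \<bar>t\<bar>" if t: "\<bar>t\<bar> < d" for t
    proof -
      have bd: "\<bar>f (X s t) - f (X s 0) - t * g x\<bar> \<le> e * \<bar>t\<bar>" if s: "s \<in> {0<..<d}" for s
      proof -
        have "\<bar>(f (X s t) - t * g x) - (f (X s 0) - 0 * g x)\<bar> \<le> \<bar>e * t - e * 0\<bar>"
        proof (rule deriv_dominated[where a = "- d" and b = d and f' = "\<lambda>t. g (X s t) - g x" and g' = "\<lambda>_. e"])
          fix h assume h: "h \<in> {- d<..<d}"
          then have h3: "\<bar>h\<bar> < x $ 3" by (auto simp: d_def)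
          show "((\<lambda>t. f (X s t) - t * g x) has_real_derivative g (X s h) - g x) (at h)"
            by (rule derivative_eq_intros D h3 refl | use s in simp)+
          show "((\<lambda>t. e * t) has_real_derivative e) (at h)" by (auto intro!: derivative_eq_intros)
          have "dist (X s h) x \<le> norm (s *\<^sub>R axis j (1::real)) + norm (h *\<^sub>R axis i (1::real))"
            unfolding X_def dist_norm by (metis add.assoc add_diff_cancel_left' norm_triangle_ineq)
          also have "\<dots> < d0" using s h by (auto simp: d_def norm_axis_1)
          finally show "\<bar>g (X s h) - g x\<bar> \<le> e"
            using d0(2)[OF Xcl[OF h3]] by (simp add: dist_norm less_imp_le)
        qed (use t d in auto)
        then show ?thesis using e by (simp add: abs_mult algebra_simps)
      qed
      have "\<bar>t\<bar> < x $ 3" "\<bar>0\<bar> < x $ 3" using t x0 by (auto simp: d_def)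
      note Xt = Xcl[OF this(1)] Xcl[OF this(2)]
      have lim: "((\<lambda>s. f (X s r)) \<longlongrightarrow> f (X 0 r)) (at_right 0)" if "\<bar>r\<bar> < x $ 3" for r
      proof -
        have "continuous_on UNIV (\<lambda>s. f (X s r))"
          by (rule continuous_on_compose2[OF f]) (use Xcl[OF that] in \<open>auto simp: X_def intro!: continuous_intros\<close>)
        then have "isCont (\<lambda>s. f (X s r)) 0" by (simp add: continuous_on_eq_continuous_at)
        then show ?thesis by (simp add: isCont_def filterlim_at_split)
      qed
      show ?thesis
      proof (rule tendsto_upperbound)
        show "((\<lambda>s. \<bar>f (X s t) - f (X s 0) - t * g x\<bar>) \<longlongrightarrow> \<bar>f (X 0 t) - f (X 0 0) - t * g x\<bar>) (at_right 0)"
          by (intro tendsto_intros lim) (use t x0 in \<open>auto simp: d_def\<close>)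
        show "\<forall>\<^sub>F s in at_right 0. \<bar>f (X s t) - f (X s 0) - t * g x\<bar> \<le> e * \<bar>t\<bar>"
          by (rule eventually_at_rightI[of 0 d]) (use bd d in auto)
      qed simp
    qed
    with d show ?thesis by blast
  qed
  have "((\<lambda>t. f (X 0 t)) has_derivative (\<lambda>t. t * g x)) (at 0)"
    unfolding has_derivative_at_alt
    using lin by (auto intro!: bounded_linear_mult_left)
  then show ?thesis
    by (simp add: has_partial_def has_vector_derivative_def X_def)
qed (rule off)

section \<open>The polar angle as a Lipschitz function\<close>

lemma le_twice_sin:
  assumes "0 \<le> d" "d \<le> pi / 2" shows "d \<le> 2 * sin d"
proof -
  have c: "0 < cos (d / 2)" using assms using pi_gt_zero by (intro cos_gt_zero_pi) linarith+
  have "0 \<le> d / 2" "d / 2 < pi / 2" using assms pi_gt_zero by linarith+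
  then have "\<bar>d / 2\<bar> \<le> \<bar>tan (d / 2)\<bar>" by (intro abs_tan_ge) simp
  moreover have "0 \<le> tan (d / 2)" using c assms sin_ge_zero[of "d / 2"] by (simp add: tan_def)
  ultimately have t: "d / 2 \<le> tan (d / 2)" using assms by simp
  \<comment> \<open>\<open>sin d\<close> is \<open>tan (d / 2)\<close> times
    \<open>2 (cos (d / 2))\<^sup>2\<close>, and that factor is at least 1 because
    \<open>cos d\<close> is nonnegative.\<close>
  have "0 \<le> cos d" using assms by (intro cos_ge_zero) auto
  then have c2: "1 \<le> 2 * (cos (d / 2))\<^sup>2" using cos_double_cos[of "d / 2"] by simp
  have "sin d = tan (d / 2) * (2 * (cos (d / 2))\<^sup>2)"
    using sin_double[of "d / 2"] c by (simp add: tan_def power2_eq_square)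
  moreover have "tan (d / 2) * 1 \<le> tan (d / 2) * (2 * (cos (d / 2))\<^sup>2)"
    using c2 t assms by (intro mult_left_mono) auto
  ultimately show ?thesis using t by simp
qed

definition axis_dist :: "real^3 \<Rightarrow> real" where
  "axis_dist x = sqrt ((x $ 1)\<^sup>2 + (x $ 2)\<^sup>2)"

lemma axis_dist_nonneg [simp]: "0 \<le> axis_dist x"
  by (simp add: axis_dist_def)

text \<open>The distance to the axis is the norm of the horizontal projection, a linear map that
  does not increase norms.\<close>

lemma axis_dist_lipschitz: "\<bar>axis_dist x - axis_dist z\<bar> \<le> norm (x - z)"
proof -
  let ?p = "\<lambda>x. vector [x $ 1, x $ 2, 0] :: real^3"
  have e: "axis_dist x = norm (?p x)" for x
    by (simp add: axis_dist_def norm_eq_sqrt_inner inner_vec_def sum_3 power2_eq_square)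
  have "\<bar>axis_dist x - axis_dist z\<bar> \<le> norm (?p x - ?p z)" unfolding e by (rule norm_triangle_ineq3)
  also have "\<dots> \<le> norm (x - z)"
    by (rule power2_le_imp_le) (simp_all add: norm_sq_3)
  finally show ?thesis .
qed

lemma axis_dist_components: "\<bar>x $ 1\<bar> \<le> axis_dist x" "\<bar>x $ 2\<bar> \<le> axis_dist x"
  unfolding axis_dist_def by (auto intro!: real_le_rsqrt)

lemma shell_height:
  assumes "x \<in> shell \<alpha> \<beta>" "0 < \<alpha>"
  shows "0 < norm x" "x $ 3 / norm x \<in> {0..1}" "colat (x $ 3 / norm x) = axis_dist x / norm x"
    "axis_dist x \<le> norm x" "\<bar>x $ 3\<bar> \<le> norm x" "0 < axis_dist x \<Longrightarrow> x $ 3 / norm x \<in> {0..<1}"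
proof -
  show n: "0 < norm x" using assms by (auto simp: shell_def)
  show c3: "\<bar>x $ 3\<bar> \<le> norm x" by (rule component_le_norm_cart)
  have x3: "0 \<le> x $ 3" using assms by (auto simp: shell_def closed_half_space0_def)
  show 2: "x $ 3 / norm x \<in> {0..1}" using c3 x3 n by auto
  have sq: "(norm x)\<^sup>2 = (axis_dist x)\<^sup>2 + (x $ 3)\<^sup>2"
    by (simp add: norm_sq_3 axis_dist_def)
  have "(axis_dist x / norm x)\<^sup>2 + (x $ 3 / norm x)\<^sup>2 = 1"
    unfolding power_divide add_divide_distrib[symmetric] sq[symmetric] using n by simp
  then have "1 - (x $ 3 / norm x)\<^sup>2 = (axis_dist x / norm x)\<^sup>2" by linarith
  then show c: "colat (x $ 3 / norm x) = axis_dist x / norm x"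
    using n by (simp add: colat_def)
  show "axis_dist x \<le> norm x"
    by (rule power2_le_imp_le) (auto simp: sq)
  show "x $ 3 / norm x \<in> {0..<1}" if "0 < axis_dist x"
  proof -
    have "x $ 3 / norm x \<noteq> 1"
    proof
      assume "x $ 3 / norm x = 1"
      with c have "axis_dist x / norm x = 0" by (simp only: colat_def) simp
      with that n show False by simp
    qed
    with 2 show ?thesis unfolding atLeastAtMost_iff atLeastLessThan_iff by linarith
  qed
qed

text \<open>The sine of a difference of polar angles is the cross product of the pairs
  \<open>(axis_dist, x $ 3)\<close> over the product of the norms, and this is linear in the
  differences of the points. The angle rather than \<open>y\<close> is the coordinate in which a
  profile with \<open>A' = O(1 / colat)\<close> is Lipschitz.\<close>

lemma arccos_height_lipschitz:
  assumes x: "x \<in> shell \<alpha> \<beta>" and z: "z \<in> shell \<alpha> \<beta>" and \<alpha>: "0 < \<alpha>"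
  shows "\<bar>arccos (x $ 3 / norm x) - arccos (z $ 3 / norm z)\<bar> \<le> 4 / \<alpha> * norm (x - z)"
proof -
  note hx = shell_height[OF x \<alpha>] and hz = shell_height[OF z \<alpha>]
  define p q where "p = arccos (x $ 3 / norm x)" and "q = arccos (z $ 3 / norm z)"
  have pq: "cos p = x $ 3 / norm x" "cos q = z $ 3 / norm z"
    "sin p = axis_dist x / norm x" "sin q = axis_dist z / norm z"
    using hx hz by (auto simp: p_def q_def sin_arccos colat_def)
  have r: "0 \<le> p" "p \<le> pi / 2" "0 \<le> q" "q \<le> pi / 2"
    using hx(2) hz(2) arccos_bounded[of "x $ 3 / norm x"] arccos_bounded[of "z $ 3 / norm z"]
      arccos_le_mono[of "x $ 3 / norm x" 0] arccos_le_mono[of "z $ 3 / norm z" 0]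
    by (auto simp: p_def q_def)
  have "\<bar>p - q\<bar> \<le> pi / 2" using r by linarith
  then have "\<bar>p - q\<bar> \<le> 2 * sin \<bar>p - q\<bar>" by (intro le_twice_sin) auto
  also have "sin \<bar>p - q\<bar> \<le> \<bar>sin (p - q)\<bar>"
    using sin_minus[of "p - q"] by (cases "p \<le> q") (simp_all add: abs_if)
  also have "sin (p - q) = (axis_dist x * z $ 3 - x $ 3 * axis_dist z) / (norm x * norm z)"
    unfolding sin_diff pq using hx hz by (simp add: field_simps)
  also have "\<bar>\<dots>\<bar> = \<bar>(axis_dist x - axis_dist z) * z $ 3 + axis_dist z * (z $ 3 - x $ 3)\<bar> / (norm x * norm z)"
    by (simp add: abs_divide algebra_simps)
  also have "\<dots> \<le> (norm (x - z) * norm z + norm z * norm (x - z)) / (norm x * norm z)"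
  proof (intro divide_right_mono order_trans[OF abs_triangle_ineq] add_mono)
    show "\<bar>(axis_dist x - axis_dist z) * z $ 3\<bar> \<le> norm (x - z) * norm z"
      unfolding abs_mult by (intro mult_mono axis_dist_lipschitz hz) auto
    have "\<bar>z $ 3 - x $ 3\<bar> \<le> norm (x - z)"
      using component_le_norm_cart[of "x - z" 3] by (simp add: abs_minus_commute)
    then show "\<bar>axis_dist z * (z $ 3 - x $ 3)\<bar> \<le> norm z * norm (x - z)"
      unfolding abs_mult using hz(4) by (intro mult_mono) auto
  qed auto
  also have "\<dots> = 2 * norm (x - z) / norm x" using hx hz by (simp add: field_simps)
  also have "\<dots> \<le> 2 * norm (x - z) / \<alpha>"
    using x \<alpha> hx(1) by (intro divide_left_mono mult_pos_pos) (auto simp: shell_def)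
  finally show ?thesis by (simp add: p_def q_def mult_ac)
qed

text \<open>As a function of the angle \<open>t\<close> the profile has derivative
  \<open>- A' (cos t) sin t\<close>, of size at most \<open>C sin t powi (- d)\<close>. The mean
  value theorem produces an intermediate angle whose sine is at least the smaller of the two end
  values; the power \<open>d\<close> of the minimum compensates for exactly that. The closed
  interval serves \<open>d = 0\<close>, the half-open one profiles that may be unbounded on the
  axis.\<close>

lemma variation_in_angle:
  assumes I: "I = {0..<1} \<or> I = {0..1::real}" and A: "continuous_on I A"
    and A': "\<And>y. y \<in> {0<..<1} \<Longrightarrow> (A has_real_derivative A' y) (at y)"
    and bd: "\<And>y. y \<in> {0<..<1} \<Longrightarrow> \<bar>A' y\<bar> \<le> C * colat y powi (- 1 - int d)"
    and y: "y1 \<in> I" "y2 \<in> I"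
  shows "\<bar>A y1 - A y2\<bar> * (min (colat y1) (colat y2)) ^ d \<le> C * \<bar>arccos y1 - arccos y2\<bar>"
proof -
  have *: "\<bar>A y1 - A y2\<bar> * (colat y2) ^ d \<le> C * \<bar>arccos y1 - arccos y2\<bar> \<and> colat y2 \<le> colat y1"
    if lt: "y1 < y2" and y: "y1 \<in> I" "y2 \<in> I" for y1 y2
  proof -
    have b: "0 \<le> y1" "y2 \<le> 1" using y I by auto
    define p q where "p = arccos y1" and "q = arccos y2"
    have qp: "q < p" "0 \<le> q" "p \<le> pi / 2"
      using lt b arccos_less_arccos[of y1 y2] arccos_lbound[of y2] arccos_le_mono[of y1 0] by (auto simp: p_def q_def)
    have cs: "cos p = y1" "cos q = y2" using b lt by (auto simp: p_def q_def)
    have cI: "cos t \<in> {y1..y2}" if "t \<in> {q..p}" for t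
      using that qp cos_mono_le_eq[of t p] cos_mono_le_eq[of q t] cs by auto
    have co: "cos t \<in> {0<..<1}" if "t \<in> {q<..<p}" for t
      using that qp cos_monotone_0_pi[of t p] cos_monotone_0_pi[of q t] cs b by auto
    have sub: "{y1..y2} \<subseteq> I" using I y by auto
    have "continuous_on {q..p} (\<lambda>t. A (cos t))"
      by (rule continuous_on_compose2[OF A]) (use cI sub in \<open>auto intro!: continuous_intros\<close>)
    moreover have der: "((\<lambda>t. A (cos t)) has_real_derivative A' (cos t) * (- sin t)) (at t)" if "t \<in> {q<..<p}" for t
      using DERIV_chain2[OF A'[OF co[OF that]] DERIV_cos[of t]] by simp
    then have "\<And>t. q < t \<Longrightarrow> t < p \<Longrightarrow> (\<lambda>t. A (cos t)) differentiable (at t)"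
      by (meson greaterThanLessThan_iff real_differentiable_def)
    ultimately obtain l t where t: "q < t" "t < p" "((\<lambda>t. A (cos t)) has_real_derivative l) (at t)"
      "A (cos p) - A (cos q) = (p - q) * l"
      using MVT[OF qp(1)] by blast
    then have l: "l = A' (cos t) * (- sin t)"
      using der[of t] DERIV_unique by (metis greaterThanLessThan_iff)
    have st: "0 < sin t" using t qp by (intro sin_gt_zero) auto
    have colt: "colat (cos t) = sin t" unfolding colat_def using st by (simp add: sin_squared_eq[symmetric])
    have colq: "colat y2 = sin q" unfolding colat_def cs(2)[symmetric] using qp sin_ge_zero[of q] by (simp add: sin_squared_eq[symmetric])
    have colp: "colat y1 = sin p" unfolding colat_def cs(1)[symmetric] using qp sin_ge_zero[of p] by (simp add: sin_squared_eq[symmetric])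
    have mono: "sin q \<le> sin t" "sin q \<le> sin p" using t qp by (auto intro!: sin_monotone_2pi_le)
    have pw: "sin t powi (- 1 - int d) * sin t * sin t ^ d = 1"
      using st power_int_add[of "sin t" "- 1 - int d" "1 + int d"] by (simp add: power_int_add)
    have sq0: "0 \<le> sin q" using qp pi_gt_zero by (intro sin_ge_zero) linarith+
    have C0: "0 \<le> C * sin t powi (- 1 - int d)" using bd[OF co, of t] t colt by (metis abs_ge_zero greaterThanLessThan_iff order_trans)
    have "\<bar>l\<bar> * sin q ^ d \<le> (C * sin t powi (- 1 - int d)) * sin t * sin t ^ d"
      unfolding l abs_mult using bd[OF co, of t] t st colt mono qp C0
      by (intro mult_mono power_mono) (auto intro: sq0 zero_le_power)
    also have "\<dots> = C" using pw by (simp add: mult.assoc)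
    finally have "(p - q) * (\<bar>l\<bar> * sin q ^ d) \<le> (p - q) * C" using qp by (intro mult_left_mono) auto
    moreover have "\<bar>A y1 - A y2\<bar> = (p - q) * \<bar>l\<bar>"
      using t(4) qp by (simp add: cs abs_mult)
    ultimately show ?thesis using qp mono unfolding colq colp
      by (simp add: p_def[symmetric] q_def[symmetric] mult_ac)
  qed
  consider "y1 < y2" | "y2 < y1" | "y1 = y2" by linarith
  then show ?thesis
  proof cases
    case 1 then show ?thesis using *[OF 1 y] by (simp add: min_absorb2)
  next
    case 2 then show ?thesis using *[OF 2 y(2,1)] by (simp add: min_absorb1 abs_minus_commute)
  qed auto
qed

section \<open>Monomials in the horizontal coordinates times profiles\<close>

lemma abs_power_diff_le:
  fixes x z M :: real
  assumes "\<bar>x\<bar> \<le> M" "\<bar>z\<bar> \<le> M"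
  shows "M * \<bar>x ^ i - z ^ i\<bar> \<le> real i * M ^ i * \<bar>x - z\<bar>"
proof (induction i)
  case (Suc i)
  have M: "0 \<le> M" using assms by linarith
  have "x ^ Suc i - z ^ Suc i = x * (x ^ i - z ^ i) + (x - z) * z ^ i" by (simp add: algebra_simps)
  then have "\<bar>x ^ Suc i - z ^ Suc i\<bar> \<le> \<bar>x\<bar> * \<bar>x ^ i - z ^ i\<bar> + \<bar>x - z\<bar> * \<bar>z\<bar> ^ i"
    by (metis abs_mult abs_triangle_ineq power_abs)
  also have "\<dots> \<le> M * \<bar>x ^ i - z ^ i\<bar> + \<bar>x - z\<bar> * M ^ i"
    using assms M by (intro add_mono mult_mono power_mono) auto
  finally have "M * \<bar>x ^ Suc i - z ^ Suc i\<bar> \<le> M * (M * \<bar>x ^ i - z ^ i\<bar> + \<bar>x - z\<bar> * M ^ i)"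
    using M by (rule mult_left_mono)
  also have "\<dots> \<le> M * (real i * M ^ i * \<bar>x - z\<bar> + \<bar>x - z\<bar> * M ^ i)"
    using M Suc by (intro mult_left_mono add_mono) auto
  finally show ?case by (simp add: algebra_simps)
qed simp

text \<open>Multiplied through by \<open>M\<close>, which avoids the truncated exponent
  \<open>i + j - 1\<close>.\<close>

lemma abs_monomial_diff_le:
  fixes x1 x2 z1 z2 M D :: real
  assumes "\<bar>x1\<bar> \<le> M" "\<bar>x2\<bar> \<le> M" "\<bar>z1\<bar> \<le> M" "\<bar>z2\<bar> \<le> M" "\<bar>x1 - z1\<bar> \<le> D" "\<bar>x2 - z2\<bar> \<le> D"
  shows "M * \<bar>x1 ^ i * x2 ^ j - z1 ^ i * z2 ^ j\<bar> \<le> real (i + j) * M ^ (i + j) * D"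
proof -
  have M: "0 \<le> M" using assms by linarith
  have "x1 ^ i * x2 ^ j - z1 ^ i * z2 ^ j = x1 ^ i * (x2 ^ j - z2 ^ j) + (x1 ^ i - z1 ^ i) * z2 ^ j"
    by (simp add: algebra_simps)
  then have "\<bar>x1 ^ i * x2 ^ j - z1 ^ i * z2 ^ j\<bar> \<le> \<bar>x1\<bar> ^ i * \<bar>x2 ^ j - z2 ^ j\<bar> + \<bar>x1 ^ i - z1 ^ i\<bar> * \<bar>z2\<bar> ^ j"
    by (metis abs_mult abs_triangle_ineq power_abs)
  also have "\<dots> \<le> M ^ i * \<bar>x2 ^ j - z2 ^ j\<bar> + \<bar>x1 ^ i - z1 ^ i\<bar> * M ^ j"
    using assms M by (intro add_mono mult_mono power_mono) auto
  finally have "M * \<bar>x1 ^ i * x2 ^ j - z1 ^ i * z2 ^ j\<bar>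
      \<le> M * (M ^ i * \<bar>x2 ^ j - z2 ^ j\<bar> + \<bar>x1 ^ i - z1 ^ i\<bar> * M ^ j)"
    using M by (rule mult_left_mono)
  also have "\<dots> = M ^ i * (M * \<bar>x2 ^ j - z2 ^ j\<bar>) + (M * \<bar>x1 ^ i - z1 ^ i\<bar>) * M ^ j" by (simp add: algebra_simps)
  also have "\<dots> \<le> M ^ i * (real j * M ^ j * D) + (real i * M ^ i * D) * M ^ j"
    using assms M
    by (intro add_mono mult_left_mono mult_right_mono order_trans[OF abs_power_diff_le])
       (auto intro!: mult_left_mono)
  finally show ?thesis by (simp add: algebra_simps power_add)
qed

text \<open>The condition on \<open>A\<close> under which \<open>Q(x\<^sub>1, x\<^sub>2) A(x\<^sub>3/|x|)\<close> is locally Lipschitz for every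
  monomial \<open>Q\<close> of degree \<open>d\<close>.\<close>

definition lip_profile :: "nat \<Rightarrow> (real \<Rightarrow> real) \<Rightarrow> bool" where
  "lip_profile d A \<longleftrightarrow> (\<exists>A'. (\<forall>y\<in>{0<..<1}. (A has_real_derivative A' y) (at y)) \<and> wt 0 (- 1 - int d) A') \<and>
     (if d = 0 then continuous_on {0..1} A else continuous_on {0..<1} A \<and> wt 0 (1 - int d) A)"

lemma lip_profile_wt: "wt 1 (1 - int d) A \<Longrightarrow> 0 < d \<Longrightarrow> lip_profile d A"
  unfolding lip_profile_def One_nat_def wt_Suc_iff by simp

text \<open>The difference splits as \<open>Qx (A yx - A yz) + (Qx - Qz) A yz\<close>, with
  \<open>z\<close> the point farther from the axis. In the first term the \<open>d\<close>
  horizontal factors offset the loss in \<open>variation_in_angle\<close>. In the second the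
  monomial varies at a rate of order \<open>axis_dist z ^ (d - 1)\<close>, which offsets the growth
  of \<open>A\<close> near the axis.\<close>

lemma loclip_profile:
  assumes "lip_profile (i + j) A"
  shows "loclip (\<lambda>x. (x $ 1) ^ i * (x $ 2) ^ j * A (x $ 3 / norm x))"
  unfolding loclip_def
proof (intro allI impI)
  fix \<alpha> \<beta> :: real assume \<alpha>: "0 < \<alpha>"
  define d where "d = i + j"
  define f where "f x = (x $ 1) ^ i * (x $ 2) ^ j * A (x $ 3 / norm x)" for x :: "real^3"
  obtain A' where A': "\<And>y. y \<in> {0<..<1} \<Longrightarrow> (A has_real_derivative A' y) (at y)" "wt 0 (- 1 - int d) A'"
    using assms unfolding lip_profile_def d_def by blast
  obtain C where C: "0 \<le> C" "\<And>y. y \<in> {0<..<1} \<Longrightarrow> \<bar>A' y\<bar> \<le> C * colat y powi (- 1 - int d)"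
    using wt_bound[OF A'(2)] by blast
  have "\<exists>C. \<forall>x\<in>shell \<alpha> \<beta>. \<forall>z\<in>shell \<alpha> \<beta>. norm (f x - f z) \<le> C * norm (x - z)"
  proof (cases "d = 0")
    case True
    then have ij: "i = 0" "j = 0" and cA: "continuous_on {0..1} A"
      using assms by (auto simp: d_def lip_profile_def)
    show ?thesis
    proof (intro exI[of _ "C * (4 / \<alpha>)"] ballI)
      fix x z assume xz: "x \<in> shell \<alpha> \<beta>" "z \<in> shell \<alpha> \<beta>"
      have "norm (f x - f z) \<le> C * \<bar>arccos (x $ 3 / norm x) - arccos (z $ 3 / norm z)\<bar>"
        using variation_in_angle[OF _ cA A'(1) C(2) shell_height(2)[OF xz(1) \<alpha>] shell_height(2)[OF xz(2) \<alpha>]]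
        by (simp add: f_def ij True)
      also have "\<dots> \<le> C * (4 / \<alpha> * norm (x - z))"
        by (intro mult_left_mono arccos_height_lipschitz[OF xz \<alpha>] C(1))
      finally show "norm (f x - f z) \<le> C * (4 / \<alpha>) * norm (x - z)" by (simp add: mult.assoc)
    qed
  next
    case False
    then have cA: "continuous_on {0..<1} A" and wA: "wt 0 (1 - int d) A"
      using assms by (auto simp: d_def lip_profile_def)
    obtain B0 where B0: "0 \<le> B0" "\<And>y. y \<in> {0<..<1} \<Longrightarrow> \<bar>A y\<bar> \<le> B0 * colat y powi (1 - int d)"
      using wt_bound[OF wA] by blast
    \<comment> \<open>The weight bounds \<open>A\<close> on the open interval; the maximum with
      \<open>\<bar>A 0\<bar>\<close> covers the boundary plane, where
      \<open>colat 0 = 1\<close>.\<close>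
    define B where "B = max B0 \<bar>A 0\<bar>"
    have B: "\<bar>A y\<bar> \<le> B * colat y powi (1 - int d)" if y: "y \<in> {0..<1}" for y
    proof (cases "y = 0")
      case True then show ?thesis by (simp add: B_def colat_def)
    next
      case False
      then have "\<bar>A y\<bar> \<le> B0 * colat y powi (1 - int d)" using B0 y by auto
      also have "\<dots> \<le> B * colat y powi (1 - int d)"
        using colat_pos[OF y] by (intro mult_right_mono) (auto simp: B_def)
      finally show ?thesis .
    qed
    define K where "K = \<beta> ^ d * (C * (4 / \<alpha>)) + real d * (B * \<beta> ^ (d - 1))"
    have main: "norm (f x - f z) \<le> K * norm (x - z)"
      if xz: "x \<in> shell \<alpha> \<beta>" "z \<in> shell \<alpha> \<beta>" and le: "axis_dist x \<le> axis_dist z" for x z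
    proof -
      note hx = shell_height[OF xz(1) \<alpha>] and hz = shell_height[OF xz(2) \<alpha>]
      have \<beta>: "norm x \<le> \<beta>" "norm z \<le> \<beta>" "0 < \<beta>" using xz \<alpha> by (auto simp: shell_def)
      have K: "0 \<le> K" using \<beta> \<alpha> C by (auto simp: K_def B_def intro!: add_nonneg_nonneg mult_nonneg_nonneg)
      define h where "h = axis_dist z"
      define yx yz where "yx = x $ 3 / norm x" and "yz = z $ 3 / norm z"
      define Qx Qz where "Qx = (x $ 1) ^ i * (x $ 2) ^ j" and "Qz = (z $ 1) ^ i * (z $ 2) ^ j"
      have Qx: "\<bar>Qx\<bar> \<le> axis_dist x ^ d"
        unfolding Qx_def d_def abs_mult power_abs power_add
        using axis_dist_components[of x] by (intro mult_mono power_mono) auto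
      have fx: "f x = Qx * A yx" "f z = Qz * A yz" by (simp_all add: f_def Qx_def Qz_def yx_def yz_def)
      have ax: "\<bar>x $ 1\<bar> \<le> h" "\<bar>x $ 2\<bar> \<le> h" "\<bar>z $ 1\<bar> \<le> h" "\<bar>z $ 2\<bar> \<le> h"
        using axis_dist_components[of x] axis_dist_components[of z] le by (auto simp: h_def)
      show ?thesis
      proof (cases "h = 0")
        \<comment> \<open>Both points lie on the axis, and a monomial of positive degree vanishes at
          both.\<close>
        case True
        then have "Qx = 0" "Qz = 0" using ax False by (auto simp: Qx_def Qz_def d_def zero_power)
        then show ?thesis using K by (simp add: fx)
      next
        case h0: False
        then have h: "0 < h" by (simp add: h_def less_le)
        have yz: "yz \<in> {0..<1}" using hz(6) h by (simp add: yz_def h_def)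
        have 1: "\<bar>Qx\<bar> * \<bar>A yx - A yz\<bar> \<le> \<beta> ^ d * (C * (4 / \<alpha>)) * norm (x - z)"
        proof (cases "axis_dist x = 0")
          case True
          then have "Qx = 0" using Qx False by (simp add: power_0_left)
          then show ?thesis using \<beta> C \<alpha> by simp
        next
          case hx0: False
          then have ph: "0 < axis_dist x" by (simp add: less_le)
          then have yx: "yx \<in> {0..<1}" using hx(6) by (simp add: yx_def)
          have "axis_dist x / \<beta> \<le> colat yx"
            using hx \<beta> ph unfolding yx_def hx(3) by (intro divide_left_mono) auto
          moreover have "axis_dist x / \<beta> \<le> axis_dist z / norm z"
            using hz \<beta> ph le by (intro frac_le) auto
          then have "axis_dist x / \<beta> \<le> colat yz" unfolding yz_def hz(3) .
          ultimately have "axis_dist x \<le> \<beta> * min (colat yx) (colat yz)"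
            using \<beta> by (simp add: min_def divide_le_eq mult.commute)
          then have "\<bar>Qx\<bar> \<le> (\<beta> * min (colat yx) (colat yz)) ^ d"
            using Qx ph by (intro order_trans[OF Qx power_mono]) auto
          then have "\<bar>Qx\<bar> * \<bar>A yx - A yz\<bar> \<le> (\<beta> * min (colat yx) (colat yz)) ^ d * \<bar>A yx - A yz\<bar>"
            by (rule mult_right_mono) auto
          also have "\<dots> = \<beta> ^ d * (\<bar>A yx - A yz\<bar> * (min (colat yx) (colat yz)) ^ d)"
            by (simp add: power_mult_distrib)
          also have "\<dots> \<le> \<beta> ^ d * (C * \<bar>arccos yx - arccos yz\<bar>)"
            using \<beta> by (intro mult_left_mono variation_in_angle[OF _ cA A'(1) C(2) yx yz]) auto
          also have "\<dots> \<le> \<beta> ^ d * (C * (4 / \<alpha> * norm (x - z)))"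
            unfolding yx_def yz_def using \<beta> C
            by (intro mult_left_mono arccos_height_lipschitz[OF xz \<alpha>]) auto
          finally show ?thesis by (simp add: mult.assoc)
        qed
        have 2: "\<bar>Qx - Qz\<bar> * \<bar>A yz\<bar> \<le> real d * (B * \<beta> ^ (d - 1)) * norm (x - z)"
        proof -
          have "h * \<bar>Qx - Qz\<bar> \<le> real d * h ^ d * norm (x - z)"
            unfolding Qx_def Qz_def d_def
            by (rule abs_monomial_diff_le[OF ax])
               (metis component_le_norm_cart vector_minus_component)+
          also have "\<dots> = h * (real d * h ^ (d - 1) * norm (x - z))"
            using False by (cases d) auto
          finally have q: "\<bar>Qx - Qz\<bar> \<le> real d * h ^ (d - 1) * norm (x - z)" using h by simp
          have "colat yz powi (1 - int d) = (norm z / h) ^ (d - 1)"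
            unfolding yz_def hz(3) h_def[symmetric] using False
            by (cases d) (auto simp: power_int_def power_inverse[symmetric] inverse_eq_divide)
          then have "\<bar>A yz\<bar> \<le> B * (norm z / h) ^ (d - 1)" using B[OF yz] by simp
          then have "\<bar>Qx - Qz\<bar> * \<bar>A yz\<bar> \<le> (real d * h ^ (d - 1) * norm (x - z)) * (B * (norm z / h) ^ (d - 1))"
            using q h by (intro mult_mono) auto
          also have "\<dots> = real d * (B * norm z ^ (d - 1)) * norm (x - z)"
            using h by (simp add: power_divide)
          also have "\<dots> \<le> real d * (B * \<beta> ^ (d - 1)) * norm (x - z)"
            using \<beta> by (intro mult_right_mono mult_left_mono power_mono) (auto simp: B_def)
          finally show ?thesis .
        qed
        have "f x - f z = Qx * (A yx - A yz) + (Qx - Qz) * A yz" by (simp add: fx algebra_simps)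
        then have "norm (f x - f z) \<le> \<bar>Qx\<bar> * \<bar>A yx - A yz\<bar> + \<bar>Qx - Qz\<bar> * \<bar>A yz\<bar>"
          by (metis abs_mult abs_triangle_ineq real_norm_def)
        with 1 2 show ?thesis by (simp add: K_def distrib_right)
      qed
    qed
    show ?thesis
    proof (intro exI[of _ K] ballI)
      fix x z assume "x \<in> shell \<alpha> \<beta>" "z \<in> shell \<alpha> \<beta>"
      then show "norm (f x - f z) \<le> K * norm (x - z)"
        using main[of x z] main[of z x] by (cases "axis_dist x \<le> axis_dist z") (auto simp: norm_minus_commute abs_minus_commute)
    qed
  qed
  then show "\<exists>C. \<forall>x\<in>shell \<alpha> \<beta>. \<forall>y\<in>shell \<alpha> \<beta>. norm ((x $ 1) ^ i * (x $ 2) ^ j * A (x $ 3 / norm x) -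
      (y $ 1) ^ i * (y $ 2) ^ j * A (y $ 3 / norm y)) \<le> C * norm (x - y)"
    by (simp add: f_def)
qed

text \<open>The closure of \<open>lip_profile\<close> under the rules for differentiating
  \<open>Q(x\<^sub>1, x\<^sub>2) A(x\<^sub>3/|x|)\<close>: a derivative of \<open>A\<close> brings one horizontal factor for \<open>i = 1, 2\<close>
  and two for \<open>i = 3\<close>.\<close>

primrec Lk_profile :: "nat \<Rightarrow> nat \<Rightarrow> (real \<Rightarrow> real) \<Rightarrow> bool" where
  "Lk_profile 0 d A \<longleftrightarrow> lip_profile d A"
| "Lk_profile (Suc n) d A \<longleftrightarrow> lip_profile d A \<and> (0 < d \<longrightarrow> Lk_profile n (d - 1) A) \<and>
     (\<exists>A'. (\<forall>y\<in>{0<..<1}. (A has_real_derivative A' y) (at y)) \<and>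
       Lk_profile n (d + 1) A' \<and> Lk_profile n (d + 2) A')"

lemma has_partial_nth_power:
  "has_partial k (\<lambda>x. (x $ l) ^ i) (real i * (x $ l) ^ (i - 1) * (if k = l then 1 else 0)) x"
  by (rule has_partial_chain[OF has_partial_nth]) (auto intro!: derivative_eq_intros)

lemma Lk_monomial_profile:
  "Lk_profile n (i + j) A \<Longrightarrow> Lk n (\<lambda>x. (x $ 1) ^ i * (x $ 2) ^ j * A (x $ 3 / norm x))"
proof (induction n arbitrary: i j A)
  case 0 then show ?case by (simp add: loclip_profile)
next
  case (Suc n)
  define f where "f = (\<lambda>i j A (x::real^3). (x $ 1) ^ i * (x $ 2) ^ j * A (x $ 3 / norm x) :: real)"
  define \<iota> where "\<iota> x = inverse (norm x) * (inverse (norm x) * inverse (norm x))" for x :: "real^3"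
  have lf: "loclip (f i j A)" unfolding f_def using Suc.prems unfolding Lk_profile.simps by (intro loclip_profile) blast
  obtain A' where A': "\<And>y. y \<in> {0<..<1} \<Longrightarrow> (A has_real_derivative A' y) (at y)"
    "Lk_profile n (i + j + 1) A'" "Lk_profile n (i + j + 2) A'"
    using Suc.prems unfolding Lk_profile.simps by blast
  have low: "Lk n (f (i - 1) j A)" if "0 < i"
    using Suc.IH[of "i - 1" j A] Suc.prems that by (simp add: f_def)
  have low': "Lk n (f i (j - 1) A)" if "0 < j"
    using Suc.IH[of i "j - 1" A] Suc.prems that by (simp add: f_def)
  have hi: "Lk n (f (i + 1) j A')" "Lk n (f i (j + 1) A')" "Lk n (f (i + 2) j A')" "Lk n (f i (j + 2) A')"
    using Suc.IH[of "i + 1" j A'] Suc.IH[of i "j + 1" A'] Suc.IH[of "i + 2" j A'] Suc.IH[of i "j + 2" A'] A'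
    by (simp_all add: f_def add_ac)
  have \<iota>: "Lk n \<iota>" unfolding \<iota>_def[abs_def] by (intro Lk_mult Lk_inverse_norm)
  \<comment> \<open>The partial derivative of \<open>x $ 3 / norm x\<close> is
    \<open>- x $ k\<close> times \<open>x $ 3 / norm x ^ 3\<close> for horizontal \<open>k\<close>,
    and \<open>(x $ 1)\<^sup>2 + (x $ 2)\<^sup>2\<close> over \<open>norm x ^ 3\<close> for
    \<open>k = 3\<close>. For \<open>i = 0\<close> the truncated exponent \<open>i - 1\<close> is
    harmless, since its coefficient is 0.\<close>
  define g where "g k x = (if k = 1 then real i * f (i - 1) j A x - x $ 3 * (\<iota> x * f (i + 1) j A' x)
     else if k = 2 then real j * f i (j - 1) A x - x $ 3 * (\<iota> x * f i (j + 1) A' x)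
     else \<iota> x * (f (i + 2) j A' x + f i (j + 2) A' x))" for k :: 3 and x
  have l1: "Lk n (\<lambda>x. real i * f (i - 1) j A x)"
    using low by (cases "i = 0") (auto intro!: Lk_const Lk_mult)
  have l2: "Lk n (\<lambda>x. real j * f i (j - 1) A x)"
    using low' by (cases "j = 0") (auto intro!: Lk_const Lk_mult)
  have gL: "Lk n (g k)" for k
  proof -
    have "Lk n (\<lambda>x. real i * f (i - 1) j A x + - (x $ 3 * (\<iota> x * f (i + 1) j A' x)))"
      "Lk n (\<lambda>x. real j * f i (j - 1) A x + - (x $ 3 * (\<iota> x * f i (j + 1) A' x)))"
      "Lk n (\<lambda>x. \<iota> x * (f (i + 2) j A' x + f i (j + 2) A' x))"
      by (intro Lk_add Lk_minus Lk_mult Lk_nth \<iota> hi l1 l2)+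
    then show ?thesis unfolding g_def[abs_def] by (cases "k = 1"; cases "k = 2") simp_all
  qed
  have off: "has_partial k (f i j A) (g k x) x" if x: "x \<in> offaxis" for k x
  proof -
    have z: "has_partial k (\<lambda>x. A (x $ 3 / norm x)) (zonal_partial k 0 A A' x) x"
      using has_partial_zonal[OF x A'(1), of k 0] by (simp add: zonal_def[abs_def])
    note * = has_partial_mult[OF has_partial_mult[OF has_partial_nth_power[of k 1 i] has_partial_nth_power[of k 2 j]] z]
    define \<rho> where "\<rho> = norm x"
    define y where "y = x $ 3 / \<rho>"
    have r: "x $ 3 = y * \<rho>" "\<rho> \<noteq> 0" using offaxis_nz[OF x] by (auto simp: y_def \<rho>_def)
    have s: "x $ 1 * x $ 1 + x $ 2 * x $ 2 = \<rho>\<^sup>2 * (1 - y\<^sup>2)"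
      using norm_sq_3[of x] unfolding r(1) \<rho>_def by (simp add: algebra_simps power2_eq_square)
    have io: "\<iota> x = inverse \<rho> * inverse \<rho> * inverse \<rho>" by (simp add: \<iota>_def \<rho>_def)
    have zp: "zonal_partial k 0 A A' x = (if k = 3 then (x $ 1 * x $ 1 + x $ 2 * x $ 2) * (\<iota> x * A' y)
        else - (x $ k * (x $ 3 * (\<iota> x * A' y))))"
    proof -
      have eq: "zonal_partial k 0 A A' x = - (x $ k * (inverse \<rho> * inverse \<rho> * (y * A' y))) + (if k = 3 then inverse \<rho> * A' y else 0)"
        unfolding zonal_partial_def zonal_def \<rho>_def[symmetric] y_def[symmetric]
        by (simp add: power_int_def power2_eq_square)
      show ?thesis
      proof (cases "k = 3")
        case True
        have "inverse \<rho> * \<rho> = 1" using r(2) by simp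
        then have "- (y * \<rho> * (inverse \<rho> * inverse \<rho> * (y * A' y))) + inverse \<rho> * A' y
          = \<rho>\<^sup>2 * (1 - y\<^sup>2) * (inverse \<rho> * inverse \<rho> * inverse \<rho> * A' y)" by algebra
        then show ?thesis using True unfolding eq io s by (simp add: r(1))
      next
        case False
        then show ?thesis using r(2) unfolding eq io by (simp add: r(1))
      qed
    qed
    have fA: "f i j A' x = (x $ 1) ^ i * (x $ 2) ^ j * A' y" for i j
      by (simp add: f_def y_def \<rho>_def)
    have "has_partial k (\<lambda>x. (x $ 1) ^ i * (x $ 2) ^ j * A (x $ 3 / norm x)) (g k x) x"
    proof (rule has_partial_cong[OF *])
      show "(x $ 1) ^ i * (x $ 2) ^ j * zonal_partial k 0 A A' x +
        ((x $ 1) ^ i * (real j * x $ 2 ^ (j - 1) * (if k = 2 then 1 else 0)) +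
         real i * x $ 1 ^ (i - 1) * (if k = 1 then 1 else 0) * (x $ 2) ^ j) * A (x $ 3 / norm x) = g k x"
        using exhaust_3[of k] unfolding g_def fA zp
        by (elim disjE) (simp_all add: f_def algebra_simps)
    qed
    then show ?thesis by (simp add: f_def)
  qed
  \<comment> \<open>The chain rule is available off the axis. Continuity of the function and of the
    candidate derivative, both obtained from Lipschitz bounds, extends it to the axis.\<close>
  have "Lk (Suc n) (f i j A)"
    by (rule Lk_SucI[OF lf gL has_partial_across_axis[OF loclip_continuous[OF lf] loclip_continuous[OF Lk_loclip[OF gL]] off]])
  then show ?case by (simp add: f_def)
qed

section \<open>Weights that suffice for \<open>Lk_profile\<close>\<close>

lemma lip_profile_0:
  assumes "continuous_on {0..1} A" "\<And>y. y \<in> {0<..<1} \<Longrightarrow> (A has_real_derivative A' y) (at y)" "wt 0 (- 1) A'"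
  shows "lip_profile 0 A"
proof -
  have "\<forall>y\<in>{0<..<1}. (A has_real_derivative A' y) (at y)" using assms(2) by blast
  moreover have "wt 0 (- 1 - int 0) A'" using assms(3) by simp
  ultimately show ?thesis unfolding lip_profile_def using assms(1) by metis
qed

lemma Lk_profile_SucI:
  assumes "lip_profile d A" "\<And>y. y \<in> {0<..<1} \<Longrightarrow> (A has_real_derivative A' y) (at y)"
    "Lk_profile n (d + 1) A'" "Lk_profile n (d + 2) A'" "0 < d \<Longrightarrow> Lk_profile n (d - 1) A"
  shows "Lk_profile (Suc n) d A"
  unfolding Lk_profile.simps using assms by blast

text \<open>For the pressure profile: one derivative of the field, no horizontal factor.\<close>

lemma Lk_profile_1_0:
  assumes "continuous_on {0..1} A" "\<And>y. y \<in> {0<..<1} \<Longrightarrow> (A has_real_derivative A1 y) (at y)" "wt 1 0 A1"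
  shows "Lk_profile (Suc 0) 0 A"
proof -
  have "lip_profile 0 A" by (rule lip_profile_0[OF assms(1,2) wt_weaken[OF wt_le[OF assms(3)]]]) auto
  moreover have "lip_profile 1 A1" "lip_profile 2 A1"
    by (intro lip_profile_wt wt_weaken[OF assms(3)]; simp)+
  ultimately show ?thesis using assms(2) by (intro Lk_profile_SucI) (simp_all add: eval_nat_numeral)
qed

text \<open>For the horizontal and swirl profiles, which come with one horizontal factor.
  Differentiating that factor leads back to degree 0 at level 1.\<close>

lemma Lk_profile_2_1:
  assumes "continuous_on {0..1} A" "\<And>y. y \<in> {0<..<1} \<Longrightarrow> (A has_real_derivative A1 y) (at y)" "wt 2 0 A1"
  shows "Lk_profile (Suc (Suc 0)) 1 A"
proof -
  have w1: "wt 1 0 A1" using wt_le[OF assms(3)] by simp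
  have c: "continuous_on {0..<1} A" by (rule continuous_on_subset[OF assms(1)]) auto
  have "wt (Suc 0) 0 A"
    by (rule wt_SucI[OF wt_bounded_continuous[OF assms(1)] c assms(2) wt_weaken[OF wt_le[OF assms(3)]]]) auto
  then have a: "lip_profile 1 A" by (intro lip_profile_wt) auto
  obtain A2 where A2: "\<And>y. y \<in> {0<..<1} \<Longrightarrow> (A1 has_real_derivative A2 y) (at y)" "wt 1 (0 - 2) A2"
    using wt_SucE[of 1 0 A1] assms(3) by (metis Suc_1)
  have l: "lip_profile 1 A1" "lip_profile 2 A1" "lip_profile 3 A1"
    by (intro lip_profile_wt wt_weaken[OF w1]; simp)+
  have m: "lip_profile 3 A2" "lip_profile 4 A2" "lip_profile 5 A2"
    by (intro lip_profile_wt wt_weaken[OF A2(2)]; simp)+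
  have "Lk_profile (Suc 0) (1 + 1) A1" "Lk_profile (Suc 0) (1 + 2) A1"
    by (rule Lk_profile_SucI[OF _ A2(1)]; use l m in \<open>simp add: eval_nat_numeral\<close>)+
  moreover have "Lk_profile (Suc 0) (1 - 1) A" using Lk_profile_1_0[OF assms(1,2) w1] by simp
  ultimately show ?thesis by (intro Lk_profile_SucI[OF a assms(2)])
qed

text \<open>For the vertical profile. Its second derivative may grow like \<open>1 / colat\<close>,
  but \<open>A1\<close> has to be continuous up to the axis, since one chain of derivatives takes
  away the horizontal factor and reaches \<open>A1\<close> at degree 0.\<close>

lemma Lk_profile_2_0:
  assumes "continuous_on {0..1} A" "\<And>y. y \<in> {0<..<1} \<Longrightarrow> (A has_real_derivative A1 y) (at y)"
    "continuous_on {0..1} A1" "\<And>y. y \<in> {0<..<1} \<Longrightarrow> (A1 has_real_derivative A2 y) (at y)" "wt 1 (- 1) A2"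
  shows "Lk_profile (Suc (Suc 0)) 0 A"
proof -
  have w2: "wt 0 (- 1) A2" using wt_le[OF assms(5)] by simp
  have c: "continuous_on {0..<1} A1" by (rule continuous_on_subset[OF assms(3)]) auto
  have "wt (Suc 0) 0 A1"
    by (rule wt_SucI[OF wt_bounded_continuous[OF assms(3)] c assms(4) wt_weaken[OF w2]]) auto
  then have w1: "wt 1 0 A1" by simp
  have a: "lip_profile 0 A" by (rule lip_profile_0[OF assms(1,2) wt_weaken[OF wt_le[OF w1]]]) auto
  have b: "lip_profile 0 A1" by (rule lip_profile_0[OF assms(3,4) w2])
  have l: "lip_profile 1 A1" "lip_profile 2 A1"
    by (intro lip_profile_wt wt_weaken[OF w1]; simp)+
  have m: "lip_profile 2 A2" "lip_profile 3 A2" "lip_profile 4 A2"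
    by (intro lip_profile_wt wt_weaken[OF assms(5)]; simp)+
  have "Lk_profile (Suc 0) (0 + 1) A1" "Lk_profile (Suc 0) (0 + 2) A1"
    by (rule Lk_profile_SucI[OF _ assms(4)]; use l m b in \<open>simp add: eval_nat_numeral\<close>)+
  then show ?thesis by (intro Lk_profile_SucI[OF a assms(2)]) simp_all
qed

section \<open>The profile equations\<close>

text \<open>The profile equations for given \<open>v\<close>. In the fluid problem \<open>H = (1 - y\<^sup>2) k\<close> is the swirl
  profile, \<open>(1 - y\<^sup>2) v\<close> the stream function profile, and \<open>R = (1 - y\<^sup>2)\<^sup>2 (v' + v\<^sup>2/2)\<close>; the
  boundary conditions determine \<open>H\<close> and \<open>R\<close>.\<close>

definition profile_system ::
  "(real \<Rightarrow> real) \<Rightarrow> (real \<Rightarrow> real) \<Rightarrow> (real \<Rightarrow> real) \<Rightarrow> (real \<Rightarrow> real) \<Rightarrow> (real \<Rightarrow> real) \<Rightarrow> (real \<Rightarrow> real) \<Rightarrow> bool" where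
  "profile_system q N v H W R \<longleftrightarrow>
     (\<forall>y\<in>{0<..<1}. (H has_real_derivative W y) (at y)) \<and>
     (\<forall>y\<in>{0<..<1}. (W has_real_derivative - q y - v y * W y) (at y)) \<and>
     continuous_on {0..1} H \<and> H 0 = 0 \<and> H 1 = 0 \<and>
     (\<exists>R1 R2. (\<forall>y\<in>{0<..<1}. (R has_real_derivative R1 y) (at y)) \<and>
        (\<forall>y\<in>{0<..<1}. (R1 has_real_derivative R2 y) (at y)) \<and>
        (\<forall>y\<in>{0<..<1}. (R2 has_real_derivative N y - 2 * (H y / (1 - y\<^sup>2)) * W y) (at y))) \<and>
     (R \<longlongrightarrow> 0) (at_right 0) \<and> ((\<lambda>y. R y / (1 - y)) \<longlongrightarrow> 0) (at_left 1)"

section \<open>A priori bounds for small forcing\<close>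

lemma inverse_colat_ge_1: "y \<in> {0<..<1} \<Longrightarrow> 1 \<le> 1 / sqrt (1 - y\<^sup>2)"
  using unit_sq_pos[of y] by (simp add: le_divide_eq)

text \<open>The mean value theorem from the end point 1; \<open>1 - y \<le> 1 - y\<^sup>2\<close>
  turns linear decay into a bound for the quotient. It estimates \<open>k\<close> by
  \<open>W\<close>, and later \<open>v\<close> by the radial velocity.\<close>

lemma abs_le_of_deriv_bound:
  assumes H: "\<And>y. y \<in> {0<..<1} \<Longrightarrow> (H has_real_derivative W y) (at y)"
    and c: "continuous_on {0..1} H" "H 1 = 0"
    and W: "\<And>y. y \<in> {0<..<1} \<Longrightarrow> \<bar>W y\<bar> \<le> \<eta>"
    and y: "y \<in> {0<..<1}"
  shows "\<bar>H y\<bar> \<le> \<eta> * (1 - y)" "\<bar>H y / (1 - y\<^sup>2)\<bar> \<le> \<eta>"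
proof -
  have "continuous_on {y..1} H" by (rule continuous_on_subset[OF c(1)]) (use y in auto)
  moreover have "\<And>x. y < x \<Longrightarrow> x < 1 \<Longrightarrow> H differentiable (at x)"
    using H y real_differentiable_def by (metis greaterThanLessThan_iff order_less_trans)
  ultimately obtain l z where z: "y < z" "z < 1" "(H has_real_derivative l) (at z)" "H 1 - H y = (1 - y) * l"
    using MVT[of y 1 H] y by auto
  have "l = W z" using DERIV_unique[OF z(3) H[of z]] z y by auto
  then have "\<bar>l\<bar> \<le> \<eta>" using W[of z] z y by auto
  moreover have "\<bar>H y\<bar> = (1 - y) * \<bar>l\<bar>" using z(4) c(2) y by (metis abs_minus abs_mult abs_of_pos diff_0 diff_gt_0_iff_gt greaterThanLessThan_iff)
  ultimately show 1: "\<bar>H y\<bar> \<le> \<eta> * (1 - y)" using y by (simp add: mult_left_mono mult.commute)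
  have p: "0 < 1 - y\<^sup>2" using unit_sq_pos[of y] y by simp
  have "0 \<le> \<eta>" using W[OF y] by linarith
  moreover have "1 - y \<le> 1 - y\<^sup>2" using y by (simp add: power2_eq_square mult_left_le)
  ultimately have "\<eta> * (1 - y) \<le> \<eta> * (1 - y\<^sup>2)" by (intro mult_left_mono)
  with 1 have "\<bar>H y\<bar> \<le> \<eta> * (1 - y\<^sup>2)" by linarith
  then show "\<bar>H y / (1 - y\<^sup>2)\<bar> \<le> \<eta>" using p by (simp add: abs_divide divide_le_eq)
qed

context
  fixes q N :: "real \<Rightarrow> real" and \<epsilon> :: real
  assumes \<epsilon>: "0 \<le> \<epsilon>"
    and q: "\<And>y. y \<in> {0<..<1} \<Longrightarrow> \<bar>q y\<bar> \<le> \<epsilon> / 2 * (1 / sqrt (1 - y\<^sup>2))"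
    and N: "\<And>y. y \<in> {0<..<1} \<Longrightarrow> \<bar>N y\<bar> \<le> \<epsilon> / sqrt (1 - y\<^sup>2)"
begin

text \<open>Rolle's theorem for \<open>H\<close> provides the zero of \<open>W\<close> from which
  the Gronwall estimate starts. The majorant of \<open>q\<close> integrates to
  \<open>\<epsilon> / 2\<close> times \<open>arcsin\<close>, which varies by at most 2; so
  \<open>T = \<epsilon>\<close>, and the Gronwall factor makes it
  \<open>2 \<epsilon>\<close>.\<close>

lemma profile_system_W:
  assumes "profile_system q N v H W R" and v: "\<And>y. y \<in> {0<..<1} \<Longrightarrow> \<bar>v y\<bar> \<le> 1 / 2"
    and y: "y \<in> {0<..<1}"
  shows "\<bar>W y\<bar> \<le> 2 * \<epsilon>"
proof -
  have H: "\<And>y. y \<in> {0<..<1} \<Longrightarrow> (H has_real_derivative W y) (at y)"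
    and W: "\<And>y. y \<in> {0<..<1} \<Longrightarrow> (W has_real_derivative - q y - v y * W y) (at y)"
    and c: "continuous_on {0..1} H" "H 0 = H 1" using assms(1) unfolding profile_system_def by auto
  have "\<exists>z. 0 < z \<and> z < 1 \<and> (H has_real_derivative 0) (at z)"
    using Rolle[of 0 1 H] c H by (meson greaterThanLessThan_iff real_differentiable_def zero_less_one)
  then obtain z where z: "z \<in> {0<..<1}" "W z = 0" using H DERIV_unique by (metis greaterThanLessThan_iff)
  show ?thesis
  proof (rule small_gronwall[OF W DERIV_cmult[OF DERIV_arcsin_unit] _ _ z y, of "\<epsilon> / 2" \<epsilon>])
    fix t :: real assume t: "t \<in> {0<..<1}"
    have "\<bar>- q t - v t * W t\<bar> \<le> \<bar>q t\<bar> + \<bar>v t\<bar> * \<bar>W t\<bar>"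
      using abs_triangle_ineq4[of "- q t" "v t * W t"] by (simp add: abs_mult)
    also have "\<dots> \<le> \<epsilon> / 2 * (1 / sqrt (1 - t\<^sup>2)) + 1 / 2 * \<bar>W t\<bar>"
      by (intro add_mono q t mult_right_mono v) auto
    finally show "\<bar>- q t - v t * W t\<bar> \<le> \<bar>W t\<bar> / 2 + \<epsilon> / 2 * (1 / sqrt (1 - t\<^sup>2))" by simp
  next
    fix s t :: real assume "s \<in> {0<..<1}" "t \<in> {0<..<1}"
    from arcsin_unit_diff[OF this] have "\<epsilon> / 2 * \<bar>arcsin t - arcsin s\<bar> \<le> \<epsilon> / 2 * 2"
      using \<epsilon> by (intro mult_left_mono) auto
    moreover have "\<epsilon> / 2 * arcsin t - \<epsilon> / 2 * arcsin s = \<epsilon> / 2 * (arcsin t - arcsin s)"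
      by (simp only: right_diff_distrib)
    ultimately show "\<bar>\<epsilon> / 2 * arcsin t - \<epsilon> / 2 * arcsin s\<bar> \<le> \<epsilon>"
      using \<epsilon> by (simp only: abs_mult abs_of_nonneg divide_nonneg_nonneg zero_le_numeral)
  qed
qed

lemma profile_system_k:
  assumes "profile_system q N v H W R" and v: "\<And>y. y \<in> {0<..<1} \<Longrightarrow> \<bar>v y\<bar> \<le> 1 / 2"
    and y: "y \<in> {0<..<1}"
  shows "\<bar>H y / (1 - y\<^sup>2)\<bar> \<le> 2 * \<epsilon>"
  by (rule abs_le_of_deriv_bound(2)[OF _ _ _ profile_system_W[OF assms(1) v] y])
     (use assms(1) in \<open>auto simp: profile_system_def\<close>)

text \<open>The quadratic term is at most
  \<open>2 \<bar>k\<bar> \<bar>W\<bar> \<le> 8 \<epsilon>\<^sup>2\<close>, and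
  \<open>1 \<le> 1 / sqrt (1 - y\<^sup>2)\<close> merges it with the majorant of
  \<open>N\<close>.\<close>

lemma profile_system_R:
  assumes "profile_system q N v H W R" and v: "\<And>y. y \<in> {0<..<1} \<Longrightarrow> \<bar>v y\<bar> \<le> 1 / 2"
    and y: "y \<in> {0<..<1}"
  shows "\<bar>R y\<bar> \<le> 4 * (\<epsilon> + 8 * \<epsilon>\<^sup>2) * (1 - y)\<^sup>2"
proof -
  obtain R1 R2 where R: "\<And>y. y \<in> {0<..<1} \<Longrightarrow> (R has_real_derivative R1 y) (at y)"
    "\<And>y. y \<in> {0<..<1} \<Longrightarrow> (R1 has_real_derivative R2 y) (at y)"
    "\<And>y. y \<in> {0<..<1} \<Longrightarrow> (R2 has_real_derivative N y - 2 * (H y / (1 - y\<^sup>2)) * W y) (at y)"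
    "(R \<longlongrightarrow> 0) (at_right 0)" "((\<lambda>y. R y / (1 - y)) \<longlongrightarrow> 0) (at_left 1)"
    using assms(1) unfolding profile_system_def by blast
  show ?thesis
  proof (rule third_order_bound[OF R(1-3) _ R(4,5) y])
    fix t :: real assume t: "t \<in> {0<..<1}"
    have "\<bar>N t - 2 * (H t / (1 - t\<^sup>2)) * W t\<bar> \<le> \<bar>N t\<bar> + 2 * \<bar>H t / (1 - t\<^sup>2)\<bar> * \<bar>W t\<bar>"
      using abs_triangle_ineq4[of "N t" "2 * (H t / (1 - t\<^sup>2)) * W t"] by (simp add: abs_mult)
    also have "\<dots> \<le> \<epsilon> / sqrt (1 - t\<^sup>2) + 2 * (2 * \<epsilon>) * (2 * \<epsilon>)"
      using \<epsilon> by (intro add_mono mult_mono N t profile_system_k[OF assms(1) v t] profile_system_W[OF assms(1) v t]) auto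
    also have "2 * (2 * \<epsilon>) * (2 * \<epsilon>) \<le> 8 * \<epsilon>\<^sup>2 * (1 / sqrt (1 - t\<^sup>2))"
      using mult_left_mono[OF inverse_colat_ge_1[OF t], of "8 * \<epsilon>\<^sup>2"] by (simp add: power2_eq_square)
    finally show "\<bar>N t - 2 * (H t / (1 - t\<^sup>2)) * W t\<bar> \<le> (\<epsilon> + 8 * \<epsilon>\<^sup>2) / sqrt (1 - t\<^sup>2)"
      by (simp add: add_divide_distrib)
  qed
qed

text \<open>The forcing cancels in the differences, so every term carries a factor \<open>d\<close>.
  Rolle's theorem is applied once more, to \<open>H - H'\<close>. The bound for \<open>R\<close> is
  quadratic in \<open>\<epsilon>\<close> because \<open>v\<close> influences \<open>R\<close> only
  through the product \<open>k W\<close>.\<close>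

lemma profile_system_diff:
  assumes s: "profile_system q N v H W R" "profile_system q N v' H' W' R'"
    and v: "\<And>y. y \<in> {0<..<1} \<Longrightarrow> \<bar>v y\<bar> \<le> 1 / 2" "\<And>y. y \<in> {0<..<1} \<Longrightarrow> \<bar>v' y\<bar> \<le> 1 / 2"
    and d: "\<And>y. y \<in> {0<..<1} \<Longrightarrow> \<bar>v y - v' y\<bar> \<le> d"
    and y: "y \<in> {0<..<1}"
  shows "\<bar>H y - H' y\<bar> \<le> 4 * \<epsilon> * d" "\<bar>R y - R' y\<bar> \<le> 128 * \<epsilon>\<^sup>2 * d * (1 - y)\<^sup>2"
proof -
  have H: "\<And>y. y \<in> {0<..<1} \<Longrightarrow> (H has_real_derivative W y) (at y)"
      "\<And>y. y \<in> {0<..<1} \<Longrightarrow> (H' has_real_derivative W' y) (at y)"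
    and W: "\<And>y. y \<in> {0<..<1} \<Longrightarrow> (W has_real_derivative - q y - v y * W y) (at y)"
      "\<And>y. y \<in> {0<..<1} \<Longrightarrow> (W' has_real_derivative - q y - v' y * W' y) (at y)"
    and c: "continuous_on {0..1} H" "H 0 = 0" "H 1 = 0" "continuous_on {0..1} H'" "H' 0 = 0" "H' 1 = 0"
    using s unfolding profile_system_def by auto
  obtain R1 R2 where R: "\<And>y. y \<in> {0<..<1} \<Longrightarrow> (R has_real_derivative R1 y) (at y)"
    "\<And>y. y \<in> {0<..<1} \<Longrightarrow> (R1 has_real_derivative R2 y) (at y)"
    "\<And>y. y \<in> {0<..<1} \<Longrightarrow> (R2 has_real_derivative N y - 2 * (H y / (1 - y\<^sup>2)) * W y) (at y)"
    "(R \<longlongrightarrow> 0) (at_right 0)" "((\<lambda>y. R y / (1 - y)) \<longlongrightarrow> 0) (at_left 1)"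
    using s(1) unfolding profile_system_def by blast
  obtain R1' R2' where R': "\<And>y. y \<in> {0<..<1} \<Longrightarrow> (R' has_real_derivative R1' y) (at y)"
    "\<And>y. y \<in> {0<..<1} \<Longrightarrow> (R1' has_real_derivative R2' y) (at y)"
    "\<And>y. y \<in> {0<..<1} \<Longrightarrow> (R2' has_real_derivative N y - 2 * (H' y / (1 - y\<^sup>2)) * W' y) (at y)"
    "(R' \<longlongrightarrow> 0) (at_right 0)" "((\<lambda>y. R' y / (1 - y)) \<longlongrightarrow> 0) (at_left 1)"
    using s(2) unfolding profile_system_def by blast
  have W2: "\<bar>W y\<bar> \<le> 2 * \<epsilon>" "\<bar>W' y\<bar> \<le> 2 * \<epsilon>" if "y \<in> {0<..<1}" for y
    using profile_system_W[OF s(1) v(1) that] profile_system_W[OF s(2) v(2) that] by blast+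
  have K2: "\<bar>H y / (1 - y\<^sup>2)\<bar> \<le> 2 * \<epsilon>" "\<bar>H' y / (1 - y\<^sup>2)\<bar> \<le> 2 * \<epsilon>" if "y \<in> {0<..<1}" for y
    using profile_system_k[OF s(1) v(1) that] profile_system_k[OF s(2) v(2) that] by blast+
  have d0: "0 \<le> d" using d[OF y] by linarith
  have HH: "((\<lambda>y. H y - H' y) has_real_derivative W y - W' y) (at y)" if "y \<in> {0<..<1}" for y
    by (rule DERIV_diff[OF H(1)[OF that] H(2)[OF that]])
  have cHH: "continuous_on {0..1} (\<lambda>y. H y - H' y)" using c by (intro continuous_intros)
  have "\<exists>z. 0 < z \<and> z < 1 \<and> ((\<lambda>y. H y - H' y) has_real_derivative 0) (at z)"
    using Rolle[OF zero_less_one _ cHH] c HH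
    by (metis diff_self greaterThanLessThan_iff real_differentiable_def)
  then obtain z where z: "z \<in> {0<..<1}" "W z - W' z = 0" using HH DERIV_unique by (metis greaterThanLessThan_iff)
  have WW: "\<bar>W y - W' y\<bar> \<le> 4 * \<epsilon> * d" if y: "y \<in> {0<..<1}" for y
  proof -
    have "\<bar>W y - W' y\<bar> \<le> 2 * (2 * \<epsilon> * d)"
    proof (rule small_gronwall[where E = "\<lambda>y. W y - W' y" and G = "\<lambda>t. 2 * \<epsilon> * d * t" and G' = "\<lambda>_. 2 * \<epsilon> * d",
          OF DERIV_diff[OF W(1) W(2)] _ _ _ z y])
      fix t :: real assume t: "t \<in> {0<..<1}"
      show "((\<lambda>t. 2 * \<epsilon> * d * t) has_real_derivative 2 * \<epsilon> * d) (at t)" by (auto intro!: derivative_eq_intros)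
      \<comment> \<open>The difference solves the linear equation with coefficient \<open>v\<close>
        and source \<open>(v - v') W'\<close>.\<close>
      have "- q t - v t * W t - (- q t - v' t * W' t) = - (v t * (W t - W' t)) - (v t - v' t) * W' t"
        by (simp add: algebra_simps)
      then have "\<bar>- q t - v t * W t - (- q t - v' t * W' t)\<bar> \<le> \<bar>v t\<bar> * \<bar>W t - W' t\<bar> + \<bar>v t - v' t\<bar> * \<bar>W' t\<bar>"
        using abs_triangle_ineq4[of "- (v t * (W t - W' t))" "(v t - v' t) * W' t"] by (simp only: abs_mult abs_minus)
      also have "\<dots> \<le> 1 / 2 * \<bar>W t - W' t\<bar> + d * (2 * \<epsilon>)"
        by (intro add_mono mult_right_mono mult_mono v d W2 t d0) auto
      also have "\<dots> = \<bar>W t - W' t\<bar> / 2 + 2 * \<epsilon> * d" by simp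
      finally show "\<bar>- q t - v t * W t - (- q t - v' t * W' t)\<bar> \<le> \<bar>W t - W' t\<bar> / 2 + 2 * \<epsilon> * d" .
    next
      fix s t :: real assume st: "s \<in> {0<..<1}" "t \<in> {0<..<1}"
      have "\<bar>2 * \<epsilon> * d * t - 2 * \<epsilon> * d * s\<bar> = 2 * \<epsilon> * d * \<bar>t - s\<bar>"
        using \<epsilon> d0 by (simp only: right_diff_distrib[symmetric] abs_mult abs_of_nonneg abs_numeral)
      also have "\<dots> \<le> 2 * \<epsilon> * d * 1" using st \<epsilon> d0 by (intro mult_left_mono) auto
      finally show "\<bar>2 * \<epsilon> * d * t - 2 * \<epsilon> * d * s\<bar> \<le> 2 * \<epsilon> * d" by simp
    qed
    then show ?thesis by simp
  qed
  have c1: "H 1 - H' 1 = 0" using c by simp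
  have b: "\<bar>H y - H' y\<bar> \<le> 4 * \<epsilon> * d * (1 - y)" "\<bar>(H y - H' y) / (1 - y\<^sup>2)\<bar> \<le> 4 * \<epsilon> * d"
    if y: "y \<in> {0<..<1}" for y
    by (rule abs_le_of_deriv_bound[of "\<lambda>y. H y - H' y", OF HH cHH c1 WW y]; assumption)+
  have "4 * \<epsilon> * d * (1 - y) \<le> 4 * \<epsilon> * d * 1" using y \<epsilon> d0 by (intro mult_left_mono) auto
  with b(1)[OF y] show "\<bar>H y - H' y\<bar> \<le> 4 * \<epsilon> * d" by simp
  have "\<bar>R y - R' y\<bar> \<le> 4 * (32 * \<epsilon>\<^sup>2 * d) * (1 - y)\<^sup>2"
  proof (rule third_order_bound[OF DERIV_diff[OF R(1) R'(1)] DERIV_diff[OF R(2) R'(2)] DERIV_diff[OF R(3) R'(3)] _ _ _ y])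
    show "((\<lambda>y. R y - R' y) \<longlongrightarrow> 0) (at_right 0)" using tendsto_diff[OF R(4) R'(4)] by simp
    show "((\<lambda>y. (R y - R' y) / (1 - y)) \<longlongrightarrow> 0) (at_left 1)"
      using tendsto_diff[OF R(5) R'(5)] by (simp add: diff_divide_distrib)
    fix t :: real assume t: "t \<in> {0<..<1}"
    define k k' where "k = H t / (1 - t\<^sup>2)" and "k' = H' t / (1 - t\<^sup>2)"
    have kk: "\<bar>k - k'\<bar> \<le> 4 * \<epsilon> * d" using b(2)[OF t] by (simp add: k_def k'_def diff_divide_distrib)
    have "\<bar>N t - 2 * k * W t - (N t - 2 * k' * W' t)\<bar> = 2 * \<bar>k * (W t - W' t) + (k - k') * W' t\<bar>"
      by (simp add: algebra_simps abs_if)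
    also have "\<dots> \<le> 2 * (\<bar>k\<bar> * \<bar>W t - W' t\<bar> + \<bar>k - k'\<bar> * \<bar>W' t\<bar>)"
      by (intro mult_left_mono) (simp_all add: abs_mult[symmetric])
    also have "\<dots> \<le> 2 * (2 * \<epsilon> * (4 * \<epsilon> * d) + 4 * \<epsilon> * d * (2 * \<epsilon>))"
      using K2[OF t] \<epsilon> d0 unfolding k_def[symmetric]
      by (intro mult_left_mono add_mono mult_mono WW W2 kk t) auto
    also have "\<dots> = 32 * \<epsilon>\<^sup>2 * d * 1" by (simp add: power2_eq_square)
    also have "\<dots> \<le> 32 * \<epsilon>\<^sup>2 * d * (1 / sqrt (1 - t\<^sup>2))"
      using d0 by (intro mult_left_mono inverse_colat_ge_1 t) auto
    finally show "\<bar>N t - 2 * (H t / (1 - t\<^sup>2)) * W t - (N t - 2 * (H' t / (1 - t\<^sup>2)) * W' t)\<bar> \<le> 32 * \<epsilon>\<^sup>2 * d / sqrt (1 - t\<^sup>2)"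
      by (simp add: k_def k'_def)
  qed
  then show "\<bar>R y - R' y\<bar> \<le> 128 * \<epsilon>\<^sup>2 * d * (1 - y)\<^sup>2" by simp
qed

end

section \<open>The two linear profile problems and the fixed point\<close>

lemma antiderivative_exists:
  fixes f :: "real \<Rightarrow> real"
  assumes "continuous_on {0..1} f"
  obtains F where "continuous_on {0..1} F" "F 0 = 0"
    "\<And>y. y \<in> {0<..<1} \<Longrightarrow> (F has_real_derivative f y) (at y)"
proof -
  define F where "F y = integral {0..y} f" for y
  have D: "(F has_real_derivative f y) (at y within {0..1})" if "y \<in> {0..1}" for y
    unfolding F_def[abs_def] by (rule integral_has_real_derivative[OF assms that])
  show thesis
  proof (rule that)
    show "continuous_on {0..1} F" using D by (intro DERIV_continuous_on)
    show "F 0 = 0" by (simp add: F_def)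
    show "(F has_real_derivative f y) (at y)" if "y \<in> {0<..<1}" for y
      using D[of y] that at_within_interior[of y "{0..1}"] by (simp add: interior_atLeastAtMost_real)
  qed
qed

lemma continuous_on_extend_at_1:
  fixes f :: "real \<Rightarrow> real"
  assumes f: "continuous_on {0..<1} f" and l: "(f \<longlongrightarrow> L) (at_left 1)"
  shows "continuous_on {0..1} (\<lambda>y. if y = 1 then L else f y)"
proof (rule continuous_on_IccI)
  have "\<forall>\<^sub>F y in at_left 1. f y = (if y = 1 then L else f y)" by (auto simp: eventually_at_filter)
  from Lim_transform_eventually[OF l this]
  show "((\<lambda>y. if y = 1 then L else f y) \<longlongrightarrow> (if 1 = (1::real) then L else f 1)) (at_left 1)" by simp
  have "continuous_on {0..1/2} f" by (rule continuous_on_subset[OF f]) auto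
  then have "(f \<longlongrightarrow> f 0) (at_right 0)" by (rule continuous_on_Icc_at_rightD) simp
  moreover have "\<forall>\<^sub>F y in at_right 0. f y = (if y = 1 then L else f y)"
    by (rule eventually_at_rightI[of 0 1]) auto
  ultimately have "((\<lambda>y. if y = 1 then L else f y) \<longlongrightarrow> f 0) (at_right 0)" by (rule Lim_transform_eventually)
  then show "((\<lambda>y. if y = 1 then L else f y) \<longlongrightarrow> (if 0 = (1::real) then L else f 0)) (at_right 0)" by simp
  fix x :: real assume x: "0 < x" "x < 1"
  have "continuous_on {0<..<1} f" by (rule continuous_on_subset[OF f]) auto
  then have "isCont f x" using x by (simp add: continuous_on_eq_continuous_at)
  then have "(f \<longlongrightarrow> f x) (at x)" by (simp add: isCont_def)
  moreover have "\<forall>\<^sub>F y in at x. f y = (if y = 1 then L else f y)"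
    by (rule eventually_mono[OF eventually_at_in_open'[of "{0<..<1}" x]]) (use x in auto)
  ultimately have "((\<lambda>y. if y = 1 then L else f y) \<longlongrightarrow> f x) (at x)" by (rule Lim_transform_eventually)
  then show "((\<lambda>y. if y = 1 then L else f y) \<longlongrightarrow> (if x = 1 then L else f x)) (at x)" using x by simp
qed simp

lemma at_left_1: "continuous_on {0..1} f \<Longrightarrow> (f \<longlongrightarrow> f 1) (at_left (1::real))" for f :: "real \<Rightarrow> real"
  by (rule continuous_on_Icc_at_leftD) auto

lemma quotient_at_1:
  fixes f :: "real \<Rightarrow> real"
  assumes "\<And>y. y \<in> {0<..<1} \<Longrightarrow> (f has_real_derivative f' y) (at y)" "continuous_on {0..1} f"
    "continuous_on {0..1} f'" "f 1 = 0"
  shows "((\<lambda>y. f y / (1 - y)) \<longlongrightarrow> - f' 1) (at_left 1)"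
proof (rule lhopital_left[where f' = f' and g' = "\<lambda>_. - 1"])
  have ev: "\<forall>\<^sub>F y in at_left (1::real). y \<in> {0<..<1}" by (rule eventually_at_leftI[of 0]) auto
  show "(f \<longlongrightarrow> 0) (at_left 1)" using at_left_1[OF assms(2)] assms(4) by simp
  have "((\<lambda>y. 1 - y) \<longlongrightarrow> 1 - 1) (at_left (1::real))" by (intro tendsto_intros)
  then show "((\<lambda>y. 1 - y) \<longlongrightarrow> 0) (at_left (1::real))" by simp
  show "\<forall>\<^sub>F y in at_left (1::real). 1 - y \<noteq> 0" using ev by eventually_elim auto
  show "\<forall>\<^sub>F y in at_left 1. (f has_real_derivative f' y) (at y)" using ev by eventually_elim (rule assms)
  show "\<forall>\<^sub>F y in at_left (1::real). ((\<lambda>y. 1 - y) has_real_derivative - 1) (at y)"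
    by (auto intro!: always_eventually derivative_eq_intros)
  show "((\<lambda>y. f' y / - 1) \<longlongrightarrow> - f' 1) (at_left 1)" using tendsto_minus[OF at_left_1[OF assms(3)]] by simp
qed auto

text \<open>Variation of constants with the integrating factor \<open>exp V\<close>,
  \<open>V' = v\<close>. The functions \<open>c A - B\<close> solve the equation and vanish at 0,
  and \<open>c\<close> can be chosen to give \<open>H 1 = 0\<close> because \<open>A\<close> is
  strictly increasing.\<close>

lemma swirl_profile_exists:
  fixes q v :: "real \<Rightarrow> real"
  assumes q: "continuous_on {0..1} q" and v: "continuous_on {0..1} v"
  obtains H W where "continuous_on {0..1} H" "continuous_on {0..1} W" "H 0 = 0" "H 1 = 0"
    "\<And>y. y \<in> {0<..<1} \<Longrightarrow> (H has_real_derivative W y) (at y)"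
    "\<And>y. y \<in> {0<..<1} \<Longrightarrow> (W has_real_derivative - q y - v y * W y) (at y)"
proof -
  obtain V where V: "continuous_on {0..1} V" "\<And>y. y \<in> {0<..<1} \<Longrightarrow> (V has_real_derivative v y) (at y)"
    using antiderivative_exists[OF v] by blast
  have eV: "continuous_on {0..1} (\<lambda>y. exp (V y))" "continuous_on {0..1} (\<lambda>y. exp (- V y))"
    using V by (auto intro!: continuous_intros)
  obtain Q where Q: "continuous_on {0..1} Q" "\<And>y. y \<in> {0<..<1} \<Longrightarrow> (Q has_real_derivative exp (V y) * q y) (at y)"
    using antiderivative_exists[OF continuous_on_mult[OF eV(1) q]] by blast
  obtain A where A: "continuous_on {0..1} A" "A 0 = 0" "\<And>y. y \<in> {0<..<1} \<Longrightarrow> (A has_real_derivative exp (- V y)) (at y)"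
    using antiderivative_exists[OF eV(2)] by blast
  obtain B where B: "continuous_on {0..1} B" "B 0 = 0" "\<And>y. y \<in> {0<..<1} \<Longrightarrow> (B has_real_derivative exp (- V y) * Q y) (at y)"
    using antiderivative_exists[OF continuous_on_mult[OF eV(2) Q(1)]] by blast
  have "A 0 < A 1"
    by (rule DERIV_pos_imp_increasing_open) (use A in \<open>auto intro!: exI[of _ "exp (- V _)"]\<close>)
  then have A1: "A 1 \<noteq> 0" using A by simp
  define c where "c = B 1 / A 1"
  show thesis
  proof (rule that[of "\<lambda>y. c * A y - B y" "\<lambda>y. exp (- V y) * (c - Q y)"])
    show "continuous_on {0..1} (\<lambda>y. c * A y - B y)" "continuous_on {0..1} (\<lambda>y. exp (- V y) * (c - Q y))"
      using A(1) B(1) eV(2) Q(1) by (auto intro!: continuous_intros)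
    show "c * A 0 - B 0 = 0" "c * A 1 - B 1 = 0" using A B A1 by (simp_all add: c_def)
    fix y :: real assume y: "y \<in> {0<..<1}"
    show "((\<lambda>y. c * A y - B y) has_real_derivative exp (- V y) * (c - Q y)) (at y)"
      by (rule derivative_eq_intros A B y refl | simp add: algebra_simps)+
    have "exp (- V y) * exp (V y) = 1" by (simp add: exp_minus)
    then have "exp (- V y) * (exp (V y) * q y) = q y" by (simp add: mult.assoc[symmetric])
    then show "((\<lambda>y. exp (- V y) * (c - Q y)) has_real_derivative - q y - v y * (exp (- V y) * (c - Q y))) (at y)"
      by (auto intro!: derivative_eq_intros V Q y simp: algebra_simps)
  qed
qed

text \<open>The singularity on the axis is removable by l'Hopital's rule; \<open>- W 1 / 2\<close>
  is the derivative of \<open>H\<close> at 1 over the derivative \<open>- 2\<close> of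
  \<open>1 - y\<^sup>2\<close>.\<close>

lemma divide_sin_sq_exists:
  fixes H W :: "real \<Rightarrow> real"
  assumes H: "continuous_on {0..1} H" "continuous_on {0..1} W" "H 1 = 0"
    "\<And>y. y \<in> {0<..<1} \<Longrightarrow> (H has_real_derivative W y) (at y)"
  obtains k where "continuous_on {0..1} k" "\<And>y. y \<in> {0..1} \<Longrightarrow> H y = (1 - y\<^sup>2) * k y" "k 1 = - W 1 / 2"
proof -
  have nz: "1 - y\<^sup>2 \<noteq> 0" if "y \<in> {0..<1}" for y :: real using unit_sq_pos[OF that] by simp
  have "((\<lambda>y. H y / (1 - y) * (1 / (1 + y))) \<longlongrightarrow> - W 1 * (1 / (1 + 1))) (at_left 1)"
    by (intro tendsto_intros quotient_at_1 H) auto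
  moreover have "\<forall>\<^sub>F y in at_left 1. H y / (1 - y) * (1 / (1 + y)) = H y / (1 - y\<^sup>2)"
    by (rule eventually_at_leftI[of 0]) (auto simp: power2_eq_square algebra_simps)
  ultimately have l: "((\<lambda>y. H y / (1 - y\<^sup>2)) \<longlongrightarrow> - W 1 * (1 / (1 + 1))) (at_left 1)"
    by (rule Lim_transform_eventually)
  have c: "continuous_on {0..<1} (\<lambda>y. H y / (1 - y\<^sup>2))"
    by (intro continuous_intros continuous_on_subset[OF H(1)]) (use nz in auto)
  show thesis
    by (rule that[OF continuous_on_extend_at_1[OF c l]]) (use nz H(3) in auto)
qed

text \<open>\<open>J\<close> is the second derivative of \<open>R\<close> up to an unknown constant.
  Antiderivatives normalised to vanish at 1 build in a double zero there, and \<open>c\<close> is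
  the one parameter left to achieve \<open>R 0 = 0\<close>. The double zero is what makes the
  quotient \<open>r\<close> continuous on the axis.\<close>

lemma radial_profile_exists:
  fixes J :: "real \<Rightarrow> real"
  assumes J: "continuous_on {0..1} J"
  obtains c R R1 r where "continuous_on {0..1} R" "continuous_on {0..1} R1" "continuous_on {0..1} r"
    "\<And>y. y \<in> {0<..<1} \<Longrightarrow> (R has_real_derivative R1 y) (at y)"
    "\<And>y. y \<in> {0<..<1} \<Longrightarrow> (R1 has_real_derivative J y + c) (at y)"
    "R 0 = 0" "R 1 = 0" "R1 1 = 0" "\<And>y. y \<in> {0..1} \<Longrightarrow> R y = (1 - y\<^sup>2)\<^sup>2 * r y"
proof -
  obtain J2 where J2: "continuous_on {0..1} J2" "\<And>y. y \<in> {0<..<1} \<Longrightarrow> (J2 has_real_derivative J y) (at y)"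
    using antiderivative_exists[OF J] by blast
  have "continuous_on {0..1} (\<lambda>y. J2 y - J2 1)" using J2(1) by (intro continuous_intros)
  then obtain J3 where J3: "continuous_on {0..1} J3" "J3 0 = 0"
    "\<And>y. y \<in> {0<..<1} \<Longrightarrow> (J3 has_real_derivative J2 y - J2 1) (at y)"
    using antiderivative_exists by blast
  define c where "c = 2 * J3 1"
  define R where "R y = J3 y - J3 1 + c * (1 - y)\<^sup>2 / 2" for y
  define R1 where "R1 y = J2 y - J2 1 - c * (1 - y)" for y
  have D1: "(R has_real_derivative R1 y) (at y)" if "y \<in> {0<..<1}" for y
    unfolding R_def[abs_def] R1_def
    by (rule derivative_eq_intros J3 that refl | simp add: field_simps)+
  have D2: "(R1 has_real_derivative J y + c) (at y)" if "y \<in> {0<..<1}" for y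
    unfolding R1_def[abs_def] by (rule derivative_eq_intros J2 that refl | simp)+
  have cR: "continuous_on {0..1} R" "continuous_on {0..1} R1"
    unfolding R_def[abs_def] R1_def[abs_def] using J2(1) J3(1) by (auto intro!: continuous_intros)
  have e: "R 0 = 0" "R 1 = 0" "R1 1 = 0" by (simp_all add: R_def R1_def J3(2) c_def)
  have cJ: "continuous_on {0..1} (\<lambda>y. J y + c)" using J by (intro continuous_intros)
  have ev: "\<forall>\<^sub>F y in at_left (1::real). y \<in> {0<..<1}" by (rule eventually_at_leftI[of 0]) auto
  have q2: "((\<lambda>y. R y / (1 - y)\<^sup>2) \<longlongrightarrow> (J 1 + c) / 2) (at_left 1)"
  proof (rule lhopital_left[where f' = R1 and g' = "\<lambda>y. - 2 * (1 - y)"])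
    show "(R \<longlongrightarrow> 0) (at_left 1)" using at_left_1[OF cR(1)] e by simp
    have "((\<lambda>y. (1 - y)\<^sup>2) \<longlongrightarrow> (1 - 1)\<^sup>2) (at_left (1::real))" by (intro tendsto_intros)
    then show "((\<lambda>y. (1 - y)\<^sup>2) \<longlongrightarrow> 0) (at_left (1::real))" by simp
    show "\<forall>\<^sub>F y in at_left (1::real). (1 - y)\<^sup>2 \<noteq> 0" using ev by eventually_elim auto
    show "\<forall>\<^sub>F y in at_left (1::real). - 2 * (1 - y) \<noteq> 0" using ev by eventually_elim auto
    show "\<forall>\<^sub>F y in at_left 1. (R has_real_derivative R1 y) (at y)" using ev by eventually_elim (rule D1)
    show "\<forall>\<^sub>F y in at_left (1::real). ((\<lambda>y. (1 - y)\<^sup>2) has_real_derivative - 2 * (1 - y)) (at y)"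
      by (auto intro!: always_eventually derivative_eq_intros)
    have "((\<lambda>y. R1 y / (1 - y) * (- 1 / 2)) \<longlongrightarrow> - (J 1 + c) * (- 1 / 2)) (at_left 1)"
      by (intro tendsto_intros quotient_at_1[OF D2 cR(2) cJ e(3)])
    moreover have "\<forall>\<^sub>F y in at_left 1. R1 y / (1 - y) * (- 1 / 2) = R1 y / (- 2 * (1 - y))"
      using ev by eventually_elim (simp add: field_simps)
    ultimately have "((\<lambda>y. R1 y / (- 2 * (1 - y))) \<longlongrightarrow> - (J 1 + c) * (- 1 / 2)) (at_left 1)"
      by (rule Lim_transform_eventually)
    moreover have "- (J 1 + c) * (- 1 / 2) = (J 1 + c) / 2" by (simp add: field_simps)
    ultimately show "((\<lambda>y. R1 y / (- 2 * (1 - y))) \<longlongrightarrow> (J 1 + c) / 2) (at_left 1)" by (simp only:)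
  qed
  have nz: "1 - y\<^sup>2 \<noteq> 0" if "y \<in> {0..<1}" for y :: real using unit_sq_pos[OF that] by simp
  have "((\<lambda>y. R y / (1 - y)\<^sup>2 * (1 / (1 + y)\<^sup>2)) \<longlongrightarrow> (J 1 + c) / 2 * (1 / (1 + 1)\<^sup>2)) (at_left 1)"
    by (intro tendsto_intros q2) auto
  moreover have "\<forall>\<^sub>F y in at_left 1. R y / (1 - y)\<^sup>2 * (1 / (1 + y)\<^sup>2) = R y / (1 - y\<^sup>2)\<^sup>2"
  proof (rule eventually_mono[OF ev])
    fix y :: real
    have "1 - y\<^sup>2 = (1 - y) * (1 + y)" by (simp add: algebra_simps power2_eq_square)
    then show "R y / (1 - y)\<^sup>2 * (1 / (1 + y)\<^sup>2) = R y / (1 - y\<^sup>2)\<^sup>2" by (simp add: power_mult_distrib)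
  qed
  ultimately have l: "((\<lambda>y. R y / (1 - y\<^sup>2)\<^sup>2) \<longlongrightarrow> (J 1 + c) / 2 * (1 / (1 + 1)\<^sup>2)) (at_left 1)"
    by (rule Lim_transform_eventually)
  have c: "continuous_on {0..<1} (\<lambda>y. R y / (1 - y\<^sup>2)\<^sup>2)"
    by (intro continuous_intros continuous_on_subset[OF cR(1)]) (use nz in auto)
  show thesis
    by (rule that[OF cR continuous_on_extend_at_1[OF c l] D1 D2 e]) (use nz e in auto)
qed

text \<open>\<open>P v r\<close> is to be read as: \<open>r\<close> is the quotient
  \<open>R / (1 - y\<^sup>2)\<^sup>2\<close> obtained with coefficient \<open>v\<close>. A relation
  suffices, since a choice of \<open>r\<close> is made for each \<open>v\<close> and the Lipschitz
  bound holds for all choices. Both \<open>r\<close> and \<open>v\<^sup>2 / 2\<close> contribute the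
  Lipschitz constant 1/4, the latter because \<open>\<mu> \<le> 1 / 4\<close>, so integration over
  the unit interval contracts by 1/2.\<close>

lemma picard_fixed_point:
  fixes P :: "(real \<Rightarrow> real) \<Rightarrow> (real \<Rightarrow> real) \<Rightarrow> bool"
  assumes \<mu>: "0 \<le> \<mu>" "\<mu> \<le> 1 / 4"
    and ex: "\<And>v. continuous_on {0..1} v \<Longrightarrow> (\<And>y. y \<in> {0..1} \<Longrightarrow> \<bar>v y\<bar> \<le> \<mu>) \<Longrightarrow> \<exists>r. continuous_on {0..1} r \<and> P v r"
    and bd: "\<And>v r y. P v r \<Longrightarrow> (\<And>y. y \<in> {0..1} \<Longrightarrow> \<bar>v y\<bar> \<le> \<mu>) \<Longrightarrow> y \<in> {0<..<1} \<Longrightarrow> \<bar>r y - (v y)\<^sup>2 / 2\<bar> \<le> \<mu>"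
    and lip: "\<And>v r v' r' d y. P v r \<Longrightarrow> P v' r' \<Longrightarrow> (\<And>y. y \<in> {0..1} \<Longrightarrow> \<bar>v y\<bar> \<le> \<mu>) \<Longrightarrow>
      (\<And>y. y \<in> {0..1} \<Longrightarrow> \<bar>v' y\<bar> \<le> \<mu>) \<Longrightarrow> (\<And>y. y \<in> {0..1} \<Longrightarrow> \<bar>v y - v' y\<bar> \<le> d) \<Longrightarrow> y \<in> {0<..<1} \<Longrightarrow>
      \<bar>r y - r' y\<bar> \<le> d / 4"
  obtains v r where "P v r" "continuous_on {0..1} v" "continuous_on {0..1} r" "v 0 = 0"
    "\<And>y. y \<in> {0..1} \<Longrightarrow> \<bar>v y\<bar> \<le> \<mu>"
    "\<And>y. y \<in> {0<..<1} \<Longrightarrow> (v has_real_derivative r y - (v y)\<^sup>2 / 2) (at y)"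
proof -
  define X where "X = {f :: real \<Rightarrow>\<^sub>C real. \<forall>y. \<bar>apply_bcontfun f y\<bar> \<le> \<mu>}"
  have cl: "closed X"
  proof -
    have "X = (\<Inter>y. {f. \<bar>apply_bcontfun f y\<bar> \<le> \<mu>})" by (auto simp: X_def)
    moreover have "closed {f :: real \<Rightarrow>\<^sub>C real. \<bar>apply_bcontfun f y\<bar> \<le> \<mu>}" for y
    proof -
      have "continuous_on UNIV (\<lambda>f :: real \<Rightarrow>\<^sub>C real. apply_bcontfun f y)"
        unfolding continuous_on_iff by (metis UNIV_I dist_fun_lt_imp_dist_val_lt)
      then show ?thesis by (intro closed_Collect_le continuous_intros)
    qed
    ultimately show ?thesis by auto
  qed
  \<comment> \<open>Extends functions on \<open>[0, 1]\<close> to the whole line by constants, so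
    that Banach's theorem can be used in the space of bounded continuous functions.\<close>
  define clamp where "clamp y = max 0 (min 1 y)" for y :: real
  have cl01: "clamp y \<in> {0..1}" for y by (auto simp: clamp_def)
  have cl_id: "clamp y = y" if "y \<in> {0..1}" for y using that by (auto simp: clamp_def)
  have ccl: "continuous_on UNIV clamp" unfolding clamp_def[abs_def] by (intro continuous_intros)
  have step: "\<exists>r F. continuous_on {0..1} r \<and> P (apply_bcontfun f) r \<and> continuous_on {0..1} F \<and> F 0 = 0 \<and>
     (\<forall>y\<in>{0<..<1}. (F has_real_derivative r y - (apply_bcontfun f y)\<^sup>2 / 2) (at y))" if f: "f \<in> X" for f
  proof -
    have c: "continuous_on {0..1} (apply_bcontfun f)" by (rule continuous_on_subset[OF continuous_on_apply_bcontfun]) auto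
    obtain r where r: "continuous_on {0..1} r" "P (apply_bcontfun f) r"
      using ex[OF c] f by (auto simp: X_def)
    have "continuous_on {0..1} (\<lambda>y. r y - (apply_bcontfun f y)\<^sup>2 / 2)" using r c by (intro continuous_intros) auto
    from antiderivative_exists[OF this] r show ?thesis by metis
  qed
  then obtain r F where rF: "\<And>f. f \<in> X \<Longrightarrow> continuous_on {0..1} (r f)" "\<And>f. f \<in> X \<Longrightarrow> P (apply_bcontfun f) (r f)"
    "\<And>f. f \<in> X \<Longrightarrow> continuous_on {0..1} (F f)" "\<And>f. f \<in> X \<Longrightarrow> F f 0 = 0"
    "\<And>f y. f \<in> X \<Longrightarrow> y \<in> {0<..<1} \<Longrightarrow> (F f has_real_derivative r f y - (apply_bcontfun f y)\<^sup>2 / 2) (at y)"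
    by metis
  have grow: "\<bar>D y\<bar> \<le> B" if D: "continuous_on {0..1} D" "D 0 = 0" "\<And>y. y \<in> {0<..<1} \<Longrightarrow> (D has_real_derivative D' y) (at y)"
      "\<And>y. y \<in> {0<..<1} \<Longrightarrow> \<bar>D' y\<bar> \<le> B" and y: "y \<in> {0..1}" for D D' :: "real \<Rightarrow> real" and B y
  proof (cases "y = 0")
    case True
    have "0 \<le> B" using D(4)[of "1/2"] by auto
    then show ?thesis using True D by simp
  next
    case False
    then have y0: "0 < y" using y by auto
    have "continuous_on {0..y} D" by (rule continuous_on_subset[OF D(1)]) (use y in auto)
    moreover have "D differentiable (at x)" if "0 < x" "x < y" for x
      using D(3)[of x] that y real_differentiable_def by auto
    ultimately obtain l z where z: "0 < z" "z < y" "(D has_real_derivative l) (at z)" "D y - D 0 = (y - 0) * l"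
      using MVT[OF y0] by metis
    have z1: "z \<in> {0<..<1}" using z y by auto
    have "l = D' z" by (rule DERIV_unique[OF z(3) D(3)[OF z1]])
    then have "\<bar>l\<bar> \<le> B" using D(4)[OF z1] by simp
    moreover have "\<bar>D y\<bar> = y * \<bar>l\<bar>" using z(4) D(2) y0 by (simp add: abs_mult)
    moreover have "y * \<bar>l\<bar> \<le> 1 * \<bar>l\<bar>" using y by (intro mult_right_mono) auto
    ultimately show ?thesis by linarith
  qed
  have Fb: "\<bar>F f y\<bar> \<le> \<mu>" if f: "f \<in> X" and y: "y \<in> {0..1}" for f y
    by (rule grow[OF rF(3,4,5)[OF f] bd[OF rF(2)[OF f]] y]) (use f in \<open>auto simp: X_def\<close>)
  define T where "T f = Bcontfun (\<lambda>y. F f (clamp y))" for f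
  have Tap: "apply_bcontfun (T f) y = F f (clamp y)" if f: "f \<in> X" for f y
  proof -
    have "continuous_on UNIV (\<lambda>y. F f (clamp y))"
      by (rule continuous_on_compose2[OF rF(3)[OF f] ccl]) (use cl01 in auto)
    moreover have "bounded (range (\<lambda>y. F f (clamp y)))"
      unfolding bounded_iff using Fb[OF f cl01] by auto
    ultimately have "(\<lambda>y. F f (clamp y)) \<in> bcontfun" by (simp add: bcontfun_def)
    then show ?thesis by (simp add: T_def Bcontfun_inverse)
  qed
  have "\<exists>!f. f \<in> X \<and> T f = f"
  proof (rule Banach_fix[where c = "1 / 2"])
    show "complete X" using cl by (simp add: complete_eq_closed)
    show "X \<noteq> {}" using \<mu> by (auto simp: X_def intro!: exI[of _ 0])
    show "T ` X \<subseteq> X" using Fb[OF _ cl01] by (auto simp: X_def Tap[unfolded X_def])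
    fix f g assume fg: "f \<in> X" "g \<in> X"
    define d where "d = dist f g"
    have dfg: "\<bar>apply_bcontfun f y - apply_bcontfun g y\<bar> \<le> d" for y
      using dist_bounded[of f y g] by (simp add: d_def dist_real_def)
    have fb: "\<bar>apply_bcontfun f y\<bar> \<le> \<mu>" "\<bar>apply_bcontfun g y\<bar> \<le> \<mu>" for y using fg by (auto simp: X_def)
    show "dist (T f) (T g) \<le> 1 / 2 * dist f g"
    proof (rule dist_bound)
      fix y
      have "\<bar>F f (clamp y) - F g (clamp y)\<bar> \<le> 1 / 2 * d"
      proof (rule grow[OF _ _ DERIV_diff[OF rF(5)[OF fg(1)] rF(5)[OF fg(2)]] _ cl01])
        show "continuous_on {0..1} (\<lambda>y. F f y - F g y)" using rF(3) fg by (intro continuous_intros) auto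
        show "F f 0 - F g 0 = 0" using rF(4) fg by simp
        fix t :: real assume t: "t \<in> {0<..<1}"
        define a b where "a = apply_bcontfun f t" and "b = apply_bcontfun g t"
        have "\<bar>r f t - r g t\<bar> \<le> d / 4"
          by (rule lip[OF rF(2)[OF fg(1)] rF(2)[OF fg(2)] fb(1) fb(2) dfg t])
        moreover have "\<bar>a\<^sup>2 / 2 - b\<^sup>2 / 2\<bar> \<le> d / 4"
        proof -
          have "a\<^sup>2 / 2 - b\<^sup>2 / 2 = (a + b) / 2 * (a - b)" by (simp add: power2_eq_square algebra_simps)
          then have "\<bar>a\<^sup>2 / 2 - b\<^sup>2 / 2\<bar> = \<bar>(a + b) / 2\<bar> * \<bar>a - b\<bar>" by (simp only: abs_mult)
          also have "\<dots> \<le> 1 / 4 * d"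
            using fb[of t] dfg[of t] \<mu> abs_triangle_ineq[of a b] unfolding a_def b_def
            by (intro mult_mono) (simp_all add: abs_divide)
          finally show ?thesis by simp
        qed
        ultimately show "\<bar>r f t - (apply_bcontfun f t)\<^sup>2 / 2 - (r g t - (apply_bcontfun g t)\<^sup>2 / 2)\<bar> \<le> 1 / 2 * d"
          unfolding a_def[symmetric] b_def[symmetric] by linarith
      qed
      then show "dist (apply_bcontfun (T f) y) (apply_bcontfun (T g) y) \<le> 1 / 2 * dist f g"
        by (simp add: Tap fg dist_real_def d_def)
    qed
  qed auto
  then obtain f where f: "f \<in> X" "T f = f" by blast
  have fF: "apply_bcontfun f y = F f y" if "y \<in> {0..1}" for y
    using Tap[OF f(1), of y] f(2) cl_id[OF that] by simp
  show thesis
  proof (rule that[OF rF(2)[OF f(1)] _ rF(1)[OF f(1)]])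
    show "continuous_on {0..1} (apply_bcontfun f)"
      by (rule continuous_on_subset[OF continuous_on_apply_bcontfun]) auto
    show "apply_bcontfun f 0 = 0" using fF[of 0] rF(4)[OF f(1)] by simp
    show "\<bar>apply_bcontfun f y\<bar> \<le> \<mu>" for y using f by (auto simp: X_def)
    fix y :: real assume y: "y \<in> {0<..<1}"
    show "(apply_bcontfun f has_real_derivative r f y - (apply_bcontfun f y)\<^sup>2 / 2) (at y)"
      by (rule has_field_derivative_transform_within_open[OF rF(5)[OF f(1) y], of "{0<..<1}"])
         (use y fF in auto)
  qed
qed

text \<open>The equation for \<open>R\<close> in integrated form,
  \<open>R1' = - 2 E - F1 + c\<close> with \<open>E' = k W - G\<close>. \<open>F1\<close> is
  continuous up to the axis, whereas \<open>N = 2 G - F1'\<close> may blow up there, so all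
  antiderivatives are those of continuous functions. In the fluid problem \<open>F1\<close> is the
  radial force profile and \<open>G\<close> the polar one divided by
  \<open>sin \<phi>\<close>.\<close>

definition forced_profiles where
  "forced_profiles q G F1 v r H W k E R R1 (c::real) \<longleftrightarrow>
     continuous_on {0..1} r \<and> continuous_on {0..1} H \<and> continuous_on {0..1} W \<and> continuous_on {0..1} k \<and>
     continuous_on {0..1} E \<and> continuous_on {0..1} R \<and> continuous_on {0..1} R1 \<and>
     H 0 = 0 \<and> H 1 = 0 \<and> R 0 = 0 \<and> R 1 = 0 \<and> R1 1 = 0 \<and>
     (\<forall>y\<in>{0..1}. H y = (1 - y\<^sup>2) * k y) \<and> (\<forall>y\<in>{0..1}. R y = (1 - y\<^sup>2)\<^sup>2 * r y) \<and>
     (\<forall>y\<in>{0<..<1::real}. (H has_real_derivative W y) (at y) \<and> (W has_real_derivative - q y - v y * W y) (at y) \<and>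
       (E has_real_derivative k y * W y - G y) (at y) \<and> (R has_real_derivative R1 y) (at y) \<and>
       (R1 has_real_derivative - 2 * E y - F1 y + c) (at y))"

lemma forced_profiles_exist:
  fixes q G F1 v :: "real \<Rightarrow> real"
  assumes q: "continuous_on {0..1} q" and G: "continuous_on {0..1} G" and F1: "continuous_on {0..1} F1"
    and v: "continuous_on {0..1} v"
  shows "\<exists>r H W k E R R1 c. forced_profiles q G F1 v r H W k E R R1 c"
proof -
  obtain H W where H: "continuous_on {0..1} H" "continuous_on {0..1} W" "H 0 = 0" "H 1 = 0"
    "\<And>y. y \<in> {0<..<1} \<Longrightarrow> (H has_real_derivative W y) (at y)"
    "\<And>y. y \<in> {0<..<1} \<Longrightarrow> (W has_real_derivative - q y - v y * W y) (at y)"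
    using swirl_profile_exists[OF q v] by blast
  obtain k where k: "continuous_on {0..1} k" "\<And>y. y \<in> {0..1} \<Longrightarrow> H y = (1 - y\<^sup>2) * k y"
    using divide_sin_sq_exists[OF H(1,2,4,5)] by blast
  have "continuous_on {0..1} (\<lambda>y. k y * W y - G y)" using k H G by (intro continuous_intros)
  then obtain E where E: "continuous_on {0..1} E" "\<And>y. y \<in> {0<..<1} \<Longrightarrow> (E has_real_derivative k y * W y - G y) (at y)"
    using antiderivative_exists by blast
  have J: "continuous_on {0..1} (\<lambda>y. - 2 * E y - F1 y)" using E F1 by (intro continuous_intros)
  obtain c R R1 r where R: "continuous_on {0..1} R" "continuous_on {0..1} R1" "continuous_on {0..1} r"
    "\<And>y. y \<in> {0<..<1} \<Longrightarrow> (R has_real_derivative R1 y) (at y)"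
    "\<And>y. y \<in> {0<..<1} \<Longrightarrow> (R1 has_real_derivative - 2 * E y - F1 y + c) (at y)"
    "R 0 = 0" "R 1 = 0" "R1 1 = 0" "\<And>y. y \<in> {0..1} \<Longrightarrow> R y = (1 - y\<^sup>2)\<^sup>2 * r y"
    using radial_profile_exists[OF J] by metis
  have "forced_profiles q G F1 v r H W k E R R1 c"
    unfolding forced_profiles_def by (intro conjI ballI) (rule H k E R; assumption?)+
  then show ?thesis by metis
qed

lemma forced_profilesD:
  assumes "forced_profiles q G F1 v r H W k E R R1 c"
  shows "continuous_on {0..1} r" "continuous_on {0..1} H" "continuous_on {0..1} W" "continuous_on {0..1} k"
    "continuous_on {0..1} E" "continuous_on {0..1} R" "continuous_on {0..1} R1"
    "H 0 = 0" "H 1 = 0" "R 0 = 0" "R 1 = 0" "R1 1 = 0"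
    "y \<in> {0..1} \<Longrightarrow> H y = (1 - y\<^sup>2) * k y" "y \<in> {0..1} \<Longrightarrow> R y = (1 - y\<^sup>2)\<^sup>2 * r y"
    "y \<in> {0<..<1} \<Longrightarrow> (H has_real_derivative W y) (at y)"
    "y \<in> {0<..<1} \<Longrightarrow> (W has_real_derivative - q y - v y * W y) (at y)"
    "y \<in> {0<..<1} \<Longrightarrow> (E has_real_derivative k y * W y - G y) (at y)"
    "y \<in> {0<..<1} \<Longrightarrow> (R has_real_derivative R1 y) (at y)"
    "y \<in> {0<..<1} \<Longrightarrow> (R1 has_real_derivative - 2 * E y - F1 y + c) (at y)"
  using assms by (simp_all add: forced_profiles_def)

lemma forced_profiles_system:
  assumes f: "forced_profiles q G F1 v r H W k E R R1 c"
    and F1: "\<And>y. y \<in> {0<..<1} \<Longrightarrow> (F1 has_real_derivative F1' y) (at y)"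
  shows "profile_system q (\<lambda>y. 2 * G y - F1' y) v H W R"
proof -
  note D = forced_profilesD[OF f]
  have "((\<lambda>y. R y / (1 - y)) \<longlongrightarrow> - R1 1) (at_left 1)" by (rule quotient_at_1[OF D(18,6,7,11)])
  then have l1: "((\<lambda>y. R y / (1 - y)) \<longlongrightarrow> 0) (at_left 1)" by (simp add: D)
  have "(R \<longlongrightarrow> R 0) (at_right 0)" by (rule continuous_on_Icc_at_rightD[OF D(6)]) simp
  then have l0: "(R \<longlongrightarrow> 0) (at_right 0)" by (simp add: D)
  have R2: "((\<lambda>y. - 2 * E y - F1 y + c) has_real_derivative 2 * G y - F1' y - 2 * (H y / (1 - y\<^sup>2)) * W y) (at y)"
    if y: "y \<in> {0<..<1}" for y
  proof -
    have "(E has_real_derivative k y * W y - G y) (at y)" "H y = (1 - y\<^sup>2) * k y" "1 - y\<^sup>2 \<noteq> 0"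
      using D(17)[OF y] D(13)[of y] y unit_sq_pos[of y] by auto
    then show ?thesis by (auto intro!: derivative_eq_intros F1 y)
  qed
  show ?thesis unfolding profile_system_def
    by (intro conjI ballI exI, (erule D R2 | rule D l0 l1)+)
qed

text \<open>With \<open>\<epsilon> = 1/384\<close> the quotient satisfies \<open>\<bar>r\<bar> \<le>
  4 (\<epsilon> + 8 \<epsilon>\<^sup>2) = 49/4608\<close>, so the ball of radius 1/24 is mapped to
  itself, and \<open>128 \<epsilon>\<^sup>2 = 1/1152\<close> is well below the 1/4 demanded by the
  fixed point lemma. The bound on \<open>k\<close> is \<open>2 \<epsilon> = 1/192\<close>.\<close>

lemma profile_solution_exists:
  fixes q G F1 F1' :: "real \<Rightarrow> real"
  assumes q: "continuous_on {0..1} q" and G: "continuous_on {0..1} G" and F1: "continuous_on {0..1} F1"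
    and F1': "\<And>y. y \<in> {0<..<1} \<Longrightarrow> (F1 has_real_derivative F1' y) (at y)"
    and qb: "\<And>y. y \<in> {0<..<1} \<Longrightarrow> \<bar>q y\<bar> \<le> (1/384) / 2 * (1 / sqrt (1 - y\<^sup>2))"
    and Nb: "\<And>y. y \<in> {0<..<1} \<Longrightarrow> \<bar>2 * G y - F1' y\<bar> \<le> (1/384) / sqrt (1 - y\<^sup>2)"
  obtains v r H W k E R R1 c where "forced_profiles q G F1 v r H W k E R R1 c"
    "continuous_on {0..1} v" "v 0 = 0" "\<And>y. y \<in> {0..1} \<Longrightarrow> \<bar>v y\<bar> \<le> 1/24"
    "\<And>y. y \<in> {0<..<1} \<Longrightarrow> (v has_real_derivative r y - (v y)\<^sup>2 / 2) (at y)"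
    "\<And>y. y \<in> {0<..<1} \<Longrightarrow> \<bar>r y - (v y)\<^sup>2 / 2\<bar> \<le> 1/24"
    "\<And>y. y \<in> {0<..<1} \<Longrightarrow> \<bar>k y\<bar> \<le> 1/192"
proof -
  define P where "P v r \<longleftrightarrow> (\<exists>H W k E R R1 c. forced_profiles q G F1 v r H W k E R R1 c)" for v r
  define N where "N y = 2 * G y - F1' y" for y
  have Nb': "\<bar>N y\<bar> \<le> (1/384) / sqrt (1 - y\<^sup>2)" if "y \<in> {0<..<1}" for y using Nb[OF that] by (simp add: N_def)
  have sys: "profile_system q N v H W R" if "forced_profiles q G F1 v r H W k E R R1 c" for v r H W k E R R1 c
    using forced_profiles_system[OF that F1'] by (simp add: N_def[abs_def])
  have half: "\<bar>v y\<bar> \<le> 1/2" if "\<And>y. y \<in> {0..1} \<Longrightarrow> \<bar>v y\<bar> \<le> 1/24" "y \<in> {0<..<1}" for v :: "real \<Rightarrow> real" and y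
    using that(1)[of y] that(2) by auto
  have e0: "(0::real) \<le> 1/384" by simp
  have sq1: "(1 - y)\<^sup>2 \<le> (1 - y\<^sup>2)\<^sup>2" "0 < (1 - y\<^sup>2)\<^sup>2" if "y \<in> {0<..<1}" for y :: real
  proof -
    have "y\<^sup>2 \<le> y" using that by (simp add: power2_eq_square mult_left_le)
    then show "(1 - y)\<^sup>2 \<le> (1 - y\<^sup>2)\<^sup>2" using that by (intro power_mono) auto
    show "0 < (1 - y\<^sup>2)\<^sup>2" using unit_sq_pos[of y] that by simp
  qed
  have quot: "\<bar>r\<bar> \<le> B" if "\<bar>(1 - y\<^sup>2)\<^sup>2 * r\<bar> \<le> B * (1 - y)\<^sup>2" "0 \<le> B" "y \<in> {0<..<1}" for r B y :: real
  proof -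
    have "(1 - y\<^sup>2)\<^sup>2 * \<bar>r\<bar> \<le> B * (1 - y)\<^sup>2" using that(1) by (simp add: abs_mult)
    also have "\<dots> \<le> B * (1 - y\<^sup>2)\<^sup>2" using sq1(1)[OF that(3)] that(2) by (intro mult_left_mono)
    finally have "(1 - y\<^sup>2)\<^sup>2 * \<bar>r\<bar> \<le> (1 - y\<^sup>2)\<^sup>2 * B" by (simp only: mult.commute)
    then show ?thesis using sq1(2)[OF that(3)] by (simp only: mult_le_cancel_left_pos)
  qed
  have small: "\<bar>x - s / 2\<bar> \<le> 1/24"
    if "\<bar>x\<bar> \<le> 4 * (1/384 + 8 * (1/384)\<^sup>2)" "0 \<le> s" "s \<le> (1/24)\<^sup>2" for x s :: real
  proof -
    have "\<bar>x\<bar> \<le> 49/4608" "s \<le> 1/576" using that by (simp_all add: power_divide)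
    with that(2) show ?thesis unfolding abs_le_iff by linarith
  qed
  have rbound: "\<bar>r y\<bar> \<le> 4 * (1/384 + 8 * (1/384)\<^sup>2)"
    if f: "forced_profiles q G F1 v r H W k E R R1 c" and v: "\<And>y. y \<in> {0..1} \<Longrightarrow> \<bar>v y\<bar> \<le> 1/24"
      and y: "y \<in> {0<..<1}" for v r H W k E R R1 c y
  proof -
    have e: "R y = (1 - y\<^sup>2)\<^sup>2 * r y" using forced_profilesD(14)[OF f, of y] y by simp
    have "\<bar>R y\<bar> \<le> 4 * (1/384 + 8 * (1/384)\<^sup>2) * (1 - y)\<^sup>2"
    proof (rule profile_system_R[OF e0 qb Nb' sys[OF f] _ y])
      show "\<bar>v y\<bar> \<le> 1/2" if "y \<in> {0<..<1}" for y by (rule half[OF v that])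
    qed
    then show ?thesis unfolding e by (rule quot[OF _ _ y]) simp
  qed
  obtain v r where vr: "P v r" "continuous_on {0..1} v" "continuous_on {0..1} r" "v 0 = 0"
    "\<And>y. y \<in> {0..1} \<Longrightarrow> \<bar>v y\<bar> \<le> 1/24"
    "\<And>y. y \<in> {0<..<1} \<Longrightarrow> (v has_real_derivative r y - (v y)\<^sup>2 / 2) (at y)"
  proof (rule picard_fixed_point[of "1/24" P])
    fix v :: "real \<Rightarrow> real" assume "continuous_on {0..1} v"
    from forced_profiles_exist[OF q G F1 this] show "\<exists>r. continuous_on {0..1} r \<and> P v r"
      unfolding P_def using forced_profilesD(1) by metis
  next
    fix v r y assume Pv: "P v r" and v: "\<And>y. y \<in> {0..1} \<Longrightarrow> \<bar>v y\<bar> \<le> 1/24" and y: "y \<in> {0<..<1::real}"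
    obtain H W k E R R1 c where f: "forced_profiles q G F1 v r H W k E R R1 c" using Pv unfolding P_def by blast
    have "\<bar>r y\<bar> \<le> 4 * (1/384 + 8 * (1/384)\<^sup>2)" by (rule rbound[OF f v y])
    moreover have "\<bar>v y\<bar>\<^sup>2 \<le> (1/24)\<^sup>2" using v[of y] y by (intro power_mono) auto
    ultimately show "\<bar>r y - (v y)\<^sup>2 / 2\<bar> \<le> 1/24" by (intro small) simp_all
  next
    fix v r v' r' d y
    assume P: "P v r" "P v' r'" and v: "\<And>y. y \<in> {0..1} \<Longrightarrow> \<bar>v y\<bar> \<le> 1/24" "\<And>y. y \<in> {0..1} \<Longrightarrow> \<bar>v' y\<bar> \<le> 1/24"
      and d: "\<And>y. y \<in> {0..1} \<Longrightarrow> \<bar>v y - v' y\<bar> \<le> d" and y: "y \<in> {0<..<1::real}"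
    obtain H W k E R R1 c where f: "forced_profiles q G F1 v r H W k E R R1 c" using P unfolding P_def by blast
    obtain H' W' k' E' R' R1' c' where f': "forced_profiles q G F1 v' r' H' W' k' E' R' R1' c'" using P unfolding P_def by blast
    have e: "R y = (1 - y\<^sup>2)\<^sup>2 * r y" "R' y = (1 - y\<^sup>2)\<^sup>2 * r' y" using forced_profilesD(14)[OF f, of y] forced_profilesD(14)[OF f', of y] y by simp_all
    have vh: "\<bar>v y\<bar> \<le> 1/2" "\<bar>v' y\<bar> \<le> 1/2" if "y \<in> {0<..<1}" for y
      using half[of v] half[of v'] v that by blast+
    have d': "\<bar>v t - v' t\<bar> \<le> d" if "t \<in> {0<..<1}" for t using d[of t] that by auto
    have d0: "0 \<le> d" using d'[OF y] by linarith
    have "\<bar>R y - R' y\<bar> \<le> 128 * (1/384)\<^sup>2 * d * (1 - y)\<^sup>2"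
      by (rule profile_system_diff(2)[OF e0 qb Nb' sys[OF f] sys[OF f'] vh d' y])
    then have "\<bar>(1 - y\<^sup>2)\<^sup>2 * (r y - r' y)\<bar> \<le> 128 * (1/384)\<^sup>2 * d * (1 - y)\<^sup>2"
      unfolding e right_diff_distrib[symmetric] .
    then have "\<bar>r y - r' y\<bar> \<le> 128 * (1/384)\<^sup>2 * d" by (rule quot[OF _ _ y]) (use d0 in simp)
    moreover have "128 * (1/384)\<^sup>2 * d \<le> d / 4" using d0 by (simp add: power2_eq_square)
    ultimately show "\<bar>r y - r' y\<bar> \<le> d / 4" by linarith
  qed auto
  obtain H W k E R R1 c where f: "forced_profiles q G F1 v r H W k E R R1 c" using vr(1) unfolding P_def by blast
  have vh: "\<bar>v y\<bar> \<le> 1/2" if "y \<in> {0<..<1}" for y using half[of v] vr(5) that by blast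
  show thesis
  proof (rule that[OF f vr(2,4,5,6)])
    fix y :: real assume y: "y \<in> {0<..<1}"
    have "\<bar>r y\<bar> \<le> 4 * (1/384 + 8 * (1/384)\<^sup>2)" by (rule rbound[OF f vr(5) y])
    moreover have "\<bar>v y\<bar>\<^sup>2 \<le> (1/24)\<^sup>2" using vr(5)[of y] y by (intro power_mono) auto
    ultimately show "\<bar>r y - (v y)\<^sup>2 / 2\<bar> \<le> 1/24" by (intro small) simp_all
    have "H y = (1 - y\<^sup>2) * k y" "1 - y\<^sup>2 \<noteq> 0" using forced_profilesD(13)[OF f, of y] y unit_sq_pos[of y] by auto
    with profile_system_k[OF e0 qb Nb' sys[OF f] vh y] show "\<bar>k y\<bar> \<le> 1/192" by simp
  qed
qed

section \<open>Weights gained by integration, and regularity of the profiles\<close>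

lemma one_minus_le_sin_sq: "y \<in> {0..1} \<Longrightarrow> 1 - y \<le> 1 - y\<^sup>2" for y :: real
  by (simp add: power2_eq_square mult_left_le)

text \<open>For \<open>e \<ge> 0\<close> the mean value theorem gains
  \<open>1 - y \<le> (colat y)\<^sup>2\<close>. For \<open>e = - 1\<close> the derivative may be
  unbounded, and the exact integral \<open>arccos y \<le> 2 colat y\<close> takes its place.\<close>

lemma wt_integrate:
  assumes A: "continuous_on {0..1} A" "A 1 = 0"
    "\<And>y. y \<in> {0<..<1} \<Longrightarrow> (A has_real_derivative A' y) (at y)" "wt n e A'" and e: "- 1 \<le> e"
  shows "wt (Suc n) (e + 2) A"
proof (rule wt_SucI[OF _ _ A(3)])
  show "continuous_on {0..<1} A" by (rule continuous_on_subset[OF A(1)]) auto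
  show "wt n (e + 2 - 2) A'" using A(4) by simp
  obtain C where C: "0 \<le> C" "\<And>y. y \<in> {0<..<1} \<Longrightarrow> \<bar>A' y\<bar> \<le> C * colat y powi e"
    using wt_bound[OF A(4)] by blast
  have lim: "\<bar>A y\<bar> \<le> B" if y: "y \<in> {0<..<1}" and bd: "\<And>z. z \<in> {y<..<1} \<Longrightarrow> \<bar>A z - A y\<bar> \<le> B" for y B
  proof -
    have "\<bar>A 1 - A y\<bar> \<le> B"
    proof (rule tendsto_upperbound)
      show "((\<lambda>z. \<bar>A z - A y\<bar>) \<longlongrightarrow> \<bar>A 1 - A y\<bar>) (at_left 1)" by (intro tendsto_intros at_left_1 A)
      show "\<forall>\<^sub>F z in at_left 1. \<bar>A z - A y\<bar> \<le> B"
        by (rule eventually_at_leftI[of y]) (use y bd in auto)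
    qed simp
    then show ?thesis using A(2) by simp
  qed
  show "wt 0 (e + 2) A"
  proof (cases "e = - 1")
    case True
    show ?thesis
    proof (rule wt_0I[of _ "2 * C"], rule lim)
      fix y z :: real assume y: "y \<in> {0<..<1}" and z: "z \<in> {y<..<1}"
      have "\<bar>A z - A y\<bar> \<le> \<bar>C * arcsin z - C * arcsin y\<bar>"
      proof (rule deriv_dominated[OF A(3) DERIV_cmult[OF DERIV_arcsin_unit]])
        fix t :: real assume t: "t \<in> {0<..<1}"
        have "colat t powi - 1 = 1 / sqrt (1 - t\<^sup>2)" by (simp add: colat_def power_int_def inverse_eq_divide)
        then show "\<bar>A' t\<bar> \<le> C * (1 / sqrt (1 - t\<^sup>2))" using C(2)[OF t] True by simp
      qed (use y z in auto)
      also have "\<dots> = C * (arcsin z - arcsin y)"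
        using C(1) y z arcsin_le_mono[of y z] by (simp add: right_diff_distrib[symmetric] abs_mult)
      also have "\<dots> \<le> C * (pi / 2 - arcsin y)"
        using C(1) y z arcsin_ubound[of z] by (intro mult_left_mono) auto
      also have "pi / 2 - arcsin y = arccos y" using arcsin_arccos_eq[of y] y by simp
      also have "C * arccos y \<le> C * (2 * colat y)"
      proof (rule mult_left_mono[OF _ C(1)])
        have "arccos y \<le> 2 * sin (arccos y)"
          using y arccos_lbound[of y] arccos_le_mono[of y 0] by (intro le_twice_sin) auto
        also have "sin (arccos y) = colat y" using y by (simp add: sin_arccos colat_def)
        finally show "arccos y \<le> 2 * colat y" .
      qed
      also have "C * (2 * colat y) = 2 * C * colat y powi (e + 2)" using True by (simp add: power_int_def)
      finally show "\<bar>A z - A y\<bar> \<le> 2 * C * colat y powi (e + 2)" .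
    qed
  next
    case False
    then have e0: "0 \<le> e" using e by simp
    show ?thesis
    proof (rule wt_0I[of _ C], rule lim)
      fix y z :: real assume y: "y \<in> {0<..<1}" and z: "z \<in> {y<..<1}"
      have py: "0 < colat y" using y colat_pos by auto
      obtain c where c: "y < c" "c < z" "A z - A y = (z - y) * A' c"
        using MVT2[of y z A A'] A(3) y z by (metis atLeastAtMost_iff greaterThanLessThan_iff le_less_trans less_le_trans order_less_imp_le)
      have cc: "c \<in> {0<..<1}" using c y z by auto
      have "y\<^sup>2 \<le> c\<^sup>2" using c y by (intro power_mono) auto
      then have "colat c \<le> colat y" by (simp add: colat_def)
      then have mono: "colat c powi e \<le> colat y powi e"
        using e0 colat_pos[of c] cc by (auto simp: power_int_def intro!: power_mono)
      have "\<bar>A z - A y\<bar> = (z - y) * \<bar>A' c\<bar>" using c by (simp add: abs_mult)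
      also have "\<dots> \<le> (1 - y\<^sup>2) * (C * colat y powi e)"
      proof (rule mult_mono)
        show "z - y \<le> 1 - y\<^sup>2" using one_minus_le_sin_sq[of y] y z by auto
        show "\<bar>A' c\<bar> \<le> C * colat y powi e"
          using C(2)[OF cc] mult_left_mono[OF mono C(1)] by linarith
        show "0 \<le> 1 - y\<^sup>2" using unit_sq[of y] y by auto
      qed simp
      also have "1 - y\<^sup>2 = colat y powi 2" using colat_sq[of y] y by (simp add: power_int_def)
      also have "colat y powi 2 * (C * colat y powi e) = C * colat y powi (e + 2)"
        using py by (simp add: power_int_add mult_ac)
      finally show "\<bar>A z - A y\<bar> \<le> C * colat y powi (e + 2)" .
    qed
  qed
qed

lemma continuous_on_Icc_Ico: "continuous_on {0..1} f \<Longrightarrow> continuous_on {0..<1::real} f"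
  by (rule continuous_on_subset) auto

lemma wt_divide_sin_sq: "wt n (e + 2) A \<Longrightarrow> wt n e (\<lambda>y. A y * inverse (1 - y\<^sup>2))"
  using wt_mult[OF _ wt_inverse_sin_sq[of n], of "e + 2" A] by simp

lemma wt_mult_sin_sq: "wt n e A \<Longrightarrow> wt n (e + 2) (\<lambda>y. (1 - y\<^sup>2) * A y)"
  using wt_mult[OF wt_sin_sq[of n], of e A] by (simp add: add.commute)

text \<open>The product has weight 1 and so tends to 0 on the axis; the factor
  \<open>1 - y\<^sup>2\<close> gives it the value 0 there whatever \<open>A 1\<close> is.\<close>

lemma continuous_sin_sq_mult:
  assumes "wt (Suc n) (- 1) A" shows "continuous_on {0..1} (\<lambda>y. (1 - y\<^sup>2) * A y)"
proof -
  have w: "wt (Suc n) 1 (\<lambda>y. (1 - y\<^sup>2) * A y)" using wt_mult_sin_sq[OF assms] by simp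
  have "continuous_on {0..1} (\<lambda>y. if y = 1 then 0 else (1 - y\<^sup>2) * A y)"
    by (rule continuous_on_extend_at_1[OF wt_continuous[OF w] wt_tendsto_0[OF w]])
  moreover have "(\<lambda>y. if y = 1 then 0 else (1 - y\<^sup>2) * A y) = (\<lambda>y. (1 - y\<^sup>2) * A y)" by auto
  ultimately show ?thesis by (simp only:)
qed

text \<open>\<open>(1 - y\<^sup>2) LA + y LB\<close> is the radial component and
  \<open>y LA - LB\<close> the polar one over \<open>sin \<phi>\<close>. The radial one contains
  \<open>P\<close> but not \<open>P1\<close>, the polar one \<open>P1\<close> but not
  \<open>P\<close>; this is how the pressure gets eliminated. The long bracket is the second
  derivative of \<open>(1 - y\<^sup>2)\<^sup>2 (v' + v\<^sup>2 / 2)\<close>, that is, of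
  \<open>R\<close>.\<close>

lemma momentum_identities:
  fixes y v v1 v2 v3 k k1 P P1 :: real
  defines "a \<equiv> (1 - y\<^sup>2) * v1 - y * v"
  defines "a1 \<equiv> (1 - y\<^sup>2) * v2 - 3 * y * v1 - v"
  defines "a2 \<equiv> (1 - y\<^sup>2) * v3 - 5 * y * v2 - 4 * v1"
  defines "b \<equiv> y * a - v"
  defines "b1 \<equiv> a + y * a1 - v1"
  defines "b2 \<equiv> 2 * a1 + y * a2 - v2"
  defines "LA \<equiv> - ((1 - y\<^sup>2) * a2 - 4 * y * a1 - 2 * a)
     + (- 2 * ((1 - y\<^sup>2) * a + y * b) * a - (1 - y\<^sup>2) * (y * a - b) * a1 + a\<^sup>2 - k\<^sup>2) + (- 2 * P - y * P1)"
  defines "LB \<equiv> - ((1 - y\<^sup>2) * b2 - 2 * y * b1)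
     + (- ((1 - y\<^sup>2) * a + y * b) * b - (1 - y\<^sup>2) * (y * a - b) * b1) + (- 2 * y * P + (1 - y\<^sup>2) * P1)"
  shows "(1 - y\<^sup>2) * LA + y * LB = 2 * ((1 - y\<^sup>2) * v1 - 2 * y * v)
      - ((1 - y\<^sup>2)\<^sup>2 * (v3 + v1\<^sup>2 + v * v2) - 8 * y * (1 - y\<^sup>2) * (v2 + v * v1) + (12 * y\<^sup>2 - 4) * (v1 + v\<^sup>2 / 2))
      - (1 - y\<^sup>2) * (v\<^sup>2 + k\<^sup>2) - 2 * P" (is ?rad)
    and "y * LA - LB = ((1 - y\<^sup>2) * v2 - 4 * y * v1 - 2 * v) - ((1 - y\<^sup>2) * (v * v1) - y * v\<^sup>2) - y * k\<^sup>2 - P1" (is ?ang)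
proof -
  have f: "(1 - y\<^sup>2) * a + y * b = (1 - y\<^sup>2) * v1 - 2 * y * v" "y * a - b = v"
    unfolding a_def b_def by (simp_all add: algebra_simps power2_eq_square)
  show ?rad unfolding LA_def LB_def f
    unfolding b_def b1_def b2_def a_def a1_def a2_def
    by (simp add: algebra_simps power2_eq_square)
  show ?ang unfolding LA_def LB_def f
    unfolding b_def b1_def b2_def a_def a1_def a2_def
    by (simp add: algebra_simps power2_eq_square)
qed

lemma momentum_profile_field:
  assumes u: "\<And>z. z \<in> offaxis \<Longrightarrow> u z = profile_field (- 1) a k b z"
    and p: "\<And>z. z \<in> offaxis \<Longrightarrow> p z = zonal (- 2) P z"
    and x: "x \<in> offaxis"
    and a: "\<And>y. y \<in> {0<..<1} \<Longrightarrow> (a has_real_derivative a1 y) (at y)" "\<And>y. y \<in> {0<..<1} \<Longrightarrow> (a1 has_real_derivative a2 y) (at y)"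
    and k: "\<And>y. y \<in> {0<..<1} \<Longrightarrow> (k has_real_derivative k1 y) (at y)" "\<And>y. y \<in> {0<..<1} \<Longrightarrow> (k1 has_real_derivative k2 y) (at y)"
    and b: "\<And>y. y \<in> {0<..<1} \<Longrightarrow> (b has_real_derivative b1 y) (at y)" "\<And>y. y \<in> {0<..<1} \<Longrightarrow> (b1 has_real_derivative b2 y) (at y)"
    and P: "\<And>y. y \<in> {0<..<1} \<Longrightarrow> (P has_real_derivative P1 y) (at y)"
  shows "- laplacian u x + convection u x + grad p x = profile_field (- 3)
    (\<lambda>y. - ((1 - y\<^sup>2) * a2 y - 4 * y * a1 y - 2 * a y)
     + (- 2 * ((1 - y\<^sup>2) * a y + y * b y) * a y - (1 - y\<^sup>2) * (y * a y - b y) * a1 y + (a y)\<^sup>2 - (k y)\<^sup>2) + (- 2 * P y - y * P1 y))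
    (\<lambda>y. - ((1 - y\<^sup>2) * k2 y - 4 * y * k1 y - 2 * k y)
     + (- 2 * ((1 - y\<^sup>2) * a y + y * b y) * k y - (1 - y\<^sup>2) * (y * a y - b y) * k1 y + 2 * a y * k y))
    (\<lambda>y. - ((1 - y\<^sup>2) * b2 y - 2 * y * b1 y)
     + (- ((1 - y\<^sup>2) * a y + y * b y) * b y - (1 - y\<^sup>2) * (y * a y - b y) * b1 y) + (- 2 * y * P y + (1 - y\<^sup>2) * P1 y)) x"
proof -
  have lin: "- profile_field (- 3) A K B x + profile_field (- 3) A' K' B' x + profile_field (- 3) A'' (\<lambda>y. 0) B'' x =
      profile_field (- 3) (\<lambda>y. - A y + A' y + A'' y) (\<lambda>y. - K y + K' y) (\<lambda>y. - B y + B' y + B'' y) x"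
    for A K B A' K' B' A'' B''
    unfolding vec_eq_iff forall_3 by (simp add: zonal_def distrib_left right_diff_distrib)
  show ?thesis
    by (simp only: laplacian_profile_field[OF u x a(1) k(1) b(1) a(2) k(2) b(2)]
      convection_profile_field[OF u x a(1) k(1) b(1)] grad_zonal[OF p x P] lin)
qed

text \<open>The fixed point yields merely continuous profiles. Here they are raised to the weights
  demanded by \<open>Lk_profile\<close>, and the pressure profile is recovered. The third derivative
  of \<open>v\<close> may grow like \<open>colat powi (- 3)\<close>, but the velocity contains it
  only with the factor \<open>1 - y\<^sup>2\<close>.\<close>

lemma regular_profiles:
  assumes fp: "forced_profiles q G F1 v r H W k E R R1 c"
    and v: "continuous_on {0..1} v" "\<And>y. y \<in> {0<..<1} \<Longrightarrow> (v has_real_derivative r y - (v y)\<^sup>2 / 2) (at y)"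
    and q: "continuous_on {0..1} q" "wt 1 0 q" and G: "continuous_on {0..1} G" "wt 1 0 G"
    and F1: "continuous_on {0..1} F1" "\<And>y. y \<in> {0<..<1} \<Longrightarrow> (F1 has_real_derivative F1' y) (at y)"
    and N: "wt 0 (- 1) (\<lambda>y. 2 * G y - F1' y)"
  obtains v1 v2 v3 k1 k2 P P1 where
    "\<And>y. v1 y = r y - (v y)\<^sup>2 / 2"
    "\<And>y. y \<in> {0<..<1} \<Longrightarrow> (v has_real_derivative v1 y) (at y)"
    "\<And>y. y \<in> {0<..<1} \<Longrightarrow> (v1 has_real_derivative v2 y) (at y)"
    "\<And>y. y \<in> {0<..<1} \<Longrightarrow> (v2 has_real_derivative v3 y) (at y)"
    "\<And>y. y \<in> {0<..<1} \<Longrightarrow> (k has_real_derivative k1 y) (at y)"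
    "\<And>y. y \<in> {0<..<1} \<Longrightarrow> (k1 has_real_derivative k2 y) (at y)"
    "\<And>y. y \<in> {0<..<1} \<Longrightarrow> (P has_real_derivative P1 y) (at y)"
    "Lk_profile (Suc (Suc 0)) 1 (\<lambda>y. (1 - y\<^sup>2) * v1 y - y * v y)"
    "Lk_profile (Suc (Suc 0)) 1 k"
    "Lk_profile (Suc (Suc 0)) 0 (\<lambda>y. y * ((1 - y\<^sup>2) * v1 y - y * v y) - v y)"
    "Lk_profile (Suc 0) 0 P"
    "\<And>y. y \<in> {0<..<1} \<Longrightarrow> (1 - y\<^sup>2) * k2 y - 4 * y * k1 y - 2 * k y = - q y - v y * ((1 - y\<^sup>2) * k1 y - 2 * y * k y)"
    "\<And>y. y \<in> {0<..<1} \<Longrightarrow> 2 * ((1 - y\<^sup>2) * v1 y - 2 * y * v y)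
      - ((1 - y\<^sup>2)\<^sup>2 * (v3 y + (v1 y)\<^sup>2 + v y * v2 y) - 8 * y * (1 - y\<^sup>2) * (v2 y + v y * v1 y) + (12 * y\<^sup>2 - 4) * (v1 y + (v y)\<^sup>2 / 2))
      - (1 - y\<^sup>2) * ((v y)\<^sup>2 + (k y)\<^sup>2) - 2 * P y = F1 y"
    "\<And>y. y \<in> {0<..<1} \<Longrightarrow> ((1 - y\<^sup>2) * v2 y - 4 * y * v1 y - 2 * v y) - ((1 - y\<^sup>2) * (v y * v1 y) - y * (v y)\<^sup>2)
      - y * (k y)\<^sup>2 - P1 y = G y"
proof -
  note D = forced_profilesD[OF fp]
  note Ico = continuous_on_Icc_Ico
  define v1 where "v1 y = r y - (v y)\<^sup>2 / 2" for y
  have v1: "\<And>y. y \<in> {0<..<1} \<Longrightarrow> (v has_real_derivative v1 y) (at y)" using v(2) by (simp add: v1_def)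
  have cv1: "continuous_on {0..1} v1" unfolding v1_def[abs_def] using D(1) v(1) by (intro continuous_intros) auto
  have nz: "1 - y\<^sup>2 \<noteq> 0" if "y \<in> {0..<1}" for y :: real using unit_sq_pos[OF that] by simp

  have v_0: "wt 0 0 v" "wt 0 0 v1" "wt 0 0 W" using wt_bounded_continuous v(1) cv1 D(3) by blast+
  have v_1: "wt 1 0 v"
    unfolding One_nat_def by (rule wt_SucI[OF v_0(1) Ico[OF v(1)] v1 wt_weaken[OF v_0(2)]]) auto
  have k_0: "wt 0 0 k" using wt_bounded_continuous D(4) by blast

  text \<open>The swirl profile: subtracting the linear part of \<open>H\<close> at \<open>y = 1\<close> makes \<open>H / (1 - y\<^sup>2)\<close> a
    smooth function plus a remainder with two extra powers of \<open>colat\<close>.\<close>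
  define W1 where "W1 y = - q y - v y * W y" for y
  have W: "\<And>y. y \<in> {0<..<1} \<Longrightarrow> (W has_real_derivative W1 y) (at y)" using D(16) by (simp add: W1_def)
  have cW1: "continuous_on {0..1} W1" unfolding W1_def[abs_def] using q v(1) D(3) by (intro continuous_intros)
  have W_1: "wt 1 0 W"
    unfolding One_nat_def
    by (rule wt_SucI[OF v_0(3) Ico[OF D(3)] W wt_weaken[OF wt_bounded_continuous[OF cW1]]]) auto
  have W1_1: "wt 1 0 W1"
  proof -
    have "wt 1 0 (\<lambda>y. v y * W y)" using wt_mult[OF v_1 W_1] by simp
    then show ?thesis unfolding W1_def[abs_def] by (rule wt_diff[OF wt_minus[OF q(2)]])
  qed
  define Ht where "Ht y = H y + (1 - y) * W 1" for y
  have Ht1: "wt 2 2 (\<lambda>y. W y - W 1)"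
  proof -
    have "wt (Suc 1) (0 + 2) (\<lambda>y. W y - W 1)"
    proof (rule wt_integrate[OF _ _ _ W1_1])
      show "continuous_on {0..1} (\<lambda>y. W y - W 1)" using D(3) by (intro continuous_intros)
      show "((\<lambda>y. W y - W 1) has_real_derivative W1 y) (at y)" if "y \<in> {0<..<1}" for y
        by (rule derivative_eq_intros W[OF that] refl | simp)+
    qed simp_all
    then show ?thesis by (simp add: eval_nat_numeral)
  qed
  have Ht: "wt 3 4 Ht"
  proof -
    have "wt (Suc 2) (2 + 2) Ht"
    proof (rule wt_integrate[OF _ _ _ Ht1])
      show "continuous_on {0..1} Ht" unfolding Ht_def[abs_def] using D(2) by (intro continuous_intros)
      show "Ht 1 = 0" using D(9) by (simp add: Ht_def)
      show "(Ht has_real_derivative W y - W 1) (at y)" if "y \<in> {0<..<1}" for y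
        unfolding Ht_def[abs_def] by (rule derivative_eq_intros D(15)[OF that] refl | simp)+
    qed simp
    then show ?thesis by (simp add: eval_nat_numeral)
  qed
  have kt: "wt 3 2 (\<lambda>y. Ht y * inverse (1 - y\<^sup>2))" using wt_divide_sin_sq[of 3 2 Ht] Ht by simp
  have "wt (Suc 2) 2 (\<lambda>y. Ht y * inverse (1 - y\<^sup>2))" using kt by (simp add: eval_nat_numeral)
  from wt_SucE[OF this] obtain kt1 where
    kt1: "\<And>y. y \<in> {0<..<1} \<Longrightarrow> ((\<lambda>y. Ht y * inverse (1 - y\<^sup>2)) has_real_derivative kt1 y) (at y)" "wt 2 (2 - 2) kt1"
    by blast
  define k1 where "k1 y = W 1 * (inverse (1 + y) * inverse (1 + y)) + kt1 y" for y
  \<comment> \<open>\<open>(1 - y) W 1 / (1 - y\<^sup>2)\<close> simplifies to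
    \<open>W 1 / (1 + y)\<close>, which is smooth up to \<open>y = 1\<close>.\<close>
  have k_eq: "k y = - W 1 * inverse (1 + y) + Ht y * inverse (1 - y\<^sup>2)" if "y \<in> {0..<1}" for y
  proof -
    define s t where "s = 1 - y" and "t = 1 + y"
    have "s \<noteq> 0" "t \<noteq> 0" using that by (auto simp: s_def t_def)
    then have st: "s * inverse s = 1" "t * inverse t = 1" "1 - y\<^sup>2 = s * t"
      by (simp_all add: right_inverse) (simp add: s_def t_def power2_eq_square algebra_simps)
    have "Ht y = s * t * k y + s * W 1" using D(13)[of y] that st(3) by (simp add: Ht_def s_def)
    then show ?thesis unfolding st(3) t_def[symmetric] inverse_mult_distrib using st(1,2) by algebra
  qed
  have k1: "(k has_real_derivative k1 y) (at y)" if y: "y \<in> {0<..<1}" for y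
  proof (rule has_field_derivative_transform_within_open[of "\<lambda>y. - W 1 * inverse (1 + y) + Ht y * inverse (1 - y\<^sup>2)"])
    have "1 + y \<noteq> 0" using y by auto
    then have "((\<lambda>y. - W 1 * inverse (1 + y)) has_real_derivative W 1 * (inverse (1 + y) * inverse (1 + y))) (at y)"
      by (auto intro!: derivative_eq_intros)
    from DERIV_add[OF this kt1(1)[OF y]]
    show "((\<lambda>y. - W 1 * inverse (1 + y) + Ht y * inverse (1 - y\<^sup>2)) has_real_derivative k1 y) (at y)"
      by (simp add: k1_def)
    show "y \<in> {0<..<1}" by (rule y)
  qed (use k_eq in auto)
  have k1_2: "wt 2 0 k1"
    unfolding k1_def[abs_def]
    by (intro wt_add kt1(2)[simplified] wt_cmult)
       (use wt_mult[OF wt_inverse_1_plus[of 2] wt_inverse_1_plus[of 2]] in simp)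
  then obtain k2 where k2: "\<And>y. y \<in> {0<..<1} \<Longrightarrow> (k1 has_real_derivative k2 y) (at y)"
    using wt_SucE[of 1 0 k1] by (metis Suc_1)
  have k_1: "wt 1 0 k"
    unfolding One_nat_def
    by (rule wt_SucI[OF k_0 Ico[OF D(4)] k1 wt_weaken[OF wt_le[OF k1_2]]]) auto

  text \<open>Likewise for \<open>R\<close>, with its quadratic part at \<open>y = 1\<close>.\<close>
  define R2 where "R2 y = - 2 * E y - F1 y + c" for y
  define R3 where "R3 y = (2 * G y - F1' y) - 2 * (k y * W y)" for y
  have R1: "\<And>y. y \<in> {0<..<1} \<Longrightarrow> (R1 has_real_derivative R2 y) (at y)" using D(19) by (simp add: R2_def)
  have R2: "(R2 has_real_derivative R3 y) (at y)" if "y \<in> {0<..<1}" for y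
    unfolding R2_def[abs_def] R3_def
    by (rule derivative_eq_intros D(17) F1 that refl | simp)+
  have cR2: "continuous_on {0..1} R2" unfolding R2_def[abs_def] using D(5) F1(1) by (intro continuous_intros)
  have "wt 0 0 (\<lambda>y. k y * W y)" using wt_mult[OF k_0 v_0(3)] by simp
  then have R3_0: "wt 0 (- 1) R3"
    unfolding R3_def[abs_def] by (intro wt_diff N wt_cmult) (rule wt_weaken, auto)
  have w1: "wt 1 1 (\<lambda>y. R2 y - R2 1)"
  proof -
    have "wt (Suc 0) (- 1 + 2) (\<lambda>y. R2 y - R2 1)"
    proof (rule wt_integrate[OF _ _ _ R3_0])
      show "continuous_on {0..1} (\<lambda>y. R2 y - R2 1)" using cR2 by (intro continuous_intros)
      show "((\<lambda>y. R2 y - R2 1) has_real_derivative R3 y) (at y)" if "y \<in> {0<..<1}" for y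
        by (rule derivative_eq_intros R2[OF that] refl | simp)+
    qed simp_all
    then show ?thesis by simp
  qed
  have w2: "wt 2 3 (\<lambda>y. R1 y + R2 1 * (1 - y))"
  proof -
    have "wt (Suc 1) (1 + 2) (\<lambda>y. R1 y + R2 1 * (1 - y))"
    proof (rule wt_integrate[OF _ _ _ w1])
      show "continuous_on {0..1} (\<lambda>y. R1 y + R2 1 * (1 - y))" using D(7) by (intro continuous_intros)
      show "((\<lambda>y. R1 y + R2 1 * (1 - y)) has_real_derivative R2 y - R2 1) (at y)" if "y \<in> {0<..<1}" for y
        by (rule derivative_eq_intros R1[OF that] refl | simp)+
      show "R1 1 + R2 1 * (1 - 1) = 0" using D(12) by simp
    qed simp
    then show ?thesis by (simp add: eval_nat_numeral)
  qed
  \<comment> \<open>Three integrations raise the weight of \<open>R3\<close> from -1 to 5; two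
    divisions by \<open>1 - y\<^sup>2\<close> leave weight 1 for \<open>rt\<close>.\<close>
  define Rt where "Rt y = R y - R2 1 / 2 * (1 - y)\<^sup>2" for y
  have Rt: "wt 3 5 Rt"
  proof -
    have "wt (Suc 2) (3 + 2) Rt"
    proof (rule wt_integrate[OF _ _ _ w2])
      show "continuous_on {0..1} Rt" unfolding Rt_def[abs_def] using D(6) by (intro continuous_intros)
      show "Rt 1 = 0" using D(11) by (simp add: Rt_def)
      show "(Rt has_real_derivative R1 y + R2 1 * (1 - y)) (at y)" if "y \<in> {0<..<1}" for y
        unfolding Rt_def[abs_def] by (rule derivative_eq_intros D(18)[OF that] refl | simp add: field_simps)+
    qed simp
    then show ?thesis by (simp add: eval_nat_numeral)
  qed
  define rt where "rt y = Rt y * inverse (1 - y\<^sup>2) * inverse (1 - y\<^sup>2)" for y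
  define cr where "cr = R2 1 / 2"
  have rt: "wt 3 1 rt"
  proof -
    have "wt 3 (1 + 2) (\<lambda>y. Rt y * inverse (1 - y\<^sup>2))" using wt_divide_sin_sq[of 3 3 Rt] Rt by simp
    from wt_divide_sin_sq[OF this] show ?thesis by (simp add: rt_def[abs_def])
  qed
  then have "wt (Suc 2) 1 rt" by (simp add: eval_nat_numeral)
  from wt_SucE[OF this] obtain rt1 where
    rt1: "\<And>y. y \<in> {0<..<1} \<Longrightarrow> (rt has_real_derivative rt1 y) (at y)" and "wt 2 (1 - 2) rt1"
    by blast
  then have rt1_2: "wt 2 (- 1) rt1" by simp
  have sm: "wt n 0 (\<lambda>y. cr * (inverse (1 + y) * inverse (1 + y)))" for n
    by (intro wt_cmult) (use wt_mult[OF wt_inverse_1_plus[of n] wt_inverse_1_plus[of n]] in simp)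
  have sm': "wt n 0 (\<lambda>y. - 2 * cr * (inverse (1 + y) * (inverse (1 + y) * inverse (1 + y))))" for n
    by (intro wt_cmult) (use wt_mult[OF wt_inverse_1_plus[of n] wt_mult[OF wt_inverse_1_plus[of n] wt_inverse_1_plus[of n]]] in simp)
  have r_eq: "r y = cr * (inverse (1 + y) * inverse (1 + y)) + rt y" if y: "y \<in> {0..<1}" for y
  proof -
    define s t where "s = 1 - y" and "t = 1 + y"
    have "s \<noteq> 0" "t \<noteq> 0" using y by (auto simp: s_def t_def)
    then have st: "s * inverse s = 1" "t * inverse t = 1" "1 - y\<^sup>2 = s * t"
      by (simp_all add: right_inverse) (simp add: s_def t_def power2_eq_square algebra_simps)
    have "R y = (s * t)\<^sup>2 * r y" using D(14)[of y] y st(3) by simp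
    then have "rt y = ((s * t)\<^sup>2 * r y - cr * s\<^sup>2) * inverse (s * t) * inverse (s * t)"
      unfolding rt_def Rt_def st(3) cr_def s_def by simp
    then show ?thesis unfolding t_def[symmetric] inverse_mult_distrib using st(1,2) by algebra
  qed
  define r1 where "r1 y = - 2 * cr * (inverse (1 + y) * (inverse (1 + y) * inverse (1 + y))) + rt1 y" for y
  have r1: "(r has_real_derivative r1 y) (at y)" if y: "y \<in> {0<..<1}" for y
  proof (rule has_field_derivative_transform_within_open[of "\<lambda>y. cr * (inverse (1 + y) * inverse (1 + y)) + rt y"])
    have "1 + y \<noteq> 0" using y by auto
    then have "((\<lambda>y. cr * (inverse (1 + y) * inverse (1 + y))) has_real_derivative - 2 * cr * (inverse (1 + y) * (inverse (1 + y) * inverse (1 + y)))) (at y)"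
      by (auto intro!: derivative_eq_intros)
    from DERIV_add[OF this rt1[OF y]]
    show "((\<lambda>y. cr * (inverse (1 + y) * inverse (1 + y)) + rt y) has_real_derivative r1 y) (at y)" by (simp add: r1_def)
    show "y \<in> {0<..<1}" by (rule y)
  qed (use r_eq in auto)
  have r1_2: "wt 2 (- 1) r1"
    unfolding r1_def[abs_def] by (rule wt_add[OF wt_weaken[OF sm'] rt1_2]) simp
  have r_3: "wt 3 0 r"
    by (rule wt_cong_open[OF wt_add[OF sm wt_weaken[OF rt]] r_eq[symmetric] Ico[OF D(1)]]) auto

  \<comment> \<open>\<open>v1 = r - v\<^sup>2 / 2\<close> inherits the level of \<open>v\<close>,
    and \<open>v\<close> is one level above \<open>v1\<close>. Alternating the two raises both up to
    level 3, the level of \<open>r\<close>.\<close>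
  have up: "wt n 0 v1" if "wt n 0 v" "n \<le> 3" for n
  proof -
    have "wt n 0 (\<lambda>y. v y * v y)" using wt_mult[OF that(1) that(1)] by simp
    from wt_diff[OF wt_le[OF r_3 that(2)] wt_cmult[OF this, of "1/2"]] show ?thesis
      by (simp add: v1_def[abs_def] power2_eq_square)
  qed
  have up': "wt n 0 v1 \<Longrightarrow> wt (Suc n) 0 v" for n
    by (rule wt_SucI[OF v_0(1) Ico[OF v(1)] v1 wt_weaken]) auto
  have v_3: "wt 3 0 v"
    using up'[OF up[OF up'[OF up[OF v_1]]]] by (simp add: eval_nat_numeral)
  have v1_3: "wt 3 0 v1" using up[OF v_3] by simp
  define v2 where "v2 y = r1 y - v y * v1 y" for y
  have v2: "(v1 has_real_derivative v2 y) (at y)" if "y \<in> {0<..<1}" for y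
    unfolding v1_def[abs_def] v2_def by (rule derivative_eq_intros r1 v1 that refl | simp add: v1_def)+
  have v2_2: "wt 2 (- 1) v2"
    unfolding v2_def[abs_def]
    by (intro wt_diff r1_2 wt_weaken[OF wt_mult[OF wt_le[OF v_3] wt_le[OF v1_3]]]) auto
  have "wt (Suc 1) (- 1) v2" using v2_2 by (simp add: eval_nat_numeral)
  from wt_SucE[OF this] obtain v3 where
    v3: "\<And>y. y \<in> {0<..<1} \<Longrightarrow> (v2 has_real_derivative v3 y) (at y)" "wt 1 (- 1 - 2) v3"
    by blast

  define a where "a y = (1 - y\<^sup>2) * v1 y - y * v y" for y
  define a1 where "a1 y = (1 - y\<^sup>2) * v2 y - 3 * y * v1 y - v y" for y
  define a2 where "a2 y = (1 - y\<^sup>2) * v3 y - 5 * y * v2 y - 4 * v1 y" for y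
  define b where "b y = y * a y - v y" for y
  define b1 where "b1 y = a y + y * a1 y - v1 y" for y
  define b2 where "b2 y = 2 * a1 y + y * a2 y - v2 y" for y
  have da: "(a has_real_derivative a1 y) (at y)" "(a1 has_real_derivative a2 y) (at y)" if y: "y \<in> {0<..<1}" for y
    unfolding a_def[abs_def] a1_def[abs_def] a2_def
    by (rule derivative_eq_intros v1 v2 v3 y refl | simp add: algebra_simps)+
  have db: "(b has_real_derivative b1 y) (at y)" "(b1 has_real_derivative b2 y) (at y)" if y: "y \<in> {0<..<1}" for y
    unfolding b_def[abs_def] b1_def[abs_def] b2_def
    by (rule derivative_eq_intros v1 v2 da y refl | simp add: algebra_simps)+
  have ca: "continuous_on {0..1} a" unfolding a_def[abs_def] using cv1 v(1) by (intro continuous_intros)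
  have cb: "continuous_on {0..1} b" unfolding b_def[abs_def] using ca v(1) by (intro continuous_intros)
  \<comment> \<open>\<open>v2\<close> may be unbounded on the axis; with this factor it is
    continuous there, and so is \<open>a1\<close>.\<close>
  have cv2: "continuous_on {0..1} (\<lambda>y. (1 - y\<^sup>2) * v2 y)"
    by (rule continuous_sin_sq_mult[of 1]) (use v2_2 in \<open>simp add: eval_nat_numeral\<close>)
  have ca1: "continuous_on {0..1} a1" unfolding a1_def[abs_def]
    by (intro continuous_on_diff[OF continuous_on_diff[OF cv2]] continuous_intros cv1 v(1))
  have cb1: "continuous_on {0..1} b1" unfolding b1_def[abs_def] using ca ca1 cv1 by (intro continuous_intros)
  have ww: "wt 2 1 (\<lambda>y. (1 - y\<^sup>2) * v2 y)" "wt 1 (- 1) (\<lambda>y. (1 - y\<^sup>2) * v3 y)"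
    using wt_mult_sin_sq[OF v2_2] wt_mult_sin_sq[OF v3(2)] by simp_all
  have yv: "wt n e A \<Longrightarrow> wt n e (\<lambda>y. d * y * A y)" for n e A d
    using wt_mult[OF wt_cmult[OF wt_id[of n], of d], of e A] by simp
  have a1_2: "wt 2 0 a1"
    unfolding a1_def[abs_def]
    by (intro wt_diff yv wt_weaken[OF ww(1)] wt_le[OF v1_3] wt_le[OF v_3]) auto
  have a2_1: "wt 1 (- 1) a2"
    unfolding a2_def[abs_def]
    by (intro wt_diff yv wt_cmult ww(2) wt_le[OF v2_2] wt_weaken[OF wt_le[OF v1_3]]) auto
  have b2_1: "wt 1 (- 1) b2"
    unfolding b2_def[abs_def]
    using yv[OF a2_1, of 1]
    by (intro wt_diff wt_add wt_cmult wt_le[OF v2_2] wt_weaken[OF wt_le[OF a1_2]]) auto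

  \<comment> \<open>The radial equation solved for the pressure. Its \<open>F1\<close> cancels
    against the one in \<open>R2 = - 2 E - F1 + c\<close>, so \<open>P\<close> has a bounded
    derivative although \<open>F1'\<close> may be unbounded.\<close>
  define P where "P y = ((1 - y\<^sup>2) * v1 y - 2 * y * v y) - (1 - y\<^sup>2) * ((v y)\<^sup>2 + (k y)\<^sup>2) / 2 + E y - c / 2" for y
  define P1 where "P1 y = ((1 - y\<^sup>2) * v2 y - 4 * y * v1 y - 2 * v y)
     - ((1 - y\<^sup>2) * (v y * v1 y + k y * k1 y) - y * (v y * v y + k y * k y)) + (k y * W y - G y)" for y
  have dP: "(P has_real_derivative P1 y) (at y)" if y: "y \<in> {0<..<1}" for y
    unfolding P_def[abs_def] P1_def
    by (rule derivative_eq_intros v1 v2 k1 D(17) y refl | simp add: field_simps power2_eq_square)+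
  have cP: "continuous_on {0..1} P" unfolding P_def[abs_def] using cv1 v(1) D(4,5) by (intro continuous_intros) auto
  have vv: "wt 1 0 v1" "wt 1 0 v" "wt 1 0 k1" using wt_le[OF v1_3] wt_le[OF v_3] wt_le[OF k1_2] by auto
  have mm: "wt 1 0 A \<Longrightarrow> wt 1 0 B \<Longrightarrow> wt 1 0 (\<lambda>y. A y * B y)" for A B using wt_mult[of 1 0 A 0 B] by simp
  have ss: "wt 1 0 A \<Longrightarrow> wt 1 0 (\<lambda>y. (1 - y\<^sup>2) * A y)" for A
    using wt_weaken[OF wt_mult_sin_sq[of 1 0 A], of 0] by simp
  have P1_1: "wt 1 0 P1"
  proof -
    have p1: "wt 1 0 (\<lambda>y. (1 - y\<^sup>2) * v2 y)" by (rule wt_weaken[OF wt_le[OF ww(1)]]) auto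
    have p2: "wt 1 0 (\<lambda>y. 4 * y * v1 y)" by (rule yv[OF vv(1)])
    have p3: "wt 1 0 (\<lambda>y. 2 * v y)" by (rule wt_cmult[OF vv(2)])
    have p4: "wt 1 0 (\<lambda>y. (1 - y\<^sup>2) * (v y * v1 y + k y * k1 y))" by (intro ss wt_add mm vv k_1)
    have p5: "wt 1 0 (\<lambda>y. y * (v y * v y + k y * k y))"
      using yv[OF wt_add[OF mm[OF vv(2) vv(2)] mm[OF k_1 k_1]], of 1] by simp
    have p6: "wt 1 0 (\<lambda>y. k y * W y - G y)" by (intro wt_diff mm k_1 W_1 G(2))
    show ?thesis unfolding P1_def[abs_def]
      by (rule wt_add[OF wt_diff[OF wt_diff[OF wt_diff[OF p1 p2] p3] wt_diff[OF p4 p5]] p6])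
  qed

  have Hk: "W y = (1 - y\<^sup>2) * k1 y - 2 * y * k y"
     "W1 y = (1 - y\<^sup>2) * k2 y - 4 * y * k1 y - 2 * k y" if y: "y \<in> {0<..<1}" for y
  proof -
    have 1: "((\<lambda>y. (1 - y\<^sup>2) * k y) has_real_derivative (1 - y\<^sup>2) * k1 y - 2 * y * k y) (at y)" if "y \<in> {0<..<1}" for y
      by (rule derivative_eq_intros k1 that refl | simp add: algebra_simps)+
    have e: "W y = (1 - y\<^sup>2) * k1 y - 2 * y * k y" if y: "y \<in> {0<..<1}" for y
    proof (rule DERIV_unique[OF _ 1[OF y]])
      show "((\<lambda>y. (1 - y\<^sup>2) * k y) has_real_derivative W y) (at y)"
        by (rule has_field_derivative_transform_within_open[OF D(15)[OF y], of "{0<..<1}"]) (use y D(13) in auto)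
    qed
    show "W y = (1 - y\<^sup>2) * k1 y - 2 * y * k y" by (rule e[OF y])
    have 2: "((\<lambda>y. (1 - y\<^sup>2) * k1 y - 2 * y * k y) has_real_derivative (1 - y\<^sup>2) * k2 y - 4 * y * k1 y - 2 * k y) (at y)"
      by (rule derivative_eq_intros k1 k2 y refl | simp add: algebra_simps)+
    show "W1 y = (1 - y\<^sup>2) * k2 y - 4 * y * k1 y - 2 * k y"
    proof (rule DERIV_unique[OF _ 2])
      show "((\<lambda>y. (1 - y\<^sup>2) * k1 y - 2 * y * k y) has_real_derivative W1 y) (at y)"
        by (rule has_field_derivative_transform_within_open[OF W[OF y], of "{0<..<1}"]) (use y e in auto)
    qed
  qed
  \<comment> \<open>\<open>R2\<close> stems from the linear problem; uniqueness of derivatives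
    identifies it with the explicit second derivative of
    \<open>(1 - y\<^sup>2)\<^sup>2 (v1 + v\<^sup>2 / 2)\<close>.\<close>
  have R2_eq: "R2 y = (1 - y\<^sup>2)\<^sup>2 * (v3 y + (v1 y)\<^sup>2 + v y * v2 y) - 8 * y * (1 - y\<^sup>2) * (v2 y + v y * v1 y) + (12 * y\<^sup>2 - 4) * (v1 y + (v y)\<^sup>2 / 2)"
    if y: "y \<in> {0<..<1}" for y
  proof -
    define X where "X y = (1 - y\<^sup>2)\<^sup>2 * (v1 y + (v y)\<^sup>2 / 2)" for y
    define X1 where "X1 y = (1 - y\<^sup>2)\<^sup>2 * (v2 y + v y * v1 y) - 4 * y * (1 - y\<^sup>2) * (v1 y + (v y)\<^sup>2 / 2)" for y
    have X: "(X has_real_derivative X1 y) (at y)" if "y \<in> {0<..<1}" for y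
      unfolding X_def[abs_def] X1_def by (rule derivative_eq_intros v1 v2 that refl | simp add: field_simps)+
    have X1: "(X1 has_real_derivative (1 - y\<^sup>2)\<^sup>2 * (v3 y + (v1 y)\<^sup>2 + v y * v2 y) - 8 * y * (1 - y\<^sup>2) * (v2 y + v y * v1 y) + (12 * y\<^sup>2 - 4) * (v1 y + (v y)\<^sup>2 / 2)) (at y)"
      unfolding X1_def[abs_def]
      by (rule derivative_eq_intros v1 v2 v3 y refl | simp add: field_simps power2_eq_square)+
    have RX: "R y = X y" if "y \<in> {0<..<1}" for y using D(14)[of y] that by (simp add: X_def v1_def)
    have e: "R1 y = X1 y" if y: "y \<in> {0<..<1}" for y
      by (rule DERIV_unique[OF _ X[OF y]], rule has_field_derivative_transform_within_open[OF D(18)[OF y], of "{0<..<1}"])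
         (use y RX in auto)
    show ?thesis
      by (rule DERIV_unique[OF _ X1], rule has_field_derivative_transform_within_open[OF R1[OF y], of "{0<..<1}"])
         (use y e in auto)
  qed
  show thesis
  proof (rule that[OF v1_def v1 v2 v3(1) k1 k2 dP])
    show "Lk_profile (Suc (Suc 0)) 1 (\<lambda>y. (1 - y\<^sup>2) * v1 y - y * v y)"
      using Lk_profile_2_1[OF ca da(1) a1_2] by (simp add: a_def[abs_def])
    show "Lk_profile (Suc (Suc 0)) 1 k" by (rule Lk_profile_2_1[OF D(4) k1 k1_2])
    show "Lk_profile (Suc (Suc 0)) 0 (\<lambda>y. y * ((1 - y\<^sup>2) * v1 y - y * v y) - v y)"
      using Lk_profile_2_0[OF cb db(1) cb1 db(2) b2_1] by (simp add: a_def[abs_def] b_def[abs_def])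
    show "Lk_profile (Suc 0) 0 P" by (rule Lk_profile_1_0[OF cP dP P1_1])
    fix y :: real assume y: "y \<in> {0<..<1}"
    show "(1 - y\<^sup>2) * k2 y - 4 * y * k1 y - 2 * k y = - q y - v y * ((1 - y\<^sup>2) * k1 y - 2 * y * k y)"
      using Hk[OF y] by (simp add: W1_def)
    show "2 * ((1 - y\<^sup>2) * v1 y - 2 * y * v y)
      - ((1 - y\<^sup>2)\<^sup>2 * (v3 y + (v1 y)\<^sup>2 + v y * v2 y) - 8 * y * (1 - y\<^sup>2) * (v2 y + v y * v1 y) + (12 * y\<^sup>2 - 4) * (v1 y + (v y)\<^sup>2 / 2))
      - (1 - y\<^sup>2) * ((v y)\<^sup>2 + (k y)\<^sup>2) - 2 * P y = F1 y"
      unfolding R2_eq[OF y, symmetric] by (simp add: P_def R2_def field_simps)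
    show "((1 - y\<^sup>2) * v2 y - 4 * y * v1 y - 2 * v y) - ((1 - y\<^sup>2) * (v y * v1 y) - y * (v y)\<^sup>2)
      - y * (k y)\<^sup>2 - P1 y = G y"
      unfolding P1_def Hk(1)[OF y] by (simp add: algebra_simps power2_eq_square)
  qed
qed

section \<open>Axisymmetric fields and their profiles\<close>

lemma e_phi_eq: "e_phi \<phi> \<theta> = vector [cos \<phi> * cos \<theta>, cos \<phi> * sin \<theta>, - sin \<phi>]"
proof -
  have "(sin \<theta>)\<^sup>2 + (cos \<theta>)\<^sup>2 = 1" by simp
  then have "- (sin \<theta>) * (sin \<phi> * sin \<theta>) - cos \<theta> * (sin \<phi> * cos \<theta>) = - sin \<phi>" by algebra
  then show ?thesis
    unfolding vec_eq_iff forall_3 e_phi_def e_theta_def e_rho_def cross3_def by simp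
qed

lemma spherical_nth [simp]:
  "spherical \<rho> \<phi> \<theta> $ 1 = \<rho> * (sin \<phi> * cos \<theta>)" "spherical \<rho> \<phi> \<theta> $ 2 = \<rho> * (sin \<phi> * sin \<theta>)"
  "spherical \<rho> \<phi> \<theta> $ 3 = \<rho> * cos \<phi>"
  by (simp_all add: spherical_def e_rho_def)

lemma norm_spherical:
  assumes "0 < \<rho>" shows "norm (spherical \<rho> \<phi> \<theta>) = \<rho>"
proof -
  have "(sin \<phi>)\<^sup>2 + (cos \<phi>)\<^sup>2 = 1" "(sin \<theta>)\<^sup>2 + (cos \<theta>)\<^sup>2 = 1" by simp_all
  then have "(\<rho> * (sin \<phi> * cos \<theta>))\<^sup>2 + (\<rho> * (sin \<phi> * sin \<theta>))\<^sup>2 + (\<rho> * cos \<phi>)\<^sup>2 = \<rho>\<^sup>2" by algebra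
  then have "(norm (spherical \<rho> \<phi> \<theta>))\<^sup>2 = \<rho>\<^sup>2" unfolding norm_sq_3 spherical_nth .
  then show ?thesis using assms by simp
qed

lemma spherical_closed:
  assumes "0 < \<rho>" "\<phi> \<in> {0..pi/2}" shows "spherical \<rho> \<phi> \<theta> \<in> closed_half_space0"
proof -
  have "0 \<le> cos \<phi>" using assms by (intro cos_ge_zero) auto
  then show ?thesis using norm_spherical[OF assms(1), of \<phi> \<theta>] assms(1) by (auto simp: closed_half_space0_def)
qed

lemma frame_nth:
  "(p *\<^sub>R e_rho \<phi> \<theta> + q *\<^sub>R e_phi \<phi> \<theta> + r *\<^sub>R e_theta \<theta>) $ 1 = cos \<theta> * (p * sin \<phi> + q * cos \<phi>) - sin \<theta> * r"
  "(p *\<^sub>R e_rho \<phi> \<theta> + q *\<^sub>R e_phi \<phi> \<theta> + r *\<^sub>R e_theta \<theta>) $ 2 = sin \<theta> * (p * sin \<phi> + q * cos \<phi>) + cos \<theta> * r"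
  "(p *\<^sub>R e_rho \<phi> \<theta> + q *\<^sub>R e_phi \<phi> \<theta> + r *\<^sub>R e_theta \<theta>) $ 3 = p * cos \<phi> - q * sin \<phi>"
  by (simp_all add: e_rho_def e_phi_eq e_theta_def algebra_simps)

lemma closed_half_space0_spherical:
  assumes "x \<in> closed_half_space0"
  obtains \<theta> where "x = spherical (norm x) (arccos (x $ 3 / norm x)) \<theta>" "x $ 3 / norm x \<in> {0..1}"
    "sin (arccos (x $ 3 / norm x)) = axis_dist x / norm x" "0 < norm x"
    "arccos (x $ 3 / norm x) \<in> {0..pi/2}"
    "axis_dist x * cos \<theta> = x $ 1" "axis_dist x * sin \<theta> = x $ 2"
proof -
  have n: "0 < norm x" using assms by (auto simp: closed_half_space0_def)
  have sh: "x \<in> shell (norm x) (norm x)" using assms by (simp add: shell_def)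
  note h = shell_height[OF sh n]
  have s: "sin (arccos (x $ 3 / norm x)) = axis_dist x / norm x"
    using h by (simp add: sin_arccos colat_def)
  have "\<exists>\<theta>. axis_dist x * cos \<theta> = x $ 1 \<and> axis_dist x * sin \<theta> = x $ 2"
  proof (cases "axis_dist x = 0")
    case True
    then show ?thesis using axis_dist_components[of x] by auto
  next
    case False
    have "(x $ 1 / axis_dist x)\<^sup>2 + (x $ 2 / axis_dist x)\<^sup>2 = ((x $ 1)\<^sup>2 + (x $ 2)\<^sup>2) / (axis_dist x)\<^sup>2"
      by (simp add: power_divide add_divide_distrib)
    also have "\<dots> = 1" using False by (simp add: axis_dist_def)
    finally obtain t where "x $ 1 / axis_dist x = cos t" "x $ 2 / axis_dist x = sin t"
      using sincos_total_2pi by metis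
    then show ?thesis using False by (intro exI[of _ t]) (auto simp: field_simps)
  qed
  then obtain \<theta> where \<theta>: "axis_dist x * cos \<theta> = x $ 1" "axis_dist x * sin \<theta> = x $ 2" by blast
  have "x = spherical (norm x) (arccos (x $ 3 / norm x)) \<theta>"
    unfolding vec_eq_iff forall_3 spherical_nth s using h \<theta> n by simp
  moreover have "arccos (x $ 3 / norm x) \<in> {0..pi/2}"
    using h(2) arccos_lbound[of "x $ 3 / norm x"] arccos_le_mono[of "x $ 3 / norm x" 0] by auto
  ultimately show thesis using that h(2) s n \<theta> by blast
qed

lemma meridian_spherical: "y \<in> {0..1} \<Longrightarrow> spherical \<rho> (arccos y) 0 = \<rho> *\<^sub>R meridian y"
  unfolding vec_eq_iff forall_3 by (simp add: sin_arccos)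

lemma meridian_closed: "y \<in> {0..1} \<Longrightarrow> meridian y \<in> closed_half_space0"
  using norm_meridian[of y] by (auto simp: closed_half_space0_def simp del: norm_meridian)

text \<open>On the axis the horizontal frame vectors at \<open>\<theta> = 0\<close> and at
  \<open>\<theta> = \<pi>\<close> are opposite, while the point is the same.\<close>

lemma axisymmetric_on_axis:
  assumes "axisymmetric_field v" "0 < z"
  shows "v (vector [0, 0, z]) $ 1 = 0" "v (vector [0, 0, z]) $ 2 = 0"
proof -
  from assms(1) obtain v\<rho> v\<phi> v\<theta> where v: "\<And>\<rho> \<phi> \<theta>. 0 < \<rho> \<Longrightarrow> \<phi> \<in> {0..pi/2} \<Longrightarrow> v (spherical \<rho> \<phi> \<theta>) =
     v\<rho> \<rho> \<phi> *\<^sub>R e_rho \<phi> \<theta> + v\<phi> \<rho> \<phi> *\<^sub>R e_phi \<phi> \<theta> + v\<theta> \<rho> \<phi> *\<^sub>R e_theta \<theta>"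
    unfolding axisymmetric_field_def by blast
  have "spherical z 0 \<theta> = vector [0, 0, z]" for \<theta> unfolding vec_eq_iff forall_3 by simp
  with v[of z 0 0] v[of z 0 pi] assms(2) pi_gt_zero
  have "v (vector [0, 0, z]) = v\<rho> z 0 *\<^sub>R e_rho 0 0 + v\<phi> z 0 *\<^sub>R e_phi 0 0 + v\<theta> z 0 *\<^sub>R e_theta 0"
    "v (vector [0, 0, z]) = v\<rho> z 0 *\<^sub>R e_rho 0 pi + v\<phi> z 0 *\<^sub>R e_phi 0 pi + v\<theta> z 0 *\<^sub>R e_theta pi" by simp_all
  from arg_cong[OF this(1), of "\<lambda>w. w $ 1"] arg_cong[OF this(2), of "\<lambda>w. w $ 1"]
    arg_cong[OF this(1), of "\<lambda>w. w $ 2"] arg_cong[OF this(2), of "\<lambda>w. w $ 2"]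
  have "v (vector [0, 0, z]) $ 1 = v\<phi> z 0" "v (vector [0, 0, z]) $ 1 = - v\<phi> z 0"
    "v (vector [0, 0, z]) $ 2 = v\<theta> z 0" "v (vector [0, 0, z]) $ 2 = - v\<theta> z 0"
    unfolding frame_nth by simp_all
  then show "v (vector [0, 0, z]) $ 1 = 0" "v (vector [0, 0, z]) $ 2 = 0" by simp_all
qed

text \<open>Rotation and scaling recover the field from the meridian. The values of \<open>a\<close>
  and \<open>k\<close> at \<open>y = 1\<close> are multiplied by \<open>x $ 1 = x $ 2 = 0\<close>,
  which leaves them free for a continuous extension.\<close>

lemma axisymmetric_profile_field:
  assumes ax: "axisymmetric_field v" and hom: "homogeneous n v"
    and a: "\<And>y. y \<in> {0..<1} \<Longrightarrow> a y = v (meridian y) $ 1 / colat y"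
    and k: "\<And>y. y \<in> {0..<1} \<Longrightarrow> k y = v (meridian y) $ 2 / colat y"
    and b: "\<And>y. y \<in> {0..1} \<Longrightarrow> b y = v (meridian y) $ 3"
    and x: "x \<in> closed_half_space0"
  shows "v x = profile_field n a k b x"
proof -
  from ax obtain v\<rho> v\<phi> v\<theta> where v: "\<And>\<rho> \<phi> \<theta>. 0 < \<rho> \<Longrightarrow> \<phi> \<in> {0..pi/2} \<Longrightarrow> v (spherical \<rho> \<phi> \<theta>) =
     v\<rho> \<rho> \<phi> *\<^sub>R e_rho \<phi> \<theta> + v\<phi> \<rho> \<phi> *\<^sub>R e_phi \<phi> \<theta> + v\<theta> \<rho> \<phi> *\<^sub>R e_theta \<theta>"
    unfolding axisymmetric_field_def by blast
  obtain \<theta> where xs: "x = spherical (norm x) (arccos (x $ 3 / norm x)) \<theta>" and y01: "x $ 3 / norm x \<in> {0..1}"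
    and s: "sin (arccos (x $ 3 / norm x)) = axis_dist x / norm x" and n: "0 < norm x"
    and \<phi>: "arccos (x $ 3 / norm x) \<in> {0..pi/2}"
    and \<theta>: "axis_dist x * cos \<theta> = x $ 1" "axis_dist x * sin \<theta> = x $ 2"
    by (rule closed_half_space0_spherical[OF x])
  define \<rho> where "\<rho> = norm x"
  define y where "y = x $ 3 / \<rho>"
  have m: "v (\<rho> *\<^sub>R meridian y) = (\<rho> powi n) *\<^sub>R v (meridian y)"
    using hom meridian_closed[of y] y01 n unfolding homogeneous_def y_def \<rho>_def by blast
  define p q r where "p = v\<rho> \<rho> (arccos y)" and "q = v\<phi> \<rho> (arccos y)" and "r = v\<theta> \<rho> (arccos y)"
  have vx: "v x = p *\<^sub>R e_rho (arccos y) \<theta> + q *\<^sub>R e_phi (arccos y) \<theta> + r *\<^sub>R e_theta \<theta>"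
    using v[OF n \<phi>, of \<theta>] xs by (simp add: p_def q_def r_def y_def \<rho>_def)
  have vm: "(\<rho> powi n) *\<^sub>R v (meridian y) = p *\<^sub>R e_rho (arccos y) 0 + q *\<^sub>R e_phi (arccos y) 0 + r *\<^sub>R e_theta 0"
    unfolding m[symmetric] using v[OF n \<phi>, of 0] meridian_spherical[of y \<rho>] y01 by (simp add: p_def q_def r_def y_def \<rho>_def)
  have vm': "\<rho> powi n * v (meridian y) $ 1 = p * sin (arccos y) + q * cos (arccos y)"
    "\<rho> powi n * v (meridian y) $ 2 = r" "\<rho> powi n * v (meridian y) $ 3 = p * cos (arccos y) - q * sin (arccos y)"
    using arg_cong[OF vm, of "\<lambda>w. w $ 1"] arg_cong[OF vm, of "\<lambda>w. w $ 2"] arg_cong[OF vm, of "\<lambda>w. w $ 3"]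
    unfolding frame_nth by simp_all
  have vx': "v x $ 1 = cos \<theta> * (\<rho> powi n * v (meridian y) $ 1) - sin \<theta> * (\<rho> powi n * v (meridian y) $ 2)"
    "v x $ 2 = sin \<theta> * (\<rho> powi n * v (meridian y) $ 1) + cos \<theta> * (\<rho> powi n * v (meridian y) $ 2)"
    "v x $ 3 = \<rho> powi n * v (meridian y) $ 3"
    unfolding vx frame_nth vm' by simp_all
  have y': "y \<in> {0..1}" using y01 by (simp add: y_def \<rho>_def)
  have r0: "\<rho> \<noteq> 0" using n by (simp add: \<rho>_def)
  show ?thesis
  proof (cases "y = 1")
    case True
    have "axis_dist x = 0" using s n unfolding \<rho>_def[symmetric] y_def[symmetric] True by (simp add: \<rho>_def)
    then have x0: "x $ 1 = 0" "x $ 2 = 0" using \<theta> by auto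
    have "meridian 1 = vector [0, 0, 1]" unfolding vec_eq_iff forall_3 by simp
    then have "v (meridian y) $ 1 = 0" "v (meridian y) $ 2 = 0"
      using axisymmetric_on_axis[OF ax, of 1] True by simp_all
    then show ?thesis
      unfolding vec_eq_iff forall_3 vx' using b[OF y'] by (simp add: x0 zonal_def y_def \<rho>_def)
  next
    case False
    then have y1: "y \<in> {0..<1}" using y' by auto
    have c: "colat y = axis_dist x / \<rho>" using s y' by (simp add: sin_arccos colat_def y_def \<rho>_def)
    have pos: "0 < axis_dist x" using colat_pos[OF y1] n unfolding c \<rho>_def by (simp add: zero_less_divide_iff)
    have z: "axis_dist x * zonal (n - 1) a x = \<rho> powi n * v (meridian y) $ 1"
      "axis_dist x * zonal (n - 1) k x = \<rho> powi n * v (meridian y) $ 2"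
      using r0 pos unfolding zonal_def \<rho>_def[symmetric] y_def[symmetric] a[OF y1] k[OF y1] c
      by (simp_all add: power_int_diff)
    show ?thesis
      unfolding vec_eq_iff forall_3 vx' z[symmetric] profile_field_nth \<theta>[symmetric] zonal_def[of n b]
      using b[OF y'] by (simp add: y_def \<rho>_def mult_ac)
  qed
qed

text \<open>The radial and polar witnesses are the pair of horizontal radial and vertical components
  \<open>(S, T)\<close>, rotated by the polar angle.\<close>

lemma profile_field_axisymmetric:
  assumes "\<And>x. x \<in> closed_half_space0 \<Longrightarrow> u x = profile_field n a k b x"
  shows "axisymmetric_field u"
  unfolding axisymmetric_field_def
proof (intro exI allI impI ballI)
  fix \<rho> \<phi> \<theta> :: real assume h: "0 < \<rho>" "\<phi> \<in> {0..pi/2}"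
  let ?z = "\<lambda>n a. \<rho> powi n * a (cos \<phi>) :: real"
  note nr = norm_spherical[OF h(1), of \<phi> \<theta>]
  from assms[OF spherical_closed[OF h]] have u: "u (spherical \<rho> \<phi> \<theta>) = profile_field n a k b (spherical \<rho> \<phi> \<theta>)" .
  have z: "zonal m f (spherical \<rho> \<phi> \<theta>) = \<rho> powi m * f (cos \<phi>)" for m f
    using h by (simp add: zonal_def nr)
  have e: "p * sin \<phi> + q * cos \<phi> = S" "p * cos \<phi> - q * sin \<phi> = T"
    if "p = S * sin \<phi> + T * cos \<phi>" "q = S * cos \<phi> - T * sin \<phi>" for p q S T :: real
  proof -
    have "(sin \<phi>)\<^sup>2 + (cos \<phi>)\<^sup>2 = 1" by simp
    then show "p * sin \<phi> + q * cos \<phi> = S" "p * cos \<phi> - q * sin \<phi> = T" unfolding that by algebra+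
  qed
  define S T where "S = \<rho> * sin \<phi> * (\<rho> powi (n - 1) * a (cos \<phi>))" and "T = \<rho> powi n * b (cos \<phi>)"
  show "u (spherical \<rho> \<phi> \<theta>) =
     (\<rho> * sin \<phi> * (\<rho> powi (n - 1) * a (cos \<phi>)) * sin \<phi> + \<rho> powi n * b (cos \<phi>) * cos \<phi>) *\<^sub>R e_rho \<phi> \<theta>
     + (\<rho> * sin \<phi> * (\<rho> powi (n - 1) * a (cos \<phi>)) * cos \<phi> - \<rho> powi n * b (cos \<phi>) * sin \<phi>) *\<^sub>R e_phi \<phi> \<theta>
     + (\<rho> * sin \<phi> * (\<rho> powi (n - 1) * k (cos \<phi>))) *\<^sub>R e_theta \<theta>"
    unfolding vec_eq_iff forall_3 frame_nth u profile_field_nth z S_def[symmetric] T_def[symmetric] e[OF refl refl]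
    by (simp add: S_def T_def mult_ac)
qed

lemma profile_field_homogeneous:
  assumes "\<And>x. x \<in> closed_half_space0 \<Longrightarrow> u x = profile_field n a k b x"
  shows "homogeneous n u"
  unfolding homogeneous_def
proof (intro ballI allI impI)
  fix x :: "real^3" and s :: real assume x: "x \<in> closed_half_space0" and s: "0 < s"
  have sx: "s *\<^sub>R x \<in> closed_half_space0" using x s by (auto simp: closed_half_space0_def)
  have z: "zonal m f (s *\<^sub>R x) = s powi m * zonal m f x" for m f
    using s by (simp add: zonal_def power_int_mult_distrib)
  have sn: "s * s powi (n - 1) = s powi n" using s by (simp add: power_int_diff)
  have p: "s * c * (s powi (n - 1) * d) = s powi n * (c * d)" for c d
    unfolding sn[symmetric] by (simp only: mult_ac)
  then show "u (s *\<^sub>R x) = (s powi n) *\<^sub>R u x"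
    unfolding assms[OF x] assms[OF sx] vec_eq_iff forall_3
    by (simp add: z p right_diff_distrib distrib_left)
qed

lemma zonal_axisymmetric:
  assumes "\<And>x. x \<in> closed_half_space0 \<Longrightarrow> p x = zonal n P x"
  shows "axisymmetric_scalar p" "homogeneous n p"
proof -
  show "homogeneous n p"
    unfolding homogeneous_def
  proof (intro ballI allI impI)
    fix x :: "real^3" and s :: real assume x: "x \<in> closed_half_space0" and s: "0 < s"
    have "s *\<^sub>R x \<in> closed_half_space0" using x s by (auto simp: closed_half_space0_def)
    from assms[OF this] assms[OF x] s show "p (s *\<^sub>R x) = (s powi n) *\<^sub>R p x"
      by (simp add: zonal_def power_int_mult_distrib)
  qed
  show "axisymmetric_scalar p"
    unfolding axisymmetric_scalar_def
  proof (intro exI allI impI ballI)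
    fix \<rho> \<phi> \<theta> :: real assume h: "0 < \<rho>" "\<phi> \<in> {0..pi/2}"
    note nr = norm_spherical[OF h(1), of \<phi> \<theta>]
    from assms[OF spherical_closed[OF h]] show "p (spherical \<rho> \<phi> \<theta>) = \<rho> powi n * P (cos \<phi>)"
      using h by (simp add: zonal_def nr)
  qed
qed

lemma axisymmetric_zonal:
  assumes ax: "axisymmetric_scalar p" and hom: "homogeneous n p" and x: "x \<in> closed_half_space0"
  shows "p x = zonal n (\<lambda>y. p (meridian y)) x"
proof -
  from ax obtain P where P: "\<And>\<rho> \<phi> \<theta>. 0 < \<rho> \<Longrightarrow> \<phi> \<in> {0..pi/2} \<Longrightarrow> p (spherical \<rho> \<phi> \<theta>) = P \<rho> \<phi>"
    unfolding axisymmetric_scalar_def by blast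
  obtain \<theta> where xs: "x = spherical (norm x) (arccos (x $ 3 / norm x)) \<theta>" and y: "x $ 3 / norm x \<in> {0..1}"
    and n: "0 < norm x" and \<phi>: "arccos (x $ 3 / norm x) \<in> {0..pi/2}"
    using closed_half_space0_spherical[OF x] by metis
  have "p x = p (spherical (norm x) (arccos (x $ 3 / norm x)) 0)" using P[OF n \<phi>] xs by metis
  also have "\<dots> = p (norm x *\<^sub>R meridian (x $ 3 / norm x))" by (simp only: meridian_spherical[OF y])
  also have "\<dots> = norm x powi n * p (meridian (x $ 3 / norm x))"
    using hom meridian_closed[OF y] n unfolding homogeneous_def by auto
  finally show ?thesis by (simp add: zonal_def)
qed

lemma swirl_free_profile:
  assumes "\<And>x. x \<in> closed_half_space0 \<Longrightarrow> u x = profile_field n a k b x" "\<And>y. y \<in> {0..<1} \<Longrightarrow> k y = 0"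
  shows "swirl_free u"
  unfolding swirl_free_def
proof (intro allI impI ballI)
  fix \<rho> \<phi> \<theta> :: real assume h: "0 < \<rho>" "\<phi> \<in> {0..pi/2}"
  note nr = norm_spherical[OF h(1), of \<phi> \<theta>]
  have c0: "0 \<le> cos \<phi>" using h by (intro cos_ge_zero) auto
  from assms(1)[OF spherical_closed[OF h]] have u: "u (spherical \<rho> \<phi> \<theta>) = profile_field n a k b (spherical \<rho> \<phi> \<theta>)" .
  have z: "zonal m f (spherical \<rho> \<phi> \<theta>) = \<rho> powi m * f (cos \<phi>)" for m f
    using h by (simp add: zonal_def nr)
  define S K where "S = \<rho> * sin \<phi> * (\<rho> powi (n - 1) * a (cos \<phi>))" and "K = \<rho> * sin \<phi> * (\<rho> powi (n - 1) * k (cos \<phi>))"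
  have us: "u (spherical \<rho> \<phi> \<theta>) $ 1 = cos \<theta> * S - sin \<theta> * K" "u (spherical \<rho> \<phi> \<theta>) $ 2 = sin \<theta> * S + cos \<theta> * K"
    unfolding u profile_field_nth z by (simp_all add: S_def K_def)
  have "(sin \<theta>)\<^sup>2 + (cos \<theta>)\<^sup>2 = 1" by simp
  then have "(cos \<theta> * S - sin \<theta> * K) * (- sin \<theta>) + (sin \<theta> * S + cos \<theta> * K) * cos \<theta> = K" by algebra
  then have "u (spherical \<rho> \<phi> \<theta>) \<bullet> e_theta \<theta> = K"
    unfolding inner_vec_def sum_3 us by (simp add: e_theta_def)
  also have "\<dots> = 0"
  proof (cases "\<phi> = 0")
    case False
    then have "cos \<phi> < cos 0" using h pi_gt_zero by (intro cos_monotone_0_pi) auto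
    then show ?thesis using assms(2)[of "cos \<phi>"] c0 by (simp add: K_def)
  qed (simp add: K_def)
  finally show "u (spherical \<rho> \<phi> \<theta>) \<bullet> e_theta \<theta> = 0" .
qed

lemma swirl_free_meridian:
  assumes "swirl_free F" "y \<in> {0..1}" shows "F (meridian y) $ 2 = 0"
proof -
  have "arccos y \<in> {0..pi/2}" using assms(2) arccos_lbound[of y] arccos_le_mono[of y 0] by auto
  with assms(1) have "F (spherical 1 (arccos y) 0) \<bullet> e_theta 0 = 0" unfolding swirl_free_def by auto
  then show ?thesis using meridian_spherical[OF assms(2), of 1] by (simp add: inner_vec_def sum_3 e_theta_def)
qed

section \<open>Differentiating profiles; the profiles of the forcing\<close>

lemma DERIV_colat: "y \<in> {0<..<1} \<Longrightarrow> (colat has_real_derivative - y / colat y) (at y)"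
  unfolding colat_def[abs_def]
  by (rule derivative_eq_intros refl | use unit_sq_pos[of y] in \<open>simp add: field_simps\<close>)+

lemma continuous_on_colat: "continuous_on A colat"
  unfolding colat_def[abs_def] by (intro continuous_intros)

text \<open>The profiles are differentiated along the vertical line through \<open>(1, 0, 0)\<close>, where only the
  third partial derivative of the field enters.\<close>

definition vline :: "real \<Rightarrow> real^3" where
  "vline y = vector [1, 0, y / colat y]"

lemma meridian_vline: "y \<in> {0..<1} \<Longrightarrow> meridian y = colat y *\<^sub>R vline y"
  using colat_pos[of y] unfolding vec_eq_iff forall_3 by (simp add: vline_def colat_def[symmetric])

lemma vline_closed: "y \<in> {0..<1} \<Longrightarrow> vline y \<in> closed_half_space0"
  using colat_pos[of y] by (simp add: vline_def closed_half_space0_def vec_eq_iff exI[of _ 1])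

text \<open>The exponent \<open>m\<close> absorbs the degree of homogeneity and a possible division
  by \<open>colat\<close>. The result consists of terms of the same shape, so the rule can be
  iterated; the shift by 3 comes from the derivative \<open>1 / colat y ^ 3\<close> of
  \<open>y / colat y\<close>.\<close>

lemma DERIV_vline:
  fixes f g :: "real^3 \<Rightarrow> real"
  assumes f: "\<And>x. x \<in> half_space \<Longrightarrow> has_partial 3 f (g x) x" and y: "y \<in> {0<..<1}"
  shows "((\<lambda>y. colat y powi m * f (vline y)) has_real_derivative
    - of_int m * y * (colat y powi (m - 2) * f (vline y)) + colat y powi (m - 3) * g (vline y)) (at y)"
proof -
  have c: "0 < colat y" using colat_pos[of y] y by auto
  have hs: "vline y \<in> half_space" using c y by (auto simp: half_space_def vline_def)
  let ?l = "\<lambda>z. vector [1, 0, z] :: real^3"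
  have e: "?l (z + t) = ?l z + t *\<^sub>R axis 3 1" for z t :: real
    unfolding vec_eq_iff forall_3 by (simp add: axis_def)
  have "((\<lambda>t. f (?l (y / colat y + t))) has_real_derivative g (vline y)) (at 0)"
    using f[OF hs] unfolding has_partial_def e has_real_derivative_iff_has_vector_derivative by (simp add: vline_def)
  then have 1: "((\<lambda>z. f (?l z)) has_real_derivative g (vline y)) (at (y / colat y))"
    using DERIV_shift[of "\<lambda>z. f (?l z)" "g (vline y)" 0 "y / colat y"] by (simp add: add.commute)
  have sq: "(colat y)\<^sup>2 + y\<^sup>2 = 1" using colat_sq[of y] y by simp
  have 2: "((\<lambda>y. y / colat y) has_real_derivative 1 / colat y ^ 3) (at y)"
  proof -
    have "((\<lambda>y. y / colat y) has_real_derivative (1 * colat y - y * (- y / colat y)) / (colat y * colat y)) (at y)"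
      by (rule DERIV_divide[OF DERIV_ident DERIV_colat[OF y]]) (use c in simp)
    moreover have "(1 * colat y - y * (- y / colat y)) / (colat y * colat y) = ((colat y)\<^sup>2 + y\<^sup>2) / colat y ^ 3"
      using c by (simp add: field_simps power2_eq_square power3_eq_cube)
    ultimately show ?thesis unfolding sq by simp
  qed
  have 3: "((\<lambda>y. f (vline y)) has_real_derivative g (vline y) * (1 / colat y ^ 3)) (at y)"
    unfolding vline_def[of "_ :: real", abs_def] using DERIV_chain2[OF 1 2] by (simp add: vline_def)
  have 4: "((\<lambda>y. colat y powi m) has_real_derivative of_int m * colat y powi (m - 1) * (- y / colat y)) (at y)"
    using c by (auto intro!: derivative_eq_intros DERIV_colat y)
  have p: "colat y powi (m - 1) = colat y powi m / colat y" "colat y powi (m - 2) = colat y powi m / (colat y)\<^sup>2"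
     "colat y powi (m - 3) = colat y powi m / colat y ^ 3"
    using c by (simp_all add: power_int_diff)
  show ?thesis
    by (rule DERIV_cong[OF DERIV_mult[OF 4 3]]) (use c in \<open>simp add: p field_simps power2_eq_square\<close>)
qed

lemma vline_twice_differentiable:
  fixes f g h :: "real^3 \<Rightarrow> real"
  assumes "\<And>x. x \<in> half_space \<Longrightarrow> has_partial 3 f (g x) x" "\<And>x. x \<in> half_space \<Longrightarrow> has_partial 3 g (h x) x"
  obtains A1 A2 where "\<And>y. y \<in> {0<..<1} \<Longrightarrow> ((\<lambda>y. colat y powi m * f (vline y)) has_real_derivative A1 y) (at y)"
    "\<And>y. y \<in> {0<..<1} \<Longrightarrow> (A1 has_real_derivative A2 y) (at y)"
proof (rule that[OF DERIV_vline[OF assms(1)]], assumption, assumption)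
  fix y :: real assume y: "y \<in> {0<..<1}"
  show "((\<lambda>y. - of_int m * y * (colat y powi (m - 2) * f (vline y)) + colat y powi (m - 3) * g (vline y)) has_real_derivative
     (- of_int m * y * (- of_int (m - 2) * y * (colat y powi (m - 2 - 2) * f (vline y)) + colat y powi (m - 2 - 3) * g (vline y))
      + - of_int m * (colat y powi (m - 2) * f (vline y)))
     + (- of_int (m - 3) * y * (colat y powi (m - 3 - 2) * g (vline y)) + colat y powi (m - 3 - 3) * h (vline y))) (at y)"
    by (rule DERIV_add[OF DERIV_mult'[OF _ DERIV_vline[OF assms(1) y]] DERIV_vline[OF assms(2) y]])
       (auto intro!: derivative_eq_intros)
qed

lemma continuous_on_meridian: "continuous_on {0..1} meridian"
proof -
  have "continuous_on {0..1} (\<lambda>y. \<chi> i. meridian y $ i)"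
  proof (rule continuous_on_vec_lambda)
    have "\<forall>i. continuous_on {0..1} (\<lambda>y. meridian y $ i)"
      unfolding forall_3 meridian_nth by (intro conjI continuous_intros)
    then show "continuous_on {0..1} (\<lambda>y. meridian y $ i)" for i by blast
  qed
  then show ?thesis by (simp add: vec_lambda_eta)
qed

lemma meridian_comp_bounded:
  fixes f :: "real^3 \<Rightarrow> real^3"
  assumes "continuous_on closed_half_space0 f"
  shows "continuous_on {0..1} (\<lambda>y. f (meridian y) $ j)" "wt 0 0 (\<lambda>y. f (meridian y) $ j)"
proof -
  show c: "continuous_on {0..1} (\<lambda>y. f (meridian y) $ j)"
    by (intro continuous_intros continuous_on_compose2[OF assms continuous_on_meridian])
       (use meridian_closed in auto)
  show "wt 0 0 (\<lambda>y. f (meridian y) $ j)" by (rule wt_bounded_continuous[OF c])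
qed

lemma meridian_1: "meridian 1 = vector [0, 0, 1]"
  unfolding vec_eq_iff forall_3 by simp

text \<open>Central projection onto the plane \<open>x $ 3 = 1\<close>: by homogeneity
  \<open>f (meridian y)\<close> is \<open>y powi n\<close> times the value of \<open>f\<close> at
  \<open>(colat y / y, 0, 1)\<close>, so the quotient becomes a difference quotient at the
  pole.\<close>

lemma horizontal_profile_limit:
  fixes f :: "real^3 \<Rightarrow> real"
  assumes d: "has_partial 1 f L (meridian 1)" and f0: "f (meridian 1) = 0"
    and hom: "\<And>x s. x \<in> closed_half_space0 \<Longrightarrow> 0 < s \<Longrightarrow> f (s *\<^sub>R x) = s powi n * f x"
  shows "((\<lambda>y. f (meridian y) / colat y) \<longlongrightarrow> L) (at_left 1)"
proof -
  let ?l = "\<lambda>t. meridian 1 + t *\<^sub>R axis 1 1 :: real^3"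
  have "((\<lambda>t. f (?l t)) has_real_derivative L) (at 0)"
    using d by (simp add: has_partial_def has_real_derivative_iff_has_vector_derivative)
  then have q: "((\<lambda>t. f (?l t) / t) \<longlongrightarrow> L) (at 0)"
    by (simp add: has_field_derivative_iff f0)
  have ev: "\<forall>\<^sub>F y in at_left (1::real). y \<in> {0<..<1}" by (rule eventually_at_leftI[of 0]) auto
  have "((\<lambda>y. sqrt (1 - y\<^sup>2) / y) \<longlongrightarrow> sqrt (1 - 1\<^sup>2) / 1) (at_left (1::real))" by (intro tendsto_intros) auto
  then have "((\<lambda>y. colat y / y) \<longlongrightarrow> 0) (at_left 1)" by (simp add: colat_def[abs_def])
  moreover have "\<forall>\<^sub>F y in at_left 1. colat y / y \<noteq> 0"
    using ev by eventually_elim (use colat_pos in \<open>auto simp: less_imp_neq[symmetric]\<close>)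
  ultimately have "filterlim (\<lambda>y. colat y / y) (at 0) (at_left 1)" by (simp add: filterlim_at)
  from filterlim_compose[OF q this]
  have 1: "((\<lambda>y. f (?l (colat y / y)) / (colat y / y)) \<longlongrightarrow> L) (at_left 1)" .
  have "((\<lambda>y. y powi (n - 1)) \<longlongrightarrow> 1 powi (n - 1)) (at_left (1::real))" by (intro tendsto_intros) auto
  from tendsto_mult[OF this 1]
  have 2: "((\<lambda>y. y powi (n - 1) * (f (?l (colat y / y)) / (colat y / y))) \<longlongrightarrow> L) (at_left 1)" by simp
  show ?thesis
  proof (rule Lim_transform_eventually[OF 2], rule eventually_mono[OF ev])
    fix y :: real assume y: "y \<in> {0<..<1}"
    have m: "meridian y = y *\<^sub>R ?l (colat y / y)"
      using y unfolding vec_eq_iff forall_3 by (simp add: axis_def colat_def)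
    have "?l (colat y / y) $ 3 = 1" by (simp add: axis_def)
    then have "?l (colat y / y) \<in> closed_half_space0"
      unfolding closed_half_space0_def by (metis (mono_tags, lifting) mem_Collect_eq zero_index zero_le_one zero_neq_one)
    from hom[OF this, of y] have "f (meridian y) = y powi n * f (?l (colat y / y))" unfolding m using y by simp
    then show "y powi (n - 1) * (f (?l (colat y / y)) / (colat y / y)) = f (meridian y) / colat y"
      using y by (simp add: power_int_diff)
  qed
qed

lemma wt_0E:
  assumes "wt 0 0 f"
  obtains C where "\<And>y. y \<in> {0<..<1} \<Longrightarrow> \<bar>f y\<bar> \<le> C"
proof -
  from assms obtain C where "\<forall>y\<in>{0<..<1}. \<bar>f y\<bar> \<le> C" unfolding wt_0_iff by auto
  then show thesis by (intro that[of C]) blast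
qed

lemma sup_norm_le: "sup_norm A f \<le> ereal c \<longleftrightarrow> (\<forall>x\<in>A. norm (f x) \<le> c)"
  by (simp add: sup_norm_def SUP_le_iff)

text \<open>The weights come from the partial derivatives of \<open>F\<close> being continuous up to
  the axis, the smallness from the curl alone; \<open>F\<close> itself may be large.\<close>

lemma forcing_profiles:
  assumes ax: "axisymmetric_field F" and hom: "homogeneous (- 3) F" and C1: "C_k 1 F"
    and small: "sup_norm open_half_sphere_angles (tangential_part (curl F)) \<le> ereal \<epsilon>"
  obtains FA FK FB F1' where
    "\<And>x. x \<in> closed_half_space0 \<Longrightarrow> F x = profile_field (- 3) FA FK FB x"
    "\<And>y. y \<in> {0..<1} \<Longrightarrow> FK y = F (meridian y) $ 2 / colat y"
    "continuous_on {0..1} FK" "continuous_on {0..1} (\<lambda>y. y * FA y - FB y)" "continuous_on {0..1} (\<lambda>y. (1 - y\<^sup>2) * FA y + y * FB y)"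
    "\<And>y. y \<in> {0<..<1} \<Longrightarrow> ((\<lambda>y. (1 - y\<^sup>2) * FA y + y * FB y) has_real_derivative F1' y) (at y)"
    "wt 1 0 FK" "wt 1 0 (\<lambda>y. y * FA y - FB y)"
    "\<And>y. y \<in> {0<..<1} \<Longrightarrow> \<bar>FK y\<bar> \<le> \<epsilon> / 2 * (1 / sqrt (1 - y\<^sup>2))"
    "\<And>y. y \<in> {0<..<1} \<Longrightarrow> \<bar>2 * (y * FA y - FB y) - F1' y\<bar> \<le> \<epsilon> / sqrt (1 - y\<^sup>2)"
proof -
  from C1 have cF: "continuous_on closed_half_space0 F"
    and "\<forall>i. \<exists>g. continuous_on closed_half_space0 g \<and> (\<forall>x\<in>half_space. has_partial i F (g x) x)"
    by (simp_all add: has_partial_def)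
  then obtain g where g: "\<And>i. continuous_on closed_half_space0 (g i)" "\<And>i x. x \<in> half_space \<Longrightarrow> has_partial i F (g i x) x"
    by metis
  \<comment> \<open>At the pole the profile is filled in with the horizontal derivative, which is
    the limit of the quotient.\<close>
  define prof where "prof j y = (if y = 1 then g 1 (meridian 1) $ j else F (meridian y) $ j / colat y)" for j y
  define FA FK FB where "FA = prof 1" and "FK = prof 2" and "FB y = F (meridian y) $ 3" for y
  have F: "F x = profile_field (- 3) FA FK FB x" if "x \<in> closed_half_space0" for x
    by (rule axisymmetric_profile_field[OF ax hom _ _ _ that]) (auto simp: FA_def FK_def FB_def prof_def)
  have homj: "F (s *\<^sub>R x) $ j = s powi (- 3) * F x $ j" if "x \<in> closed_half_space0" "0 < s" for s x j
    using hom that unfolding homogeneous_def by auto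
  have m1: "meridian 1 \<in> half_space" by (simp add: half_space_def)
  have prof_c: "continuous_on {0..1} (prof j)" if j: "j = 1 \<or> j = 2" for j
  proof -
    have "F (meridian 1) $ j = 0" using axisymmetric_on_axis[OF ax, of 1] j by (auto simp: meridian_1)
    then have l: "((\<lambda>y. F (meridian y) $ j / colat y) \<longlongrightarrow> g 1 (meridian 1) $ j) (at_left 1)"
      by (intro horizontal_profile_limit[where n = "- 3"] has_partial_vec_nth g m1 homj)
    have "continuous_on {0..<1} (\<lambda>y. F (meridian y) $ j / colat y)"
      using colat_pos by (intro continuous_on_divide continuous_on_colat continuous_on_subset[OF meridian_comp_bounded(1)[OF cF]])
        (auto simp: less_imp_neq[symmetric])
    from continuous_on_extend_at_1[OF this l] show ?thesis by (simp add: prof_def[abs_def])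
  qed
  have cA: "continuous_on {0..1} FA" and cK: "continuous_on {0..1} FK" and cB: "continuous_on {0..1} FB"
    using prof_c meridian_comp_bounded(1)[OF cF] by (auto simp: FA_def FK_def FB_def[abs_def])
  have vl: "F (meridian y) $ j = colat y powi (- 3) * F (vline y) $ j" if "y \<in> {0..<1}" for y j
    unfolding meridian_vline[OF that] by (rule homj[OF vline_closed[OF that] colat_pos[OF that]])
  have dj: "\<exists>D. \<forall>y\<in>{0<..<1}. ((\<lambda>y. colat y powi m * F (vline y) $ j) has_real_derivative D y) (at y)" for m j
    by (intro exI ballI, rule DERIV_vline[where f = "\<lambda>x. F x $ j" and g = "\<lambda>x. g 3 x $ j"])
       (rule has_partial_vec_nth g | assumption)+
  have dprof: "\<exists>D. \<forall>y\<in>{0<..<1}. (prof j has_real_derivative D y) (at y)" for j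
  proof -
    obtain D where D: "\<forall>y\<in>{0<..<1}. ((\<lambda>y. colat y powi (- 4) * F (vline y) $ j) has_real_derivative D y) (at y)" using dj by blast
    have "(prof j has_real_derivative D y) (at y)" if y: "y \<in> {0<..<1}" for y
    proof (rule has_field_derivative_transform_within_open[OF bspec[OF D y], of "{0<..<1}"])
      fix t :: real assume t: "t \<in> {0<..<1}"
      then have "0 < colat t" using colat_pos[of t] by auto
      then show "colat t powi (- 4) * F (vline t) $ j = prof j t"
        using t vl[of t j] power_int_add[of "colat t" "- 3" "- 1"] by (simp add: prof_def divide_inverse)
    qed (use y in auto)
    then show ?thesis by blast
  qed
  obtain FA1 where FA1: "\<And>y. y \<in> {0<..<1} \<Longrightarrow> (FA has_real_derivative FA1 y) (at y)" using dprof unfolding FA_def by blast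
  obtain FK1 where FK1: "\<And>y. y \<in> {0<..<1} \<Longrightarrow> (FK has_real_derivative FK1 y) (at y)" using dprof unfolding FK_def by blast
  obtain FB1 where FB1: "\<And>y. y \<in> {0<..<1} \<Longrightarrow> (FB has_real_derivative FB1 y) (at y)"
  proof -
    obtain D where D: "\<forall>y\<in>{0<..<1}. ((\<lambda>y. colat y powi (- 3) * F (vline y) $ 3) has_real_derivative D y) (at y)" using dj by blast
    have "(FB has_real_derivative D y) (at y)" if y: "y \<in> {0<..<1}" for y
      by (rule has_field_derivative_transform_within_open[OF bspec[OF D y], of "{0<..<1}"])
         (use y vl in \<open>auto simp: FB_def\<close>)
    then show thesis by (rule that)
  qed
  have Foff: "F z = profile_field (- 3) FA FK FB z" if "z \<in> offaxis" for z
    using F offaxis_half_space half_space_closed that by blast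
  \<comment> \<open>The partial derivatives, known to be continuous, are rewritten in terms of the
    profiles on the meridian.\<close>
  have pt: "g i (meridian y) =
    (vector [colat y * zonal_partial i (- 4) FA FA1 (meridian y) + (if i = 1 then 1 else 0) * FA y - (if i = 2 then 1 else 0) * FK y,
      (if i = 2 then 1 else 0) * FA y + (colat y * zonal_partial i (- 4) FK FK1 (meridian y) + (if i = 1 then 1 else 0) * FK y),
      zonal_partial i (- 3) FB FB1 (meridian y)] :: real^3)" if y: "y \<in> {0<..<1}" for i y
  proof -
    have y': "y \<in> {0..1}" using y by auto
    show ?thesis
      using has_partial_unique[OF g(2)[OF offaxis_half_space[OF meridian_offaxis[OF y]], of i]
        has_partial_profile_field[OF Foff meridian_offaxis[OF y] FA1 FK1 FB1, of i]]
      by (simp add: zonal_meridian[OF y'] colat_def)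
  qed
  have zp: "zonal_partial i n A A1 (meridian y) = (if i = 1 then colat y else if i = 2 then 0 else y) * (of_int n * A y - y * A1 y)
      + (if i = 3 then A1 y else 0)" if "y \<in> {0<..<1}" for i n A A1 y
    using that exhaust_3[of i] by (auto simp: zonal_partial_def colat_def)
  have horiz: "wt 1 0 (prof j)" if j: "j = 1 \<or> j = 2"
    and D: "\<And>y. y \<in> {0<..<1} \<Longrightarrow> (prof j has_real_derivative D y) (at y)"
    and g1: "\<And>y. y \<in> {0<..<1} \<Longrightarrow> g 1 (meridian y) $ j = (colat y)\<^sup>2 * (- 4 * prof j y - y * D y) + prof j y"
    and g3: "\<And>y. y \<in> {0<..<1} \<Longrightarrow> g 3 (meridian y) $ j = colat y * (y * (- 4 * prof j y - y * D y) + D y)" for j D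
  proof -
    \<comment> \<open>A combination of continuous functions in which the undifferentiated terms
      cancel and \<open>y\<^sup>2 + (colat y)\<^sup>2 = 1\<close> leaves exactly
      \<open>(colat y)\<^sup>2 D y\<close>, without any division by \<open>y\<close>.\<close>
    define Z where "Z y = y * (prof j y - 4 * (colat y)\<^sup>2 * prof j y - g 1 (meridian y) $ j)
      + colat y * (g 3 (meridian y) $ j + 4 * y * colat y * prof j y)" for y
    have "continuous_on {0..1} Z"
      unfolding Z_def by (intro continuous_intros prof_c j continuous_on_colat meridian_comp_bounded g)
    from wt_bounded_continuous[OF this] obtain C where C: "\<And>y. y \<in> {0<..<1} \<Longrightarrow> \<bar>Z y\<bar> \<le> C"
      by (rule wt_0E) (rule that, blast)
    have b: "(colat y)\<^sup>2 * \<bar>D y\<bar> \<le> C" if y: "y \<in> {0<..<1}" for y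
    proof -
      have "(colat y)\<^sup>2 + y\<^sup>2 = 1" using colat_sq[of y] y by simp
      then have "Z y = (colat y)\<^sup>2 * D y"
        unfolding Z_def g1[OF y] g3[OF y] by (simp add: algebra_simps power2_eq_square)
      with C[OF y] show ?thesis by (simp add: abs_mult)
    qed
    have "wt 0 (0 - 2) D"
    proof (rule wt_0I[of _ C])
      fix y :: real assume y: "y \<in> {0<..<1}"
      then have "0 < colat y" using colat_pos[of y] by auto
      then show "\<bar>D y\<bar> \<le> C * colat y powi (0 - 2)"
        using b[OF y] by (simp add: power_int_def power_inverse[symmetric] field_simps)
    qed
    then show ?thesis unfolding One_nat_def
      by (intro wt_SucI[OF wt_bounded_continuous[OF prof_c[OF j]] continuous_on_Icc_Ico[OF prof_c[OF j]] D])
  qed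
  have wK: "wt 1 0 FK" unfolding FK_def
    by (rule horiz[OF _ FK1[unfolded FK_def]])
       (auto simp: pt zp FK_def power2_eq_square algebra_simps)
  have wA: "wt 1 0 FA" unfolding FA_def
    by (rule horiz[OF _ FA1[unfolded FA_def]])
       (auto simp: pt zp FA_def power2_eq_square algebra_simps)
  have wB: "wt 1 0 FB"
  proof -
    \<comment> \<open>The same cancellation in the vertical component leaves
      \<open>colat y FB1 y\<close>.\<close>
    define Z where "Z y = - y * (g 1 (meridian y) $ 3 + 3 * colat y * FB y) + colat y * (g 3 (meridian y) $ 3 + 3 * y * FB y)" for y
    have "continuous_on {0..1} Z"
      unfolding Z_def by (intro continuous_intros cB continuous_on_colat meridian_comp_bounded g)
    from wt_bounded_continuous[OF this] obtain C where C: "\<And>y. y \<in> {0<..<1} \<Longrightarrow> \<bar>Z y\<bar> \<le> C"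
      by (rule wt_0E) (rule that, blast)
    have b: "colat y * \<bar>FB1 y\<bar> \<le> C" if y: "y \<in> {0<..<1}" for y
    proof -
      have sq: "(colat y)\<^sup>2 + y\<^sup>2 = 1" using colat_sq[of y] y by simp
      have g1: "g 1 (meridian y) $ 3 = colat y * (- 3 * FB y - y * FB1 y)" and g3: "g 3 (meridian y) $ 3 = y * (- 3 * FB y - y * FB1 y) + FB1 y"
        using y by (simp_all add: pt zp)
      have "Z y = colat y * FB1 y"
        unfolding Z_def g1 g3 by (simp add: algebra_simps)
      with C[OF y] show ?thesis using colat_pos[of y] y by (simp add: abs_mult)
    qed
    have w: "wt 0 (- 1) FB1"
    proof (rule wt_0I[of _ C])
      fix y :: real assume y: "y \<in> {0<..<1}"
      then have "0 < colat y" using colat_pos[of y] by auto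
      then show "\<bar>FB1 y\<bar> \<le> C * colat y powi (- 1)"
        using b[OF y] by (simp add: power_int_def field_simps)
    qed
    show ?thesis unfolding One_nat_def
      by (rule wt_SucI[OF wt_bounded_continuous[OF cB] continuous_on_Icc_Ico[OF cB] FB1 wt_weaken[OF w]]) auto
  qed
  define F1' where "F1' y = (1 - y\<^sup>2) * FA1 y - 2 * y * FA y + (y * FB1 y + FB y)" for y
  have dF1: "((\<lambda>y. (1 - y\<^sup>2) * FA y + y * FB y) has_real_derivative F1' y) (at y)" if "y \<in> {0<..<1}" for y
    unfolding F1'_def by (rule derivative_eq_intros FA1 FB1 that refl | simp add: algebra_simps)+
  have curl: "\<bar>2 * colat y * FK y\<bar> \<le> \<epsilon>" "\<bar>colat y * (2 * (y * FA y - FB y) - F1' y)\<bar> \<le> \<epsilon>" if y: "y \<in> {0<..<1}" for y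
  proof -
    have sq: "(colat y)\<^sup>2 + y\<^sup>2 = 1" using colat_sq[of y] y by simp
    have p: "partial i F (meridian y) = g i (meridian y)" for i
      by (rule partial_eqI[OF g(2)[OF offaxis_half_space[OF meridian_offaxis[OF y]]]])
    define \<phi> where "\<phi> = arccos y"
    have \<phi>: "0 \<le> \<phi>" "\<phi> < pi / 2" using y arccos_lbound[of y] arccos_less_arccos[of 0 y] by (auto simp: \<phi>_def)
    have cs: "cos \<phi> = y" "sin \<phi> = colat y" using y by (simp_all add: \<phi>_def sin_arccos colat_def)
    define w where "w = curl F (meridian y)"
    have sp: "spherical 1 \<phi> 0 = meridian y" using meridian_spherical[of y 1] y by (simp add: \<phi>_def)
    \<comment> \<open>One point on each circle of latitude suffices; at longitude 0 the frame is
      \<open>e_phi = (y, 0, - colat y)\<close> and \<open>e_theta = (0, 1, 0)\<close>.\<close>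
    have "(\<phi>, 0) \<in> open_half_sphere_angles" using \<phi> by (simp add: open_half_sphere_angles_def)
    with small have tp: "norm (tangential_part (curl F) (\<phi>, 0)) \<le> \<epsilon>" unfolding sup_norm_le by blast
    define P T where "P = w \<bullet> e_phi \<phi> 0" and "T = w \<bullet> e_theta 0"
    have t: "tangential_part (curl F) (\<phi>, 0) = P *\<^sub>R e_phi \<phi> 0 + T *\<^sub>R e_theta 0"
      by (simp add: tangential_part_def sp w_def P_def T_def)
    have ep: "e_phi \<phi> 0 = vector [y, 0, - colat y]" by (simp add: e_phi_eq cs)
    have "(norm (tangential_part (curl F) (\<phi>, 0)))\<^sup>2 = P\<^sup>2 * (y\<^sup>2 + (colat y)\<^sup>2) + T\<^sup>2"
      unfolding t norm_sq_3 by (simp add: ep e_theta_def power_mult_distrib algebra_simps)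
    also have "\<dots> = P\<^sup>2 + T\<^sup>2" using sq by (simp add: add.commute)
    finally have n2: "P\<^sup>2 + T\<^sup>2 \<le> \<epsilon>\<^sup>2" using power_mono[OF tp norm_ge_zero, of 2] by simp
    have e0: "0 \<le> \<epsilon>" using tp norm_ge_zero order_trans by blast
    have PT: "\<bar>P\<bar> \<le> \<epsilon>" "\<bar>T\<bar> \<le> \<epsilon>"
      using n2 e0 zero_le_power2[of P] zero_le_power2[of T] abs_le_square_iff[of P \<epsilon>] abs_le_square_iff[of T \<epsilon>]
      by linarith+
    have w_eq: "w = vector [- (colat y * (y * (- 4 * FK y - y * FK1 y) + FK1 y)),
      colat y * (y * (- 4 * FA y - y * FA1 y) + FA1 y) - colat y * (- 3 * FB y - y * FB1 y),
      colat y * (colat y * (- 4 * FK y - y * FK1 y)) + FK y - (- FK y)]"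
      unfolding w_def curl_def p using y by (simp add: pt zp)
    have "P = - (colat y * (y * (- 4 * FK y - y * FK1 y) + FK1 y)) * y
       + (colat y * (colat y * (- 4 * FK y - y * FK1 y)) + FK y - (- FK y)) * - colat y"
      unfolding P_def w_eq ep inner_vec_def sum_3 by simp
    also have "\<dots> = 2 * colat y * FK y" using sq by algebra
    finally show "\<bar>2 * colat y * FK y\<bar> \<le> \<epsilon>" using PT by simp
    have "T = colat y * (y * (- 4 * FA y - y * FA1 y) + FA1 y) - colat y * (- 3 * FB y - y * FB1 y)"
      unfolding T_def w_eq e_theta_def inner_vec_def sum_3 by simp
    also have "\<dots> = - (colat y * (2 * (y * FA y - FB y) - F1' y))" unfolding F1'_def by algebra
    finally show "\<bar>colat y * (2 * (y * FA y - FB y) - F1' y)\<bar> \<le> \<epsilon>" using PT by simp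
  qed
  show thesis
  proof (rule that[OF F _ cK _ _ dF1 wK])
    show "FK y = F (meridian y) $ 2 / colat y" if "y \<in> {0..<1}" for y using that by (simp add: FK_def prof_def)
    show "continuous_on {0..1} (\<lambda>y. y * FA y - FB y)" "continuous_on {0..1} (\<lambda>y. (1 - y\<^sup>2) * FA y + y * FB y)"
      using cA cB by (auto intro!: continuous_intros)
    have "wt 1 (0 + 0) (\<lambda>y. y * FA y)" by (rule wt_mult[OF wt_id wA])
    then show "wt 1 0 (\<lambda>y. y * FA y - FB y)" using wB by (intro wt_diff) simp_all
    fix y :: real assume y: "y \<in> {0<..<1}"
    then have c: "0 < colat y" using colat_pos[of y] by auto
    show "\<bar>FK y\<bar> \<le> \<epsilon> / 2 * (1 / sqrt (1 - y\<^sup>2))" "\<bar>2 * (y * FA y - FB y) - F1' y\<bar> \<le> \<epsilon> / sqrt (1 - y\<^sup>2)"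
      using mult_imp_le_div_pos[OF c, of "\<bar>FK y\<bar>" "\<epsilon> / 2"]
        mult_imp_le_div_pos[OF c, of "\<bar>2 * (y * FA y - FB y) - F1' y\<bar>" \<epsilon>] curl[OF y] c
      unfolding colat_def[symmetric] abs_mult by (simp_all add: mult_ac)
  qed
qed

section \<open>The small solution\<close>

text \<open>Every point is approached along the direction \<open>(1, 0, 1)\<close>, which leaves the
  boundary plane at once. It also avoids the axis for small \<open>t\<close>, since the first
  coordinate \<open>x $ 1 + t\<close> can vanish only at \<open>t = - x $ 1\<close>.\<close>

lemma eq_from_offaxis:
  fixes f g :: "real^3 \<Rightarrow> 'a::real_normed_vector"
  assumes f: "continuous_on closed_half_space0 f" and g: "continuous_on closed_half_space0 g"
    and eq: "\<And>x. x \<in> offaxis \<Longrightarrow> f x = g x" and x: "x \<in> closed_half_space0"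
  shows "f x = g x"
proof -
  define c where "c t = x + t *\<^sub>R (axis 1 1 + axis 3 1)" for t :: real
  have c_nth: "c t $ 1 = x $ 1 + t" "c t $ 2 = x $ 2" "c t $ 3 = x $ 3 + t" for t
    by (simp_all add: c_def axis_def)
  have cl: "c t \<in> closed_half_space0" if "t \<in> {0..1}" for t
  proof (cases "t = 0")
    case False
    then have "0 < c t $ 3" using that x by (simp add: c_nth closed_half_space0_def)
    then show ?thesis by (metis half_space_closed half_space_def mem_Collect_eq)
  qed (use x in \<open>simp add: c_def\<close>)
  have cc: "continuous_on {0..1} c" unfolding c_def[abs_def] by (intro continuous_intros)
  have lim: "((\<lambda>t. h (c t)) \<longlongrightarrow> h x) (at_right 0)" if "continuous_on closed_half_space0 h" for h :: "real^3 \<Rightarrow> 'a"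
  proof -
    have "continuous_on {0..1} (\<lambda>t. h (c t))" by (rule continuous_on_compose2[OF that cc]) (use cl in auto)
    from continuous_on_Icc_at_rightD[OF this] show ?thesis by (simp add: c_def)
  qed
  have ev: "\<forall>\<^sub>F t in at_right 0. f (c t) = g (c t)"
  proof (rule eventually_at_rightI[of 0 "if x $ 1 < 0 then - x $ 1 else 1"])
    fix t :: real assume "t \<in> {0<..<if x $ 1 < 0 then - x $ 1 else 1}"
    then have "c t \<in> offaxis" using x by (simp add: offaxis_def c_nth closed_half_space0_def split: if_splits)
    then show "f (c t) = g (c t)" by (rule eq)
  qed auto
  from Lim_transform_eventually[OF lim[OF f] ev] have "((\<lambda>t. g (c t)) \<longlongrightarrow> f x) (at_right 0)" .
  from tendsto_unique[OF _ this lim[OF g]] show ?thesis by simp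
qed

lemma zonal_powers:
  "zonal (- 2) a x = inverse (norm x) * (inverse (norm x) * a (x $ 3 / norm x))"
  "zonal (- 1) a x = inverse (norm x) * a (x $ 3 / norm x)"
  by (simp_all add: zonal_def power_int_minus power2_eq_square mult.assoc)

lemma Lk_profile_field:
  assumes "Lk_profile n 1 a" "Lk_profile n 1 k" "Lk_profile n 0 b"
  shows "Lk n (profile_field (- 1) a k b)"
proof (rule Lk_vec)
  have h: "Lk n (\<lambda>x. x $ 1 * A (x $ 3 / norm x))" "Lk n (\<lambda>x. x $ 2 * A (x $ 3 / norm x))" if "Lk_profile n 1 A" for A
    using Lk_monomial_profile[of n 1 0 A] Lk_monomial_profile[of n 0 1 A] that by simp_all
  have v: "Lk n (\<lambda>x. b (x $ 3 / norm x))" using Lk_monomial_profile[of n 0 0 b] assms(3) by simp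
  define I where "I = (\<lambda>x :: real^3. inverse (norm x))"
  have I: "Lk n I" unfolding I_def by (rule Lk_inverse_norm)
  have "Lk n (\<lambda>x. I x * (I x * (x $ 1 * a (x $ 3 / norm x))) + - (I x * (I x * (x $ 2 * k (x $ 3 / norm x)))))"
    "Lk n (\<lambda>x. I x * (I x * (x $ 2 * a (x $ 3 / norm x))) + I x * (I x * (x $ 1 * k (x $ 3 / norm x))))"
    "Lk n (\<lambda>x. I x * b (x $ 3 / norm x))"
    by (intro Lk_add Lk_minus Lk_mult I h v assms)+
  then have "\<forall>j. Lk n (\<lambda>x. profile_field (- 1) a k b x $ j)"
    unfolding forall_3 profile_field_nth by (simp add: zonal_powers I_def mult_ac)
  then show "Lk n (\<lambda>x. profile_field (- 1) a k b x $ j)" for j by blast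
qed

lemma norm_3_le: "norm x \<le> \<bar>x $ 1\<bar> + \<bar>x $ 2\<bar> + \<bar>x $ 3\<bar>" for x :: "real^3"
  using norm_le_l1_cart[of x] by (simp add: sum_3)

text \<open>Off the axis the equations are the profile identities. The classes \<open>Lk\<close>
  supply continuous first and second derivatives, so the equations extend to the axis by
  continuity.\<close>

lemma small_solution_exists:
  assumes ax: "axisymmetric_field F" and hom: "homogeneous (- 3) F" and C1: "C_k 1 F"
    and small: "sup_norm open_half_sphere_angles (tangential_part (curl F)) \<le> ereal (1/384)"
  obtains u p where "axisym_selfsim_solution F u p" "sup_norm open_half_sphere u \<le> ereal (1/4)"
    "Lk (Suc (Suc 0)) u" "Lk (Suc 0) p"
proof -
  obtain FA FK FB F1' where F: "\<And>x. x \<in> closed_half_space0 \<Longrightarrow> F x = profile_field (- 3) FA FK FB x"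
    and fc: "continuous_on {0..1} FK" "continuous_on {0..1} (\<lambda>y. y * FA y - FB y)" "continuous_on {0..1} (\<lambda>y. (1 - y\<^sup>2) * FA y + y * FB y)"
    and F1': "\<And>y. y \<in> {0<..<1} \<Longrightarrow> ((\<lambda>y. (1 - y\<^sup>2) * FA y + y * FB y) has_real_derivative F1' y) (at y)"
    and fw: "wt 1 0 FK" "wt 1 0 (\<lambda>y. y * FA y - FB y)"
    and fb: "\<And>y. y \<in> {0<..<1} \<Longrightarrow> \<bar>FK y\<bar> \<le> (1/384) / 2 * (1 / sqrt (1 - y\<^sup>2))"
      "\<And>y. y \<in> {0<..<1} \<Longrightarrow> \<bar>2 * (y * FA y - FB y) - F1' y\<bar> \<le> (1/384) / sqrt (1 - y\<^sup>2)"
    by (rule forcing_profiles[OF ax hom C1 small]) (rule that, blast+)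
  show thesis
  proof (rule profile_solution_exists[OF fc F1' fb])
    fix v r H W k E R R1 c
    assume
    fp: "forced_profiles FK (\<lambda>y. y * FA y - FB y) (\<lambda>y. (1 - y\<^sup>2) * FA y + y * FB y) v r H W k E R R1 c"
    and cv: "continuous_on {0..1} v" and v0: "v 0 = 0" and vb: "\<And>y. y \<in> {0..1} \<Longrightarrow> \<bar>v y\<bar> \<le> 1/24"
    and dv: "\<And>y. y \<in> {0<..<1} \<Longrightarrow> (v has_real_derivative r y - (v y)\<^sup>2 / 2) (at y)"
    and rb: "\<And>y. y \<in> {0<..<1} \<Longrightarrow> \<bar>r y - (v y)\<^sup>2 / 2\<bar> \<le> 1/24"
    and kb: "\<And>y. y \<in> {0<..<1} \<Longrightarrow> \<bar>k y\<bar> \<le> 1/192"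
  have wN: "wt 0 (- 1) (\<lambda>y. 2 * (y * FA y - FB y) - F1' y)"
  proof (rule wt_0I[of _ "1/384"])
    fix y :: real assume "y \<in> {0<..<1}"
    from fb(2)[OF this] show "\<bar>2 * (y * FA y - FB y) - F1' y\<bar> \<le> 1 / 384 * colat y powi (- 1)"
      by (simp only: colat_def power_int_minus power_int_1_right divide_inverse[of "1 / 384"])
  qed
  show thesis
  proof (rule regular_profiles[OF fp cv dv fc(1) fw(1) fc(2) fw(2) fc(3) F1' wN])
    fix v1 v2 v3 k1 k2 P P1
    assume
    v1r: "\<And>y. v1 y = r y - (v y)\<^sup>2 / 2"
    and v1: "\<And>y. y \<in> {0<..<1} \<Longrightarrow> (v has_real_derivative v1 y) (at y)"
    and v2: "\<And>y. y \<in> {0<..<1} \<Longrightarrow> (v1 has_real_derivative v2 y) (at y)"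
    and v3: "\<And>y. y \<in> {0<..<1} \<Longrightarrow> (v2 has_real_derivative v3 y) (at y)"
    and k1: "\<And>y. y \<in> {0<..<1} \<Longrightarrow> (k has_real_derivative k1 y) (at y)"
    and k2: "\<And>y. y \<in> {0<..<1} \<Longrightarrow> (k1 has_real_derivative k2 y) (at y)"
    and P1: "\<And>y. y \<in> {0<..<1} \<Longrightarrow> (P has_real_derivative P1 y) (at y)"
    and L: "Lk_profile (Suc (Suc 0)) 1 (\<lambda>y. (1 - y\<^sup>2) * v1 y - y * v y)" "Lk_profile (Suc (Suc 0)) 1 k"
      "Lk_profile (Suc (Suc 0)) 0 (\<lambda>y. y * ((1 - y\<^sup>2) * v1 y - y * v y) - v y)" "Lk_profile (Suc 0) 0 P"
    and eqs: "\<And>y. y \<in> {0<..<1} \<Longrightarrow> (1 - y\<^sup>2) * k2 y - 4 * y * k1 y - 2 * k y = - FK y - v y * ((1 - y\<^sup>2) * k1 y - 2 * y * k y)"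
    "\<And>y. y \<in> {0<..<1} \<Longrightarrow> 2 * ((1 - y\<^sup>2) * v1 y - 2 * y * v y)
      - ((1 - y\<^sup>2)\<^sup>2 * (v3 y + (v1 y)\<^sup>2 + v y * v2 y) - 8 * y * (1 - y\<^sup>2) * (v2 y + v y * v1 y) + (12 * y\<^sup>2 - 4) * (v1 y + (v y)\<^sup>2 / 2))
      - (1 - y\<^sup>2) * ((v y)\<^sup>2 + (k y)\<^sup>2) - 2 * P y = (1 - y\<^sup>2) * FA y + y * FB y"
    "\<And>y. y \<in> {0<..<1} \<Longrightarrow> ((1 - y\<^sup>2) * v2 y - 4 * y * v1 y - 2 * v y) - ((1 - y\<^sup>2) * (v y * v1 y) - y * (v y)\<^sup>2)
      - y * (k y)\<^sup>2 - P1 y = y * FA y - FB y"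
  note D = forced_profilesD[OF fp]
  define a where "a y = (1 - y\<^sup>2) * v1 y - y * v y" for y
  define a1 where "a1 y = (1 - y\<^sup>2) * v2 y - 3 * y * v1 y - v y" for y
  define a2 where "a2 y = (1 - y\<^sup>2) * v3 y - 5 * y * v2 y - 4 * v1 y" for y
  define b where "b y = y * a y - v y" for y
  define b1 where "b1 y = a y + y * a1 y - v1 y" for y
  define b2 where "b2 y = 2 * a1 y + y * a2 y - v2 y" for y
  have da: "(a has_real_derivative a1 y) (at y)" "(a1 has_real_derivative a2 y) (at y)" if y: "y \<in> {0<..<1}" for y
    unfolding a_def[abs_def] a1_def[abs_def] a2_def
    by (rule derivative_eq_intros v1 v2 v3 y refl | simp add: algebra_simps)+
  have db: "(b has_real_derivative b1 y) (at y)" "(b1 has_real_derivative b2 y) (at y)" if y: "y \<in> {0<..<1}" for y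
    unfolding b_def[abs_def] b1_def[abs_def] b2_def
    by (rule derivative_eq_intros v1 v2 da y refl | simp add: algebra_simps)+
  define u where "u = profile_field (- 1) a k b"
  define p where "p = zonal (- 2) P"
  have Lu: "Lk (Suc (Suc 0)) u" unfolding u_def
    by (rule Lk_profile_field) (use L in \<open>simp_all add: a_def[abs_def] b_def[abs_def]\<close>)
  have Lp: "Lk (Suc 0) p"
  proof -
    have "Lk (Suc 0) (\<lambda>x. P (x $ 3 / norm x))" using Lk_monomial_profile[of "Suc 0" 0 0 P] L(4) by simp
    from Lk_mult[OF Lk_inverse_norm Lk_mult[OF Lk_inverse_norm this]] show ?thesis
      by (simp add: p_def zonal_powers[abs_def])
  qed
  have v_ab: "y * a y - b y = v y" "(1 - y\<^sup>2) * a y + y * b y = a y - y * v y" for y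
    unfolding b_def by (simp_all add: algebra_simps power2_eq_square)
  have mom: "- laplacian u x + convection u x + grad p x = F x" if x: "x \<in> offaxis" for x
  proof -
    define y where "y = x $ 3 / norm x"
    have y: "y \<in> {0<..<1}" using offaxis_height[OF x] by (simp add: y_def)
    note id = momentum_identities[where y = y and v = "v y" and ?v1.0 = "v1 y" and ?v2.0 = "v2 y" and ?v3.0 = "v3 y"
        and k = "k y" and P = "P y" and ?P1.0 = "P1 y",
        folded a_def a1_def a2_def, folded b_def b1_def b2_def]
    let ?LA = "- ((1 - y\<^sup>2) * a2 y - 4 * y * a1 y - 2 * a y)
     + (- 2 * ((1 - y\<^sup>2) * a y + y * b y) * a y - (1 - y\<^sup>2) * (y * a y - b y) * a1 y + (a y)\<^sup>2 - (k y)\<^sup>2) + (- 2 * P y - y * P1 y)"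
    let ?LB = "- ((1 - y\<^sup>2) * b2 y - 2 * y * b1 y)
     + (- ((1 - y\<^sup>2) * a y + y * b y) * b y - (1 - y\<^sup>2) * (y * a y - b y) * b1 y) + (- 2 * y * P y + (1 - y\<^sup>2) * P1 y)"
    have i: "(1 - y\<^sup>2) * ?LA + y * ?LB = (1 - y\<^sup>2) * FA y + y * FB y" "y * ?LA - ?LB = y * FA y - FB y"
      unfolding id using eqs(2,3)[OF y] by simp_all
    \<comment> \<open>The passage from \<open>(LA, LB)\<close> to the radial and polar combinations
      has determinant \<open>- (1 - y\<^sup>2) - y\<^sup>2 = - 1\<close>, so it can be inverted for
      every \<open>y\<close>.\<close>
    have solve: "A = A' \<and> B = B'" if "(1 - y\<^sup>2) * A + y * B = (1 - y\<^sup>2) * A' + y * B'" "y * A - B = y * A' - B'" for A B A' B' :: real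
      using that by algebra
    have LA: "?LA = FA y" and LB: "?LB = FB y" using solve[OF i] by blast+
    have LK: "- ((1 - y\<^sup>2) * k2 y - 4 * y * k1 y - 2 * k y)
     + (- 2 * ((1 - y\<^sup>2) * a y + y * b y) * k y - (1 - y\<^sup>2) * (y * a y - b y) * k1 y + 2 * a y * k y) = FK y"
      unfolding eqs(1)[OF y] v_ab by (simp add: algebra_simps)
    have "- laplacian u x + convection u x + grad p x = profile_field (- 3)
      (\<lambda>y. - ((1 - y\<^sup>2) * a2 y - 4 * y * a1 y - 2 * a y)
       + (- 2 * ((1 - y\<^sup>2) * a y + y * b y) * a y - (1 - y\<^sup>2) * (y * a y - b y) * a1 y + (a y)\<^sup>2 - (k y)\<^sup>2) + (- 2 * P y - y * P1 y))
      (\<lambda>y. - ((1 - y\<^sup>2) * k2 y - 4 * y * k1 y - 2 * k y)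
       + (- 2 * ((1 - y\<^sup>2) * a y + y * b y) * k y - (1 - y\<^sup>2) * (y * a y - b y) * k1 y + 2 * a y * k y))
      (\<lambda>y. - ((1 - y\<^sup>2) * b2 y - 2 * y * b1 y)
       + (- ((1 - y\<^sup>2) * a y + y * b y) * b y - (1 - y\<^sup>2) * (y * a y - b y) * b1 y) + (- 2 * y * P y + (1 - y\<^sup>2) * P1 y)) x"
      by (rule momentum_profile_field[OF _ _ x da k1 k2 db P1]) (simp_all add: u_def p_def)
    also have "\<dots> = profile_field (- 3) FA FK FB x"
      unfolding profile_field_eq_iff[OF x] Let_def y_def[symmetric] using LA LK LB by blast
    finally show ?thesis using F[OF half_space_closed[OF offaxis_half_space[OF x]]] by simp
  qed
  have div: "divergence u x = 0" if x: "x \<in> offaxis" for x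
  proof -
    define y where "y = x $ 3 / norm x"
    have "divergence u x = zonal (- 2) (\<lambda>y. 2 * y\<^sup>2 * a y - (1 - y\<^sup>2) * y * a1 y - y * b y + (1 - y\<^sup>2) * b1 y) x"
      by (rule divergence_profile_field[OF _ x da(1) k1 db(1)]) (simp_all add: u_def)
    moreover have "2 * y\<^sup>2 * a y - (1 - y\<^sup>2) * y * a1 y - y * b y + (1 - y\<^sup>2) * b1 y = 0"
      unfolding b_def b1_def a_def by (simp add: algebra_simps power2_eq_square)
    ultimately show ?thesis by (simp add: zonal_def y_def)
  qed
  \<comment> \<open>Versions of the derivatives that are continuous up to the boundary and across
    the axis.\<close>
  obtain g where g: "\<And>i. Lk (Suc 0) (g i)" "\<And>i x. x \<in> half_space \<Longrightarrow> has_partial i u (g i x) x"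
    using Lk_SucE[OF Lu] by blast
  have "\<forall>i. \<exists>h. Lk 0 h \<and> (\<forall>x\<in>half_space. has_partial i (g i) (h x) x)"
    using Lk_SucE[OF g(1)] by metis
  then obtain h where h: "\<And>i. Lk 0 (h i)" "\<And>i x. x \<in> half_space \<Longrightarrow> has_partial i (g i) (h i x) x" by metis
  obtain gp where gp: "\<And>i. Lk 0 (gp i)" "\<And>i x. x \<in> half_space \<Longrightarrow> has_partial i p (gp i x) x"
    using Lk_SucE[OF Lp] by blast
  have pu: "partial i u x = g i x" if "x \<in> half_space" for i x by (rule partial_eqI[OF g(2)[OF that]])
  have lap: "laplacian u x = (\<Sum>i\<in>UNIV. h i x)" if x: "x \<in> half_space" for x
  proof -
    have "partial i (partial i u) x = h i x" for i
      by (rule partial_eqI, rule has_partial_transform[OF open_half_space x _ h(2)[OF x]]) (simp add: pu)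
    then show ?thesis by (simp add: laplacian_def)
  qed
  have mom': "- laplacian u x + convection u x + grad p x = F x" if x: "x \<in> half_space" for x
  proof -
    define M where "M x = - (\<Sum>i\<in>UNIV. h i x) + (\<Sum>i\<in>UNIV. (u x $ i) *\<^sub>R g i x) + (\<chi> i. gp i x)" for x
    have M: "- laplacian u x + convection u x + grad p x = M x" if "x \<in> half_space" for x
      using that by (simp add: M_def lap convection_def grad_def pu partial_eqI[OF gp(2)[OF that]])
    have "M x = F x"
    proof (rule eq_from_offaxis[OF _ _ _ half_space_closed[OF x]])
      show "continuous_on closed_half_space0 M"
        unfolding M_def[abs_def]
        by (intro continuous_intros loclip_continuous Lk_loclip[OF Lu] Lk_loclip[OF g(1)] Lk_loclip[OF h(1)] Lk_loclip[OF gp(1)])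
      show "continuous_on closed_half_space0 F" using C1 by simp
      show "M z = F z" if "z \<in> offaxis" for z using M[OF offaxis_half_space[OF that]] mom[OF that] by simp
    qed
    with M[OF x] show ?thesis by simp
  qed
  have div': "divergence u x = 0" if x: "x \<in> half_space" for x
  proof -
    define M where "M x = (\<Sum>i\<in>UNIV. g i x $ i)" for x
    have M: "divergence u x = M x" if "x \<in> half_space" for x using that by (simp add: M_def divergence_def pu)
    have "M x = 0"
    proof (rule eq_from_offaxis[OF _ _ _ half_space_closed[OF x]])
      show "continuous_on closed_half_space0 M"
        unfolding M_def[abs_def] by (intro continuous_intros loclip_continuous Lk_loclip[OF g(1)])
      show "M z = 0" if "z \<in> offaxis" for z using M[OF offaxis_half_space[OF that]] div[OF that] by simp
    qed simp
    with M[OF x] show ?thesis by simp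
  qed
  \<comment> \<open>No-slip involves \<open>a 0 = v1 0\<close> besides \<open>v 0\<close>; the
    condition \<open>R 0 = 0\<close> supplies \<open>v1 0 = r 0 = 0\<close>.\<close>
  have bdry: "u x = 0" if "x \<in> boundary_plane0" for x
  proof -
    have "R 0 = (1 - 0\<^sup>2)\<^sup>2 * r 0" "H 0 = (1 - 0\<^sup>2) * k 0" using D(13,14)[of 0] by auto
    then have "r 0 = 0" "k 0 = 0" using D(8,10) by auto
    then have "a 0 = 0" "b 0 = 0" "k 0 = 0" using v0 by (simp_all add: a_def b_def v1r)
    then show ?thesis using that unfolding vec_eq_iff forall_3 u_def profile_field_nth
      by (simp add: zonal_def boundary_plane0_def)
  qed
  have sol: "axisym_selfsim_solution F u p"
    unfolding axisym_selfsim_solution_def solves_system_def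
  proof (intro conjI ballI)
    show "C_k 2 u" using Lk_C_k[OF Lu] by (simp only: numeral_2_eq_2)
    show "C_k 1 p" using Lk_C_k[OF Lp] by (simp only: One_nat_def)
    show "axisymmetric_field u" by (rule profile_field_axisymmetric[of u "- 1" a k b]) (simp add: u_def)
    show "homogeneous (- 1) u" by (rule profile_field_homogeneous[of u "- 1" a k b]) (simp add: u_def)
    show "axisymmetric_scalar p" "homogeneous (- 2) p" by (rule zonal_axisymmetric[of p "- 2" P]; simp add: p_def)+
  qed (use mom' div' bdry in auto)
  \<comment> \<open>The components are at most 1/12, 1/192 and 1/8, with sum 41/192 below
    1/4.\<close>
  have bound: "norm (u (meridian y)) \<le> 1/4" if y: "y \<in> {0<..<1}" for y
  proof -
    have y': "y \<in> {0..1}" using y by auto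
    have s: "0 \<le> 1 - y\<^sup>2" "1 - y\<^sup>2 \<le> 1" using unit_sq[OF y'] by auto
    have bv: "\<bar>v1 y\<bar> \<le> 1/24" "\<bar>v y\<bar> \<le> 1/24" using rb[OF y] vb[OF y'] by (simp_all add: v1r)
    have "\<bar>a y\<bar> \<le> \<bar>(1 - y\<^sup>2) * v1 y\<bar> + \<bar>y * v y\<bar>" unfolding a_def by (rule abs_triangle_ineq4)
    also have "\<dots> \<le> 1 * (1/24) + 1 * (1/24)"
      unfolding abs_mult using s y bv by (intro add_mono mult_mono) auto
    finally have ba: "\<bar>a y\<bar> \<le> 1/12" by simp
    have "\<bar>b y\<bar> \<le> \<bar>y * a y\<bar> + \<bar>v y\<bar>" unfolding b_def by (rule abs_triangle_ineq4)
    also have "\<bar>y * a y\<bar> \<le> 1 * (1/12)" unfolding abs_mult using y ba by (intro mult_mono) auto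
    finally have bb: "\<bar>b y\<bar> \<le> 1/8" using bv by simp
    have c: "\<bar>sqrt (1 - y\<^sup>2)\<bar> \<le> 1" using s by simp
    have "\<bar>u (meridian y) $ 1\<bar> \<le> 1 * (1/12)" "\<bar>u (meridian y) $ 2\<bar> \<le> 1 * (1/192)" "\<bar>u (meridian y) $ 3\<bar> \<le> 1/8"
      unfolding u_def profile_field_nth using y' ba bb kb[OF y] c
      by (simp_all only: zonal_meridian meridian_nth mult_zero_left diff_0_right add_0 abs_mult) (intro mult_mono; simp)+
    then show ?thesis using norm_3_le[of "u (meridian y)"] by linarith
  qed
  have sup: "sup_norm open_half_sphere u \<le> ereal (1/4)"
    unfolding sup_norm_le
  proof
    fix x assume "x \<in> open_half_sphere"
    then have nx: "norm x = 1" and x3: "0 < x $ 3" by (auto simp: open_half_sphere_def half_space_def)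
    have xc: "x \<in> closed_half_space0" using nx x3 by (auto simp: closed_half_space0_def)
    define y where "y = x $ 3"
    have y1: "y \<le> 1" using component_le_norm_cart[of x 3] nx by (simp add: y_def)
    have sq: "(x $ 1)\<^sup>2 + (x $ 2)\<^sup>2 = 1 - y\<^sup>2" using norm_sq_3[of x] nx by (simp add: y_def)
    have zn: "zonal m f x = f y" for m f by (simp add: zonal_def nx y_def)
    have e: "norm (u x) = norm (u (meridian y))"
    proof -
      have y01: "y \<in> {0..1}" using y1 x3 by (simp add: y_def)
      have m: "(sqrt (1 - y\<^sup>2))\<^sup>2 = 1 - y\<^sup>2" using unit_sq[OF y01] by simp
      have "(norm (u x))\<^sup>2 = ((x $ 1)\<^sup>2 + (x $ 2)\<^sup>2) * ((a y)\<^sup>2 + (k y)\<^sup>2) + (b y)\<^sup>2"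
        unfolding norm_sq_3 u_def profile_field_nth zn by (simp add: algebra_simps power2_eq_square)
      also have "\<dots> = (norm (u (meridian y)))\<^sup>2"
        unfolding norm_sq_3 u_def profile_field_nth zonal_meridian[OF y01] meridian_nth power_mult_distrib m sq
        by (simp add: algebra_simps power_mult_distrib m)
      finally show ?thesis by simp
    qed
    show "norm (u x) \<le> 1/4"
    proof (cases "y = 1")
      case False
      then show ?thesis unfolding e using bound[of y] y1 x3 by (simp add: y_def)
    next
      \<comment> \<open>The profile bounds hold on the open interval; the pole is reached by
        continuity.\<close>
      case True
      have "continuous_on {0..1} (\<lambda>y. norm (u (meridian y)))"
        by (intro continuous_intros continuous_on_compose2[OF loclip_continuous[OF Lk_loclip[OF Lu]] continuous_on_meridian])
           (use meridian_closed in auto)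
      from at_left_1[OF this] have "norm (u (meridian 1)) \<le> 1/4"
        by (rule tendsto_upperbound) (rule eventually_at_leftI[of 0], erule bound, simp_all)
      then show ?thesis unfolding e True .
    qed
  qed
  show thesis by (rule that[OF sol sup Lu Lp])
  qed
  qed
qed

section \<open>Uniqueness\<close>

lemma profile_twice_differentiable:
  fixes u :: "real^3 \<Rightarrow> real^3"
  assumes C2: "C_k (Suc (Suc 0)) u" and hom: "homogeneous n u"
    and A: "\<And>y. y \<in> {0<..<1} \<Longrightarrow> A y = colat y powi m * u (meridian y) $ j"
  obtains A1 A2 where "\<And>y. y \<in> {0<..<1} \<Longrightarrow> (A has_real_derivative A1 y) (at y)"
    "\<And>y. y \<in> {0<..<1} \<Longrightarrow> (A1 has_real_derivative A2 y) (at y)"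
proof -
  obtain g where g: "C_k (Suc 0) g" "\<And>x. x \<in> half_space \<Longrightarrow> has_partial 3 u (g x) x"
    using C2 unfolding C_k.simps(2)[of "Suc 0"] has_partial_def by metis
  obtain h where h: "\<And>x. x \<in> half_space \<Longrightarrow> has_partial 3 g (h x) x"
    using g(1) unfolding C_k.simps(2)[of 0] has_partial_def by metis
  obtain A1 A2 where A1: "\<And>y. y \<in> {0<..<1} \<Longrightarrow> ((\<lambda>y. colat y powi (m + n) * u (vline y) $ j) has_real_derivative A1 y) (at y)"
    and A2: "\<And>y. y \<in> {0<..<1} \<Longrightarrow> (A1 has_real_derivative A2 y) (at y)"
    by (rule vline_twice_differentiable[OF has_partial_vec_nth[OF g(2), of _ j] has_partial_vec_nth[OF h, of _ j]]) blast+
  have e: "colat y powi (m + n) * u (vline y) $ j = A y" if y: "y \<in> {0<..<1}" for y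
  proof -
    have y': "y \<in> {0..<1}" using y by simp
    have c: "0 < colat y" by (rule colat_pos[OF y'])
    have "u (meridian y) = colat y powi n *\<^sub>R u (vline y)"
      unfolding meridian_vline[OF y'] using hom vline_closed[OF y'] c by (simp add: homogeneous_def)
    then show ?thesis unfolding A[OF y] using c by (simp add: power_int_add)
  qed
  have "(A has_real_derivative A1 y) (at y)" if y: "y \<in> {0<..<1}" for y
    by (rule has_field_derivative_transform_within_open[OF A1[OF y] _ y e]) simp_all
  then show thesis using A2 by (rule that)
qed

lemma pressure_profile_differentiable:
  fixes p :: "real^3 \<Rightarrow> real"
  assumes C1: "C_k (Suc 0) p" and hom: "homogeneous n p"
  obtains P1 where "\<And>y. y \<in> {0<..<1} \<Longrightarrow> ((\<lambda>y. p (meridian y)) has_real_derivative P1 y) (at y)"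
proof -
  obtain g where g: "\<And>x. x \<in> half_space \<Longrightarrow> has_partial 3 p (g x) x"
    using C1 unfolding C_k.simps(2)[of 0] has_partial_def by metis
  have e: "colat y powi n * p (vline y) = p (meridian y)" if y: "y \<in> {0<..<1}" for y
  proof -
    have y': "y \<in> {0..<1}" using y by simp
    show ?thesis
      unfolding meridian_vline[OF y'] using hom vline_closed[OF y'] colat_pos[OF y'] by (simp add: homogeneous_def)
  qed
  show thesis
  proof (rule that)
    fix y :: real assume y: "y \<in> {0<..<1}"
    show "((\<lambda>y. p (meridian y)) has_real_derivative
        - of_int n * y * (colat y powi (n - 2) * p (vline y)) + colat y powi (n - 3) * g (vline y)) (at y)"
      by (rule has_field_derivative_transform_within_open[OF DERIV_vline[OF g y] _ y e]) simp_all
  qed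
qed

text \<open>What the uniqueness arguments need to know of a solution. The clause with
  \<open>M\<close> passes any bound on \<open>u\<close> to \<open>v\<close>; it is used with 1/4 for
  small solutions and with an unspecified bound for arbitrary ones.\<close>

definition velocity_profiles ::
  "(real \<Rightarrow> real) \<Rightarrow> (real \<Rightarrow> real) \<Rightarrow> (real^3 \<Rightarrow> real^3) \<Rightarrow> (real \<Rightarrow> real) \<Rightarrow> (real \<Rightarrow> real) \<Rightarrow> (real \<Rightarrow> real) \<Rightarrow>
   (real \<Rightarrow> real) \<Rightarrow> (real \<Rightarrow> real) \<Rightarrow> bool" where
  "velocity_profiles q N u v v1 H W R \<longleftrightarrow>
     (\<forall>x\<in>offaxis. u x = profile_field (- 1) (\<lambda>y. (1 - y\<^sup>2) * v1 y - y * v y) (\<lambda>y. H y / (1 - y\<^sup>2))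
        (\<lambda>y. y * ((1 - y\<^sup>2) * v1 y - y * v y) - v y) x) \<and>
     (\<forall>y\<in>{0<..<1}. (v has_real_derivative v1 y) (at y)) \<and>
     (\<forall>y\<in>{0<..<1}. R y = (1 - y\<^sup>2)\<^sup>2 * (v1 y + (v y)\<^sup>2 / 2)) \<and>
     continuous_on {0..<1} v \<and> v 0 = 0 \<and>
     (\<forall>M. (\<forall>y\<in>{0<..<1}. norm (u (meridian y)) \<le> M) \<longrightarrow> (\<forall>y\<in>{0<..<1}. \<bar>v y\<bar> \<le> M)) \<and>
     profile_system q N v H W R"

lemma velocity_profilesD:
  assumes "velocity_profiles q N u v v1 H W R"
  shows "\<And>x. x \<in> offaxis \<Longrightarrow> u x = profile_field (- 1) (\<lambda>y. (1 - y\<^sup>2) * v1 y - y * v y) (\<lambda>y. H y / (1 - y\<^sup>2))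
        (\<lambda>y. y * ((1 - y\<^sup>2) * v1 y - y * v y) - v y) x"
    "\<And>y. y \<in> {0<..<1} \<Longrightarrow> (v has_real_derivative v1 y) (at y)"
    "\<And>y. y \<in> {0<..<1} \<Longrightarrow> R y = (1 - y\<^sup>2)\<^sup>2 * (v1 y + (v y)\<^sup>2 / 2)"
    "continuous_on {0..<1} v" "v 0 = 0"
    "\<And>M y. (\<And>y. y \<in> {0<..<1} \<Longrightarrow> norm (u (meridian y)) \<le> M) \<Longrightarrow> y \<in> {0<..<1} \<Longrightarrow> \<bar>v y\<bar> \<le> M"
    "profile_system q N v H W R"
proof -
  note D = assms[unfolded velocity_profiles_def]
  note D' = D[THEN conjunct2, THEN conjunct2, THEN conjunct2]
  note D'' = D'[THEN conjunct2, THEN conjunct2]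
  fix x y M
  show "x \<in> offaxis \<Longrightarrow> u x = profile_field (- 1) (\<lambda>y. (1 - y\<^sup>2) * v1 y - y * v y) (\<lambda>y. H y / (1 - y\<^sup>2))
        (\<lambda>y. y * ((1 - y\<^sup>2) * v1 y - y * v y) - v y) x"
    by (rule D[THEN conjunct1, THEN bspec])
  show "y \<in> {0<..<1} \<Longrightarrow> (v has_real_derivative v1 y) (at y)"
    by (rule D[THEN conjunct2, THEN conjunct1, THEN bspec])
  show "y \<in> {0<..<1} \<Longrightarrow> R y = (1 - y\<^sup>2)\<^sup>2 * (v1 y + (v y)\<^sup>2 / 2)"
    by (rule D[THEN conjunct2, THEN conjunct2, THEN conjunct1, THEN bspec])
  show "continuous_on {0..<1} v" by (rule D'[THEN conjunct1])
  show "v 0 = 0" by (rule D'[THEN conjunct2, THEN conjunct1])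
  show "(\<And>y. y \<in> {0<..<1} \<Longrightarrow> norm (u (meridian y)) \<le> M) \<Longrightarrow> y \<in> {0<..<1} \<Longrightarrow> \<bar>v y\<bar> \<le> M"
    by (rule D''[THEN conjunct1, THEN spec, THEN mp, THEN bspec]) (rule ballI)
  show "profile_system q N v H W R" by (rule D''[THEN conjunct2])
qed

text \<open>The divergence equation expresses the horizontal profile \<open>a\<close> and the vertical profile \<open>b\<close> of
  the velocity by \<open>v = y a - b\<close> alone, so \<open>v\<close> inherits three derivatives from \<open>a\<close> and \<open>b\<close>.\<close>

lemma divergence_free_profiles:
  fixes a b :: "real \<Rightarrow> real"
  assumes a: "\<And>y. y \<in> {0<..<1} \<Longrightarrow> (a has_real_derivative a1 y) (at y)" "\<And>y. y \<in> {0<..<1} \<Longrightarrow> (a1 has_real_derivative a2 y) (at y)"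
    and b: "\<And>y. y \<in> {0<..<1} \<Longrightarrow> (b has_real_derivative b1 y) (at y)" "\<And>y. y \<in> {0<..<1} \<Longrightarrow> (b1 has_real_derivative b2 y) (at y)"
    and div: "\<And>y. y \<in> {0<..<1} \<Longrightarrow> 2 * y\<^sup>2 * a y - (1 - y\<^sup>2) * y * a1 y - y * b y + (1 - y\<^sup>2) * b1 y = 0"
    and v: "\<And>y. v y = y * a y - b y"
  obtains v1 v2 v3 where
    "\<And>y. y \<in> {0<..<1} \<Longrightarrow> (v has_real_derivative v1 y) (at y)"
    "\<And>y. y \<in> {0<..<1} \<Longrightarrow> (v1 has_real_derivative v2 y) (at y)"
    "\<And>y. y \<in> {0<..<1} \<Longrightarrow> (v2 has_real_derivative v3 y) (at y)"
    "\<And>y. y \<in> {0<..<1} \<Longrightarrow> a y = (1 - y\<^sup>2) * v1 y - y * v y"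
    "\<And>y. y \<in> {0<..<1} \<Longrightarrow> a1 y = (1 - y\<^sup>2) * v2 y - 3 * y * v1 y - v y"
    "\<And>y. y \<in> {0<..<1} \<Longrightarrow> a2 y = (1 - y\<^sup>2) * v3 y - 5 * y * v2 y - 4 * v1 y"
    "\<And>y. y \<in> {0<..<1} \<Longrightarrow> b1 y = a y + y * a1 y - v1 y"
    "\<And>y. y \<in> {0<..<1} \<Longrightarrow> b2 y = 2 * a1 y + y * a2 y - v2 y"
proof -
  define v1 where "v1 y = a y + y * a1 y - b1 y" for y
  define v2 where "v2 y = 2 * a1 y + y * a2 y - b2 y" for y
  define v3 where "v3 y = (a2 y + 5 * y * v2 y + 4 * v1 y) / (1 - y\<^sup>2)" for y
  have dv: "(v has_real_derivative v1 y) (at y)" if y: "y \<in> {0<..<1}" for y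
    unfolding v[abs_def] v1_def by (rule derivative_eq_intros a b y refl | simp)+
  have dv1: "(v1 has_real_derivative v2 y) (at y)" if y: "y \<in> {0<..<1}" for y
    unfolding v1_def[abs_def] v2_def by (rule derivative_eq_intros a b y refl | simp)+
  have ea: "a y = (1 - y\<^sup>2) * v1 y - y * v y" if y: "y \<in> {0<..<1}" for y
    using div[OF y] unfolding v1_def v by (simp add: algebra_simps power2_eq_square)
  have ea1: "a1 y = (1 - y\<^sup>2) * v2 y - 3 * y * v1 y - v y" if y: "y \<in> {0<..<1}" for y
  proof (rule DERIV_unique[OF a(1)[OF y]])
    have "((\<lambda>y. (1 - y\<^sup>2) * v1 y - y * v y) has_real_derivative (1 - y\<^sup>2) * v2 y - 3 * y * v1 y - v y) (at y)"
      by (rule derivative_eq_intros dv dv1 y refl | simp)+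
    then show "(a has_real_derivative (1 - y\<^sup>2) * v2 y - 3 * y * v1 y - v y) (at y)"
      by (rule has_field_derivative_transform_within_open[OF _ _ y ea[symmetric]]) simp_all
  qed
  have ne: "1 - y\<^sup>2 \<noteq> 0" if "y \<in> {0<..<1}" for y :: real using unit_sq_pos[of y] that by simp
  have ev2: "v2 y = (a1 y + 3 * y * v1 y + v y) / (1 - y\<^sup>2)" if y: "y \<in> {0<..<1}" for y
    using ea1[OF y] ne[OF y] by (simp add: eq_divide_eq)
  have dv2: "(v2 has_real_derivative v3 y) (at y)" if y: "y \<in> {0<..<1}" for y
  proof -
    define s where "s = 1 - y\<^sup>2"
    define X where "X = a1 y + 3 * y * v1 y + v y"
    have s: "s \<noteq> 0" using ne[OF y] by (simp add: s_def)
    have X: "X = v2 y * s" using ev2[OF y] s by (simp add: X_def s_def)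
    have n: "((\<lambda>y. a1 y + 3 * y * v1 y + v y) has_real_derivative (a2 y + 3 * y * v2 y + 4 * v1 y)) (at y)"
      by (rule derivative_eq_intros a dv dv1 y refl | simp)+
    have d: "((\<lambda>y. 1 - y\<^sup>2) has_real_derivative - (2 * y)) (at y)" by (rule derivative_eq_intros refl | simp)+
    have "((\<lambda>y. (a1 y + 3 * y * v1 y + v y) / (1 - y\<^sup>2)) has_real_derivative
        ((a2 y + 3 * y * v2 y + 4 * v1 y) * s - X * - (2 * y)) / (s * s)) (at y)"
      unfolding s_def X_def by (rule DERIV_divide[OF n d ne[OF y]])
    moreover have "((a2 y + 3 * y * v2 y + 4 * v1 y) * s - X * - (2 * y)) / (s * s) = v3 y"
      unfolding v3_def s_def[symmetric] X using s by (simp add: divide_simps) (simp add: algebra_simps)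
    ultimately have "((\<lambda>y. (a1 y + 3 * y * v1 y + v y) / (1 - y\<^sup>2)) has_real_derivative v3 y) (at y)" by simp
    then show ?thesis
      by (rule has_field_derivative_transform_within_open[OF _ _ y ev2[symmetric]]) simp_all
  qed
  have ea2: "a2 y = (1 - y\<^sup>2) * v3 y - 5 * y * v2 y - 4 * v1 y" if y: "y \<in> {0<..<1}" for y
    unfolding v3_def using ne[OF y] by simp
  show thesis
    by (rule that[of v1 v2 v3, OF dv dv1 dv2 ea ea1 ea2]) (simp_all add: v1_def v2_def)
qed

text \<open>Equality of profile fields at one point off the axis is equality of the three profiles
  there, so the vector equation splits separately at each \<open>y\<close>.\<close>

lemma momentum_profiles:
  assumes mom: "\<And>x. x \<in> offaxis \<Longrightarrow> - laplacian u x + convection u x + grad p x = profile_field (- 3) FA FK FB x"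
    and u: "\<And>x. x \<in> offaxis \<Longrightarrow> u x = profile_field (- 1) a k b x"
    and p: "\<And>x. x \<in> offaxis \<Longrightarrow> p x = zonal (- 2) P x"
    and da: "\<And>y. y \<in> {0<..<1} \<Longrightarrow> (a has_real_derivative a1 y) (at y)" "\<And>y. y \<in> {0<..<1} \<Longrightarrow> (a1 has_real_derivative a2 y) (at y)"
    and dk: "\<And>y. y \<in> {0<..<1} \<Longrightarrow> (k has_real_derivative k1 y) (at y)" "\<And>y. y \<in> {0<..<1} \<Longrightarrow> (k1 has_real_derivative k2 y) (at y)"
    and db: "\<And>y. y \<in> {0<..<1} \<Longrightarrow> (b has_real_derivative b1 y) (at y)" "\<And>y. y \<in> {0<..<1} \<Longrightarrow> (b1 has_real_derivative b2 y) (at y)"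
    and dP: "\<And>y. y \<in> {0<..<1} \<Longrightarrow> (P has_real_derivative P1 y) (at y)"
    and ab: "a y = (1 - y\<^sup>2) * v1 - y * v" "a1 y = (1 - y\<^sup>2) * v2 - 3 * y * v1 - v"
      "a2 y = (1 - y\<^sup>2) * v3 - 5 * y * v2 - 4 * v1"
      "b y = y * a y - v" "b1 y = a y + y * a1 y - v1" "b2 y = 2 * a1 y + y * a2 y - v2"
    and y: "y \<in> {0<..<1}"
  shows "(1 - y\<^sup>2) * k2 y - 4 * y * k1 y - 2 * k y = - FK y - v * ((1 - y\<^sup>2) * k1 y - 2 * y * k y)"
    and "2 * ((1 - y\<^sup>2) * v1 - 2 * y * v)
      - ((1 - y\<^sup>2)\<^sup>2 * (v3 + v1\<^sup>2 + v * v2) - 8 * y * (1 - y\<^sup>2) * (v2 + v * v1) + (12 * y\<^sup>2 - 4) * (v1 + v\<^sup>2 / 2))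
      - (1 - y\<^sup>2) * (v\<^sup>2 + (k y)\<^sup>2) - 2 * P y = (1 - y\<^sup>2) * FA y + y * FB y"
    and "((1 - y\<^sup>2) * v2 - 4 * y * v1 - 2 * v) - ((1 - y\<^sup>2) * (v * v1) - y * v\<^sup>2) - y * (k y)\<^sup>2 - P1 y = y * FA y - FB y"
proof -
  have x: "meridian y \<in> offaxis" by (rule meridian_offaxis[OF y])
  have y': "y \<in> {0..1}" using y by simp
  have h: "meridian y $ 3 / norm (meridian y) = y" using y' by simp
  note eq = trans[OF momentum_profile_field[OF u p x da dk db dP, symmetric] mom[OF x]]
  have LA: "- ((1 - y\<^sup>2) * a2 y - 4 * y * a1 y - 2 * a y)
     + (- 2 * ((1 - y\<^sup>2) * a y + y * b y) * a y - (1 - y\<^sup>2) * (y * a y - b y) * a1 y + (a y)\<^sup>2 - (k y)\<^sup>2) + (- 2 * P y - y * P1 y) = FA y"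
    and LK: "- ((1 - y\<^sup>2) * k2 y - 4 * y * k1 y - 2 * k y)
     + (- 2 * ((1 - y\<^sup>2) * a y + y * b y) * k y - (1 - y\<^sup>2) * (y * a y - b y) * k1 y + 2 * a y * k y) = FK y"
    and LB: "- ((1 - y\<^sup>2) * b2 y - 2 * y * b1 y)
     + (- ((1 - y\<^sup>2) * a y + y * b y) * b y - (1 - y\<^sup>2) * (y * a y - b y) * b1 y) + (- 2 * y * P y + (1 - y\<^sup>2) * P1 y) = FB y"
    using eq unfolding profile_field_eq_iff[OF x] Let_def h by blast+
  have v_ab: "y * a y - b y = v" "(1 - y\<^sup>2) * a y + y * b y = a y - y * v"
    unfolding ab(4) by (simp_all add: algebra_simps power2_eq_square)
  show "(1 - y\<^sup>2) * k2 y - 4 * y * k1 y - 2 * k y = - FK y - v * ((1 - y\<^sup>2) * k1 y - 2 * y * k y)"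
    using LK unfolding v_ab by (simp add: algebra_simps)
  note id = momentum_identities[where y = y and v = v and ?v1.0 = v1 and ?v2.0 = v2 and ?v3.0 = v3
      and k = "k y" and P = "P y" and ?P1.0 = "P1 y",
      folded ab(1-3), folded ab(4), folded ab(5,6)]
  from id show "2 * ((1 - y\<^sup>2) * v1 - 2 * y * v)
      - ((1 - y\<^sup>2)\<^sup>2 * (v3 + v1\<^sup>2 + v * v2) - 8 * y * (1 - y\<^sup>2) * (v2 + v * v1) + (12 * y\<^sup>2 - 4) * (v1 + v\<^sup>2 / 2))
      - (1 - y\<^sup>2) * (v\<^sup>2 + (k y)\<^sup>2) - 2 * P y = (1 - y\<^sup>2) * FA y + y * FB y"
    "((1 - y\<^sup>2) * v2 - 4 * y * v1 - 2 * v) - ((1 - y\<^sup>2) * (v * v1) - y * v\<^sup>2) - y * (k y)\<^sup>2 - P1 y = y * FA y - FB y"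
    unfolding LA LB by (metis+)
qed

lemma meridian_0: "meridian 0 \<in> boundary_plane0"
  by (simp add: boundary_plane0_def vec_eq_iff forall_3)

text \<open>\<open>R2\<close> is the second derivative of \<open>R\<close> as rewritten by the
  radial equation. The explicit one contains \<open>v3\<close>, for which no further derivative is
  known; the rewritten one contains \<open>v1\<close>, \<open>v\<close>, \<open>k\<close>,
  \<open>P\<close> and \<open>F1\<close>. Thus \<open>R\<close> has a third derivative for a C2
  velocity and a C1 pressure, and the polar equation removes \<open>P1\<close> from it.\<close>

lemma profile_system_of_momentum:
  assumes dv: "\<And>y. y \<in> {0<..<1} \<Longrightarrow> (v has_real_derivative v1 y) (at y)"
      "\<And>y. y \<in> {0<..<1} \<Longrightarrow> (v1 has_real_derivative v2 y) (at y)"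
      "\<And>y. y \<in> {0<..<1} \<Longrightarrow> (v2 has_real_derivative v3 y) (at y)"
    and dk: "\<And>y. y \<in> {0<..<1} \<Longrightarrow> (k has_real_derivative k1 y) (at y)" "\<And>y. y \<in> {0<..<1} \<Longrightarrow> (k1 has_real_derivative k2 y) (at y)"
    and dP: "\<And>y. y \<in> {0<..<1} \<Longrightarrow> (P has_real_derivative P1 y) (at y)"
    and dF1: "\<And>y. y \<in> {0<..<1} \<Longrightarrow> (F1 has_real_derivative F1' y) (at y)"
    and azi: "\<And>y. y \<in> {0<..<1} \<Longrightarrow> (1 - y\<^sup>2) * k2 y - 4 * y * k1 y - 2 * k y = - q y - v y * ((1 - y\<^sup>2) * k1 y - 2 * y * k y)"
    and rad: "\<And>y. y \<in> {0<..<1} \<Longrightarrow> 2 * ((1 - y\<^sup>2) * v1 y - 2 * y * v y)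
      - ((1 - y\<^sup>2)\<^sup>2 * (v3 y + (v1 y)\<^sup>2 + v y * v2 y) - 8 * y * (1 - y\<^sup>2) * (v2 y + v y * v1 y) + (12 * y\<^sup>2 - 4) * (v1 y + (v y)\<^sup>2 / 2))
      - (1 - y\<^sup>2) * ((v y)\<^sup>2 + (k y)\<^sup>2) - 2 * P y = F1 y"
    and ang: "\<And>y. y \<in> {0<..<1} \<Longrightarrow> ((1 - y\<^sup>2) * v2 y - 4 * y * v1 y - 2 * v y) - ((1 - y\<^sup>2) * (v y * v1 y) - y * (v y)\<^sup>2)
      - y * (k y)\<^sup>2 - P1 y = G y"
    and H: "\<And>y. y \<in> {0<..<1} \<Longrightarrow> H y = (1 - y\<^sup>2) * k y" "continuous_on {0..1} H" "H 0 = 0" "H 1 = 0"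
    and R: "\<And>y. y \<in> {0<..<1} \<Longrightarrow> R y = (1 - y\<^sup>2)\<^sup>2 * (v1 y + (v y)\<^sup>2 / 2)"
    and lim: "(R \<longlongrightarrow> 0) (at_right 0)" "((\<lambda>y. R y / (1 - y)) \<longlongrightarrow> 0) (at_left 1)"
  shows "profile_system q (\<lambda>y. 2 * G y - F1' y) v H (\<lambda>y. (1 - y\<^sup>2) * k1 y - 2 * y * k y) R"
proof -
  define W where "W y = (1 - y\<^sup>2) * k1 y - 2 * y * k y" for y
  define R1 where "R1 y = (1 - y\<^sup>2)\<^sup>2 * (v2 y + v y * v1 y) - 4 * y * (1 - y\<^sup>2) * (v1 y + (v y)\<^sup>2 / 2)" for y
  define R2 where "R2 y = 2 * ((1 - y\<^sup>2) * v1 y - 2 * y * v y) - (1 - y\<^sup>2) * ((v y)\<^sup>2 + (k y)\<^sup>2) - 2 * P y - F1 y" for y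
  have dH: "(H has_real_derivative W y) (at y)" if y: "y \<in> {0<..<1}" for y
  proof -
    have "((\<lambda>y. (1 - y\<^sup>2) * k y) has_real_derivative W y) (at y)"
      unfolding W_def by (rule derivative_eq_intros dk y refl | simp)+
    then show ?thesis by (rule has_field_derivative_transform_within_open[OF _ _ y H(1)[symmetric]]) simp_all
  qed
  have dW: "(W has_real_derivative - q y - v y * W y) (at y)" if y: "y \<in> {0<..<1}" for y
  proof -
    have "(W has_real_derivative (1 - y\<^sup>2) * k2 y - 4 * y * k1 y - 2 * k y) (at y)"
      unfolding W_def[abs_def] by (rule derivative_eq_intros dk y refl | simp)+
    then show ?thesis unfolding azi[OF y] W_def[symmetric] .
  qed
  have dR: "(R has_real_derivative R1 y) (at y)" if y: "y \<in> {0<..<1}" for y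
  proof -
    have "((\<lambda>y. (1 - y\<^sup>2)\<^sup>2 * (v1 y + (v y)\<^sup>2 / 2)) has_real_derivative R1 y) (at y)"
      unfolding R1_def by (rule derivative_eq_intros dv y refl | simp add: algebra_simps)+
    then show ?thesis by (rule has_field_derivative_transform_within_open[OF _ _ y R[symmetric]]) simp_all
  qed
  have dR1: "(R1 has_real_derivative R2 y) (at y)" if y: "y \<in> {0<..<1}" for y
  proof -
    have "(R1 has_real_derivative (1 - y\<^sup>2)\<^sup>2 * (v3 y + (v1 y)\<^sup>2 + v y * v2 y) - 8 * y * (1 - y\<^sup>2) * (v2 y + v y * v1 y)
        + (12 * y\<^sup>2 - 4) * (v1 y + (v y)\<^sup>2 / 2)) (at y)"
      unfolding R1_def[abs_def] by (rule derivative_eq_intros dv y refl | simp add: algebra_simps power2_eq_square)+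
    moreover have "(1 - y\<^sup>2)\<^sup>2 * (v3 y + (v1 y)\<^sup>2 + v y * v2 y) - 8 * y * (1 - y\<^sup>2) * (v2 y + v y * v1 y)
        + (12 * y\<^sup>2 - 4) * (v1 y + (v y)\<^sup>2 / 2) = R2 y"
      using rad[OF y] unfolding R2_def by linarith
    ultimately show ?thesis by (simp only:)
  qed
  have dR2: "(R2 has_real_derivative (2 * G y - F1' y) - 2 * (H y / (1 - y\<^sup>2)) * W y) (at y)" if y: "y \<in> {0<..<1}" for y
  proof -
    have n: "1 - y\<^sup>2 \<noteq> 0" using unit_sq_pos[of y] y by simp
    have hk: "H y / (1 - y\<^sup>2) = k y" unfolding H(1)[OF y] using n by simp
    have "(R2 has_real_derivative 2 * ((1 - y\<^sup>2) * v2 y - 4 * y * v1 y - 2 * v y)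
        - ((1 - y\<^sup>2) * (2 * v y * v1 y + 2 * k y * k1 y) - 2 * y * ((v y)\<^sup>2 + (k y)\<^sup>2)) - 2 * P1 y - F1' y) (at y)"
      unfolding R2_def[abs_def] by (rule derivative_eq_intros dv dk dP dF1 y refl | simp add: algebra_simps)+
    then show ?thesis
      by (rule DERIV_cong) (unfold hk W_def ang[OF y, symmetric], simp add: algebra_simps power2_eq_square)
  qed
  have "profile_system q (\<lambda>y. 2 * G y - F1' y) v H W R"
    unfolding profile_system_def using dH dW H(2-4) dR dR1 dR2 lim by (intro conjI ballI exI[of _ R1] exI[of _ R2]) simp_all
  then show ?thesis by (simp only: W_def[abs_def])
qed

text \<open>\<open>V = (1 - y\<^sup>2) v\<close> is the stream function profile and its derivative
  is the radial velocity \<open>f\<close>; both are continuous up to the axis because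
  \<open>u\<close> is. They give the bound on \<open>v\<close> and, together with \<open>v\<close>,
  both limits for \<open>R\<close>, using no information on derivatives at the end points.\<close>

lemma velocity_profiles_exist:
  assumes sol: "axisym_selfsim_solution F u p"
    and F: "\<And>x. x \<in> closed_half_space0 \<Longrightarrow> F x = profile_field (- 3) FA FK FB x"
    and dF1: "\<And>y. y \<in> {0<..<1} \<Longrightarrow> ((\<lambda>y. (1 - y\<^sup>2) * FA y + y * FB y) has_real_derivative F1' y) (at y)"
  obtains v v1 H W R where
    "velocity_profiles FK (\<lambda>y. 2 * (y * FA y - FB y) - F1' y) u v v1 H W R"
proof -
  have C2: "C_k (Suc (Suc 0)) u" and C1: "C_k (Suc 0) p" and ax: "axisymmetric_field u" "axisymmetric_scalar p"
    and hom: "homogeneous (- 1) u" "homogeneous (- 2) p"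
    and mom: "\<And>x. x \<in> half_space \<Longrightarrow> - laplacian u x + convection u x + grad p x = F x"
    and div: "\<And>x. x \<in> half_space \<Longrightarrow> divergence u x = 0"
    and bd: "\<And>x. x \<in> boundary_plane0 \<Longrightarrow> u x = 0"
    using sol unfolding axisym_selfsim_solution_def solves_system_def numeral_2_eq_2 One_nat_def by blast+
  have cu: "continuous_on closed_half_space0 u" using C2 by simp
  define U where "U j y = u (meridian y) $ j" for j y
  have cU: "continuous_on {0..1} (U j)" for j unfolding U_def by (rule meridian_comp_bounded(1)[OF cu])
  have U0: "U j 0 = 0" for j unfolding U_def bd[OF meridian_0] by simp
  define a where "a y = U 1 y / colat y" for y
  define k where "k y = U 2 y / colat y" for y
  define b where "b = U 3"
  define P where "P y = p (meridian y)" for y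
  have u: "u x = profile_field (- 1) a k b x" if "x \<in> closed_half_space0" for x
    by (rule axisymmetric_profile_field[OF ax(1) hom(1) _ _ _ that]) (simp_all add: a_def k_def b_def U_def)
  have uo: "u x = profile_field (- 1) a k b x" if "x \<in> offaxis" for x
    by (rule u[OF half_space_closed[OF offaxis_half_space[OF that]]])
  have po: "p x = zonal (- 2) P x" if "x \<in> offaxis" for x
    unfolding P_def by (rule axisymmetric_zonal[OF ax(2) hom(2) half_space_closed[OF offaxis_half_space[OF that]]])
  have c: "0 < colat y" if "y \<in> {0..<1}" for y by (rule colat_pos[OF that])
  have ms: "U j y / colat y = colat y powi (- 1) * u (meridian y) $ j" for j y
    by (simp add: U_def power_int_minus divide_inverse)
  obtain a1 a2 where da: "\<And>y. y \<in> {0<..<1} \<Longrightarrow> (a has_real_derivative a1 y) (at y)" "\<And>y. y \<in> {0<..<1} \<Longrightarrow> (a1 has_real_derivative a2 y) (at y)"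
    by (rule profile_twice_differentiable[OF C2 hom(1), of a "- 1" 1]) (simp only: a_def ms, blast)
  obtain k1 k2 where dk: "\<And>y. y \<in> {0<..<1} \<Longrightarrow> (k has_real_derivative k1 y) (at y)" "\<And>y. y \<in> {0<..<1} \<Longrightarrow> (k1 has_real_derivative k2 y) (at y)"
    by (rule profile_twice_differentiable[OF C2 hom(1), of k "- 1" 2]) (simp only: k_def ms, blast)
  obtain b1 b2 where db: "\<And>y. y \<in> {0<..<1} \<Longrightarrow> (b has_real_derivative b1 y) (at y)" "\<And>y. y \<in> {0<..<1} \<Longrightarrow> (b1 has_real_derivative b2 y) (at y)"
    by (rule profile_twice_differentiable[OF C2 hom(1), of b 0 3]) (simp add: b_def U_def, blast)
  obtain P1 where dP: "\<And>y. y \<in> {0<..<1} \<Longrightarrow> (P has_real_derivative P1 y) (at y)"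
    unfolding P_def by (rule pressure_profile_differentiable[OF C1 hom(2)]) blast
  define v where "v y = y * a y - b y" for y
  have deq: "2 * y\<^sup>2 * a y - (1 - y\<^sup>2) * y * a1 y - y * b y + (1 - y\<^sup>2) * b1 y = 0" if y: "y \<in> {0<..<1}" for y
  proof -
    have x: "meridian y \<in> offaxis" by (rule meridian_offaxis[OF y])
    have "divergence u (meridian y) = zonal (- 2) (\<lambda>y. 2 * y\<^sup>2 * a y - (1 - y\<^sup>2) * y * a1 y - y * b y + (1 - y\<^sup>2) * b1 y) (meridian y)"
      by (rule divergence_profile_field[OF uo x da(1) dk(1) db(1)])
    then show ?thesis using div[OF offaxis_half_space[OF x]] y by simp
  qed
  show thesis
  proof (rule divergence_free_profiles[OF da db deq v_def])
    fix v1 v2 v3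
    assume dv: "\<And>y. y \<in> {0<..<1} \<Longrightarrow> (v has_real_derivative v1 y) (at y)"
      "\<And>y. y \<in> {0<..<1} \<Longrightarrow> (v1 has_real_derivative v2 y) (at y)"
      "\<And>y. y \<in> {0<..<1} \<Longrightarrow> (v2 has_real_derivative v3 y) (at y)"
    and ea: "\<And>y. y \<in> {0<..<1} \<Longrightarrow> a y = (1 - y\<^sup>2) * v1 y - y * v y"
      "\<And>y. y \<in> {0<..<1} \<Longrightarrow> a1 y = (1 - y\<^sup>2) * v2 y - 3 * y * v1 y - v y"
      "\<And>y. y \<in> {0<..<1} \<Longrightarrow> a2 y = (1 - y\<^sup>2) * v3 y - 5 * y * v2 y - 4 * v1 y"
    and eb: "\<And>y. y \<in> {0<..<1} \<Longrightarrow> b1 y = a y + y * a1 y - v1 y"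
      "\<And>y. y \<in> {0<..<1} \<Longrightarrow> b2 y = 2 * a1 y + y * a2 y - v2 y"
  have mo: "- laplacian u x + convection u x + grad p x = profile_field (- 3) FA FK FB x" if "x \<in> offaxis" for x
    using mom[OF offaxis_half_space[OF that]] F[OF half_space_closed[OF offaxis_half_space[OF that]]] by simp
  have eb0: "b y = y * a y - v y" for y by (simp add: v_def)
  note M = momentum_profiles[OF mo uo po da dk db dP ea eb0 eb]
  define H where "H y = colat y * U 2 y" for y
  define R where "R y = (1 - y\<^sup>2)\<^sup>2 * (v1 y + (v y)\<^sup>2 / 2)" for y
  have sq: "1 - y\<^sup>2 = (colat y)\<^sup>2" if "y \<in> {0..1}" for y using colat_sq[OF that] by simp
  have Hk: "H y = (1 - y\<^sup>2) * k y" if y: "y \<in> {0..<1}" for y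
    using c[OF y] sq[of y] y by (simp add: H_def k_def power2_eq_square)
  have cH: "continuous_on {0..1} H" unfolding H_def by (intro continuous_intros continuous_on_colat cU)
  have H0: "H 0 = 0" "H 1 = 0" by (simp_all add: H_def U0) (simp add: colat_def)
  have cc: "continuous_on {0..<1} (\<lambda>y. U j y / colat y)" for j
    by (intro continuous_on_divide continuous_on_colat continuous_on_subset[OF cU]) (use c in force)+
  have cv: "continuous_on {0..<1} v"
    unfolding v_def a_def b_def by (intro continuous_intros cc continuous_on_subset[OF cU]) auto
  have v0: "v 0 = 0" by (simp add: v_def b_def U0)
  define f where "f y = colat y * U 1 y + y * U 3 y" for y
  define V where "V y = y * (colat y * U 1 y) - (1 - y\<^sup>2) * U 3 y" for y
  have cf: "continuous_on {0..1} f" and cV: "continuous_on {0..1} V"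
    unfolding f_def V_def by (intro continuous_intros continuous_on_colat cU)+
  have V1: "V 1 = 0" by (simp add: V_def colat_def)
  have Vv: "V y = (1 - y\<^sup>2) * v y" if y: "y \<in> {0..<1}" for y
  proof -
    have "(1 - y\<^sup>2) * a y = colat y * U 1 y"
      unfolding a_def using c[OF y] sq[of y] y by (simp add: power2_eq_square)
    then show ?thesis unfolding V_def v_def b_def by algebra
  qed
  have fa: "f y = a y - y * v y" if y: "y \<in> {0<..<1}" for y
  proof -
    have "(1 - y\<^sup>2) * a y = colat y * U 1 y"
      unfolding a_def using c[of y] sq[of y] y by (simp add: power2_eq_square)
    then show ?thesis unfolding f_def v_def b_def by (simp add: algebra_simps power2_eq_square)
  qed
  have dV: "(V has_real_derivative f y) (at y)" if y: "y \<in> {0<..<1}" for y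
  proof -
    have "((\<lambda>y. (1 - y\<^sup>2) * v y) has_real_derivative (1 - y\<^sup>2) * v1 y - 2 * y * v y) (at y)"
      by (rule derivative_eq_intros dv y refl | simp)+
    moreover have "(1 - y\<^sup>2) * v1 y - 2 * y * v y = f y" unfolding fa[OF y] ea(1)[OF y] by simp
    ultimately have "((\<lambda>y. (1 - y\<^sup>2) * v y) has_real_derivative f y) (at y)" by simp
    then show ?thesis
      by (rule has_field_derivative_transform_within_open[OF _ _ y]) (simp_all add: Vv)
  qed
  have bound: "\<bar>v y\<bar> \<le> C" if C: "\<And>y. y \<in> {0<..<1} \<Longrightarrow> norm (u (meridian y)) \<le> C" and y: "y \<in> {0<..<1}" for C y
  proof -
    have "\<bar>f t\<bar> \<le> C" if t: "t \<in> {0<..<1}" for t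
    proof -
      have s: "(colat t)\<^sup>2 + t\<^sup>2 = 1" using sq[of t] t by simp
      \<comment> \<open>\<open>f\<close> and \<open>t U 1 - colat U 3\<close> are the radial and
        polar components of the velocity, so \<open>\<bar>f\<bar>\<close> is at most its
        norm.\<close>
      have "(f t)\<^sup>2 + (t * U 1 t - colat t * U 3 t)\<^sup>2 = ((colat t)\<^sup>2 + t\<^sup>2) * ((U 1 t)\<^sup>2 + (U 3 t)\<^sup>2)"
        unfolding f_def by algebra
      then have "(f t)\<^sup>2 + (t * U 1 t - colat t * U 3 t)\<^sup>2 = (U 1 t)\<^sup>2 + (U 3 t)\<^sup>2" unfolding s by simp
      moreover have "(norm (u (meridian t)))\<^sup>2 = (U 1 t)\<^sup>2 + (U 2 t)\<^sup>2 + (U 3 t)\<^sup>2"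
        unfolding norm_sq_3 U_def by simp
      ultimately have "(f t)\<^sup>2 \<le> (norm (u (meridian t)))\<^sup>2"
        using zero_le_power2[of "U 2 t"] zero_le_power2[of "t * U 1 t - colat t * U 3 t"] by linarith
      then have "\<bar>f t\<bar> \<le> norm (u (meridian t))" using abs_le_square_iff[of "f t" "norm (u (meridian t))"] by simp
      then show ?thesis using C[OF t] by linarith
    qed
    from abs_le_of_deriv_bound(2)[OF dV cV V1 this y] have "\<bar>V y / (1 - y\<^sup>2)\<bar> \<le> C" .
    moreover have "V y / (1 - y\<^sup>2) = v y" using Vv[of y] unit_sq_pos[of y] y by simp
    ultimately show ?thesis by simp
  qed
  have ev1: "\<forall>\<^sub>F y in at_left (1::real). y \<in> {0<..<1}" by (rule eventually_at_leftI[of 0]) auto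
  have ev0: "\<forall>\<^sub>F y in at_right (0::real). y \<in> {0<..<1}" by (rule eventually_at_rightI[of 0 1]) auto
  \<comment> \<open>\<open>v1\<close> is eliminated in favour of \<open>f\<close>, leaving functions
    whose limits at both ends are known.\<close>
  have Rf: "R y = (1 - y\<^sup>2) * (f y + 2 * y * v y + V y * v y / 2)" if y: "y \<in> {0<..<1}" for y
  proof -
    have e: "V y = (1 - y\<^sup>2) * v y" by (rule Vv) (use y in simp)
    define w where "w = (v y)\<^sup>2 / 2"
    have w: "V y * v y / 2 = (1 - y\<^sup>2) * w" unfolding e w_def by (simp add: power2_eq_square)
    show ?thesis unfolding R_def fa[OF y] ea(1)[OF y] w unfolding w_def[symmetric] by algebra
  qed
  have R0: "(R \<longlongrightarrow> 0) (at_right 0)"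
  proof -
    have s: "{0..1/2} \<subseteq> {0..<1::real}" "{0..1/2} \<subseteq> {0..1::real}" by auto
    have "continuous_on {0..1/2} (\<lambda>y. (1 - y\<^sup>2) * (f y + 2 * y * v y + V y * v y / 2))"
      by (intro continuous_intros continuous_on_subset[OF cf s(2)] continuous_on_subset[OF cV s(2)] continuous_on_subset[OF cv s(1)]) simp
    then have "((\<lambda>y. (1 - y\<^sup>2) * (f y + 2 * y * v y + V y * v y / 2)) \<longlongrightarrow>
        (1 - 0\<^sup>2) * (f 0 + 2 * 0 * v 0 + V 0 * v 0 / 2)) (at_right 0)" by (rule continuous_on_Icc_at_rightD) simp
    moreover have "(1 - 0\<^sup>2) * (f 0 + 2 * 0 * v 0 + V 0 * v 0 / 2) = 0" by (simp add: f_def U0 v0)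
    ultimately have "((\<lambda>y. (1 - y\<^sup>2) * (f y + 2 * y * v y + V y * v y / 2)) \<longlongrightarrow> 0) (at_right 0)" by metis
    then show ?thesis by (rule Lim_transform_eventually[OF _ eventually_mono[OF ev0 Rf[symmetric]]])
  qed
  have R1: "((\<lambda>y. R y / (1 - y)) \<longlongrightarrow> 0) (at_left 1)"
  proof -
    \<comment> \<open>\<open>v\<close> tends to \<open>- f 1 / 2\<close>, so
      \<open>f + 2 y v\<close> tends to 0, and \<open>V\<close> vanishes at 1; this is the origin of
      \<open>R = o(1 - y)\<close>.\<close>
    have q: "((\<lambda>y. V y / (1 - y)) \<longlongrightarrow> - f 1) (at_left 1)" by (rule quotient_at_1[OF dV cV cf V1])
    have "((\<lambda>y. inverse (1 + y)) \<longlongrightarrow> inverse (1 + 1)) (at_left (1::real))" by (intro tendsto_intros) simp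
    from tendsto_mult[OF q this] have "((\<lambda>y. V y / (1 - y) * inverse (1 + y)) \<longlongrightarrow> - f 1 * inverse (1 + 1)) (at_left 1)" .
    then have vl: "(v \<longlongrightarrow> - f 1 * inverse (1 + 1)) (at_left 1)"
    proof (rule Lim_transform_eventually[OF _ eventually_mono[OF ev1]])
      fix y :: real assume y: "y \<in> {0<..<1}"
      have "V y = v y * (1 + y) * (1 - y)" using Vv[of y] y by (simp add: algebra_simps power2_eq_square)
      then show "V y / (1 - y) * inverse (1 + y) = v y" using y by (simp add: divide_inverse[symmetric])
    qed
    have "((\<lambda>y. (1 + y) * (f y + 2 * y * v y + V y * v y / 2)) \<longlongrightarrow>
        (1 + 1) * (f 1 + 2 * 1 * (- f 1 * inverse (1 + 1)) + V 1 * (- f 1 * inverse (1 + 1)) / 2)) (at_left 1)"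
      by (intro tendsto_intros vl at_left_1[OF cf] at_left_1[OF cV]) simp
    moreover have "(1 + 1) * (f 1 + 2 * 1 * (- f 1 * inverse (1 + 1)) + V 1 * (- f 1 * inverse (1 + 1)) / 2) = 0"
      by (simp add: V1)
    ultimately have "((\<lambda>y. (1 + y) * (f y + 2 * y * v y + V y * v y / 2)) \<longlongrightarrow> 0) (at_left 1)" by metis
    then show ?thesis
    proof (rule Lim_transform_eventually[OF _ eventually_mono[OF ev1]])
      fix y :: real assume y: "y \<in> {0<..<1}"
      have e: "(1 - y\<^sup>2) = (1 - y) * (1 + y)" by (simp add: algebra_simps power2_eq_square)
      show "(1 + y) * (f y + 2 * y * v y + V y * v y / 2) = R y / (1 - y)" unfolding Rf[OF y] e using y by simp
    qed
  qed
  have ps: "profile_system FK (\<lambda>y. 2 * (y * FA y - FB y) - F1' y) v H (\<lambda>y. (1 - y\<^sup>2) * k1 y - 2 * y * k y) R"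
    by (rule profile_system_of_momentum[OF dv dk dP dF1 M Hk cH H0 _ R0 R1]) (simp_all add: R_def)
  show thesis
  proof (rule that)
    show "velocity_profiles FK (\<lambda>y. 2 * (y * FA y - FB y) - F1' y) u v v1 H (\<lambda>y. (1 - y\<^sup>2) * k1 y - 2 * y * k y) R"
      unfolding velocity_profiles_def
    proof (intro conjI ballI allI impI ps cv v0)
      show "\<bar>v y\<bar> \<le> C" if "\<forall>y\<in>{0<..<1}. norm (u (meridian y)) \<le> C" "y \<in> {0<..<1}" for C y
        by (rule bound[OF bspec[OF that(1)] that(2)])
      fix x assume x: "x \<in> offaxis"
      define y where "y = x $ 3 / norm x"
      have y: "y \<in> {0<..<1}" using offaxis_height[OF x] by (simp add: y_def)
      have y': "y \<in> {0..<1}" using y by simp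
      have n: "1 - y\<^sup>2 \<noteq> 0" using unit_sq_pos[OF y'] by simp
      show "u x = profile_field (- 1) (\<lambda>y. (1 - y\<^sup>2) * v1 y - y * v y) (\<lambda>y. H y / (1 - y\<^sup>2))
          (\<lambda>y. y * ((1 - y\<^sup>2) * v1 y - y * v y) - v y) x"
        unfolding uo[OF x] profile_field_eq_iff[OF x] Let_def y_def[symmetric] eb0 ea(1)[OF y] Hk[OF y'] using n by simp
    qed (use dv(1) R_def in blast)+
  qed
  qed
qed

section \<open>Recovering velocity and pressure from the profiles\<close>

lemma partial_cong_open:
  assumes "open \<Omega>" "x \<in> \<Omega>" "\<And>z. z \<in> \<Omega> \<Longrightarrow> f z = g z"
  shows "partial i f x = partial i g x"
proof -
  have "has_partial i f d x \<longleftrightarrow> has_partial i g d x" for d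
    using has_partial_transform[OF assms(1,2), of f g i d] has_partial_transform[OF assms(1,2), of g f i d] assms(3) by metis
  then show ?thesis by (simp add: partial_def vector_derivative_def has_partial_def)
qed

text \<open>Euler's relation for degree -2, \<open>- 2 p x = x \<bullet> grad p x\<close>: the
  gradient determines the pressure with no additive constant.\<close>

lemma pressure_profile_eq_of_grad:
  assumes p: "\<And>x. x \<in> offaxis \<Longrightarrow> p x = zonal (- 2) P x" "\<And>x. x \<in> offaxis \<Longrightarrow> p' x = zonal (- 2) P' x"
    and dP: "\<And>y. y \<in> {0<..<1} \<Longrightarrow> (P has_real_derivative P1 y) (at y)" "\<And>y. y \<in> {0<..<1} \<Longrightarrow> (P' has_real_derivative P1' y) (at y)"
    and g: "grad p (meridian y) = grad p' (meridian y)" and y: "y \<in> {0<..<1}"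
  shows "P y = P' y"
proof -
  have x: "meridian y \<in> offaxis" by (rule meridian_offaxis[OF y])
  have h: "meridian y $ 3 / norm (meridian y) = y" using y by simp
  have gp: "grad p (meridian y) = profile_field (- 3) (\<lambda>y. - 2 * P y - y * P1 y) (\<lambda>y. 0)
      (\<lambda>y. - 2 * y * P y + (1 - y\<^sup>2) * P1 y) (meridian y)" by (rule grad_zonal[OF p(1) x dP(1)])
  have gp': "grad p' (meridian y) = profile_field (- 3) (\<lambda>y. - 2 * P' y - y * P1' y) (\<lambda>y. 0)
      (\<lambda>y. - 2 * y * P' y + (1 - y\<^sup>2) * P1' y) (meridian y)" by (rule grad_zonal[OF p(2) x dP(2)])
  have e: "- 2 * P y - y * P1 y = - 2 * P' y - y * P1' y"
    "- 2 * y * P y + (1 - y\<^sup>2) * P1 y = - 2 * y * P' y + (1 - y\<^sup>2) * P1' y"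
    using gp[symmetric, unfolded g gp', unfolded profile_field_eq_iff[OF x] Let_def h] by blast+
  have s: "2 * Q = - ((1 - y\<^sup>2) * (- 2 * Q - y * Q1) + y * (- 2 * y * Q + (1 - y\<^sup>2) * Q1))" for Q Q1 :: real
    by algebra
  have "2 * P y = 2 * P' y" by (rule trans[OF s[of "P y" "P1 y", unfolded e] s[of "P' y" "P1' y", symmetric]])
  then show ?thesis by simp
qed

text \<open>Velocities that agree on an open set have the same derivatives there, so the momentum
  equation yields equal pressure gradients; continuity covers the axis and the boundary
  plane.\<close>

lemma same_solution_if_eq_velocity:
  assumes sol: "axisym_selfsim_solution F u p" "axisym_selfsim_solution F u' p'"
    and eq: "\<And>x. x \<in> offaxis \<Longrightarrow> u x = u' x"
  shows "same_solution u p u' p'"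
proof -
  have C: "C_k (Suc (Suc 0)) u" "C_k (Suc (Suc 0)) u'" "C_k (Suc 0) p" "C_k (Suc 0) p'"
    and ax: "axisymmetric_scalar p" "axisymmetric_scalar p'" and hom: "homogeneous (- 2) p" "homogeneous (- 2) p'"
    and mom: "\<And>x. x \<in> half_space \<Longrightarrow> - laplacian u x + convection u x + grad p x = F x"
      "\<And>x. x \<in> half_space \<Longrightarrow> - laplacian u' x + convection u' x + grad p' x = F x"
    using sol unfolding axisym_selfsim_solution_def solves_system_def numeral_2_eq_2 One_nat_def by blast+
  have c: "continuous_on closed_half_space0 u" "continuous_on closed_half_space0 u'"
    "continuous_on closed_half_space0 p" "continuous_on closed_half_space0 p'" using C by simp_all
  have po: "p x = zonal (- 2) (\<lambda>y. p (meridian y)) x" "p' x = zonal (- 2) (\<lambda>y. p' (meridian y)) x" if "x \<in> offaxis" for x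
    by (rule axisymmetric_zonal[OF ax(1) hom(1)] axisymmetric_zonal[OF ax(2) hom(2)], rule half_space_closed[OF offaxis_half_space[OF that]])+
  have p1: "partial i u x = partial i u' x" if "x \<in> offaxis" for i x
    by (rule partial_cong_open[OF open_offaxis that eq])
  have p2: "partial i (partial i u) x = partial i (partial i u') x" if "x \<in> offaxis" for i x
    by (rule partial_cong_open[OF open_offaxis that p1])
  have g: "grad p x = grad p' x" if x: "x \<in> offaxis" for x
  proof -
    have "laplacian u x = laplacian u' x" "convection u x = convection u' x"
      unfolding laplacian_def convection_def by (simp_all add: p1[OF x] p2[OF x] eq[OF x])
    then show ?thesis using mom[OF offaxis_half_space[OF x]] by (metis add_left_cancel)
  qed
  obtain P1 where P1: "\<And>y. y \<in> {0<..<1} \<Longrightarrow> ((\<lambda>y. p (meridian y)) has_real_derivative P1 y) (at y)"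
    by (rule pressure_profile_differentiable[OF C(3) hom(1)]) blast
  obtain P1' where P1': "\<And>y. y \<in> {0<..<1} \<Longrightarrow> ((\<lambda>y. p' (meridian y)) has_real_derivative P1' y) (at y)"
    by (rule pressure_profile_differentiable[OF C(4) hom(2)]) blast
  have "p (meridian y) = p' (meridian y)" if y: "y \<in> {0<..<1}" for y
    by (rule pressure_profile_eq_of_grad[OF po P1 P1' g[OF meridian_offaxis[OF y]] y])
  then have peq: "p x = p' x" if "x \<in> offaxis" for x
    unfolding po[OF that] zonal_def using offaxis_height[OF that] by simp
  show ?thesis
    unfolding same_solution_def
    using eq_from_offaxis[OF c(1,2) eq] eq_from_offaxis[OF c(3,4) peq] by simp
qed

lemma velocity_eq_of_profiles:
  assumes v: "velocity_profiles q N u v v1 H W R" "velocity_profiles q N u' v' v1' H' W' R'"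
    and eq: "\<And>y. y \<in> {0<..<1} \<Longrightarrow> v y = v' y" "\<And>y. y \<in> {0<..<1} \<Longrightarrow> H y = H' y"
    and x: "x \<in> offaxis"
  shows "u x = u' x"
proof -
  define y where "y = x $ 3 / norm x"
  have y: "y \<in> {0<..<1}" using offaxis_height[OF x] by (simp add: y_def)
  have "(v' has_real_derivative v1 y) (at y)"
    by (rule has_field_derivative_transform_within_open[OF velocity_profilesD(2)[OF v(1) y] _ y eq(1)]) simp_all
  then have v1: "v1 y = v1' y" by (rule DERIV_unique[OF _ velocity_profilesD(2)[OF v(2) y]])
  show ?thesis
    unfolding velocity_profilesD(1)[OF v(1) x] velocity_profilesD(1)[OF v(2) x] profile_field_eq_iff[OF x] Let_def y_def[symmetric]
      v1 eq(1)[OF y] eq(2)[OF y] by simp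
qed

section \<open>Comparison of two sets of profiles\<close>

lemma velocity_profiles_derivative:
  assumes "velocity_profiles q N u v v1 H W R" and y: "y \<in> {0<..<1}"
  shows "v1 y = R y / (1 - y\<^sup>2)\<^sup>2 - (v y)\<^sup>2 / 2"
  using velocity_profilesD(3)[OF assms] unit_sq_pos[of y] y by simp

text \<open>A contraction by hand: a bound \<open>d\<close> for the difference improves to
  \<open>d / 2\<close>. The part from \<open>R\<close> is \<open>128 / 384\<^sup>2 = 1/1152\<close>,
  and the quadratic term contributes 1/4 since both functions are bounded by 1/4.\<close>

lemma small_velocity_profiles_unique:
  assumes vp: "velocity_profiles q N u v v1 H W R" "velocity_profiles q N u' v' v1' H' W' R'"
    and q: "\<And>y. y \<in> {0<..<1} \<Longrightarrow> \<bar>q y\<bar> \<le> (1/384) / 2 * (1 / sqrt (1 - y\<^sup>2))"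
    and N: "\<And>y. y \<in> {0<..<1} \<Longrightarrow> \<bar>N y\<bar> \<le> (1/384) / sqrt (1 - y\<^sup>2)"
    and b: "\<And>y. y \<in> {0<..<1} \<Longrightarrow> \<bar>v y\<bar> \<le> 1/4" "\<And>y. y \<in> {0<..<1} \<Longrightarrow> \<bar>v' y\<bar> \<le> 1/4"
    and y: "y \<in> {0<..<1}"
  shows "v y = v' y" "H y = H' y"
proof -
  note ps = velocity_profilesD(7)[OF vp(1)] velocity_profilesD(7)[OF vp(2)]
  have half: "\<bar>v y\<bar> \<le> 1/2" "\<bar>v' y\<bar> \<le> 1/2" if "y \<in> {0<..<1}" for y
    using b(1)[OF that] b(2)[OF that] by linarith+
  have e0: "(0::real) \<le> 1/384" by simp
  note pd = profile_system_diff[OF e0 q N ps half]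
  have contr: "\<bar>v y - v' y\<bar> \<le> d / 2" if d: "\<And>y. y \<in> {0<..<1} \<Longrightarrow> \<bar>v y - v' y\<bar> \<le> d" and y: "y \<in> {0<..<1}" for d y
  proof -
    have d0: "0 \<le> d" using d[OF y] by linarith
    have D: "((\<lambda>y. v y - v' y) has_real_derivative v1 t - v1' t) (at t)" if t: "t \<in> {0<..<1}" for t
      by (rule DERIV_diff[OF velocity_profilesD(2)[OF vp(1) t] velocity_profilesD(2)[OF vp(2) t]])
    have Db: "\<bar>v1 t - v1' t\<bar> \<le> d / 2" if t: "t \<in> {0<..<1}" for t
    proof -
      define s where "s = (1 - t\<^sup>2)\<^sup>2"
      have s: "0 < s" using unit_sq_pos[of t] t by (simp add: s_def)
      have ts: "(1 - t)\<^sup>2 \<le> s"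
      proof -
        have "t\<^sup>2 \<le> t" using t by (simp add: power2_eq_square mult_left_le)
        then show ?thesis unfolding s_def using t by (intro power_mono) auto
      qed
      have "\<bar>R t - R' t\<bar> \<le> 128 * (1/384)\<^sup>2 * d * (1 - t)\<^sup>2" by (rule pd(2)[OF _ _ _ _ d t])
      also have "\<dots> \<le> 128 * (1/384)\<^sup>2 * d * s" using ts d0 by (intro mult_left_mono) auto
      finally have r: "\<bar>(R t - R' t) / s\<bar> \<le> 128 * (1/384)\<^sup>2 * d"
        unfolding abs_divide using s by (simp add: divide_le_eq)
      have "\<bar>v t + v' t\<bar> \<le> 1/2" using b(1)[OF t] b(2)[OF t] by linarith
      then have m: "\<bar>(v t + v' t) * (v t - v' t)\<bar> \<le> 1/2 * d"
        unfolding abs_mult using d[OF t] by (intro mult_mono) auto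
      have "v1 t - v1' t = (R t - R' t) / s - (v t + v' t) * (v t - v' t) / 2"
        unfolding velocity_profiles_derivative[OF vp(1) t] velocity_profiles_derivative[OF vp(2) t] s_def[symmetric]
        by (simp add: diff_divide_distrib power2_eq_square algebra_simps)
      moreover have "128 * (1/384)\<^sup>2 * d + (1/2 * d) / 2 \<le> d / 2" using d0 by (simp add: power2_eq_square)
      ultimately show ?thesis using r m by linarith
    qed
    have "continuous_on {0..y} (\<lambda>y. v y - v' y)"
      by (intro continuous_intros continuous_on_subset[OF velocity_profilesD(4)[OF vp(1)]]
          continuous_on_subset[OF velocity_profilesD(4)[OF vp(2)]]) (use y in auto)
    moreover have "\<And>x. 0 < x \<Longrightarrow> x < y \<Longrightarrow> (\<lambda>y. v y - v' y) differentiable (at x)"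
      using D y real_differentiable_def by (metis greaterThanLessThan_iff order_less_trans)
    ultimately obtain l z where z: "0 < z" "z < y" "((\<lambda>y. v y - v' y) has_real_derivative l) (at z)"
        "(v y - v' y) - (v 0 - v' 0) = (y - 0) * l"
      using MVT[of 0 y "\<lambda>y. v y - v' y"] y by auto
    have zi: "z \<in> {0<..<1}" using z y by simp
    have "l = v1 z - v1' z" by (rule DERIV_unique[OF z(3) D[OF zi]])
    then have l: "\<bar>l\<bar> \<le> d / 2" using Db[OF zi] by simp
    have "v y - v' y = y * l" using z(4) velocity_profilesD(5)[OF vp(1)] velocity_profilesD(5)[OF vp(2)] by simp
    then have "\<bar>v y - v' y\<bar> = y * \<bar>l\<bar>" using y by (simp add: abs_mult)
    also have "\<dots> \<le> 1 * (d / 2)" using y l by (intro mult_mono) auto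
    finally show ?thesis by simp
  qed
  \<comment> \<open>The iteration starts from the crude bound 1, as both functions are at most
    1/2.\<close>
  have it: "\<bar>v y - v' y\<bar> \<le> (1/2) ^ n" if "y \<in> {0<..<1}" for n y using that
  proof (induction n arbitrary: y)
    case 0
    then show ?case using half(1)[OF 0] half(2)[OF 0] by simp
  next
    case (Suc n)
    show ?case using contr[OF Suc.IH Suc.prems] by simp
  qed
  have veq: "v y = v' y" if y: "y \<in> {0<..<1}" for y
  proof (rule ccontr)
    assume "v y \<noteq> v' y"
    then have "0 < \<bar>v y - v' y\<bar>" by simp
    from real_arch_pow_inv[OF this, of "1/2"] obtain n where "(1/2) ^ n < \<bar>v y - v' y\<bar>" by auto
    with it[OF y, of n] show False by simp
  qed
  show "v y = v' y" by (rule veq[OF y])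
  have "\<bar>v y - v' y\<bar> \<le> 0" if "y \<in> {0<..<1}" for y using veq[OF that] by simp
  then have "\<bar>H y - H' y\<bar> \<le> 4 * (1/384) * 0" by (intro pd(1)[OF _ _ _ _ _ y])
  then show "H y = H' y" by simp
qed

text \<open>\<open>C\<close> may be any bound: it is the growth rate in the linear equation for
  \<open>W\<close>. Once \<open>W\<close> is zero, so is \<open>H\<close>, by the mean value
  estimate from the axis.\<close>

lemma swirl_vanishes:
  assumes vp: "velocity_profiles q N u v v1 H W R" and q: "\<And>y. y \<in> {0<..<1} \<Longrightarrow> q y = 0"
    and b: "\<And>y. y \<in> {0<..<1} \<Longrightarrow> \<bar>v y\<bar> \<le> C" and y: "y \<in> {0<..<1}"
  shows "W y = 0" "H y = 0"
proof -
  have dH: "\<And>y. y \<in> {0<..<1} \<Longrightarrow> (H has_real_derivative W y) (at y)"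
    and dW: "\<And>y. y \<in> {0<..<1} \<Longrightarrow> (W has_real_derivative - q y - v y * W y) (at y)"
    and cH: "continuous_on {0..1} H" "H 0 = 0" "H 1 = 0"
    using velocity_profilesD(7)[OF vp] unfolding profile_system_def by auto
  have dW': "(W has_real_derivative - v y * W y) (at y)" if y: "y \<in> {0<..<1}" for y
    using dW[OF y] q[OF y] by simp
  obtain \<xi> where \<xi>: "0 < \<xi>" "\<xi> < 1" "(H has_real_derivative 0) (at \<xi>)"
  proof -
    have "\<And>x. 0 < x \<Longrightarrow> x < 1 \<Longrightarrow> H differentiable (at x)"
      using dH real_differentiable_def by (metis greaterThanLessThan_iff)
    from Rolle[OF _ _ cH(1) this] cH(2,3) show thesis using that by auto
  qed
  have W\<xi>: "W \<xi> = 0" using DERIV_unique[OF dH[of \<xi>] \<xi>(3)] \<xi>(1,2) by simp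
  have W0: "W t = 0" if t: "t \<in> {0<..<1}" for t
  proof (rule linear_ode_zero[OF dW' _ _ _ W\<xi>])
    show "continuous_on {min \<xi> t..max \<xi> t} W"
      by (rule DERIV_continuous_on[OF has_field_derivative_at_within[OF dW']]) (use \<xi> t in auto)
    show "\<bar>- v s * W s\<bar> \<le> C * \<bar>W s\<bar>" if "s \<in> {0<..<1}" for s
      unfolding abs_mult using b[OF that] by (simp add: mult_right_mono)
  qed (use \<xi> t in auto)
  show "W y = 0" by (rule W0[OF y])
  have "\<bar>W t\<bar> \<le> 0" if "t \<in> {0<..<1}" for t using W0[OF that] by simp
  from abs_le_of_deriv_bound(1)[OF dH cH(1,3) this y] show "H y = 0" by simp
qed

lemma profile_system_radial:
  assumes "profile_system q N v H W R"
  obtains R1 R2 where "\<And>y. y \<in> {0<..<1} \<Longrightarrow> (R has_real_derivative R1 y) (at y)"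
    "\<And>y. y \<in> {0<..<1} \<Longrightarrow> (R1 has_real_derivative R2 y) (at y)"
    "\<And>y. y \<in> {0<..<1} \<Longrightarrow> (R2 has_real_derivative N y - 2 * (H y / (1 - y\<^sup>2)) * W y) (at y)"
    "(R \<longlongrightarrow> 0) (at_right 0)" "((\<lambda>y. R y / (1 - y)) \<longlongrightarrow> 0) (at_left 1)"
proof -
  from assms have l: "(R \<longlongrightarrow> 0) (at_right 0)" "((\<lambda>y. R y / (1 - y)) \<longlongrightarrow> 0) (at_left 1)"
    unfolding profile_system_def by blast+
  from assms obtain R1 R2 where "\<forall>y\<in>{0<..<1}. (R has_real_derivative R1 y) (at y)"
    "\<forall>y\<in>{0<..<1}. (R1 has_real_derivative R2 y) (at y)"
    "\<forall>y\<in>{0<..<1}. (R2 has_real_derivative N y - 2 * (H y / (1 - y\<^sup>2)) * W y) (at y)"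
    unfolding profile_system_def by blast
  from that[OF bspec[OF this(1)] bspec[OF this(2)] bspec[OF this(3)] l] show thesis .
qed

text \<open>With both swirls zero the third derivatives of \<open>R\<close> and \<open>R'\<close>
  agree, and the third-order estimate applies with \<open>B = 0\<close>. Then \<open>v - v'\<close>
  solves the linear equation with coefficient \<open>- (v + v') / 2\<close> and vanishes at
  0.\<close>

lemma swirl_free_velocity_profiles_unique:
  assumes vp: "velocity_profiles q N u v v1 H W R" "velocity_profiles q N u' v' v1' H' W' R'"
    and q: "\<And>y. y \<in> {0<..<1} \<Longrightarrow> q y = 0"
    and b: "\<And>y. y \<in> {0<..<1} \<Longrightarrow> \<bar>v y\<bar> \<le> C" "\<And>y. y \<in> {0<..<1} \<Longrightarrow> \<bar>v' y\<bar> \<le> C'"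
    and y: "y \<in> {0<..<1}"
  shows "v y = v' y"
proof -
  obtain R1 R2 where R: "\<And>y. y \<in> {0<..<1} \<Longrightarrow> (R has_real_derivative R1 y) (at y)"
    "\<And>y. y \<in> {0<..<1} \<Longrightarrow> (R1 has_real_derivative R2 y) (at y)"
    "\<And>y. y \<in> {0<..<1} \<Longrightarrow> (R2 has_real_derivative N y - 2 * (H y / (1 - y\<^sup>2)) * W y) (at y)"
    "(R \<longlongrightarrow> 0) (at_right 0)" "((\<lambda>y. R y / (1 - y)) \<longlongrightarrow> 0) (at_left 1)"
    by (rule profile_system_radial[OF velocity_profilesD(7)[OF vp(1)]]) (rule that, blast+)
  obtain R1' R2' where R': "\<And>y. y \<in> {0<..<1} \<Longrightarrow> (R' has_real_derivative R1' y) (at y)"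
    "\<And>y. y \<in> {0<..<1} \<Longrightarrow> (R1' has_real_derivative R2' y) (at y)"
    "\<And>y. y \<in> {0<..<1} \<Longrightarrow> (R2' has_real_derivative N y - 2 * (H' y / (1 - y\<^sup>2)) * W' y) (at y)"
    "(R' \<longlongrightarrow> 0) (at_right 0)" "((\<lambda>y. R' y / (1 - y)) \<longlongrightarrow> 0) (at_left 1)"
    by (rule profile_system_radial[OF velocity_profilesD(7)[OF vp(2)]]) (rule that, blast+)
  have RR: "R t = R' t" if t: "t \<in> {0<..<1}" for t
  proof -
    have "\<bar>R t - R' t\<bar> \<le> 4 * 0 * (1 - t)\<^sup>2"
    proof (rule third_order_bound[OF DERIV_diff[OF R(1) R'(1)] DERIV_diff[OF R(2) R'(2)] DERIV_diff[OF R(3) R'(3)] _ _ _ t])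
      show "\<bar>N s - 2 * (H s / (1 - s\<^sup>2)) * W s - (N s - 2 * (H' s / (1 - s\<^sup>2)) * W' s)\<bar> \<le> 0 / sqrt (1 - s\<^sup>2)"
        if s: "s \<in> {0<..<1}" for s
      proof -
        have "W s = 0" by (rule swirl_vanishes(1)[OF vp(1) q b(1) s])
        moreover have "W' s = 0" by (rule swirl_vanishes(1)[OF vp(2) q b(2) s])
        ultimately show ?thesis by simp
      qed
      show "((\<lambda>y. R y - R' y) \<longlongrightarrow> 0) (at_right 0)" using tendsto_diff[OF R(4) R'(4)] by simp
      show "((\<lambda>y. (R y - R' y) / (1 - y)) \<longlongrightarrow> 0) (at_left 1)"
        using tendsto_diff[OF R(5) R'(5)] by (simp add: diff_divide_distrib)
    qed
    then show ?thesis by simp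
  qed
  have "(\<lambda>y. v y - v' y) y = 0"
  proof (rule linear_ode_zero[where E = "\<lambda>y. v y - v' y" and E' = "\<lambda>y. v1 y - v1' y" and C = "(C + C') / 2" and \<xi> = 0])
    show "((\<lambda>y. v y - v' y) has_real_derivative v1 t - v1' t) (at t)" if t: "t \<in> {0<..<1}" for t
      by (rule DERIV_diff[OF velocity_profilesD(2)[OF vp(1) t] velocity_profilesD(2)[OF vp(2) t]])
    show "continuous_on {min 0 y..max 0 y} (\<lambda>y. v y - v' y)"
      by (intro continuous_intros continuous_on_subset[OF velocity_profilesD(4)[OF vp(1)]]
          continuous_on_subset[OF velocity_profilesD(4)[OF vp(2)]]) (use y in auto)
    show "\<bar>v1 t - v1' t\<bar> \<le> (C + C') / 2 * \<bar>v t - v' t\<bar>" if t: "t \<in> {0<..<1}" for t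
    proof -
      have "v1 t - v1' t = - ((v t + v' t) / 2) * (v t - v' t)"
        unfolding velocity_profiles_derivative[OF vp(1) t] velocity_profiles_derivative[OF vp(2) t] RR[OF t]
        by (simp add: power2_eq_square algebra_simps diff_divide_distrib add_divide_distrib)
      moreover have "\<bar>v t + v' t\<bar> \<le> C + C'" using b(1)[OF t] b(2)[OF t] by linarith
      then have "\<bar>- ((v t + v' t) / 2)\<bar> \<le> (C + C') / 2" by (simp add: abs_divide)
      ultimately show ?thesis by (simp only: abs_mult mult_right_mono abs_ge_zero)
    qed
    show "v 0 - v' 0 = 0" using velocity_profilesD(5)[OF vp(1)] velocity_profilesD(5)[OF vp(2)] by simp
  qed (use y in auto)
  then show ?thesis by simp
qed

text \<open>The closed meridian arc is compact, so the velocity is bounded on it; this replaces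
  smallness in the swirl-free case.\<close>

lemma velocity_profile_bounded:
  assumes vp: "velocity_profiles q N u v v1 H W R" and cu: "continuous_on closed_half_space0 u"
  obtains C where "\<And>y. y \<in> {0<..<1} \<Longrightarrow> \<bar>v y\<bar> \<le> C"
proof -
  have "continuous_on {0..1} (\<lambda>y. u (meridian y))"
    by (intro continuous_on_compose2[OF cu continuous_on_meridian]) (use meridian_closed in auto)
  then have "compact ((\<lambda>y. u (meridian y)) ` {0..1})" by (rule compact_continuous_image) simp
  then obtain C where C: "\<And>y. y \<in> {0..1} \<Longrightarrow> norm (u (meridian y)) \<le> C"
    using compact_imp_bounded bounded_iff by (metis imageI)
  have C': "norm (u (meridian y)) \<le> C" if "y \<in> {0<..<1}" for y by (rule C) (use that in simp)
  show thesis by (rule that[OF velocity_profilesD(6)[OF vp C']])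
qed

lemma swirl_free_solution:
  assumes sol: "axisym_selfsim_solution F u p" and vp: "velocity_profiles q N u v v1 H W R"
    and q: "\<And>y. y \<in> {0<..<1} \<Longrightarrow> q y = 0"
  shows "swirl_free u"
proof -
  have cu: "continuous_on closed_half_space0 u" and ax: "axisymmetric_field u" and hom: "homogeneous (- 1) u"
    and bd: "\<And>x. x \<in> boundary_plane0 \<Longrightarrow> u x = 0"
    using sol by (simp_all add: axisym_selfsim_solution_def solves_system_def numeral_2_eq_2)
  obtain C where C: "\<And>y. y \<in> {0<..<1} \<Longrightarrow> \<bar>v y\<bar> \<le> C" by (rule velocity_profile_bounded[OF vp cu]) blast
  have "u (meridian y) $ 2 = 0" if y: "y \<in> {0<..<1}" for y
    unfolding velocity_profilesD(1)[OF vp meridian_offaxis[OF y]] profile_field_nth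
    using swirl_vanishes(2)[OF vp q C y] y by simp
  \<comment> \<open>The profile equations cover the open interval; at \<open>y = 0\<close> the swirl
    vanishes by no-slip.\<close>
  moreover have "u (meridian 0) $ 2 = 0" unfolding bd[OF meridian_0] by simp
  ultimately have z: "u (meridian y) $ 2 = 0" if "y \<in> {0..<1}" for y using that by (cases "y = 0") auto
  show ?thesis
  proof (rule swirl_free_profile[OF axisymmetric_profile_field[OF ax hom]])
    show "u (meridian y) $ 2 / colat y = 0" if "y \<in> {0..<1}" for y using z[OF that] by simp
  qed (rule refl | assumption)+
qed

theorem theorem1p1:
  "\<exists>\<epsilon>>0. \<exists>\<delta>>0. \<forall>F :: real^3 \<Rightarrow> real^3.
     axisymmetric_field F \<and> homogeneous (- 3) F \<and> C_k 1 F \<and>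
     sup_norm open_half_sphere_angles (tangential_part (curl F)) \<le> ereal \<epsilon> \<longrightarrow>
     (\<exists>u p. axisym_selfsim_solution F u p \<and>
        sup_norm open_half_sphere u \<le> ereal \<delta> \<and>
        (\<forall>u' p'. axisym_selfsim_solution F u' p' \<and> sup_norm open_half_sphere u' \<le> ereal \<delta> \<longrightarrow>
           same_solution u p u' p') \<and>
        (\<forall>\<alpha>. 0 < \<alpha> \<and> \<alpha> < 1 \<longrightarrow> C_k_alpha_loc 2 \<alpha> u \<and> C_k_alpha_loc 1 \<alpha> p)) \<and>
     (swirl_free F \<longrightarrow>
        (\<forall>u p. axisym_selfsim_solution F u p \<longrightarrow> swirl_free u) \<and>
        (\<forall>u p u' p'. axisym_selfsim_solution F u p \<and> axisym_selfsim_solution F u' p' \<longrightarrow>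
           same_solution u p u' p'))"
proof (rule exI[of _ "1/384 :: real"], rule conjI, simp, rule exI[of _ "1/4 :: real"], intro conjI allI impI)
  \<comment> \<open>\<open>\<epsilon> = 1/384\<close> is the threshold of the profile estimates.
    \<open>\<delta> = 1/4\<close> has to admit the constructed solution, of size at most 41/192, and
    to keep the quadratic term small in the comparison of two small solutions.\<close>
  fix F :: "real^3 \<Rightarrow> real^3"
  assume "axisymmetric_field F \<and> homogeneous (- 3) F \<and> C_k 1 F \<and>
     sup_norm open_half_sphere_angles (tangential_part (curl F)) \<le> ereal (1/384)"
  then have asm: "axisymmetric_field F" "homogeneous (- 3) F" "C_k 1 F"
    "sup_norm open_half_sphere_angles (tangential_part (curl F)) \<le> ereal (1/384)" by blast+
  obtain FA FK FB F1' where F: "\<And>x. x \<in> closed_half_space0 \<Longrightarrow> F x = profile_field (- 3) FA FK FB x"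
    and FK: "\<And>y. y \<in> {0..<1} \<Longrightarrow> FK y = F (meridian y) $ 2 / colat y"
    and F1': "\<And>y. y \<in> {0<..<1} \<Longrightarrow> ((\<lambda>y. (1 - y\<^sup>2) * FA y + y * FB y) has_real_derivative F1' y) (at y)"
    and fb: "\<And>y. y \<in> {0<..<1} \<Longrightarrow> \<bar>FK y\<bar> \<le> (1/384) / 2 * (1 / sqrt (1 - y\<^sup>2))"
      "\<And>y. y \<in> {0<..<1} \<Longrightarrow> \<bar>2 * (y * FA y - FB y) - F1' y\<bar> \<le> (1/384) / sqrt (1 - y\<^sup>2)"
    by (rule forcing_profiles[OF asm]) (rule that, blast+)
  define N where "N y = 2 * (y * FA y - FB y) - F1' y" for y
  have Nb: "\<bar>N y\<bar> \<le> (1/384) / sqrt (1 - y\<^sup>2)" if "y \<in> {0<..<1}" for y unfolding N_def by (rule fb(2)[OF that])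
  have prof: "\<exists>v v1 H W R. velocity_profiles FK N u v v1 H W R" if "axisym_selfsim_solution F u p" for u p
    using velocity_profiles_exist[OF that F F1'] unfolding N_def[abs_def] by metis
  have cu: "continuous_on closed_half_space0 u" if "axisym_selfsim_solution F u p" for u p
    using that by (simp add: axisym_selfsim_solution_def numeral_2_eq_2)
  have small: "\<bar>v y\<bar> \<le> 1/4" if vp: "velocity_profiles FK N u v v1 H W R" and s: "sup_norm open_half_sphere u \<le> ereal (1/4)"
    and y: "y \<in> {0<..<1}" for u v v1 H W R y
  proof (rule velocity_profilesD(6)[OF vp _ y])
    fix t :: real assume "t \<in> {0<..<1}"
    then have "meridian t \<in> open_half_sphere" by (simp add: open_half_sphere_def half_space_def)
    then show "norm (u (meridian t)) \<le> 1/4" using s unfolding sup_norm_le by blast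
  qed
  obtain u p where sol: "axisym_selfsim_solution F u p" and su: "sup_norm open_half_sphere u \<le> ereal (1/4)"
    and L: "Lk (Suc (Suc 0)) u" "Lk (Suc 0) p"
    by (rule small_solution_exists[OF asm]) blast
  have uniq: "same_solution u p u' p'"
    if sol': "axisym_selfsim_solution F u' p'" and su': "sup_norm open_half_sphere u' \<le> ereal (1/4)" for u' p'
  proof -
    obtain v v1 H W R where vp: "velocity_profiles FK N u v v1 H W R" using prof[OF sol] by metis
    obtain v' v1' H' W' R' where vp': "velocity_profiles FK N u' v' v1' H' W' R'" using prof[OF sol'] by metis
    note un = small_velocity_profiles_unique[OF vp vp' fb(1) Nb small[OF vp su] small[OF vp' su']]
    show ?thesis
      by (rule same_solution_if_eq_velocity[OF sol sol' velocity_eq_of_profiles[OF vp vp' un]])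
  qed
  have reg: "C_k_alpha_loc 2 \<alpha> u \<and> C_k_alpha_loc 1 \<alpha> p" if "0 < \<alpha> \<and> \<alpha> < 1" for \<alpha>
    using Lk_C_k_alpha[OF L(1)] Lk_C_k_alpha[OF L(2)] that by (simp only: numeral_2_eq_2 One_nat_def)
  show "\<exists>u p. axisym_selfsim_solution F u p \<and>
        sup_norm open_half_sphere u \<le> ereal (1/4) \<and>
        (\<forall>u' p'. axisym_selfsim_solution F u' p' \<and> sup_norm open_half_sphere u' \<le> ereal (1/4) \<longrightarrow>
           same_solution u p u' p') \<and>
        (\<forall>\<alpha>. 0 < \<alpha> \<and> \<alpha> < 1 \<longrightarrow> C_k_alpha_loc 2 \<alpha> u \<and> C_k_alpha_loc 1 \<alpha> p)"
    by (rule exI[of _ u], rule exI[of _ p], intro conjI sol su) (use uniq reg in blast)+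
  assume sf: "swirl_free F"
  have FK0: "FK y = 0" if "y \<in> {0<..<1}" for y
    using FK[of y] swirl_free_meridian[OF sf, of y] that by simp
  show "swirl_free u" if sol: "axisym_selfsim_solution F u p" for u p
  proof -
    obtain v v1 H W R where vp: "velocity_profiles FK N u v v1 H W R" using prof[OF sol] by metis
    show ?thesis by (rule swirl_free_solution[OF sol vp FK0])
  qed
  fix u p u' p' assume "axisym_selfsim_solution F u p \<and> axisym_selfsim_solution F u' p'"
  then have sol: "axisym_selfsim_solution F u p" and sol': "axisym_selfsim_solution F u' p'" by blast+
  obtain v v1 H W R where vp: "velocity_profiles FK N u v v1 H W R" using prof[OF sol] by metis
  obtain v' v1' H' W' R' where vp': "velocity_profiles FK N u' v' v1' H' W' R'" using prof[OF sol'] by metis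
  obtain C where C: "\<And>y. y \<in> {0<..<1} \<Longrightarrow> \<bar>v y\<bar> \<le> C" by (rule velocity_profile_bounded[OF vp cu[OF sol]]) blast
  obtain C' where C': "\<And>y. y \<in> {0<..<1} \<Longrightarrow> \<bar>v' y\<bar> \<le> C'" by (rule velocity_profile_bounded[OF vp' cu[OF sol']]) blast
  have "H y = H' y" if "y \<in> {0<..<1}" for y
    using swirl_vanishes(2)[OF vp FK0 C that] swirl_vanishes(2)[OF vp' FK0 C' that] by simp
  then show "same_solution u p u' p'"
    by (intro same_solution_if_eq_velocity[OF sol sol'] velocity_eq_of_profiles[OF vp vp']
        swirl_free_velocity_profiles_unique[OF vp vp' FK0 C C'])
qed (simp_all)

end
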